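(* Let $k$ and $r$ be integers. For every easel $(\mathcal G,z,x,\psi)\in\mathcal G_{k,r}$, at least one of the following holds: (SMALL) $|V(\mathcal G)|=3$; or $\mathcal G_{k,r}$ contains an easel $(\mathcal G',z,x',\psi')$ with $(\mathcal G',z,x')\prec(\mathcal G,z,x)$ such that one of: (EXP) $(\mathcal G,z)$ is a $(\mathcal G_k,x\to x',\mathcal G_{k,r},\emptyset)$-expansion of $(\mathcal G',z)$; (EXPA) $(\mathcal G,z)$ is a $(\mathcal G_k,x\to x',\mathcal G_{k,r},\{y_1,y_2\})$-expansion of a 2-alteration of $(\mathcal G',z)$ on some vertices or edges $y_1$ and $y_2$; (EXPX) $\deg(z)=k+1$, $\deg(x)=k-2-r$, $\deg(x')\ge\deg(x)$, and $(\mathcal G,z)$ is a $(\mathcal G_k,x\to x',\mathcal G_{k,r},\{y,x'\})$-expansion of an $x'$-alteration of $(\mathcal G',z)$ on some vertex or edge $y$; (EXPB) $(\mathcal G,z)$ is a $(\mathcal G_k,x\to x',\mathcal G_{k,r},\emptyset)$-expansion of a 1-alteration of $(\mathcal G',z)$; (ADD) $x'=x$ and $(\mathcal G,z)$ is a tip-alteration of $(\mathcal G',z)$ at a vertex different from $x$; or (REM) $\mathcal G_{k,r}\cup\mathcal G_{k+1,r}$ contains an easel $(\mathcal G',z,x,\psi')$ with $(\mathcal G',z,x)\prec(\mathcal G,z,x)$ such that $(\mathcal G,z)$ is a tip-reduction of $(\mathcal G',z)$ at a vertex different from $x$. Moreover: if $\mathcal G$ contains a vertex other than $x$ of degree four,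 then (SMALL), (EXP), (EXPA), or (EXPX) holds; and if $(\mathcal G,z)$ is not $\psi$-critical, then (EXP) holds.
   Context: Graphs are finite, loopless, may have parallel edges. A $\mathbb{Z}_3$-boundary of $G$ is $\beta:V(G)\to\mathbb{Z}_3$ summing to $0$ over every component; $\mathcal G=(G,\beta)$ is a $\mathbb{Z}_3$-bordered graph. A nowhere-zero flow is an orientation with $\deg^+(v)-\deg^-(v)\equiv\beta(v)\pmod 3$ for all $v$. For a vertex $v$, $\tau(v)$ is $\{0\}$ ($\deg(v)$ even, $\beta(v)=0$), $\{-2\}$ (even, $\beta(v)=1$), $\{2\}$ (even, $\beta(v)=-1$), $\{-3,3\}$ (odd, $\beta(v)=0$), $\{1\}$ (odd, $\beta(v)=1$), $\{-1\}$ (odd, $\beta(v)=-1$); $|\tau(v)|$ is the absolute value of its elements. For a partition $\mathcal P$ of $V(G)$, $\mathcal G/\mathcal P$ identifies each part into one vertex, deletes loops and sums $\beta$ over parts; $\mathcal P$ is non-trivial if some part has $\ge2$ vertices. A canvas $(\mathcal G,z)$ is a $\mathbb{Z}_3$-bordered graph with tip $z$. A tip preflow is an orientation $\psi$ of the edges at $z$ with (in $\psi$) $\deg^+(z)-\deg^-(z)\equiv\beta(z)\pmod 3$; it extends if some nowhere-zero flow agrees with it at $z$. $\mathcal P$ is tip-respecting if $\{z\}$ is a part. The canvas is $\psi$-critical if $\psi$ does not extend in $\mathcal G$ but extends in $\mathcal G/\mathcal P$ for every non-trivial tip-respecting $\mathcal P$; flow-critical if for every non-trivial tip-respecting $\mathcal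 P$ some tip preflow extends in $\mathcal G/\mathcal P$ but not in $\mathcal G$; tame if $\deg(v)\ge4+|\tau(v)|$ for $v\ne z$. For $A\subseteq V(\mathcal G)\setminus\{z\}$, $(\mathcal G,z)\restriction A$ is the canvas obtained by contracting $V(\mathcal G)\setminus A$ into one vertex $b$, with tip $b$. An easel is $(\mathcal G,z,x,\psi)$ with $(\mathcal G,z)$ a canvas, $x\ne z$ a vertex, $\psi$ a tip preflow. A tip preflow of a canvas with $\deg(z)\le k+1$ is $k$-tallness-witnessing if it does not extend to a nowhere-zero flow and, if $\deg(z)=k+1$, it does not direct all edges at $z$ the same way. $\mathcal G_k$: flow-critical tame canvases with $\deg(z)\le k+1$ having a $k$-tallness-witnessing preflow (up to isomorphism). For a canvas with $\deg(z)\le k+1$, $(x,\psi)$ is a witness of $(k,r)$-tallness if $\psi$ is $k$-tallness-witnessing, $x\ne z$ has $\deg(x)\ge k-2-r$, and if $\deg(x)=k-2-r$ and $\deg(z)=k+1$ then $\psi$ does not direct all edges between $z$ and $V(\mathcal G)\setminus\{z,x\}$ the same way. $\mathcal G_{k,r}$: easels $(\mathcal G,z,x,\psi)$ with $(\mathcal G,z)$ tame flow-critical, $\deg(z)\le k+1$, and $(x,\psi)$ a witness of $(k,r)$-tallness. Ordering: a vertex is in-friendly (out-friendly) if $\tau(v)$ contains a non-positive (non-negative) value; an edge $uv$, $u\ne z\ne v$, is mixed if one end is in-friendly and the other out-friendly; $(\mathcal G,z)$ is $x$-homogeneous if all mixed edges are incident with $x$. With $o(\mathcal G,z)=|V(\mathcal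 G)|+|E(\mathcal G-z)|$, $(\mathcal G_1,z_1,x_1)\prec(\mathcal G_2,z_2,x_2)$ if $o(\mathcal G_1,z_1)<o(\mathcal G_2,z_2)$; or $o$ values equal, $(\mathcal G_1,z_1)$ not $x_1$-homogeneous and $(\mathcal G_2,z_2)$ $x_2$-homogeneous; or $o$ values equal, both homogeneous, $\deg(z_1)<\deg(z_2)$. Operations: adding an edge between distinct $u,v$, boundary $+1$ at $u$ and $-1$ at $v$, is a 1-alteration if $u\ne z\ne v$ and a tip-alteration at the vertex of $\{u,v\}\setminus\{z\}$ otherwise. Deleting one of at least two parallel edges between $z$ and $v$ is a tip-reduction at $v$. For a non-empty set $X$ of at most two elements, each an edge or vertex, the 2-alteration on $X$ deletes the edges of $X$, adds a vertex $y$ of boundary $0$, edges $uy,yv$ for each edge $uv\in X$, and two parallel edges $yw$ for each vertex $w\in X$. For a vertex $x\ne z$ and $y$ either a vertex $v$ of $\mathcal G'-\{x,z\}$ (set $u=v$) or an edge $uv$ of $\mathcal G'-\{x,z\}$, the $x$-alteration on $y$ adds (possibly parallel) edges $ux$ and $vx$ and, if $y$ is an edge, deletes it. A $\mathcal C$-partition of $(\mathcal G,z)$ is a tip-respecting partition $\mathcal P$ with $(\mathcal G,z)\restriction P$ isomorphic to a member of $\mathcal C$ for every part $P$ with $|P|\ge 2$; $(\mathcal G,z)$ is a $\mathcal C$-expansion of $(\mathcal G',z)$ if it has a $\mathcal C$-partition $\mathcal P$ with $\mathcal G/\mathcal P=\mathcal G'$. For $x\in V(\mathcal G)$, $x'\in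 V(\mathcal G')\setminus\{z\}$, a class of easels $\mathcal E$ and a set $Y$ of vertices and edges of $\mathcal G'$, $(\mathcal G,z)$ is a $(\mathcal C,x\to x',\mathcal E,Y)$-expansion of $(\mathcal G',z)$ if it is a $\mathcal C$-expansion via $\mathcal P$, the part $P\ni x$ is contracted into $x'$, if $|P|>1$ then there is a tip preflow $\psi_1$ with $((\mathcal G,z)\restriction P,\ x,\ \psi_1)\in\mathcal E$ (the tip being the contracted vertex), and for every vertex $y\in Y$ other than $z$ the part contracted into $y$ has size at least two (edges in $Y$ impose nothing). *)

theory Defs
  imports "HOL-Library.Multiset" "HOL-Library.Numeral_Type" "HOL-Library.Disjoint_Sets"
begin

section \<open>Bordered multigraphs\<close>

text \<open>
  Edges carry their own names, so parallel edges are distinct edges with the same set of ends.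
  The numeral type \<open>3\<close> is the ring of integers modulo 3.
\<close>

record ('v, 'e) bgraph =
  verts :: "'v set"
  edges :: "'e set"
  ends :: "'e \<Rightarrow> 'v set"
  bd :: "'v \<Rightarrow> 3"

definition multigraph :: "('v, 'e) bgraph \<Rightarrow> bool" where
  "multigraph G \<longleftrightarrow> finite (verts G) \<and> finite (edges G) \<and>
     (\<forall>e\<in>edges G. ends G e \<subseteq> verts G \<and> card (ends G e) = 2)"

definition inc :: "('v, 'e) bgraph \<Rightarrow> 'v \<Rightarrow> 'e set" where
  "inc G v = {e \<in> edges G. v \<in> ends G e}"

definition deg :: "('v, 'e) bgraph \<Rightarrow> 'v \<Rightarrow> nat" where
  "deg G v = card (inc G v)"

definition component :: "('v, 'e) bgraph \<Rightarrow> 'v \<Rightarrow> 'v set" where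
  "component G v = {w \<in> verts G. (v, w) \<in> {(a, b). \<exists>e\<in>edges G. ends G e = {a, b}}\<^sup>*}"

definition bordered :: "('v, 'e) bgraph \<Rightarrow> bool" where
  "bordered G \<longleftrightarrow> multigraph G \<and> (\<forall>v\<in>verts G. (\<Sum>w\<in>component G v. bd G w) = 0)"

definition bgraph_iso ::
  "('v \<Rightarrow> 'w) \<Rightarrow> ('e \<Rightarrow> 'f) \<Rightarrow> ('v, 'e) bgraph \<Rightarrow> ('w, 'f) bgraph \<Rightarrow> bool" where
  "bgraph_iso f g G H \<longleftrightarrow>
     bij_betw f (verts G) (verts H) \<and> bij_betw g (edges G) (edges H) \<and>
     (\<forall>e\<in>edges G. ends H (g e) = f ` ends G e) \<and>
     (\<forall>v\<in>verts G. bd H (f v) = bd G v)"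

section \<open>Orientations and flows\<close>

text \<open>
  An orientation is given by the map sending each edge to its head. For an orientation of only
  some of the edges, the values on the other edges are irrelevant.
\<close>

definition orients :: "('v, 'e) bgraph \<Rightarrow> 'e set \<Rightarrow> ('e \<Rightarrow> 'v) \<Rightarrow> bool" where
  "orients G F h \<longleftrightarrow> (\<forall>e\<in>F. h e \<in> ends G e)"

definition outdeg :: "('v, 'e) bgraph \<Rightarrow> ('e \<Rightarrow> 'v) \<Rightarrow> 'v \<Rightarrow> nat" where
  "outdeg G h v = card {e \<in> inc G v. h e \<noteq> v}"

definition indeg :: "('v, 'e) bgraph \<Rightarrow> ('e \<Rightarrow> 'v) \<Rightarrow> 'v \<Rightarrow> nat" where
  "indeg G h v = card {e \<in> inc G v. h e = v}"

definition balanced_at :: "('v, 'e) bgraph \<Rightarrow> ('e \<Rightarrow> 'v) \<Rightarrow> 'v \<Rightarrow> bool" where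
  "balanced_at G h v \<longleftrightarrow> (of_int (int (outdeg G h v) - int (indeg G h v)) :: 3) = bd G v"

definition nz_flow :: "('v, 'e) bgraph \<Rightarrow> ('e \<Rightarrow> 'v) \<Rightarrow> bool" where
  "nz_flow G h \<longleftrightarrow> orients G (edges G) h \<and> (\<forall>v\<in>verts G. balanced_at G h v)"

definition same_way :: "'v \<Rightarrow> ('e \<Rightarrow> 'v) \<Rightarrow> 'e set \<Rightarrow> bool" where
  "same_way z h F \<longleftrightarrow> (\<forall>e\<in>F. h e = z) \<or> (\<forall>e\<in>F. h e \<noteq> z)"

section \<open>Canvases\<close>

definition canvas :: "('v, 'e) bgraph \<Rightarrow> 'v \<Rightarrow> bool" where
  "canvas G z \<longleftrightarrow> bordered G \<and> z \<in> verts G"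

definition tip_preflow :: "('v, 'e) bgraph \<Rightarrow> 'v \<Rightarrow> ('e \<Rightarrow> 'v) \<Rightarrow> bool" where
  "tip_preflow G z \<psi> \<longleftrightarrow> orients G (inc G z) \<psi> \<and> balanced_at G \<psi> z"

definition extends :: "('v, 'e) bgraph \<Rightarrow> 'v \<Rightarrow> ('e \<Rightarrow> 'v) \<Rightarrow> bool" where
  "extends G z \<psi> \<longleftrightarrow> (\<exists>\<phi>. nz_flow G \<phi> \<and> (\<forall>e\<in>inc G z. \<phi> e = \<psi> e))"

definition tau :: "('v, 'e) bgraph \<Rightarrow> 'v \<Rightarrow> int set" where
  "tau G v =
     (if even (deg G v)
      then (if bd G v = 0 then {0} else if bd G v = 1 then {-2} else {2})
      else (if bd G v = 0 then {-3, 3} else if bd G v = 1 then {1} else {-1}))"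

definition tau_abs :: "('v, 'e) bgraph \<Rightarrow> 'v \<Rightarrow> int" where
  "tau_abs G v = the_elem (abs ` tau G v)"

definition tame :: "('v, 'e) bgraph \<Rightarrow> 'v \<Rightarrow> bool" where
  "tame G z \<longleftrightarrow> (\<forall>v\<in>verts G - {z}. int (deg G v) \<ge> 4 + tau_abs G v)"

subsection \<open>Contractions\<close>

definition part_of :: "'v set set \<Rightarrow> 'v \<Rightarrow> 'v set" where
  "part_of P v = (THE A. A \<in> P \<and> v \<in> A)"

text \<open>The vertices of the contracted graph are the parts themselves.\<close>

definition contract :: "('v, 'e) bgraph \<Rightarrow> 'v set set \<Rightarrow> ('v set, 'e) bgraph" where
  "contract G P =
     \<lparr>verts = P,
      edges = {e \<in> edges G. \<not> (\<exists>A\<in>P. ends G e \<subseteq> A)},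
      ends = (\<lambda>e. part_of P ` ends G e),
      bd = (\<lambda>A. \<Sum>v\<in>A. bd G v)\<rparr>"

definition tip_respecting :: "('v, 'e) bgraph \<Rightarrow> 'v \<Rightarrow> 'v set set \<Rightarrow> bool" where
  "tip_respecting G z P \<longleftrightarrow> partition_on (verts G) P \<and> {z} \<in> P"

definition nontrivial :: "'v set set \<Rightarrow> bool" where
  "nontrivial P \<longleftrightarrow> (\<exists>A\<in>P. card A \<ge> 2)"

text \<open>
  \<open>restrict_canvas G A\<close> has the tip \<open>restrict_tip G A\<close>; a vertex \<open>a\<close> of \<open>A\<close> becomes \<open>{a}\<close>.
\<close>

definition restrict_canvas :: "('v, 'e) bgraph \<Rightarrow> 'v set \<Rightarrow> ('v set, 'e) bgraph" where
  "restrict_canvas G A = contract G (insert (verts G - A) ((\<lambda>a. {a}) ` A))"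

definition restrict_tip :: "('v, 'e) bgraph \<Rightarrow> 'v set \<Rightarrow> 'v set" where
  "restrict_tip G A = verts G - A"

subsection \<open>Criticality\<close>

text \<open>
  For a tip-respecting partition \<open>P\<close>, the edges at \<open>z\<close> in \<open>G\<close> are exactly the edges at \<open>{z}\<close> in
  \<open>contract G P\<close>, and the preflow with heads \<open>\<psi>\<close> becomes there the one with heads
  \<open>part_of P \<circ> \<psi>\<close>.
\<close>

definition extends_in_contraction ::
  "('v, 'e) bgraph \<Rightarrow> 'v \<Rightarrow> 'v set set \<Rightarrow> ('e \<Rightarrow> 'v) \<Rightarrow> bool" where
  "extends_in_contraction G z P \<psi> \<longleftrightarrow> extends (contract G P) {z} (part_of P \<circ> \<psi>)"

definition preflow_critical :: "('v, 'e) bgraph \<Rightarrow> 'v \<Rightarrow> ('e \<Rightarrow> 'v) \<Rightarrow> bool" where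
  "preflow_critical G z \<psi> \<longleftrightarrow> \<not> extends G z \<psi> \<and>
     (\<forall>P. tip_respecting G z P \<and> nontrivial P \<longrightarrow> extends_in_contraction G z P \<psi>)"

definition flow_critical :: "('v, 'e) bgraph \<Rightarrow> 'v \<Rightarrow> bool" where
  "flow_critical G z \<longleftrightarrow>
     (\<forall>P. tip_respecting G z P \<and> nontrivial P \<longrightarrow>
       (\<exists>\<psi>. tip_preflow G z \<psi> \<and> extends_in_contraction G z P \<psi> \<and> \<not> extends G z \<psi>))"

section \<open>The classes of canvases and easels\<close>

definition easel :: "('v, 'e) bgraph \<Rightarrow> 'v \<Rightarrow> 'v \<Rightarrow> ('e \<Rightarrow> 'v) \<Rightarrow> bool" where
  "easel G z x \<psi> \<longleftrightarrow> canvas G z \<and> x \<in> verts G \<and> x \<noteq> z \<and> tip_preflow G z \<psi>"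

definition tallness_witnessing :: "int \<Rightarrow> ('v, 'e) bgraph \<Rightarrow> 'v \<Rightarrow> ('e \<Rightarrow> 'v) \<Rightarrow> bool" where
  "tallness_witnessing k G z \<psi> \<longleftrightarrow>
     tip_preflow G z \<psi> \<and> \<not> extends G z \<psi> \<and>
     (int (deg G z) = k + 1 \<longrightarrow> \<not> same_way z \<psi> (inc G z))"

definition tallness_witness ::
  "int \<Rightarrow> int \<Rightarrow> ('v, 'e) bgraph \<Rightarrow> 'v \<Rightarrow> 'v \<Rightarrow> ('e \<Rightarrow> 'v) \<Rightarrow> bool" where
  "tallness_witness k r G z x \<psi> \<longleftrightarrow>
     tallness_witnessing k G z \<psi> \<and> x \<in> verts G \<and> x \<noteq> z \<and> int (deg G x) \<ge> k - 2 - r \<and>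
     (int (deg G x) = k - 2 - r \<and> int (deg G z) = k + 1 \<longrightarrow>
       \<not> same_way z \<psi> {e \<in> inc G z. x \<notin> ends G e})"

text \<open>
  The classes are predicates that are invariant under isomorphism and available at all
  vertex and edge types; a canvas is isomorphic to a member iff it satisfies the predicate.
\<close>

definition canvas_class :: "int \<Rightarrow> ('v, 'e) bgraph \<Rightarrow> 'v \<Rightarrow> bool" where
  "canvas_class k G z \<longleftrightarrow>
     canvas G z \<and> flow_critical G z \<and> tame G z \<and> int (deg G z) \<le> k + 1 \<and>
     (\<exists>\<psi>. tallness_witnessing k G z \<psi>)"

definition easel_class ::
  "int \<Rightarrow> int \<Rightarrow> ('v, 'e) bgraph \<Rightarrow> 'v \<Rightarrow> 'v \<Rightarrow> ('e \<Rightarrow> 'v) \<Rightarrow> bool" where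
  "easel_class k r G z x \<psi> \<longleftrightarrow>
     easel G z x \<psi> \<and> tame G z \<and> flow_critical G z \<and> int (deg G z) \<le> k + 1 \<and>
     tallness_witness k r G z x \<psi>"

section \<open>The ordering\<close>

definition in_friendly :: "('v, 'e) bgraph \<Rightarrow> 'v \<Rightarrow> bool" where
  "in_friendly G v \<longleftrightarrow> (\<exists>t\<in>tau G v. t \<le> 0)"

definition out_friendly :: "('v, 'e) bgraph \<Rightarrow> 'v \<Rightarrow> bool" where
  "out_friendly G v \<longleftrightarrow> (\<exists>t\<in>tau G v. t \<ge> 0)"

definition mixed :: "('v, 'e) bgraph \<Rightarrow> 'v \<Rightarrow> 'e \<Rightarrow> bool" where
  "mixed G z e \<longleftrightarrow> e \<in> edges G \<and>
     (\<exists>u v. ends G e = {u, v} \<and> u \<noteq> z \<and> v \<noteq> z \<and> in_friendly G u \<and> out_friendly G v)"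

definition homogeneous :: "('v, 'e) bgraph \<Rightarrow> 'v \<Rightarrow> 'v \<Rightarrow> bool" where
  "homogeneous G z x \<longleftrightarrow> (\<forall>e. mixed G z e \<longrightarrow> x \<in> ends G e)"

definition ord_size :: "('v, 'e) bgraph \<Rightarrow> 'v \<Rightarrow> nat" where
  "ord_size G z = card (verts G) + card {e \<in> edges G. z \<notin> ends G e}"

definition prec ::
  "('v, 'e) bgraph \<Rightarrow> 'v \<Rightarrow> 'v \<Rightarrow> ('w, 'f) bgraph \<Rightarrow> 'w \<Rightarrow> 'w \<Rightarrow> bool" where
  "prec G1 z1 x1 G2 z2 x2 \<longleftrightarrow>
     ord_size G1 z1 < ord_size G2 z2 \<or>
     (ord_size G1 z1 = ord_size G2 z2 \<and> \<not> homogeneous G1 z1 x1 \<and> homogeneous G2 z2 x2) \<or>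
     (ord_size G1 z1 = ord_size G2 z2 \<and> homogeneous G1 z1 x1 \<and> homogeneous G2 z2 x2 \<and>
       deg G1 z1 < deg G2 z2)"

section \<open>Operations\<close>

text \<open>
  Operations are relations between a graph \<open>G\<close> and the result \<open>H\<close>, because the names of new
  vertices and edges are arbitrary. They should be used at infinite vertex and edge types, so that
  fresh names exist.
\<close>

definition alteration ::
  "('v, 'e) bgraph \<Rightarrow> 'v \<Rightarrow> 'v \<Rightarrow> ('v, 'e) bgraph \<Rightarrow> bool" where
  "alteration G u v H \<longleftrightarrow> u \<in> verts G \<and> v \<in> verts G \<and> u \<noteq> v \<and>
     (\<exists>e. e \<notin> edges G \<and>
       H = \<lparr>verts = verts G, edges = insert e (edges G), ends = (ends G)(e := {u, v}),
            bd = (bd G)(u := bd G u + 1, v := bd G v - 1)\<rparr>)"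

definition one_alteration :: "('v, 'e) bgraph \<Rightarrow> 'v \<Rightarrow> ('v, 'e) bgraph \<Rightarrow> bool" where
  "one_alteration G z H \<longleftrightarrow> (\<exists>u v. u \<noteq> z \<and> v \<noteq> z \<and> alteration G u v H)"

definition tip_alteration :: "('v, 'e) bgraph \<Rightarrow> 'v \<Rightarrow> 'v \<Rightarrow> ('v, 'e) bgraph \<Rightarrow> bool" where
  "tip_alteration G z w H \<longleftrightarrow> alteration G z w H \<or> alteration G w z H"

definition tip_reduction :: "('v, 'e) bgraph \<Rightarrow> 'v \<Rightarrow> 'v \<Rightarrow> ('v, 'e) bgraph \<Rightarrow> bool" where
  "tip_reduction G z v H \<longleftrightarrow> v \<in> verts G \<and> v \<noteq> z \<and>
     (\<exists>e\<in>edges G. \<exists>e'\<in>edges G. e \<noteq> e' \<and> ends G e = {z, v} \<and> ends G e' = {z, v} \<and>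
       H = G\<lparr>edges := edges G - {e}\<rparr>)"

text \<open>
  A set of vertices and edges is a subset of \<open>verts G <+> edges G\<close>, with \<open>Inl\<close> marking vertices
  and \<open>Inr\<close> marking edges. \<open>spokes G y t\<close> is the multiset of the pairs of ends of the two new edges
  joining \<open>y\<close> to \<open>t\<close>: both go to \<open>w\<close> if \<open>t\<close> is a vertex \<open>w\<close>, and one goes to each end if \<open>t\<close> is
  an edge.
\<close>

definition spokes :: "('v, 'e) bgraph \<Rightarrow> 'v \<Rightarrow> 'v + 'e \<Rightarrow> 'v set multiset" where
  "spokes G y t = (case t of
       Inl w \<Rightarrow> {#{w, y}, {w, y}#}
     | Inr e \<Rightarrow> image_mset (\<lambda>u. {u, y}) (mset_set (ends G e)))"

definition rewire ::
  "('v, 'e) bgraph \<Rightarrow> 'v \<Rightarrow> ('v + 'e) set \<Rightarrow> ('v, 'e) bgraph \<Rightarrow> bool" where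
  "rewire G y X H \<longleftrightarrow> (\<exists>F. finite F \<and> F \<inter> edges G = {} \<and>
     edges H = {e \<in> edges G. Inr e \<notin> X} \<union> F \<and>
     (\<forall>e\<in>edges G. Inr e \<notin> X \<longrightarrow> ends H e = ends G e) \<and>
     image_mset (ends H) (mset_set F) = (\<Sum>t\<in>X. spokes G y t))"

definition two_alteration ::
  "('v, 'e) bgraph \<Rightarrow> ('v + 'e) set \<Rightarrow> ('v, 'e) bgraph \<Rightarrow> bool" where
  "two_alteration G X H \<longleftrightarrow>
     X \<noteq> {} \<and> X \<subseteq> verts G <+> edges G \<and> card X \<le> 2 \<and>
     (\<exists>y. y \<notin> verts G \<and> verts H = insert y (verts G) \<and> bd H y = 0 \<and>
       (\<forall>v\<in>verts G. bd H v = bd G v) \<and> rewire G y X H)"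

definition x_alteration ::
  "('v, 'e) bgraph \<Rightarrow> 'v \<Rightarrow> 'v \<Rightarrow> 'v + 'e \<Rightarrow> ('v, 'e) bgraph \<Rightarrow> bool" where
  "x_alteration G z x y H \<longleftrightarrow>
     x \<in> verts G \<and> x \<noteq> z \<and>
     y \<in> (verts G - {x, z}) <+> {e \<in> edges G. ends G e \<inter> {x, z} = {}} \<and>
     verts H = verts G \<and> (\<forall>v\<in>verts G. bd H v = bd G v) \<and> rewire G x {y} H"

section \<open>Expansions\<close>

definition class_partition ::
  "(('v set, 'e) bgraph \<Rightarrow> 'v set \<Rightarrow> bool) \<Rightarrow> ('v, 'e) bgraph \<Rightarrow> 'v \<Rightarrow> 'v set set \<Rightarrow> bool" where
  "class_partition \<C> G z P \<longleftrightarrow> tip_respecting G z P \<and>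
     (\<forall>A\<in>P. card A \<ge> 2 \<longrightarrow> \<C> (restrict_canvas G A) (restrict_tip G A))"

definition expansion ::
  "(('v set, 'e) bgraph \<Rightarrow> 'v set \<Rightarrow> bool) \<Rightarrow> 'v \<Rightarrow> 'w \<Rightarrow>
   (('v set, 'e) bgraph \<Rightarrow> 'v set \<Rightarrow> 'v set \<Rightarrow> ('e \<Rightarrow> 'v set) \<Rightarrow> bool) \<Rightarrow> ('w + 'f) set \<Rightarrow>
   ('v, 'e) bgraph \<Rightarrow> 'v \<Rightarrow> ('w, 'f) bgraph \<Rightarrow> 'w \<Rightarrow> bool" where
  "expansion \<C> x x' \<E> Y G z G' z' \<longleftrightarrow>
     x \<in> verts G \<and> x' \<in> verts G' - {z'} \<and>
     (\<exists>P f g. class_partition \<C> G z P \<and>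
        bgraph_iso f g (contract G P) G' \<and> f {z} = z' \<and>
        f (part_of P x) = x' \<and>
        (card (part_of P x) > 1 \<longrightarrow>
          (\<exists>\<psi>\<^sub>1. \<E> (restrict_canvas G (part_of P x)) (restrict_tip G (part_of P x)) {x} \<psi>\<^sub>1)) \<and>
        (\<forall>y. Inl y \<in> Y \<and> y \<noteq> z' \<longrightarrow> (\<exists>A\<in>P. f A = y \<and> card A \<ge> 2)))"

section \<open>The outcomes\<close>

text \<open>
  In all outcomes the canvas \<open>(G', z')\<close> with its vertex \<open>x'\<close> has its own names, so identities such
  as \<open>z' = z\<close> and \<open>x' = x\<close> are expressed by an isomorphism matching these vertices.
\<close>

definition pointed_iso ::
  "('v, 'e) bgraph \<Rightarrow> 'v \<Rightarrow> 'v \<Rightarrow> ('w, 'f) bgraph \<Rightarrow> 'w \<Rightarrow> 'w \<Rightarrow> bool" where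
  "pointed_iso G z x H z' x' \<longleftrightarrow> (\<exists>f g. bgraph_iso f g G H \<and> f z = z' \<and> f x = x')"

definition EXP ::
  "int \<Rightarrow> int \<Rightarrow> ('v, 'e) bgraph \<Rightarrow> 'v \<Rightarrow> 'v \<Rightarrow> ('w, 'f) bgraph \<Rightarrow> 'w \<Rightarrow> 'w \<Rightarrow> bool" where
  "EXP k r G z x G' z' x' \<longleftrightarrow>
     expansion (canvas_class k) x x' (easel_class k r) {} G z G' z'"

definition EXPA ::
  "int \<Rightarrow> int \<Rightarrow> ('v, 'e) bgraph \<Rightarrow> 'v \<Rightarrow> 'v \<Rightarrow> ('w, 'f) bgraph \<Rightarrow> 'w \<Rightarrow> 'w \<Rightarrow> bool" where
  "EXPA k r G z x G' z' x' \<longleftrightarrow>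
     (\<exists>y\<^sub>1 y\<^sub>2 H. two_alteration G' {y\<^sub>1, y\<^sub>2} H \<and>
        expansion (canvas_class k) x x' (easel_class k r) {y\<^sub>1, y\<^sub>2} G z H z')"

definition EXPX ::
  "int \<Rightarrow> int \<Rightarrow> ('v, 'e) bgraph \<Rightarrow> 'v \<Rightarrow> 'v \<Rightarrow> ('w, 'f) bgraph \<Rightarrow> 'w \<Rightarrow> 'w \<Rightarrow> bool" where
  "EXPX k r G z x G' z' x' \<longleftrightarrow>
     int (deg G z) = k + 1 \<and> int (deg G x) = k - 2 - r \<and> deg G' x' \<ge> deg G x \<and>
     (\<exists>y H. x_alteration G' z' x' y H \<and>
        expansion (canvas_class k) x x' (easel_class k r) {y, Inl x'} G z H z')"

definition EXPB ::
  "int \<Rightarrow> int \<Rightarrow> ('v, 'e) bgraph \<Rightarrow> 'v \<Rightarrow> 'v \<Rightarrow> ('w, 'f) bgraph \<Rightarrow> 'w \<Rightarrow> 'w \<Rightarrow> bool" where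
  "EXPB k r G z x G' z' x' \<longleftrightarrow>
     (\<exists>H. one_alteration G' z' H \<and>
        expansion (canvas_class k) x x' (easel_class k r) {} G z H z')"

definition ADD ::
  "('v, 'e) bgraph \<Rightarrow> 'v \<Rightarrow> 'v \<Rightarrow> ('w, 'f) bgraph \<Rightarrow> 'w \<Rightarrow> 'w \<Rightarrow> bool" where
  "ADD G z x G' z' x' \<longleftrightarrow>
     (\<exists>v H. v \<noteq> x' \<and> tip_alteration G' z' v H \<and> pointed_iso G z x H z' x')"

definition REM ::
  "('v, 'e) bgraph \<Rightarrow> 'v \<Rightarrow> 'v \<Rightarrow> ('w, 'f) bgraph \<Rightarrow> 'w \<Rightarrow> 'w \<Rightarrow> bool" where
  "REM G z x G' z' x' \<longleftrightarrow>
     (\<exists>v H. v \<noteq> x' \<and> tip_reduction G' z' v H \<and> pointed_iso G z x H z' x')"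

end

theory Submission
  imports Defs
begin

text \<open>
  Everything rests on a degree bound (\<open>tip_bound\<close>): if a preflow of a tame flow-critical canvas does not
  extend, then every vertex \<open>v\<close> other than the tip \<open>z\<close> satisfies \<open>deg v + 2 \<le> deg z\<close>, and equality forces
  the edges at \<open>z\<close> avoiding \<open>v\<close> to point the same way and all other vertices to have degree four.
  Applied to the restrictions of a canvas to vertex sets, the bound shows that cuts are large, so that
  after deleting an edge, or lifting two pairs of edges at a vertex of degree four, a coarsest
  partition whose quotient the preflow does not extend to yields a smaller tame flow-critical canvas.

  For an easel, one merges vertices if the preflow is not critical (EXP), lifts at a vertex of degree
  four other than \<open>x\<close> (EXPA), and deletes a mixed edge avoiding \<open>x\<close> (EXPB). If none of this is possible, all
  vertices other than \<open>x\<close> and \<open>z\<close> tolerate only one sign of change, and one either deletes an edge at the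
  tip (ADD) or reverses one and doubles it, which changes the balances by multiples of \<open>3\<close> (REM).

  For \<open>r = -1\<close> the easels of the classes are exactly the violations of the inequality and of the same-way
  clause of the bound. The step above and descent along the ordering thus also prove these parts
  of the bound for canvases of one order from the bound for smaller ones; the remaining clause on vertices
  of degree four is then derived from them.
\<close>

text \<open>The cut of a proper set of at least two vertices off the tip satisfies the tameness
  inequality with 6 in place of 4. This slack pays for the reductions: such a cut may lose two edges
  (lifting), or one edge together with a change of boundary (deletion), and still be that of a tame
  vertex. A coarsest failing partition is taken because one preflow then witnesses flow-criticality
  of the quotient against all its partitions at once.

  The hard case is the extreme easel, with tip degree \<open>k + 1\<close> and
  \<open>deg x = k - 2 - r\<close>. After a lifting the tip edges off the part of \<open>x\<close>
  must still have both directions, which dictates which vertex of degree four is lifted and how its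
  edges are paired. Moreover, a part containing a lifted pair may have a cut of size
  \<open>k + 1\<close>, and membership in the class then asks for a preflow with both directions on
  that cut.

  The bound carries its equality clauses because the induction consumes them. Its hypothesis speaks
  of graphs over \<open>nat\<close>, since an induction in HOL cannot range over types.\<close>

lemma of_int_3_eq_0_iff: "(of_int n :: 3) = 0 \<longleftrightarrow> 3 dvd n"
  by (simp add: of_int_eq_0_iff_char_dvd bit1.CHAR_eq)

lemma Z3_cases: obtains "(b::3) = 0" | "b = 1" | "b = -1"
proof (cases b)
  case (of_int z)
  then have "z = 0 \<or> z = 1 \<or> z = 2" by auto
  moreover have "(2::3) = -1" by simp
  ultimately show ?thesis using that of_int by auto
qed

section \<open>Cuts, fluxes and balance of vertex sets\<close>

definition cross :: "('v, 'e) bgraph \<Rightarrow> 'v set \<Rightarrow> 'e set" where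
  "cross G S = {e \<in> edges G. ends G e \<inter> S \<noteq> {} \<and> \<not> ends G e \<subseteq> S}"

definition cutdeg :: "('v, 'e) bgraph \<Rightarrow> 'v set \<Rightarrow> nat" where
  "cutdeg G S = card (cross G S)"

definition bsum :: "('v, 'e) bgraph \<Rightarrow> 'v set \<Rightarrow> 3" where
  "bsum G S = sum (bd G) S"

text \<open>Signed like \<open>outdeg - indeg\<close>: an edge leaving \<open>S\<close> counts 1.
  The value 0 off the cut lets sums run over all edges, so that fluxes of different sets can be
  added edge by edge.\<close>

definition flux :: "('v, 'e) bgraph \<Rightarrow> ('e \<Rightarrow> 'v) \<Rightarrow> 'v set \<Rightarrow> 'e \<Rightarrow> int" where
  "flux G h S e = (if ends G e \<inter> S \<noteq> {} \<and> \<not> ends G e \<subseteq> S then if h e \<in> S then -1 else 1 else 0)"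

definition net :: "('v, 'e) bgraph \<Rightarrow> ('e \<Rightarrow> 'v) \<Rightarrow> 'v set \<Rightarrow> int" where
  "net G h S = (\<Sum>e\<in>edges G. flux G h S e)"

definition balanced_on :: "('v, 'e) bgraph \<Rightarrow> ('e \<Rightarrow> 'v) \<Rightarrow> 'v set \<Rightarrow> bool" where
  "balanced_on G h S \<longleftrightarrow> of_int (net G h S) = bsum G S"

text \<open>
  An orientation of all of \<open>G\<close> that is balanced on every part of \<open>P\<close> is a flow of the contraction by
  \<open>P\<close>; working with it avoids the contracted graph. The edges inside the parts are irrelevant.
\<close>

definition ext :: "('v, 'e) bgraph \<Rightarrow> 'v set set \<Rightarrow> 'v set \<Rightarrow> ('e \<Rightarrow> 'v) \<Rightarrow> bool" where
  "ext G P B \<psi> \<longleftrightarrow> (\<exists>h. orients G (edges G) h \<and> (\<forall>e\<in>cross G B. h e \<in> B \<longleftrightarrow> \<psi> e \<in> B) \<and>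
     (\<forall>A\<in>P. balanced_on G h A))"

definition ebt :: "('v, 'e) bgraph \<Rightarrow> 'v set \<Rightarrow> 'v set \<Rightarrow> nat" where
  "ebt G S T = card {e \<in> edges G. ends G e \<inter> S \<noteq> {} \<and> ends G e \<inter> T \<noteq> {}}"

lemma multigraph_edgeE:
  assumes "e \<in> edges G" "multigraph G"
  obtains a b where "ends G e = {a, b}" "a \<noteq> b" "a \<in> verts G" "b \<in> verts G"
  using assms unfolding multigraph_def by (metis card_2_iff insert_subset)

lemma multigraph_finite [simp]:
  assumes "multigraph G" shows "finite (verts G)" "finite (edges G)"
  using assms unfolding multigraph_def by auto

lemma card_sum_if: "finite E \<Longrightarrow> int (card {e \<in> E. p e}) = (\<Sum>e\<in>E. if p e then 1 else 0)"
  by (simp add: sum.If_cases Int_def)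

lemma finite_cross [simp]: "multigraph G \<Longrightarrow> finite (cross G S)"
  by (simp add: cross_def)

lemma cutdeg_sum: "multigraph G \<Longrightarrow>
  int (cutdeg G S) = (\<Sum>e\<in>edges G. if ends G e \<inter> S \<noteq> {} \<and> \<not> ends G e \<subseteq> S then 1 else 0)"
  unfolding cutdeg_def cross_def by (rule card_sum_if) simp

lemma ebt_sum: "multigraph G \<Longrightarrow>
  int (ebt G S T) = (\<Sum>e\<in>edges G. if ends G e \<inter> S \<noteq> {} \<and> ends G e \<inter> T \<noteq> {} then 1 else 0)"
  unfolding ebt_def by (rule card_sum_if) simp

lemma net_cross:
  assumes "multigraph G"
  shows "net G h S = (\<Sum>e\<in>cross G S. if h e \<in> S then -1 else 1)"
  unfolding net_def flux_def cross_def using assms by (simp add: sum.inter_filter)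

lemma inc_cross: assumes "multigraph G" shows "inc G v = cross G {v}"
proof -
  have "v \<in> ends G e \<longleftrightarrow> ends G e \<inter> {v} \<noteq> {} \<and> \<not> ends G e \<subseteq> {v}" if "e \<in> edges G" for e
    using assms that by (elim multigraph_edgeE) auto
  then show ?thesis unfolding inc_def cross_def by blast
qed

lemma deg_cutdeg: "multigraph G \<Longrightarrow> deg G v = cutdeg G {v}"
  by (simp add: deg_def cutdeg_def inc_cross)

lemma bsum_single [simp]: "bsum G {v} = bd G v"
  by (simp add: bsum_def)

lemma net_bound: assumes "multigraph G" shows "\<bar>net G h S\<bar> \<le> int (cutdeg G S)"
proof -
  have "\<bar>net G h S\<bar> \<le> (\<Sum>e\<in>cross G S. \<bar>if h e \<in> S then -1 else 1\<bar>)"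
    unfolding net_cross[OF assms] by (rule sum_abs)
  also have "\<dots> = (\<Sum>e\<in>cross G S. 1)" by (rule sum.cong) auto
  finally show ?thesis by (simp add: cutdeg_def)
qed

lemma net_parity: assumes "multigraph G" shows "even (net G h S) \<longleftrightarrow> even (cutdeg G S)"
proof -
  have "even ((\<Sum>e\<in>F. if h e \<in> S then -1 else 1) :: int) \<longleftrightarrow> even (card F)" if "finite F" for F :: "'b set"
    using that by (induction F rule: finite_induct) auto
  then show ?thesis using assms by (simp add: net_cross cutdeg_def)
qed

lemma balanced_at_iff: assumes "multigraph G" shows "balanced_at G h v \<longleftrightarrow> balanced_on G h {v}"
proof -
  have f: "finite (inc G v)" using assms by (simp add: inc_def)
  have "int (outdeg G h v) - int (indeg G h v) = (\<Sum>e\<in>inc G v. (if h e \<noteq> v then 1 else 0) - (if h e = v then 1 else 0))"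
    unfolding outdeg_def indeg_def by (simp only: card_sum_if[OF f] sum_subtractf)
  also have "\<dots> = (\<Sum>e\<in>inc G v. if h e \<in> {v} then -1 else 1)" by (rule sum.cong) auto
  finally have "int (outdeg G h v) - int (indeg G h v) = net G h {v}"
    by (simp only: net_cross[OF assms] inc_cross[OF assms])
  then show ?thesis unfolding balanced_at_def balanced_on_def by simp
qed

text \<open>An edge between \<open>S\<close> and \<open>T\<close> is counted once with each sign and
  cancels; this is where the head must be one of the two ends.\<close>

lemma flux_Un:
  assumes "multigraph G" "orients G (edges G) h" "S \<inter> T = {}" "e \<in> edges G"
  shows "flux G h (S \<union> T) e = flux G h S e + flux G h T e"
proof -
  obtain a b where ab: "ends G e = {a, b}" "a \<noteq> b" using assms by (elim multigraph_edgeE)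
  moreover have "h e \<in> {a, b}" using assms ab(1) unfolding orients_def by fastforce
  ultimately show ?thesis using assms(3) unfolding flux_def by auto
qed

lemma net_Un:
  assumes "multigraph G" "orients G (edges G) h" "S \<inter> T = {}"
  shows "net G h (S \<union> T) = net G h S + net G h T"
  unfolding net_def sum.distrib[symmetric] by (rule sum.cong) (use flux_Un[OF assms] in auto)

lemma net_empty [simp]: "net G h {} = 0"
  by (simp add: net_def flux_def)

lemma net_Union:
  assumes "multigraph G" "orients G (edges G) h" "finite P" "disjoint P"
  shows "net G h (\<Union>P) = (\<Sum>A\<in>P. net G h A)"
  using assms(3,4)
proof (induction P rule: finite_induct)
  case (insert A P)
  then have "disjoint P" "A \<inter> \<Union>P = {}" by (auto simp: disjoint_def)
  with insert show ?case using net_Un[OF assms(1,2)] by simp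
qed simp

lemma net_verts: "multigraph G \<Longrightarrow> net G h (verts G) = 0"
  unfolding net_def flux_def by (rule sum.neutral) (auto elim: multigraph_edgeE)

lemma bsum_Un: "finite S \<Longrightarrow> finite T \<Longrightarrow> S \<inter> T = {} \<Longrightarrow> bsum G (S \<union> T) = bsum G S + bsum G T"
  by (simp add: bsum_def sum.union_disjoint)

lemma bsum_Union:
  assumes "finite (\<Union>P)" "disjoint P"
  shows "bsum G (\<Union>P) = (\<Sum>A\<in>P. bsum G A)"
  unfolding bsum_def using assms
  by (subst sum.Union_disjoint) (auto simp: disjoint_def finite_subset[OF Union_upper])

lemma balanced_Union:
  assumes "multigraph G" "orients G (edges G) h" "disjoint P" "\<Union>P \<subseteq> verts G" "\<forall>A\<in>P. balanced_on G h A"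
  shows "balanced_on G h (\<Union>P)"
proof -
  have f: "finite (\<Union>P)" using assms by (meson finite_subset multigraph_finite)
  then have "finite P" by (rule finite_UnionD)
  then show ?thesis using assms f
    by (auto simp: balanced_on_def net_Union bsum_Union intro!: sum.cong)
qed

text \<open>\<open>net\<close> and \<open>bsum\<close> are both additive, so balance may be checked
  vertex by vertex.\<close>

lemma balanced_singles:
  assumes "multigraph G" "orients G (edges G) h" "S \<subseteq> verts G" "\<And>v. v \<in> S \<Longrightarrow> balanced_on G h {v}"
  shows "balanced_on G h S"
proof -
  have "disjoint ((\<lambda>v. {v}) ` S)" by (auto simp: disjoint_def)
  then have "balanced_on G h (\<Union>((\<lambda>v. {v}) ` S))"
    by (rule balanced_Union[OF assms(1,2)]) (use assms in auto)
  then show ?thesis by simp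
qed

text \<open>What leaves \<open>S\<close> enters its complement, and the total boundary is 0. Hence
  balance on one part of a partition follows from balance on the others.\<close>

lemma balanced_complement:
  assumes "multigraph G" "orients G (edges G) h" "bsum G (verts G) = 0" "S \<subseteq> verts G"
  shows "balanced_on G h (verts G - S) \<longleftrightarrow> balanced_on G h S"
proof -
  have V: "verts G = S \<union> (verts G - S)" using assms by auto
  have "net G h S + net G h (verts G - S) = 0"
    using net_Un[OF assms(1,2), of S "verts G - S"] net_verts[OF assms(1), of h] V by auto
  then have "net G h (verts G - S) = - net G h S" by simp
  moreover have "bsum G (verts G - S) = - bsum G S"
    using bsum_Un[of S "verts G - S" G] V assms multigraph_finite(1)[OF assms(1)]
    by (metis Diff_disjoint Un_upper1 add_eq_0_iff finite_Diff finite_subset)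
  ultimately show ?thesis by (simp add: balanced_on_def)
qed

lemma bsum_complement:
  assumes "multigraph G" "bsum G (verts G) = 0" "S \<subseteq> verts G"
  shows "bsum G (verts G - S) = - bsum G S"
  using bsum_Un[of S "verts G - S" G] assms multigraph_finite(1)[OF assms(1)]
  by (metis Diff_disjoint Un_Diff_cancel Un_absorb1 add_eq_0_iff finite_Diff finite_subset)

lemma cross_complement:
  assumes "multigraph G" "S \<subseteq> verts G" shows "cross G (verts G - S) = cross G S"
proof -
  have "(ends G e \<inter> (verts G - S) \<noteq> {} \<and> \<not> ends G e \<subseteq> verts G - S) \<longleftrightarrow> (ends G e \<inter> S \<noteq> {} \<and> \<not> ends G e \<subseteq> S)"
    if "e \<in> edges G" for e
    using that assms(1) by (rule multigraph_edgeE) (use assms(2) in auto)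
  then show ?thesis unfolding cross_def by blast
qed

lemma cutdeg_complement:
  "multigraph G \<Longrightarrow> S \<subseteq> verts G \<Longrightarrow> cutdeg G (verts G - S) = cutdeg G S"
  by (simp add: cutdeg_def cross_complement)

text \<open>Submodularity of the cut function with its exact defect: edges between
  \<open>S - T\<close> and \<open>T - S\<close> lie in both cuts on the right and in neither on the
  left.\<close>

lemma cutdeg_submodular:
  assumes "multigraph G"
  shows "cutdeg G (S \<inter> T) + cutdeg G (S \<union> T) + 2 * ebt G (S - T) (T - S) = cutdeg G S + cutdeg G T"
proof -
  have "int (cutdeg G (S \<inter> T)) + int (cutdeg G (S \<union> T)) + 2 * int (ebt G (S - T) (T - S))
      = int (cutdeg G S) + int (cutdeg G T)"
    unfolding cutdeg_sum[OF assms(1)] ebt_sum[OF assms(1)] sum_distrib_left sum.distrib[symmetric]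
  proof (rule sum.cong[OF refl])
    fix e assume "e \<in> edges G"
    then obtain a b where ab: "ends G e = {a, b}" "a \<noteq> b" using assms(1) by (rule multigraph_edgeE)
    show "(if ends G e \<inter> (S \<inter> T) \<noteq> {} \<and> \<not> ends G e \<subseteq> S \<inter> T then 1 else 0) +
      (if ends G e \<inter> (S \<union> T) \<noteq> {} \<and> \<not> ends G e \<subseteq> S \<union> T then 1 else 0) +
      2 * (if ends G e \<inter> (S - T) \<noteq> {} \<and> ends G e \<inter> (T - S) \<noteq> {} then 1 else 0) =
      (if ends G e \<inter> S \<noteq> {} \<and> \<not> ends G e \<subseteq> S then 1 else 0) +
      (if ends G e \<inter> T \<noteq> {} \<and> \<not> ends G e \<subseteq> T then 1 else (0::int))"
      unfolding ab(1)
      by (cases "a \<in> S"; cases "a \<in> T"; cases "b \<in> S"; cases "b \<in> T") simp_all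
  qed
  then show ?thesis by linarith
qed

lemma cutdeg_Un:
  assumes "multigraph G" "S \<inter> T = {}"
  shows "cutdeg G (S \<union> T) + 2 * ebt G S T = cutdeg G S + cutdeg G T"
proof -
  have "S - T = S" "T - S = T" "cutdeg G {} = 0" using assms(2) by (auto simp: cutdeg_def cross_def)
  then show ?thesis using cutdeg_submodular[OF assms(1), of S T] assms(2) by simp
qed

lemma cutdeg_ebt:
  assumes "multigraph G" "S \<inter> T = {}" "S \<inter> U = {}" "T \<inter> U = {}" "verts G = S \<union> T \<union> U"
  shows "cutdeg G S = ebt G S T + ebt G S U"
proof -
  have "int (cutdeg G S) = int (ebt G S T) + int (ebt G S U)"
    unfolding cutdeg_sum[OF assms(1)] ebt_sum[OF assms(1)] sum.distrib[symmetric]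
  proof (rule sum.cong, simp)
    fix e assume "e \<in> edges G"
    with assms(1) obtain a b where "ends G e = {a, b}" "a \<noteq> b" "a \<in> verts G" "b \<in> verts G"
      by (elim multigraph_edgeE)
    with assms show "(if ends G e \<inter> S \<noteq> {} \<and> \<not> ends G e \<subseteq> S then 1 else 0) =
      (if ends G e \<inter> S \<noteq> {} \<and> ends G e \<inter> T \<noteq> {} then 1 else (0::int)) +
      (if ends G e \<inter> S \<noteq> {} \<and> ends G e \<inter> U \<noteq> {} then 1 else 0)"
      by auto
  qed
  then show ?thesis by linarith
qed

lemma ebt_commute: "ebt G S T = ebt G T S"
  unfolding ebt_def by (rule arg_cong[of _ _ card]) auto

subsection \<open>Bordered graphs through closed sets\<close>

lemma component_closed:
  assumes "multigraph G" "v \<in> verts G"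
  shows "cross G (component G v) = {}" "v \<in> component G v" "component G v \<subseteq> verts G"
proof -
  let ?R = "{(a, b). \<exists>e\<in>edges G. ends G e = {a, b}}"
  show "v \<in> component G v" "component G v \<subseteq> verts G" using assms unfolding component_def by auto
  show "cross G (component G v) = {}"
  proof (rule ccontr)
    assume "cross G (component G v) \<noteq> {}"
    then obtain e where e: "e \<in> edges G" "ends G e \<inter> component G v \<noteq> {}" "\<not> ends G e \<subseteq> component G v"
      unfolding cross_def by blast
    obtain a b where ab: "ends G e = {a, b}" "a \<noteq> b" "a \<in> verts G" "b \<in> verts G"
      using assms(1) e(1) by (elim multigraph_edgeE)
    have "(a, b) \<in> ?R" "(b, a) \<in> ?R" using e(1) ab(1) by (auto simp: insert_commute)
    then have "a \<in> component G v \<longleftrightarrow> b \<in> component G v"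
      using ab unfolding component_def by (auto intro: rtrancl_into_rtrancl)
    then show False using e(2,3) ab(1) by auto
  qed
qed

lemma component_subset_closed:
  assumes "cross G S = {}" "v \<in> S"
  shows "component G v \<subseteq> S"
proof
  let ?R = "{(a, b). \<exists>e\<in>edges G. ends G e = {a, b}}"
  fix w assume "w \<in> component G v"
  then have "(v, w) \<in> ?R\<^sup>*" unfolding component_def by simp
  then show "w \<in> S"
  proof (induction rule: rtrancl_induct)
    case (step b c)
    then obtain e where "e \<in> edges G" "ends G e = {b, c}" by auto
    with step(3) assms(1) show ?case unfolding cross_def by auto
  qed (fact assms(2))
qed

lemma cross_Diff_closed:
  assumes "cross G S = {}" "cross G T = {}"
  shows "cross G (S - T) = {}"
  using assms unfolding cross_def by blast

text \<open>A set that no edge leaves is a disjoint union of components, which are split off one at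
  a time. The condition on closed sets passes to quotients directly, because preimages of closed
  sets are closed.\<close>

lemma bordered_iff:
  "bordered G \<longleftrightarrow> multigraph G \<and> (\<forall>S\<subseteq>verts G. cross G S = {} \<longrightarrow> bsum G S = 0)"
proof
  assume b: "bordered G"
  then have m: "multigraph G" unfolding bordered_def by simp
  have "bsum G S = 0" if "S \<subseteq> verts G" "cross G S = {}" for S
  proof -
    have "finite S" using that m by (meson finite_subset multigraph_finite)
    then show ?thesis using that
    proof (induction S rule: finite_psubset_induct)
      case (psubset S)
      show ?case
      proof (cases "S = {}")
        case False
        then obtain v where v: "v \<in> S" by blast
        let ?C = "component G v"
        have vV: "v \<in> verts G" using v psubset(3) by (rule rev_subsetD)
        have C: "?C \<subseteq> S" "v \<in> ?C" "cross G ?C = {}"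
          by (rule component_subset_closed[OF psubset(4) v] component_closed[OF m vV])+
        have 1: "bsum G ?C = 0" using b vV unfolding bordered_def bsum_def by blast
        have "bsum G (S - ?C) = 0"
          by (rule psubset(2)[OF _ _ cross_Diff_closed[OF psubset(4) C(3)]]) (use v C psubset(3) in auto)
        moreover have "?C \<union> (S - ?C) = S" using C by auto
        moreover have "finite ?C" using psubset(1) C(1) finite_subset by blast
        ultimately show ?thesis
          using 1 bsum_Un[of ?C "S - ?C" G] psubset(1) by simp
      qed (simp add: bsum_def)
    qed
  qed
  with m show "multigraph G \<and> (\<forall>S\<subseteq>verts G. cross G S = {} \<longrightarrow> bsum G S = 0)" by blast
next
  assume a: "multigraph G \<and> (\<forall>S\<subseteq>verts G. cross G S = {} \<longrightarrow> bsum G S = 0)"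
  then have "bsum G (component G v) = 0" if "v \<in> verts G" for v
    using component_closed[of G v] that by blast
  with a show "bordered G" unfolding bordered_def bsum_def by blast
qed

lemma cross_verts: "multigraph G \<Longrightarrow> cross G (verts G) = {}"
  unfolding multigraph_def cross_def by blast

lemma bordered_total: "bordered G \<Longrightarrow> bsum G (verts G) = 0"
  by (simp add: bordered_iff cross_verts)

lemma bordered_multigraph: "bordered G \<Longrightarrow> multigraph G"
  unfolding bordered_def by simp

subsection \<open>Tameness\<close>

text \<open>
  \<open>ok4\<close> is the tameness inequality \<open>d \<ge> 4 + \<bar>\<tau>\<bar>\<close> in terms of degree and boundary (a degree of at least six
  always suffices); \<open>ok6\<close> has \<open>6\<close> in place of \<open>4\<close>.
\<close>

definition ok4 :: "nat \<Rightarrow> 3 \<Rightarrow> bool" where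
  "ok4 d b \<longleftrightarrow> d \<ge> 6 \<or> d = 4 \<and> b = 0 \<or> d = 5 \<and> b \<noteq> 0"

definition ok6 :: "nat \<Rightarrow> 3 \<Rightarrow> bool" where
  "ok6 d b \<longleftrightarrow> d \<ge> 8 \<or> d = 6 \<and> b = 0 \<or> d = 7 \<and> b \<noteq> 0"

lemma ok4_tau: "int (deg G v) \<ge> 4 + tau_abs G v \<longleftrightarrow> ok4 (deg G v) (bd G v)"
proof -
  have t: "tau_abs G v = (if even (deg G v) then if bd G v = 0 then 0 else 2 else if bd G v = 0 then 3 else 1)"
    unfolding tau_abs_def tau_def by auto
  have "deg G v \<ge> 8 \<or> deg G v = 0 \<or> deg G v = 1 \<or> deg G v = 2 \<or> deg G v = 3 \<or> deg G v = 4 \<or> deg G v = 5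
    \<or> deg G v = 6 \<or> deg G v = 7" by arith
  then show ?thesis unfolding t ok4_def by (elim disjE) auto
qed

lemma tame_iff: "tame G z \<longleftrightarrow> (\<forall>v\<in>verts G - {z}. ok4 (deg G v) (bd G v))"
  unfolding tame_def ok4_tau by simp

text \<open>The three ways in which the slack is spent: not at all, on two edges with the boundary
  kept, or on one edge with the boundary changed.\<close>

lemma ok6_imp_ok4: "ok6 d b \<Longrightarrow> ok4 d b" "ok6 d b \<Longrightarrow> ok4 (d - 2) b" "ok6 d b \<Longrightarrow> b' \<noteq> b \<Longrightarrow> ok4 (d - 1) b'"
  unfolding ok4_def ok6_def by auto

lemma ok_uminus [simp]: "ok4 d (-b) = ok4 d b" "ok6 d (-b) = ok6 d b"
  unfolding ok4_def ok6_def by auto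

subsection \<open>Quotients\<close>

definition fibre :: "('v \<Rightarrow> 'w) \<Rightarrow> ('v, 'e) bgraph \<Rightarrow> 'w set \<Rightarrow> 'v set" where
  "fibre f G T = {v \<in> verts G. f v \<in> T}"

text \<open>
  Contractions, copies under other names, and copies of contractions are all instances of \<open>quot\<close>; the
  map \<open>g\<close> leads back to the original edges.
\<close>

definition quot :: "('v \<Rightarrow> 'w) \<Rightarrow> ('f \<Rightarrow> 'e) \<Rightarrow> ('v, 'e) bgraph \<Rightarrow> ('w, 'f) bgraph \<Rightarrow> bool" where
  "quot f g G K \<longleftrightarrow> f ` verts G = verts K \<and>
     bij_betw g (edges K) {e \<in> edges G. \<exists>u\<in>ends G e. \<exists>v\<in>ends G e. f u \<noteq> f v} \<and>
     (\<forall>e\<in>edges K. ends K e = f ` ends G (g e)) \<and>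
     (\<forall>w\<in>verts K. bd K w = bsum G (fibre f G {w}))"

definition fibres :: "('v \<Rightarrow> 'w) \<Rightarrow> ('v, 'e) bgraph \<Rightarrow> 'v set set" where
  "fibres f G = (\<lambda>w. fibre f G {w}) ` f ` verts G"

text \<open>The second argument is the coarser partition; equality is allowed.\<close>

definition coarser :: "'v set set \<Rightarrow> 'v set set \<Rightarrow> bool" where
  "coarser P Q \<longleftrightarrow> (\<forall>A\<in>P. \<exists>C\<in>Q. A \<subseteq> C)"

text \<open>\<open>same_way\<close> for a tip that is still a set \<open>B\<close> of vertices of
  the original graph.\<close>

definition one_way :: "('e \<Rightarrow> 'v) \<Rightarrow> 'v set \<Rightarrow> 'e set \<Rightarrow> bool" where
  "one_way h B F \<longleftrightarrow> (\<forall>e\<in>F. h e \<in> B) \<or> (\<forall>e\<in>F. h e \<notin> B)"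

definition preflow_on :: "('v, 'e) bgraph \<Rightarrow> 'v set \<Rightarrow> ('e \<Rightarrow> 'v) \<Rightarrow> bool" where
  "preflow_on G B \<psi> \<longleftrightarrow> orients G (cross G B) \<psi> \<and> balanced_on G \<psi> B"

lemma fibre_subset: "fibre f G T \<subseteq> verts G"
  by (auto simp: fibre_def)

lemma quot_edgeE:
  assumes "multigraph G" "quot f g G K" "e \<in> edges K"
  obtains a b where "g e \<in> edges G" "ends G (g e) = {a, b}" "a \<in> verts G" "b \<in> verts G" "f a \<noteq> f b"
    "ends K e = {f a, f b}"
proof -
  have "g e \<in> {e \<in> edges G. \<exists>u\<in>ends G e. \<exists>v\<in>ends G e. f u \<noteq> f v}" "ends K e = f ` ends G (g e)"
    using assms(2,3) unfolding quot_def bij_betw_def by blast+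
  then have e: "g e \<in> edges G" "\<exists>u\<in>ends G (g e). \<exists>v\<in>ends G (g e). f u \<noteq> f v" by auto
  from e(1) assms(1) obtain a b where ab: "ends G (g e) = {a, b}" "a \<in> verts G" "b \<in> verts G"
    by (rule multigraph_edgeE)
  moreover have "f a \<noteq> f b" using e(2) ab(1) by auto
  moreover have "ends K e = {f a, f b}" using \<open>ends K e = f ` ends G (g e)\<close> ab(1) by simp
  ultimately show ?thesis using that e(1) by blast
qed

lemma quot_surj:
  assumes "quot f g G K" "e \<in> edges G" "\<exists>u\<in>ends G e. \<exists>v\<in>ends G e. f u \<noteq> f v"
  shows "\<exists>e'\<in>edges K. g e' = e"
proof -
  have "e \<in> g ` edges K" using assms unfolding quot_def bij_betw_def by blast
  then show ?thesis by blast
qed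

lemma crossD: "e \<in> cross G S \<Longrightarrow> e \<in> edges G"
  by (simp add: cross_def)

lemma quot_inj: "quot f g G K \<Longrightarrow> inj_on g (edges K)"
  unfolding quot_def bij_betw_def by blast

lemma quot_verts: "quot f g G K \<Longrightarrow> verts K = f ` verts G"
  unfolding quot_def by simp

lemma quot_multigraph:
  assumes "multigraph G" "quot f g G K"
  shows "multigraph K"
proof -
  have "finite (g ` edges K)" using assms unfolding quot_def bij_betw_def by (auto intro: finite_subset[of _ "edges G"])
  then have "finite (edges K)" using quot_inj[OF assms(2)] by (simp add: finite_image_iff)
  moreover have "finite (verts K)" using assms by (simp add: quot_verts)
  moreover have "ends K e \<subseteq> verts K \<and> card (ends K e) = 2" if e: "e \<in> edges K" for e
    using assms e by (rule quot_edgeE) (use quot_verts[OF assms(2)] in simp)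
  ultimately show ?thesis unfolding multigraph_def by blast
qed

text \<open>All transport between \<open>K\<close> and \<open>G\<close> rests on this correspondence
  of cuts: degrees, net flows, closed sets and tip edges follow from it.\<close>

lemma quot_cross:
  assumes m: "multigraph G" and q: "quot f g G K"
  shows "g ` cross K T = cross G (fibre f G T)"
proof
  show "g ` cross K T \<subseteq> cross G (fibre f G T)"
  proof
    fix x assume "x \<in> g ` cross K T"
    then obtain e where e: "e \<in> cross K T" "x = g e" by blast
    then have "e \<in> edges K" by (simp add: cross_def)
    with m q show "x \<in> cross G (fibre f G T)"
      by (rule quot_edgeE) (use e in \<open>auto simp: cross_def fibre_def\<close>)
  qed
  show "cross G (fibre f G T) \<subseteq> g ` cross K T"
  proof
    fix x assume x: "x \<in> cross G (fibre f G T)"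
    then have xe: "x \<in> edges G" by (simp add: cross_def)
    then obtain a b where ab: "ends G x = {a, b}" "a \<in> verts G" "b \<in> verts G"
      using m by (rule multigraph_edgeE)
    with x have ft: "f a \<in> T \<longleftrightarrow> f b \<notin> T" by (auto simp: cross_def fibre_def)
    then have "\<exists>u\<in>ends G x. \<exists>v\<in>ends G x. f u \<noteq> f v" using ab(1) by auto
    then obtain e where e: "e \<in> edges K" "g e = x"
      using quot_surj[OF q xe] by blast
    then have "ends K e = {f a, f b}" using q ab unfolding quot_def by auto
    then have "e \<in> cross K T" using e ft by (auto simp: cross_def)
    then show "x \<in> g ` cross K T" using e by blast
  qed
qed

lemma cross_edges: "cross G S \<subseteq> edges G"
  by (auto simp: cross_def)

lemma quot_cutdeg:
  assumes "multigraph G" "quot f g G K"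
  shows "cutdeg K T = cutdeg G (fibre f G T)"
  unfolding cutdeg_def quot_cross[OF assms, symmetric]
  by (rule card_image[symmetric], rule inj_on_subset[OF quot_inj[OF assms(2)] cross_edges])

lemma quot_bsum:
  assumes "multigraph G" "quot f g G K" "T \<subseteq> verts K"
  shows "bsum K T = bsum G (fibre f G T)"
proof -
  have fin: "finite T" "finite (fibre f G T)"
    using assms quot_multigraph[OF assms(1,2)] fibre_subset[of f G T]
    by (meson finite_subset multigraph_finite)+
  have "bsum K T = (\<Sum>w\<in>T. \<Sum>v\<in>{v \<in> fibre f G T. f v = w}. bd G v)"
    unfolding bsum_def
  proof (rule sum.cong[OF refl])
    fix w assume "w \<in> T"
    then have "{v \<in> fibre f G T. f v = w} = fibre f G {w}" by (auto simp: fibre_def)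
    then show "bd K w = (\<Sum>v\<in>{v \<in> fibre f G T. f v = w}. bd G v)"
      using assms(2,3) \<open>w \<in> T\<close> unfolding quot_def bsum_def by auto
  qed
  also have "\<dots> = (\<Sum>v\<in>fibre f G T. bd G v)"
    by (rule sum.group[OF fin(2,1)]) (auto simp: fibre_def)
  finally show ?thesis by (simp add: bsum_def)
qed

lemma quot_net:
  assumes m: "multigraph G" and q: "quot f g G K"
    and h: "\<And>e. e \<in> cross K T \<Longrightarrow> h (g e) \<in> verts G \<and> h' e = f (h (g e))"
  shows "net K h' T = net G h (fibre f G T)"
proof -
  have "net G h (fibre f G T) = (\<Sum>e\<in>cross K T. if h (g e) \<in> fibre f G T then -1 else 1)"
    unfolding net_cross[OF m] quot_cross[OF m q, symmetric]
    by (subst sum.reindex) (auto intro: inj_on_subset[OF quot_inj[OF q] cross_edges])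
  also have "\<dots> = net K h' T"
    unfolding net_cross[OF quot_multigraph[OF m q]]
    by (rule sum.cong[OF refl]) (use h in \<open>auto simp: fibre_def\<close>)
  finally show ?thesis ..
qed

lemma orients_verts: "multigraph G \<Longrightarrow> orients G F h \<Longrightarrow> F \<subseteq> edges G \<Longrightarrow> e \<in> F \<Longrightarrow> h e \<in> verts G"
  unfolding multigraph_def orients_def by blast

text \<open>Orientations of \<open>K\<close> and of \<open>G\<close> correspond up to the edges
  inside fibres, and no cut along fibres sees those.\<close>

lemma quot_ext:
  assumes m: "multigraph G" and q: "quot f g G K" and Q: "\<And>T. T \<in> \<Q> \<Longrightarrow> T \<subseteq> verts K"
    and psi: "\<And>e. e \<in> cross K B \<Longrightarrow> \<psi> (g e) \<in> verts G \<and> \<psi>' e = f (\<psi> (g e))"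
  shows "ext K \<Q> B \<psi>' \<longleftrightarrow> ext G (fibre f G ` \<Q>) (fibre f G B) \<psi>"
proof
  assume "ext K \<Q> B \<psi>'"
  then obtain h' where h': "orients K (edges K) h'" "\<And>e. e \<in> cross K B \<Longrightarrow> h' e \<in> B \<longleftrightarrow> \<psi>' e \<in> B"
    "\<And>A. A \<in> \<Q> \<Longrightarrow> balanced_on K h' A" unfolding ext_def by blast
  \<comment> \<open>An end that \<open>f\<close> maps to the head chosen in \<open>K\<close>. An
    edge inside a fibre has no counterpart in \<open>K\<close> and gets an arbitrary end.\<close>
  define h where "h e = (SOME v. v \<in> ends G e \<and> (\<forall>e'\<in>edges K. g e' = e \<longrightarrow> f v = h' e'))" for e
  have hh: "h e \<in> ends G e \<and> (\<forall>e'\<in>edges K. g e' = e \<longrightarrow> f (h e) = h' e')" if e: "e \<in> edges G" for e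
  proof -
    have "\<exists>v. v \<in> ends G e \<and> (\<forall>e'\<in>edges K. g e' = e \<longrightarrow> f v = h' e')"
    proof (cases "e \<in> g ` edges K")
      case True
      then obtain e' where e': "e' \<in> edges K" "g e' = e" by blast
      then have "h' e' \<in> f ` ends G e" using h'(1) q unfolding orients_def quot_def by auto
      then obtain v where "v \<in> ends G e" "f v = h' e'" by auto
      then show ?thesis using e' quot_inj[OF q] by (auto dest: inj_onD)
    next
      case False
      obtain a where "a \<in> ends G e" using e m by (rule multigraph_edgeE) auto
      then show ?thesis using False by blast
    qed
    then show ?thesis unfolding h_def by (rule someI_ex)
  qed
  have ho: "orients G (edges G) h" using hh unfolding orients_def by blast
  have hf: "h (g e) \<in> verts G \<and> h' e = f (h (g e))" if "e \<in> edges K" for e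
  proof -
    have ge: "g e \<in> edges G" using q that unfolding quot_def bij_betw_def by blast
    then have "h (g e) \<in> verts G" using orients_verts[OF m ho order_refl] by blast
    then show ?thesis using hh[OF ge] that by metis
  qed
  have bal: "balanced_on G h (fibre f G A)" if "A \<in> \<Q>" for A
    using h'(3)[OF that] quot_net[OF m q, of A h h', OF hf[OF crossD]] quot_bsum[OF m q Q[OF that]]
    unfolding balanced_on_def by simp
  moreover have "h e \<in> fibre f G B \<longleftrightarrow> \<psi> e \<in> fibre f G B" if ec: "e \<in> cross G (fibre f G B)" for e
  proof -
    obtain e' where e': "e' \<in> cross K B" "e = g e'" using ec quot_cross[OF m q, of B] by blast
    then have "e' \<in> edges K" using crossD by metis
    then show ?thesis using hf[of e'] h'(2)[OF e'(1)] psi[OF e'(1)] e'(2) by (auto simp: fibre_def)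
  qed
  ultimately show "ext G (fibre f G ` \<Q>) (fibre f G B) \<psi>" unfolding ext_def using ho by blast
next
  assume "ext G (fibre f G ` \<Q>) (fibre f G B) \<psi>"
  then obtain h where h: "orients G (edges G) h"
    "\<And>e. e \<in> cross G (fibre f G B) \<Longrightarrow> h e \<in> fibre f G B \<longleftrightarrow> \<psi> e \<in> fibre f G B"
    "\<And>A. A \<in> \<Q> \<Longrightarrow> balanced_on G h (fibre f G A)" unfolding ext_def by blast
  define h' where "h' e = f (h (g e))" for e
  have hv: "h (g e) \<in> ends G (g e)" "h (g e) \<in> verts G" if "e \<in> edges K" for e
  proof -
    have ge: "g e \<in> edges G" using q that unfolding quot_def bij_betw_def by blast
    then show "h (g e) \<in> verts G" using orients_verts[OF m h(1) order_refl] by blast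
    show "h (g e) \<in> ends G (g e)" using h(1) ge unfolding orients_def by blast
  qed
  have "orients K (edges K) h'" using hv q unfolding orients_def h'_def quot_def by auto
  moreover have "h' e \<in> B \<longleftrightarrow> \<psi>' e \<in> B" if "e \<in> cross K B" for e
  proof -
    have "e \<in> edges K" using that by (rule crossD)
    moreover have "g e \<in> cross G (fibre f G B)" using that quot_cross[OF m q] by blast
    ultimately
    show ?thesis using h(2)[of "g e"] hv psi[OF that] by (auto simp: fibre_def h'_def)
  qed
  moreover have "balanced_on K h' A" if "A \<in> \<Q>" for A
    using h(3)[OF that] quot_net[OF m q, of A h h'] hv(2)[OF crossD] quot_bsum[OF m q Q[OF that]]
    unfolding balanced_on_def h'_def by simp
  ultimately show "ext K \<Q> B \<psi>'" unfolding ext_def by blast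
qed

text \<open>An edge at \<open>w\<close> has just two ends, so its head is known once it is known
  whether the head is \<open>w\<close>.\<close>

lemma extends_ext:
  assumes m: "multigraph K" and \<psi>: "orients K (inc K w) \<psi>"
  shows "extends K w \<psi> \<longleftrightarrow> ext K ((\<lambda>v. {v}) ` verts K) {w} \<psi>"
proof -
  have "(\<forall>e\<in>inc K w. h e = \<psi> e) \<longleftrightarrow> (\<forall>e\<in>inc K w. h e = w \<longleftrightarrow> \<psi> e = w)" if h: "orients K (edges K) h" for h
  proof
    assume r: "\<forall>e\<in>inc K w. h e = w \<longleftrightarrow> \<psi> e = w"
    show "\<forall>e\<in>inc K w. h e = \<psi> e"
    proof
      fix e assume e: "e \<in> inc K w"
      then have ee: "e \<in> edges K" "w \<in> ends K e" unfolding inc_def by auto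
      obtain a b where ab: "ends K e = {a, b}" using ee(1) m by (rule multigraph_edgeE)
      have "h e \<in> {a, b}" "\<psi> e \<in> {a, b}" using h \<psi> e ee ab unfolding orients_def by auto
      then show "h e = \<psi> e" using r e ee ab by auto
    qed
  qed auto
  then show ?thesis
    unfolding extends_def ext_def nz_flow_def inc_cross[OF m, symmetric] using balanced_at_iff[OF m] by auto
qed

lemma part_of_eq: "partition_on V P \<Longrightarrow> A \<in> P \<Longrightarrow> v \<in> A \<Longrightarrow> part_of P v = A"
  unfolding part_of_def partition_on_def disjoint_def by (rule the_equality) auto

lemma part_of_mem: "partition_on V P \<Longrightarrow> v \<in> V \<Longrightarrow> part_of P v \<in> P \<and> v \<in> part_of P v"
  using part_of_eq unfolding partition_on_def by (metis UnionE)

lemma part_subset: "partition_on V P \<Longrightarrow> A \<in> P \<Longrightarrow> A \<subseteq> V"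
  unfolding partition_on_def by blast

lemma part_nonempty: "partition_on V P \<Longrightarrow> A \<in> P \<Longrightarrow> A \<noteq> {}"
  unfolding partition_on_def by blast

lemma part_of_subset: "partition_on V P \<Longrightarrow> v \<in> V \<Longrightarrow> part_of P v \<subseteq> V"
  using part_of_mem part_subset by metis

lemma part_of_eq_iff: "partition_on V P \<Longrightarrow> A \<in> P \<Longrightarrow> v \<in> V \<Longrightarrow> part_of P v = A \<longleftrightarrow> v \<in> A"
  using part_of_eq part_of_mem by metis

lemma partition_image: assumes "partition_on V P" shows "part_of P ` V = P"
proof -
  have "A \<in> part_of P ` V" if A: "A \<in> P" for A
  proof -
    obtain v where v: "v \<in> A" using part_nonempty[OF assms A] by blast
    then have "part_of P v = A" "v \<in> V" using part_of_eq[OF assms A] part_subset[OF assms A] by auto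
    then show ?thesis by blast
  qed
  then show ?thesis using part_of_mem[OF assms] by blast
qed

lemma quot_contract:
  assumes m: "multigraph G" and P: "partition_on (verts G) P"
  shows "quot (part_of P) id G (contract G P)"
    "T \<subseteq> P \<Longrightarrow> fibre (part_of P) G T = \<Union>T"
    "fibres (part_of P) G = P"
proof -
  have fib: "fibre (part_of P) G T = \<Union>T" if "T \<subseteq> P" for T
  proof
    show "fibre (part_of P) G T \<subseteq> \<Union>T" using part_of_mem[OF P] by (auto simp: fibre_def)
    show "\<Union>T \<subseteq> fibre (part_of P) G T"
    proof
      fix v assume "v \<in> \<Union>T"
      then obtain A where A: "A \<in> T" "v \<in> A" by blast
      then have "A \<in> P" using that by blast
      then show "v \<in> fibre (part_of P) G T"
        using A part_of_eq[OF P] P unfolding fibre_def partition_on_def by auto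
    qed
  qed
  then show "T \<subseteq> P \<Longrightarrow> fibre (part_of P) G T = \<Union>T" for T .
  have "fibre (part_of P) G {A} = A" if "A \<in> P" for A using fib[of "{A}"] that by auto
  then show "fibres (part_of P) G = P" unfolding fibres_def partition_image[OF P] by auto
  have "(\<exists>A\<in>P. ends G e \<subseteq> A) \<longleftrightarrow> \<not> (\<exists>u\<in>ends G e. \<exists>v\<in>ends G e. part_of P u \<noteq> part_of P v)"
    if e: "e \<in> edges G" for e
  proof -
    obtain a b where ab: "ends G e = {a, b}" "a \<in> verts G" "b \<in> verts G"
      using e m by (rule multigraph_edgeE)
    have "(\<exists>A\<in>P. {a, b} \<subseteq> A) \<longleftrightarrow> part_of P a = part_of P b"
      using part_of_mem[OF P] part_of_eq[OF P] ab by (metis empty_subsetI insert_subset)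
    then show ?thesis using ab by auto
  qed
  then have "{e \<in> edges G. \<not> (\<exists>A\<in>P. ends G e \<subseteq> A)} =
      {e \<in> edges G. \<exists>u\<in>ends G e. \<exists>v\<in>ends G e. part_of P u \<noteq> part_of P v}" by blast
  then show "quot (part_of P) id G (contract G P)"
    unfolding quot_def contract_def using partition_image[OF P] fib[of "{_}"] by (simp add: bsum_def)
qed

lemma partition_fibre:
  assumes "quot f g G K" "partition_on (verts K) \<Q>"
  shows "partition_on (verts G) (fibre f G ` \<Q>)"
proof (rule partition_onI)
  show "\<Union>(fibre f G ` \<Q>) = verts G"
    using partition_onD1[OF assms(2)] quot_verts[OF assms(1)] unfolding fibre_def by auto
  fix A B assume "A \<in> fibre f G ` \<Q>" "B \<in> fibre f G ` \<Q>" "A \<noteq> B"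
  then obtain S T where ST: "A = fibre f G S" "B = fibre f G T" "S \<in> \<Q>" "T \<in> \<Q>" "S \<noteq> T" by blast
  then have "S \<inter> T = {}" using assms(2) unfolding partition_on_def disjoint_def by blast
  then show "disjnt A B" unfolding ST fibre_def disjnt_def by auto
next
  show "{} \<notin> fibre f G ` \<Q>"
  proof
    assume "{} \<in> fibre f G ` \<Q>"
    then obtain S where S: "S \<in> \<Q>" "fibre f G S = {}" by blast
    then obtain s where "s \<in> S" using part_nonempty[OF assms(2) S(1)] by blast
    moreover from this have "s \<in> f ` verts G"
      using part_subset[OF assms(2) S(1)] quot_verts[OF assms(1)] by auto
    ultimately show False using S(2) unfolding fibre_def by auto
  qed
qed

lemma partition_singles: "partition_on V ((\<lambda>v. {v}) ` V)"
  by (rule partition_onI) (auto simp: disjnt_def)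

lemma partition_fibres: assumes "quot f g G K" shows "partition_on (verts G) (fibres f G)"
proof -
  have "fibres f G = fibre f G ` (\<lambda>v. {v}) ` verts K" unfolding fibres_def quot_verts[OF assms] by auto
  then show ?thesis using partition_fibre[OF assms partition_singles] by simp
qed

text \<open>Removes the contracted graph from the notions of criticality: they are tested by
  orientations of \<open>K\<close> itself.\<close>

lemma eic_ext:
  assumes m: "multigraph K" and t: "tip_respecting K w \<Q>" and \<psi>: "orients K (inc K w) \<psi>"
  shows "extends_in_contraction K w \<Q> \<psi> \<longleftrightarrow> ext K \<Q> {w} \<psi>"
proof -
  have P: "partition_on (verts K) \<Q>" and w: "{w} \<in> \<Q>" using t unfolding tip_respecting_def by auto
  note q = quot_contract[OF m P]
  note m' = quot_multigraph[OF m q(1)]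
  have f1: "fibre (part_of \<Q>) K {A} = A" if "A \<in> \<Q>" for A using q(2)[of "{A}"] that by auto
  have c: "cross (contract K \<Q>) {{w}} = inc K w"
    using quot_cross[OF m q(1), of "{{w}}"] f1[OF w] inc_cross[OF m] by simp
  have o: "orients (contract K \<Q>) (inc (contract K \<Q>) {w}) (part_of \<Q> \<circ> \<psi>)"
    unfolding inc_cross[OF m'] c using \<psi> unfolding orients_def contract_def by auto
  have "fibre (part_of \<Q>) K ` (\<lambda>v. {v}) ` verts (contract K \<Q>) = \<Q>"
    using f1 by (force simp: contract_def)
  then have "ext (contract K \<Q>) ((\<lambda>v. {v}) ` verts (contract K \<Q>)) {{w}} (part_of \<Q> \<circ> \<psi>) \<longleftrightarrow> ext K \<Q> {w} \<psi>"
    using quot_ext[OF m q(1), of "(\<lambda>v. {v}) ` verts (contract K \<Q>)" "{{w}}" \<psi> "part_of \<Q> \<circ> \<psi>"] f1[OF w]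
      orients_verts[OF m \<psi>] c by (auto simp: inc_def)
  then show ?thesis unfolding extends_in_contraction_def extends_ext[OF m' o] .
qed

lemma quot_bordered:
  assumes m: "multigraph G" and q: "quot f g G K"
    and c: "\<And>S. S \<subseteq> verts K \<Longrightarrow> cross G (fibre f G S) = {} \<Longrightarrow> bsum G (fibre f G S) = 0"
  shows "bordered K"
  unfolding bordered_iff
proof (intro conjI allI impI)
  show "multigraph K" by (rule quot_multigraph[OF m q])
  fix S assume "S \<subseteq> verts K" "cross K S = {}"
  then show "bsum K S = 0" using c[of S] quot_cross[OF m q, of S] quot_bsum[OF m q] by simp
qed

text \<open>The object of the degree bound: a canvas of the kind occurring in the classes, but free
  of \<open>x\<close>, \<open>k\<close> and \<open>r\<close>.\<close>

definition failing_canvas :: "('v, 'e) bgraph \<Rightarrow> 'v \<Rightarrow> ('e \<Rightarrow> 'v) \<Rightarrow> bool" where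
  "failing_canvas K w \<psi> \<longleftrightarrow> canvas K w \<and> flow_critical K w \<and> tame K w \<and> tip_preflow K w \<psi> \<and> \<not> extends K w \<psi>"

lemma quot_preflow:
  assumes m: "multigraph G" and q: "quot f g G K" and w: "w \<in> verts K"
    and p: "preflow_on G (fibre f G {w}) \<psi>"
  shows "tip_preflow K w (f \<circ> \<psi> \<circ> g)"
    "extends K w (f \<circ> \<psi> \<circ> g) \<longleftrightarrow> ext G (fibres f G) (fibre f G {w}) \<psi>"
    "tip_respecting K w \<Q> \<Longrightarrow>
      extends_in_contraction K w \<Q> (f \<circ> \<psi> \<circ> g) \<longleftrightarrow> ext G (fibre f G ` \<Q>) (fibre f G {w}) \<psi>"
proof -
  note m' = quot_multigraph[OF m q]
  have c: "g e \<in> cross G (fibre f G {w})" if "e \<in> cross K {w}" for e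
    using that quot_cross[OF m q] by blast
  have o: "\<psi> e \<in> ends G e" if "e \<in> cross G (fibre f G {w})" for e
    using p that unfolding preflow_on_def orients_def by blast
  have v: "\<psi> (g e) \<in> verts G" if "e \<in> cross K {w}" for e
    using o[OF c[OF that]] c[OF that] m unfolding multigraph_def cross_def by blast
  have o': "orients K (inc K w) (f \<circ> \<psi> \<circ> g)"
    unfolding orients_def inc_cross[OF m'] using o c q cross_edges[of K "{w}"] unfolding quot_def by fastforce
  moreover have "balanced_at K (f \<circ> \<psi> \<circ> g) w"
    unfolding balanced_at_iff[OF m'] balanced_on_def
    using p quot_net[OF m q, of "{w}" \<psi> "f \<circ> \<psi> \<circ> g"] v quot_bsum[OF m q, of "{w}"] w
    unfolding preflow_on_def balanced_on_def by simp
  ultimately show "tip_preflow K w (f \<circ> \<psi> \<circ> g)" unfolding tip_preflow_def by blast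
  have e: "ext K \<Q> {w} (f \<circ> \<psi> \<circ> g) \<longleftrightarrow> ext G (fibre f G ` \<Q>) (fibre f G {w}) \<psi>" if "\<And>T. T \<in> \<Q> \<Longrightarrow> T \<subseteq> verts K" for \<Q>
    by (rule quot_ext[OF m q that]) (use v in auto)
  have "fibre f G ` (\<lambda>v. {v}) ` verts K = fibres f G" unfolding fibres_def quot_verts[OF q] by auto
  then show "extends K w (f \<circ> \<psi> \<circ> g) \<longleftrightarrow> ext G (fibres f G) (fibre f G {w}) \<psi>"
    unfolding extends_ext[OF m' o'] using e[of "(\<lambda>v. {v}) ` verts K"] by auto
  show "extends_in_contraction K w \<Q> (f \<circ> \<psi> \<circ> g) \<longleftrightarrow> ext G (fibre f G ` \<Q>) (fibre f G {w}) \<psi>"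
    if t: "tip_respecting K w \<Q>"
    unfolding eic_ext[OF m' t o'] by (rule e) (use t in \<open>auto simp: tip_respecting_def partition_on_def\<close>)
qed

text \<open>Partitions of \<open>K\<close> pull back to partitions of \<open>G\<close> into unions
  of fibres, so only those coarser than \<open>fibres f G\<close> have to be tested.\<close>

lemma quot_flow_critical:
  assumes m: "multigraph G" and q: "quot f g G K" and w: "w \<in> verts K"
    and H: "\<And>Q. partition_on (verts G) Q \<Longrightarrow> fibre f G {w} \<in> Q \<Longrightarrow> coarser (fibres f G) Q \<Longrightarrow> Q \<noteq> fibres f G \<Longrightarrow>
      \<exists>\<psi>. preflow_on G (fibre f G {w}) \<psi> \<and> ext G Q (fibre f G {w}) \<psi> \<and> \<not> ext G (fibres f G) (fibre f G {w}) \<psi>"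
  shows "flow_critical K w"
  unfolding flow_critical_def
proof (intro allI impI)
  fix \<Q> assume a: "tip_respecting K w \<Q> \<and> nontrivial \<Q>"
  then have P: "partition_on (verts K) \<Q>" and wQ: "{w} \<in> \<Q>" unfolding tip_respecting_def by auto
  let ?Q = "fibre f G ` \<Q>"
  have "coarser (fibres f G) ?Q" unfolding coarser_def fibres_def
  proof
    fix A assume "A \<in> (\<lambda>w. fibre f G {w}) ` f ` verts G"
    then obtain u where u: "u \<in> verts K" "A = fibre f G {u}" using quot_verts[OF q] by auto
    then obtain C where "C \<in> \<Q>" "u \<in> C" using P unfolding partition_on_def by blast
    then show "\<exists>C\<in>?Q. A \<subseteq> C" using u unfolding fibre_def by auto
  qed
  moreover have "?Q \<noteq> fibres f G"
  proof
    assume eq: "?Q = fibres f G"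
    obtain A where A: "A \<in> \<Q>" "card A \<ge> 2" using a unfolding nontrivial_def by blast
    then obtain u v where uv: "u \<in> A" "v \<in> A" "u \<noteq> v"
      by (metis One_nat_def Suc_1 card_le_Suc0_iff_eq card.infinite not_less_eq_eq le_zero_eq zero_neq_numeral)
    then have "u \<in> f ` verts G" "v \<in> f ` verts G" using A P quot_verts[OF q] unfolding partition_on_def by blast+
    then obtain u' v' where uv': "u' \<in> verts G" "v' \<in> verts G" "u = f u'" "v = f v'" by blast
    have "fibre f G A \<in> fibres f G" using A eq by blast
    then obtain s where "fibre f G A = fibre f G {s}" unfolding fibres_def by blast
    moreover have "u' \<in> fibre f G A" "v' \<in> fibre f G A" using uv uv' by (auto simp: fibre_def)
    ultimately show False using uv uv' by (auto simp: fibre_def)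
  qed
  moreover have "fibre f G {w} \<in> ?Q" using wQ by blast
  ultimately obtain \<psi> where "preflow_on G (fibre f G {w}) \<psi>" "ext G ?Q (fibre f G {w}) \<psi>"
    "\<not> ext G (fibres f G) (fibre f G {w}) \<psi>"
    using H[OF partition_fibre[OF q P]] by blast
  then show "\<exists>\<psi>. tip_preflow K w \<psi> \<and> extends_in_contraction K w \<Q> \<psi> \<and> \<not> extends K w \<psi>"
    using quot_preflow[OF m q w] a by blast
qed

lemma quot_same_way:
  assumes m: "multigraph G" and q: "quot f g G K" and p: "orients G (cross G (fibre f G {w})) \<psi>"
  shows "same_way w (f \<circ> \<psi> \<circ> g) (inc K w) \<longleftrightarrow> one_way \<psi> (fibre f G {w}) (cross G (fibre f G {w}))"
    "same_way w (f \<circ> \<psi> \<circ> g) {e \<in> inc K w. v \<notin> ends K e} \<longleftrightarrow>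
      one_way \<psi> (fibre f G {w}) {e \<in> cross G (fibre f G {w}). ends G e \<inter> fibre f G {v} = {}}"
proof -
  note m' = quot_multigraph[OF m q]
  have 1: "inc K w \<subseteq> edges K" by (auto simp: inc_def)
  have 2: "g ` inc K w = cross G (fibre f G {w})" unfolding inc_cross[OF m'] by (rule quot_cross[OF m q])
  have 3: "f (\<psi> (g e)) = w \<longleftrightarrow> \<psi> (g e) \<in> fibre f G {w}" if "e \<in> inc K w" for e
  proof -
    have "g e \<in> cross G (fibre f G {w})" using 2 that by blast
    then have "\<psi> (g e) \<in> verts G" using orients_verts[OF m p cross_edges] by blast
    then show ?thesis by (simp add: fibre_def)
  qed
  have 4: "v \<notin> ends K e \<longleftrightarrow> ends G (g e) \<inter> fibre f G {v} = {}" if "e \<in> inc K w" for e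
  proof -
    have "e \<in> edges K" using 1 that by blast
    with m q show ?thesis by (rule quot_edgeE) (auto simp: fibre_def)
  qed
  show "same_way w (f \<circ> \<psi> \<circ> g) (inc K w) \<longleftrightarrow> one_way \<psi> (fibre f G {w}) (cross G (fibre f G {w}))"
    unfolding same_way_def one_way_def 2[symmetric] using 3 by auto
  have "{e \<in> cross G (fibre f G {w}). ends G e \<inter> fibre f G {v} = {}} = g ` {e \<in> inc K w. v \<notin> ends K e}"
    unfolding 2[symmetric] using 4 by blast
  then show "same_way w (f \<circ> \<psi> \<circ> g) {e \<in> inc K w. v \<notin> ends K e} \<longleftrightarrow>
      one_way \<psi> (fibre f G {w}) {e \<in> cross G (fibre f G {w}). ends G e \<inter> fibre f G {v} = {}}"
    unfolding same_way_def one_way_def using 3 by auto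
qed

lemma quot_ord_size:
  assumes m: "multigraph G" and q: "quot f g G K"
  shows "ord_size K w = card (fibres f G) +
    card {e \<in> edges G. (\<exists>u\<in>ends G e. \<exists>v\<in>ends G e. f u \<noteq> f v) \<and> ends G e \<inter> fibre f G {w} = {}}"
proof -
  have "inj_on (\<lambda>w. fibre f G {w}) (f ` verts G)" by (rule inj_onI) (auto simp: fibre_def)
  then have 1: "card (verts K) = card (fibres f G)" unfolding fibres_def quot_verts[OF q] by (simp add: card_image)
  have "g ` {e \<in> edges K. w \<notin> ends K e} =
      {e \<in> edges G. (\<exists>u\<in>ends G e. \<exists>v\<in>ends G e. f u \<noteq> f v) \<and> ends G e \<inter> fibre f G {w} = {}}" (is "_ = ?R")
  proof
    show "g ` {e \<in> edges K. w \<notin> ends K e} \<subseteq> ?R"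
    proof
      fix x assume "x \<in> g ` {e \<in> edges K. w \<notin> ends K e}"
      then obtain e where e: "e \<in> edges K" "w \<notin> ends K e" "x = g e" by blast
      from m q e(1) show "x \<in> ?R" by (rule quot_edgeE) (use e in \<open>auto simp: fibre_def\<close>)
    qed
    show "?R \<subseteq> g ` {e \<in> edges K. w \<notin> ends K e}"
    proof
      fix x assume x: "x \<in> ?R"
      then obtain e where e: "e \<in> edges K" "g e = x" using quot_surj[OF q] by blast
      from m q e(1) have "w \<notin> ends K e" by (rule quot_edgeE) (use e x in \<open>auto simp: fibre_def\<close>)
      then show "x \<in> g ` {e \<in> edges K. w \<notin> ends K e}" using e by blast
    qed
  qed
  then have "card ?R = card {e \<in> edges K. w \<notin> ends K e}"
    by (metis (no_types, lifting) card_image inj_on_subset mem_Collect_eq quot_inj[OF q] subsetI)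
  then show ?thesis unfolding ord_size_def 1 by simp
qed

text \<open>Brings a quotient, whose vertices would be sets of vertices, back to the fixed types of
  \<open>tip_bound_below\<close>. Finiteness provides injections of the parts and of the edges into
  \<open>nat\<close>.\<close>

lemma nat_quot:
  assumes m: "multigraph G" and P: "partition_on (verts G) Q"
  obtains K :: "(nat, nat) bgraph" and f g where "quot f g G K" "fibres f G = Q"
    "\<And>v. v \<in> verts G \<Longrightarrow> fibre f G {f v} = part_of Q v"
proof -
  have "finite Q" using P m by (meson finite_elements multigraph_finite)
  then obtain \<phi> :: "'a set \<Rightarrow> nat" where \<phi>: "inj_on \<phi> Q" using finite_imp_inj_to_nat_seg by metis
  obtain \<gamma> :: "'b \<Rightarrow> nat" where \<gamma>: "inj_on \<gamma> (edges G)" using finite_imp_inj_to_nat_seg m by (metis multigraph_finite(2))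
  define f where "f v = \<phi> (part_of Q v)" for v
  define E where "E = {e \<in> edges G. \<exists>u\<in>ends G e. \<exists>v\<in>ends G e. f u \<noteq> f v}"
  define g where "g = inv_into E \<gamma>"
  define K :: "(nat, nat) bgraph" where "K = \<lparr>verts = f ` verts G, edges = \<gamma> ` E, ends = (\<lambda>e. f ` ends G (g e)),
    bd = (\<lambda>w. bsum G (fibre f G {w}))\<rparr>"
  have "inj_on \<gamma> E" using \<gamma> by (rule inj_on_subset) (auto simp: E_def)
  then have "bij_betw g (\<gamma> ` E) E" unfolding g_def by (simp add: bij_betw_inv_into inj_on_imp_bij_betw)
  then have q: "quot f g G K" unfolding quot_def K_def E_def by simp
  have fb: "fibre f G {f v} = part_of Q v" if v: "v \<in> verts G" for v
  proof -
    have "f u = f v \<longleftrightarrow> u \<in> part_of Q v" if "u \<in> verts G" for u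
      using \<phi> part_of_mem[OF P] part_of_eq_iff[OF P] v that unfolding f_def inj_on_def by metis
    then show ?thesis using part_of_subset[OF P v] by (auto simp: fibre_def)
  qed
  have "fibres f G = part_of Q ` verts G" unfolding fibres_def using fb by (force simp: image_image)
  then have "fibres f G = Q" using partition_image[OF P] by simp
  from that[OF q this fb] show ?thesis .
qed

subsection \<open>Critical partitions\<close>

text \<open>The clause on degree four is carried along because the induction uses it: it fixes the
  boundary of cuts of size seven (\<open>cut_ok6\<close>) and makes the vertices outside a wide part
  Eulerian (\<open>outside_deg4\<close>).\<close>

definition tip_bound :: "('v, 'e) bgraph \<Rightarrow> 'v \<Rightarrow> 'v \<Rightarrow> ('e \<Rightarrow> 'v) \<Rightarrow> bool" where
  "tip_bound K w v \<psi> \<longleftrightarrow> deg K v + 2 \<le> deg K w \<and> (deg K v + 2 = deg K w \<longrightarrow>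
     same_way w \<psi> {e \<in> inc K w. v \<notin> ends K e} \<and> (\<forall>u\<in>verts K - {v, w}. deg K u = 4))"

definition tip_bound_below :: "nat \<Rightarrow> bool" where
  "tip_bound_below N \<longleftrightarrow> (\<forall>(K :: (nat, nat) bgraph) w \<psi> v.
     failing_canvas K w \<psi> \<longrightarrow> v \<in> verts K \<longrightarrow> v \<noteq> w \<longrightarrow> ord_size K w < N \<longrightarrow> tip_bound K w v \<psi>)"

text \<open>\<open>tip_bound\<close> of a quotient, read in \<open>G\<close>: the tip is the part
  \<open>B\<close> and the vertex is the part \<open>A\<close>.\<close>

definition part_bound :: "('v, 'e) bgraph \<Rightarrow> 'v set set \<Rightarrow> 'v set \<Rightarrow> ('e \<Rightarrow> 'v) \<Rightarrow> 'v set \<Rightarrow> bool" where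
  "part_bound G Q B \<psi> A \<longleftrightarrow> cutdeg G A + 2 \<le> cutdeg G B \<and> (cutdeg G A + 2 = cutdeg G B \<longrightarrow>
     one_way \<psi> B {e \<in> cross G B. ends G e \<inter> A = {}} \<and> (\<forall>C\<in>Q - {A, B}. cutdeg G C = 4))"

definition critical_partition ::
  "('v, 'e) bgraph \<Rightarrow> 'v set set \<Rightarrow> 'v set \<Rightarrow> ('e \<Rightarrow> 'v) \<Rightarrow> bool" where
  "critical_partition G Q B \<psi> \<longleftrightarrow> partition_on (verts G) Q \<and> B \<in> Q \<and> \<not> ext G Q B \<psi> \<and>
     (\<forall>Q'. partition_on (verts G) Q' \<longrightarrow> B \<in> Q' \<longrightarrow> coarser Q Q' \<longrightarrow> Q' \<noteq> Q \<longrightarrow> ext G Q' B \<psi>)"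

lemma coarser_refl: "coarser P P"
  unfolding coarser_def by blast

lemma coarser_trans: "coarser P Q \<Longrightarrow> coarser Q R \<Longrightarrow> coarser P R"
  unfolding coarser_def by (meson subset_trans)

text \<open>Sending each part to the part that contains it is onto. Equal cardinalities make this
  map injective, and then each part equals its image.\<close>

lemma coarser_card:
  assumes "finite V" "partition_on V Q" "partition_on V Q'" "coarser Q Q'"
  shows "card Q' \<le> card Q" "Q' \<noteq> Q \<Longrightarrow> card Q' < card Q"
proof -
  have fin: "finite Q" using assms finite_elements by blast
  define \<phi> where "\<phi> A = (SOME C. C \<in> Q' \<and> A \<subseteq> C)" for A
  have \<phi>: "\<phi> A \<in> Q' \<and> A \<subseteq> \<phi> A" if "A \<in> Q" for A
    unfolding \<phi>_def by (rule someI_ex) (use assms(4) that in \<open>auto simp: coarser_def\<close>)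
  have cover: "\<exists>A\<in>Q. v \<in> A \<and> \<phi> A = C" if "C \<in> Q'" "v \<in> C" for C v
  proof -
    have "v \<in> V" using part_subset[OF assms(3) that(1)] that(2) by blast
    then have A: "part_of Q v \<in> Q" "v \<in> part_of Q v" using part_of_mem[OF assms(2)] by blast+
    moreover have "\<phi> (part_of Q v) = C"
      using \<phi>[OF A(1)] A(2) that part_of_eq[OF assms(3)] by (metis subsetD)
    ultimately show ?thesis by blast
  qed
  have im: "\<phi> ` Q = Q'"
  proof
    show "\<phi> ` Q \<subseteq> Q'" using \<phi> by blast
    show "Q' \<subseteq> \<phi> ` Q"
    proof
      fix C assume C: "C \<in> Q'"
      obtain v where "v \<in> C" using part_nonempty[OF assms(3) C] by blast
      then show "C \<in> \<phi> ` Q" using cover[OF C] by blast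
    qed
  qed
  then show le: "card Q' \<le> card Q" using card_image_le[OF fin, of \<phi>] by simp
  assume ne: "Q' \<noteq> Q"
  show "card Q' < card Q"
  proof (rule ccontr)
    assume "\<not> card Q' < card Q"
    then have "card (\<phi> ` Q) = card Q" using le im by simp
    then have inj: "inj_on \<phi> Q" using fin by (simp add: eq_card_imp_inj_on)
    have "\<phi> A = A" if A: "A \<in> Q" for A
    proof
      show "A \<subseteq> \<phi> A" using \<phi>[OF A] by blast
      show "\<phi> A \<subseteq> A"
      proof
        fix v assume "v \<in> \<phi> A"
        then obtain A' where "A' \<in> Q" "v \<in> A'" "\<phi> A' = \<phi> A" using cover \<phi>[OF A] by blast
        then show "v \<in> A" using inj A by (auto dest: inj_onD)
      qed
    qed
    then have "\<phi> ` Q = Q" by simp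
    then show False using im ne by simp
  qed
qed

lemma critical_partition_exists:
  assumes m: "multigraph G" and P: "partition_on (verts G) P" "B \<in> P" "\<not> ext G P B \<psi>"
  obtains Q where "critical_partition G Q B \<psi>" "coarser P Q"
proof -
  let ?p = "\<lambda>Q. partition_on (verts G) Q \<and> B \<in> Q \<and> coarser P Q \<and> \<not> ext G Q B \<psi>"
  have "?p P" using P coarser_refl by blast
  then obtain Q where Q: "?p Q" "\<And>Q'. ?p Q' \<Longrightarrow> card Q \<le> card Q'"
    using ex_has_least_nat[of ?p P card] by blast
  have "ext G Q' B \<psi>" if q: "partition_on (verts G) Q'" "B \<in> Q'" "coarser Q Q'" "Q' \<noteq> Q" for Q'
  proof (rule ccontr)
    assume "\<not> ext G Q' B \<psi>"
    then have "card Q \<le> card Q'" using Q q coarser_trans by blast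
    then show False using coarser_card(2)[OF multigraph_finite(1)[OF m], of Q Q'] Q(1) q by simp
  qed
  then have "critical_partition G Q B \<psi>" unfolding critical_partition_def using Q(1) by blast
  then show ?thesis using that Q(1) by blast
qed

text \<open>A preflow balanced at the tip is automatically balanced on the rest taken as one part,
  so an obstruction needs at least three parts.\<close>

lemma ext_two:
  assumes m: "multigraph G" and t: "bsum G (verts G) = 0" and p: "preflow_on G B \<psi>" and B: "B \<subseteq> verts G"
    and Q: "Q \<subseteq> {B, verts G - B}"
  shows "ext G Q B \<psi>"
proof -
  define h where "h e = (if e \<in> cross G B then \<psi> e else SOME v. v \<in> ends G e)" for e
  have o: "orients G (edges G) h"
    unfolding orients_def
  proof
    fix e assume e: "e \<in> edges G"
    obtain a where "a \<in> ends G e" using e m by (rule multigraph_edgeE) auto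
    then show "h e \<in> ends G e" using p unfolding h_def preflow_on_def orients_def by (auto intro: someI)
  qed
  have "net G h B = net G \<psi> B" unfolding net_cross[OF m] by (rule sum.cong) (auto simp: h_def)
  then have b: "balanced_on G h B" using p unfolding preflow_on_def balanced_on_def by simp
  then have "balanced_on G h (verts G - B)" using balanced_complement[OF m o t B] by blast
  then have "\<forall>A\<in>Q. balanced_on G h A" using b Q by blast
  then show ?thesis unfolding ext_def using o by (auto simp: h_def)
qed

text \<open>No part fills everything outside the tip; this is exactly the set that the estimates for
  proper cuts, such as \<open>cut_ok4\<close>, leave out.\<close>

lemma critical_partition_parts:
  assumes m: "multigraph G" and t: "bsum G (verts G) = 0" and p: "preflow_on G B \<psi>" and c: "critical_partition G Q B \<psi>"
  shows "A \<in> Q \<Longrightarrow> A \<noteq> verts G - B" "\<exists>A\<in>Q. A \<noteq> B" "A \<in> Q \<Longrightarrow> A \<noteq> B \<Longrightarrow> A \<inter> B = {}"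
proof -
  have P: "partition_on (verts G) Q" "B \<in> Q" "\<not> ext G Q B \<psi>" using c unfolding critical_partition_def by auto
  have B: "B \<subseteq> verts G" by (rule part_subset[OF P(1,2)])
  have n: "\<not> Q \<subseteq> {B, verts G - B}" using ext_two[OF m t p B] P(3) by blast
  then show "\<exists>A\<in>Q. A \<noteq> B" by blast
  show d: "A \<inter> B = {}" if "A \<in> Q" "A \<noteq> B" for A
    using P(1,2) that unfolding partition_on_def disjoint_def by blast
  show "A \<noteq> verts G - B" if A: "A \<in> Q"
  proof
    assume eq: "A = verts G - B"
    obtain C where C: "C \<in> Q" "C \<noteq> B" "C \<noteq> A" using n eq by blast
    then have "C \<inter> A = {}" "C \<inter> B = {}" using P(1,2) A unfolding partition_on_def disjoint_def by blast+
    moreover have "C \<subseteq> verts G" "C \<noteq> {}" using part_subset[OF P(1) C(1)] part_nonempty[OF P(1) C(1)] by auto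
    ultimately show False using eq by blast
  qed
qed

text \<open>Since the partition is critical, the single preflow \<psi> is the witness against every
  non-trivial partition of \<open>K\<close>. Tameness of \<open>K\<close> is checked on cuts of
  \<open>G\<close>.\<close>

lemma quot_failing_canvas:
  assumes m: "multigraph G" and t: "bsum G (verts G) = 0" and q: "quot f g G K" and w: "w \<in> verts K"
    and B: "fibre f G {w} = B" and p: "preflow_on G B \<psi>" and c: "critical_partition G (fibres f G) B \<psi>"
    and closed: "\<And>S. S \<subseteq> verts K \<Longrightarrow> w \<notin> S \<Longrightarrow> cross G (fibre f G S) = {} \<Longrightarrow> bsum G (fibre f G S) = 0"
    and ok: "\<And>A. A \<in> fibres f G \<Longrightarrow> A \<noteq> B \<Longrightarrow> ok4 (cutdeg G A) (bsum G A)"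
  shows "failing_canvas K w (f \<circ> \<psi> \<circ> g)"
proof -
  note p' = p[folded B] and c' = c[folded B, unfolded critical_partition_def]
  have bor: "bordered K"
  proof (rule quot_bordered[OF m q])
    fix S assume S: "S \<subseteq> verts K" "cross G (fibre f G S) = {}"
    show "bsum G (fibre f G S) = 0"
    proof (cases "w \<in> S")
      case True
      \<comment> \<open>A closed set containing the tip is traded for its complement, whose boundary
        is the negative.\<close>
      have e: "fibre f G (verts K - S) = verts G - fibre f G S"
        using quot_verts[OF q] by (auto simp: fibre_def)
      have c0: "cross G (fibre f G (verts K - S)) = {}"
        unfolding e cross_complement[OF m fibre_subset] by (rule S(2))
      have "bsum G (fibre f G (verts K - S)) = 0"
        by (rule closed[OF _ _ c0]) (use True in auto)
      then show ?thesis unfolding e bsum_complement[OF m t fibre_subset] by simp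
    qed (use closed S in auto)
  qed
  have can: "canvas K w" using bor w unfolding canvas_def by blast
  have m': "multigraph K" using bor by (rule bordered_multigraph)
  have fc: "flow_critical K w"
    by (rule quot_flow_critical[OF m q w]) (use p' c' in blast)
  have "ok4 (deg K v) (bd K v)" if v: "v \<in> verts K - {w}" for v
  proof -
    have "fibre f G {v} \<in> fibres f G" using v quot_verts[OF q] unfolding fibres_def by auto
    moreover have "fibre f G {v} \<noteq> B"
    proof
      assume "fibre f G {v} = B"
      moreover obtain u where "u \<in> verts G" "f u = v" using v quot_verts[OF q] by auto
      ultimately show False using v B unfolding fibre_def by auto
    qed
    ultimately show ?thesis
      using ok deg_cutdeg[OF m'] quot_cutdeg[OF m q, of "{v}"] quot_bsum[OF m q, of "{v}"] v by simp
  qed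
  then have tm: "tame K w" unfolding tame_iff by blast
  have tp: "tip_preflow K w (f \<circ> \<psi> \<circ> g)" "\<not> extends K w (f \<circ> \<psi> \<circ> g)"
    using quot_preflow(1,2)[OF m q w p'] c' by blast+
  show ?thesis unfolding failing_canvas_def using can fc tm tp by blast
qed

lemma tip_bound_quot:
  assumes m: "multigraph G" and q: "quot f g G K" and w: "w \<in> verts K" and v: "v \<in> verts K"
    and p: "preflow_on G (fibre f G {w}) \<psi>" and T: "tip_bound K w v (f \<circ> \<psi> \<circ> g)"
  shows "part_bound G (fibres f G) (fibre f G {w}) \<psi> (fibre f G {v})"
proof -
  have o: "orients G (cross G (fibre f G {w})) \<psi>" using p unfolding preflow_on_def by blast
  have d: "deg K u = cutdeg G (fibre f G {u})" for u
    using deg_cutdeg[OF quot_multigraph[OF m q]] quot_cutdeg[OF m q] by metis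
  have "cutdeg G C = 4" if a: "\<forall>u\<in>verts K - {v, w}. deg K u = 4" "C \<in> fibres f G - {fibre f G {v}, fibre f G {w}}" for C
  proof -
    obtain u where "u \<in> verts K" "C = fibre f G {u}" using a(2) unfolding fibres_def quot_verts[OF q] by auto
    moreover from this have "u \<noteq> v" "u \<noteq> w" using a(2) by auto
    ultimately show ?thesis using a(1) d by auto
  qed
  then show ?thesis using T unfolding tip_bound_def part_bound_def d quot_same_way(2)[OF m q o] by blast
qed

text \<open>Taking a coarsest partition for which the preflow does not extend makes the quotient critical.\<close>

lemma critical_quotient:
  assumes T: "tip_bound_below N" and m: "multigraph G" and t: "bsum G (verts G) = 0"
    and P: "partition_on (verts G) P" "B \<in> P" "\<not> ext G P B \<psi>" and p: "preflow_on G B \<psi>"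
    and closed: "\<And>A. A \<subseteq> verts G - B \<Longrightarrow> A \<noteq> {} \<Longrightarrow> A \<noteq> verts G - B \<Longrightarrow> (\<And>C. C \<in> P \<Longrightarrow> C \<subseteq> A \<or> C \<inter> A = {}) \<Longrightarrow>
      cross G A = {} \<Longrightarrow> bsum G A = 0"
    and ok: "\<And>Q A. critical_partition G Q B \<psi> \<Longrightarrow> coarser P Q \<Longrightarrow> A \<in> Q \<Longrightarrow> A \<noteq> B \<Longrightarrow> A \<subseteq> verts G - B \<Longrightarrow> A \<noteq> {} \<Longrightarrow>
      A \<noteq> verts G - B \<Longrightarrow> (\<And>C. C \<in> P \<Longrightarrow> C \<subseteq> A \<or> C \<inter> A = {}) \<Longrightarrow> ok4 (cutdeg G A) (bsum G A)"
    and size: "card P + card {e \<in> edges G. \<not> (\<exists>C\<in>P. ends G e \<subseteq> C) \<and> ends G e \<inter> B = {}} < N"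
  obtains Q and K :: "(nat, nat) bgraph" and f g where
    "critical_partition G Q B \<psi>" "coarser P Q" "quot f g G K" "fibres f G = Q"
    "\<And>v. v \<in> verts G \<Longrightarrow> fibre f G {f v} = part_of Q v"
    "\<And>b. b \<in> B \<Longrightarrow> failing_canvas K (f b) (f \<circ> \<psi> \<circ> g) \<and> ord_size K (f b) < N"
    "\<And>A. A \<in> Q \<Longrightarrow> A \<noteq> B \<Longrightarrow> part_bound G Q B \<psi> A"
proof -
  obtain Q where Q: "critical_partition G Q B \<psi>" "coarser P Q"
    using critical_partition_exists[OF m P] by blast
  then have pQ: "partition_on (verts G) Q" "B \<in> Q" unfolding critical_partition_def by auto
  obtain K :: "(nat, nat) bgraph" and f g where K: "quot f g G K" "fibres f G = Q"
    "\<And>v. v \<in> verts G \<Longrightarrow> fibre f G {f v} = part_of Q v"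
    using nat_quot[OF m pQ(1)] by metis
  have B: "B \<subseteq> verts G" "B \<noteq> {}" using part_subset[OF pQ] part_nonempty[OF pQ] by auto
  have fb: "fibre f G {f b} = B" if "b \<in> B" for b
    using K(3) part_of_eq[OF pQ that] B that by auto
  have sep: "C \<subseteq> A \<or> C \<inter> A = {}" if A: "A \<in> Q" and C: "C \<in> P" for A C
  proof -
    obtain D where D: "D \<in> Q" "C \<subseteq> D" using Q(2) C unfolding coarser_def by blast
    then have "D = A \<or> D \<inter> A = {}" using A pQ(1) unfolding partition_on_def disjoint_def by blast
    then show ?thesis using D(2) by blast
  qed
  have okQ: "ok4 (cutdeg G A) (bsum G A)" if A: "A \<in> Q" "A \<noteq> B" for A
  proof (rule ok[OF Q A])
    show "A \<subseteq> verts G - B" using part_subset[OF pQ(1) A(1)] critical_partition_parts(3)[OF m t p Q(1) A] by blast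
    show "A \<noteq> {}" by (rule part_nonempty[OF pQ(1) A(1)])
    show "A \<noteq> verts G - B" by (rule critical_partition_parts(1)[OF m t p Q(1) A(1)])
  qed (rule sep[OF A(1)])
  have tc: "failing_canvas K (f b) (f \<circ> \<psi> \<circ> g)" if b: "b \<in> B" for b
  proof (rule quot_failing_canvas[OF m t K(1) _ fb[OF b] p])
    show "f b \<in> verts K" using b B quot_verts[OF K(1)] by auto
    show "critical_partition G (fibres f G) B \<psi>" using Q(1) K(2) by simp
    show "ok4 (cutdeg G A) (bsum G A)" if "A \<in> fibres f G" "A \<noteq> B" for A
      using okQ that K(2) by blast
    fix S assume S: "S \<subseteq> verts K" "f b \<notin> S" "cross G (fibre f G S) = {}"
    show "bsum G (fibre f G S) = 0"
    proof (cases "fibre f G S = {} \<or> fibre f G S = verts G - B")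
      case True
      \<comment> \<open>The full complement of the tip is not covered by \<open>closed\<close>. If
        it is a closed set, no edge leaves \<open>B\<close>, and balance of the preflow gives
        boundary 0.\<close>
      have "bsum G (verts G - B) = 0" if e: "cross G (verts G - B) = {}"
      proof -
        have "cross G B = {}" using e cross_complement[OF m B(1)] by simp
        then have "bsum G B = 0" using p net_cross[OF m, of \<psi> B] unfolding preflow_on_def balanced_on_def by simp
        then show ?thesis using bsum_complement[OF m t B(1)] by simp
      qed
      then show ?thesis using True S(3) by (auto simp: bsum_def)
    next
      case False
      have dis: "fibre f G S \<inter> B = {}" using fb[OF b] S(2) by (auto simp: fibre_def)
      have "C \<subseteq> fibre f G S \<or> C \<inter> fibre f G S = {}" if C: "C \<in> P" for C
      proof -
        obtain D where D: "D \<in> Q" "C \<subseteq> D" using Q(2) C unfolding coarser_def by blast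
        then obtain s where "D = fibre f G {s}" using K(2) unfolding fibres_def by blast
        then show ?thesis using D(2) by (auto simp: fibre_def subset_iff)
      qed
      then show ?thesis using closed[of "fibre f G S"] False S(3) dis fibre_subset[of f G S] by blast
    qed
  qed
  have sz: "ord_size K (f b) < N" if b: "b \<in> B" for b
  proof -
    have "{e \<in> edges G. (\<exists>u\<in>ends G e. \<exists>v\<in>ends G e. f u \<noteq> f v) \<and> ends G e \<inter> B = {}}
      \<subseteq> {e \<in> edges G. \<not> (\<exists>C\<in>P. ends G e \<subseteq> C) \<and> ends G e \<inter> B = {}}"
    proof clarify
      fix e u v C assume e: "u \<in> ends G e" "v \<in> ends G e" "f u \<noteq> f v" "C \<in> P" "ends G e \<subseteq> C"
      obtain D where D: "D \<in> Q" "C \<subseteq> D" using Q(2) e(4) unfolding coarser_def by blast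
      then obtain s where "D = fibre f G {s}" using K(2) unfolding fibres_def by blast
      then show False using D(2) e by (auto simp: fibre_def)
    qed
    then have "card {e \<in> edges G. (\<exists>u\<in>ends G e. \<exists>v\<in>ends G e. f u \<noteq> f v) \<and> ends G e \<inter> B = {}}
      \<le> card {e \<in> edges G. \<not> (\<exists>C\<in>P. ends G e \<subseteq> C) \<and> ends G e \<inter> B = {}}"
      by (intro card_mono) (use m in auto)
    moreover have "card Q \<le> card P"
      by (rule coarser_card(1)[OF multigraph_finite(1)[OF m] P(1) pQ(1) Q(2)])
    ultimately show ?thesis using size quot_ord_size[OF m K(1), of "f b"] fb[OF b] K(2) by simp
  qed
  have st: "part_bound G Q B \<psi> A" if A: "A \<in> Q" "A \<noteq> B" for A
  proof -
    obtain b where b: "b \<in> B" using B(2) by blast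
    obtain a where a: "a \<in> A" using part_nonempty[OF pQ(1) A(1)] by blast
    then have aV: "a \<in> verts G" and fa: "fibre f G {f a} = A"
      using part_subset[OF pQ(1) A(1)] K(3) part_of_eq[OF pQ(1) A(1) a] by auto
    have ne: "f a \<noteq> f b" using fa fb[OF b] A(2) by auto
    have vs: "f a \<in> verts K" "f b \<in> verts K" using aV b B quot_verts[OF K(1)] by auto
    have "tip_bound K (f b) (f a) (f \<circ> \<psi> \<circ> g)" using T tc[OF b] sz[OF b] ne vs unfolding tip_bound_below_def by blast
    from tip_bound_quot[OF m K(1) vs(2,1) _ this] show ?thesis using fb[OF b] fa p K(2) by simp
  qed
  show ?thesis using that[OF Q K] tc sz st by blast
qed

subsection \<open>Restrictions to vertex sets\<close>

text \<open>The partition behind \<open>restrict_canvas\<close>, which keeps the inside of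
  \<open>A\<close>. Its counterpart \<open>outer\<close> collapses \<open>A\<close> and keeps the
  outside.\<close>

definition inner :: "('v, 'e) bgraph \<Rightarrow> 'v set \<Rightarrow> 'v set set" where
  "inner G A = insert (verts G - A) ((\<lambda>a. {a}) ` A)"

definition outer :: "('v, 'e) bgraph \<Rightarrow> 'v set \<Rightarrow> 'v set set" where
  "outer G A = insert A ((\<lambda>a. {a}) ` (verts G - A))"

lemma partition_inner: "A \<subseteq> verts G \<Longrightarrow> A \<noteq> verts G \<Longrightarrow> partition_on (verts G) (inner G A)"
  unfolding inner_def by (rule partition_onI) (auto simp: disjnt_def)

lemma partition_outer: "A \<subseteq> verts G \<Longrightarrow> A \<noteq> {} \<Longrightarrow> partition_on (verts G) (outer G A)"
  unfolding outer_def by (rule partition_onI) (auto simp: disjnt_def)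

text \<open>Vertices of \<open>A\<close> see only edges taken from \<open>h2\<close>. A vertex
  outside sees \<open>h2\<close> only on edges of the cut, where the two orientations agree.\<close>

lemma glue:
  assumes m: "multigraph G" and h: "orients G (edges G) h" "orients G (edges G) h2"
    and agree: "\<forall>e\<in>cross G A. h2 e \<in> A \<longleftrightarrow> h e \<in> A"
    and h3: "h3 = (\<lambda>e. if ends G e \<inter> A \<noteq> {} then h2 e else h e)"
  shows "orients G (edges G) h3" "v \<in> A \<Longrightarrow> net G h3 {v} = net G h2 {v}" "v \<notin> A \<Longrightarrow> net G h3 {v} = net G h {v}"
proof -
  show "orients G (edges G) h3" using h unfolding h3 orients_def by auto
  show "net G h3 {v} = net G h2 {v}" if "v \<in> A"
    unfolding net_def by (rule sum.cong[OF refl]) (use that in \<open>auto simp: flux_def h3\<close>)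
  show "net G h3 {v} = net G h {v}" if v: "v \<notin> A"
    unfolding net_def
  proof (rule sum.cong[OF refl])
    fix e assume e: "e \<in> edges G"
    then obtain a b where ab: "ends G e = {a, b}" "a \<noteq> b" using m by (rule multigraph_edgeE)
    have he: "h e \<in> {a, b}" "h2 e \<in> {a, b}" using h e ab unfolding orients_def by auto
    show "flux G h3 {v} e = flux G h {v} e"
    proof (cases "v \<in> ends G e \<and> ends G e \<inter> A \<noteq> {}")
      case True
      then have "e \<in> cross G A" using v e unfolding cross_def by auto
      with agree have "h2 e \<in> A \<longleftrightarrow> h e \<in> A" by blast
      then show ?thesis using True ab he v unfolding flux_def h3 by auto
    qed (auto simp: flux_def h3)
  qed
qed

text \<open>\<open>h\<close> is a flow everywhere outside \<open>A\<close>. If its values on the cut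
  could be continued into \<open>A\<close>, gluing would extend \<psi> to a flow of
  \<open>G\<close>.\<close>

lemma restrict_nonext:
  assumes m: "multigraph G" and A: "A \<subseteq> verts G" "z \<notin> A"
    and nx: "\<not> ext G ((\<lambda>v. {v}) ` verts G) {z} \<psi>"
    and h: "orients G (edges G) h" "\<And>e. e \<in> cross G {z} \<Longrightarrow> h e = z \<longleftrightarrow> \<psi> e = z"
      "\<And>v. v \<in> verts G - A \<Longrightarrow> balanced_on G h {v}"
  shows "\<not> ext G (inner G A) (verts G - A) h"
proof
  assume "ext G (inner G A) (verts G - A) h"
  then obtain h2 where h2: "orients G (edges G) h2"
    "\<And>e. e \<in> cross G (verts G - A) \<Longrightarrow> h2 e \<in> verts G - A \<longleftrightarrow> h e \<in> verts G - A"
    "\<And>C. C \<in> inner G A \<Longrightarrow> balanced_on G h2 C" unfolding ext_def by blast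
  have agree: "h2 e \<in> A \<longleftrightarrow> h e \<in> A" if e: "e \<in> cross G A" for e
  proof -
    have "h2 e \<in> verts G" "h e \<in> verts G"
      using orients_verts[OF m h2(1) order_refl] orients_verts[OF m h(1) order_refl] crossD[OF e] by auto
    then show ?thesis using h2(2)[of e] e cross_complement[OF m A(1)] by auto
  qed
  define h3 where "h3 = (\<lambda>e. if ends G e \<inter> A \<noteq> {} then h2 e else h e)"
  have agree': "\<forall>e\<in>cross G A. h2 e \<in> A \<longleftrightarrow> h e \<in> A" using agree by blast
  note g = glue[OF m h(1) h2(1) agree' h3_def]
  have "balanced_on G h3 {v}" if "v \<in> verts G" for v
  proof (cases "v \<in> A")
    case True
    then have "balanced_on G h2 {v}" using h2(3)[of "{v}"] unfolding inner_def by blast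
    then show ?thesis using g(2)[OF True] unfolding balanced_on_def by simp
  next
    case False
    then show ?thesis using g(3)[OF False] h(3)[of v] that unfolding balanced_on_def by simp
  qed
  moreover have "h3 e \<in> {z} \<longleftrightarrow> \<psi> e \<in> {z}" if e: "e \<in> cross G {z}" for e
  proof (cases "ends G e \<inter> A = {}")
    case False
    then obtain a where a: "a \<in> A" "ends G e = {z, a}" "e \<in> edges G"
    proof -
      have ee: "e \<in> edges G" by (rule crossD[OF e])
      obtain u v where uv: "ends G e = {u, v}" using ee m by (rule multigraph_edgeE)
      then show ?thesis using that False e A(2) ee unfolding cross_def by auto
    qed
    then have "e \<in> cross G A" using A(2) unfolding cross_def by auto
    then have "h2 e \<in> A \<longleftrightarrow> h e \<in> A" by (rule agree)
    moreover have "h2 e \<in> {z, a}" "h e \<in> {z, a}" using h(1) h2(1) a unfolding orients_def by auto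
    ultimately show ?thesis using h(2)[OF e] a A(2) False unfolding h3_def by auto
  qed (use h(2)[OF e] in \<open>auto simp: h3_def\<close>)
  ultimately have "ext G ((\<lambda>v. {v}) ` verts G) {z} \<psi>" unfolding ext_def using g(1) by auto
  then show False using nx by blast
qed

lemma cutdeg_parity:
  assumes m: "multigraph G" and S: "finite S"
  shows "even (cutdeg G S) \<longleftrightarrow> even (\<Sum>v\<in>S. cutdeg G {v})"
  using S
proof (induction S rule: finite_induct)
  case empty
  show ?case by (simp add: cutdeg_def cross_def)
next
  case (insert v S)
  then have "cutdeg G ({v} \<union> S) + 2 * ebt G {v} S = cutdeg G {v} + cutdeg G S" by (intro cutdeg_Un[OF m]) auto
  then have "even (cutdeg G (insert v S)) \<longleftrightarrow> even (cutdeg G {v} + cutdeg G S)"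
    by (metis dvd_triv_left even_add insert_is_Un)
  then show ?case using insert by simp
qed

lemma one_way_complement:
  assumes m: "multigraph G" and o: "orients G (cross G A) \<theta>" and F: "F \<subseteq> cross G A"
  shows "one_way \<theta> (verts G - A) F \<longleftrightarrow> one_way \<theta> A F"
proof -
  have "\<theta> e \<in> verts G" if "e \<in> F" for e using orients_verts[OF m o cross_edges] F that by blast
  then show ?thesis unfolding one_way_def by blast
qed

lemma part_disjoint: "partition_on V Q \<Longrightarrow> A \<in> Q \<Longrightarrow> B \<in> Q \<Longrightarrow> A \<noteq> B \<Longrightarrow> A \<inter> B = {}"
  unfolding partition_on_def disjoint_def by simp

lemma preflow_of_flow: "orients G (edges G) h \<Longrightarrow> balanced_on G h B \<Longrightarrow> preflow_on G B h"
  unfolding preflow_on_def orients_def cross_def by blast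

text \<open>\<open>T\<close> is the hypothesis of the induction on the order. Equality is allowed in
  \<open>size\<close>, since \<open>T\<close> is only applied to restrictions and quotients of
  strictly smaller order.\<close>

locale crit_canvas =
  fixes G :: "('v, 'e) bgraph" and z :: 'v and N :: nat
  assumes can: "canvas G z" and fc: "flow_critical G z" and tm: "tame G z"
    and T: "tip_bound_below N" and size: "ord_size G z \<le> N"
begin

abbreviation "V \<equiv> verts G"
abbreviation "d \<equiv> cutdeg G"
abbreviation "singles \<equiv> (\<lambda>v. {v}) ` V"

lemma m: "multigraph G" and bor: "bordered G" and zV: "z \<in> V" and total: "bsum G V = 0"
  using can bordered_multigraph bordered_total unfolding canvas_def by auto

lemma fin [simp]: "finite V" "finite (edges G)"
  using m by simp_all

lemma closed: "S \<subseteq> V \<Longrightarrow> cross G S = {} \<Longrightarrow> bsum G S = 0"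
  using bor unfolding bordered_iff by blast

lemma ok_single: "v \<in> V \<Longrightarrow> v \<noteq> z \<Longrightarrow> ok4 (d {v}) (bd G v)"
  using tm deg_cutdeg[OF m] unfolding tame_iff by force

lemma deg4: "v \<in> V \<Longrightarrow> v \<noteq> z \<Longrightarrow> 4 \<le> d {v}"
  using ok_single[of v] unfolding ok4_def by auto

text \<open>The preflow from flow-criticality is replaced by the whole orientation \<open>h\<close>
  of the contraction, which has the same directions at the tip.\<close>

lemma flow_critical_ext:
  assumes "partition_on V Q" "{z} \<in> Q" "A \<in> Q" "card A \<ge> 2"
  obtains h where "orients G (edges G) h" "\<And>C. C \<in> Q \<Longrightarrow> balanced_on G h C" "\<not> ext G singles {z} h"
proof -
  have t: "tip_respecting G z Q" using assms unfolding tip_respecting_def by blast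
  obtain \<psi> where \<psi>: "tip_preflow G z \<psi>" "extends_in_contraction G z Q \<psi>" "\<not> extends G z \<psi>"
    using fc t assms(3,4) unfolding flow_critical_def nontrivial_def by blast
  have o: "orients G (inc G z) \<psi>" using \<psi>(1) unfolding tip_preflow_def by blast
  have "ext G Q {z} \<psi>" using \<psi>(2) eic_ext[OF m t o] by blast
  then obtain h where h: "orients G (edges G) h" "\<And>e. e \<in> cross G {z} \<Longrightarrow> h e \<in> {z} \<longleftrightarrow> \<psi> e \<in> {z}"
    "\<And>C. C \<in> Q \<Longrightarrow> balanced_on G h C" unfolding ext_def by blast
  have "ext G singles {z} h \<longleftrightarrow> ext G singles {z} \<psi>" unfolding ext_def using h(2) by simp
  then have "\<not> ext G singles {z} h" using \<psi>(3) extends_ext[OF m o] by blast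
  then show ?thesis using that h by blast
qed

text \<open>A partition of the restriction is refined to single vertices outside \<open>A\<close>,
  which makes it tip-respecting in \<open>G\<close>. The flow that flow-criticality of
  \<open>G\<close> provides there serves, on the cut of \<open>A\<close>, as the preflow wanted for
  the restriction.\<close>

lemma restrict_flow_critical:
  assumes A: "A \<subseteq> V" "z \<notin> A" and q: "quot f g G K" "fibres f G = inner G A" "w \<in> verts K" "fibre f G {w} = V - A"
  shows "flow_critical K w"
proof (rule quot_flow_critical[OF m q(1,3)], unfold q(2,4))
  fix Q assume Q: "partition_on V Q" "V - A \<in> Q" "coarser (inner G A) Q" "Q \<noteq> inner G A"
  define Q' where "Q' = (Q - {V - A}) \<union> (\<lambda>v. {v}) ` (V - A)"
  have sub: "C \<subseteq> A" if C: "C \<in> Q" "C \<noteq> V - A" for C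
  proof -
    have "C \<inter> (V - A) = {}" by (rule part_disjoint[OF Q(1) C(1) Q(2) C(2)])
    then show ?thesis using part_subset[OF Q(1) C(1)] by blast
  qed

  have un: "\<Union>Q = V" using Q(1) unfolding partition_on_def by simp
  have p': "partition_on V Q'"
  proof (rule partition_onI)
    show "\<Union>Q' = V" using un Q(2) unfolding Q'_def by auto
    show "{} \<notin> Q'" using Q(1) unfolding Q'_def partition_on_def by auto
    fix C D assume "C \<in> Q'" "D \<in> Q'" "C \<noteq> D"
    then consider "C \<in> Q" "D \<in> Q" | "C \<in> Q - {V - A}" "\<exists>v\<in>V - A. D = {v}"
      | "D \<in> Q - {V - A}" "\<exists>v\<in>V - A. C = {v}" | "\<exists>u v. C = {u} \<and> D = {v}" unfolding Q'_def by blast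
    then show "disjnt C D" unfolding disjnt_def
    proof cases
      case 1 then show "C \<inter> D = {}" by (rule part_disjoint[OF Q(1) _ _ \<open>C \<noteq> D\<close>])
    next
      case 2 then show "C \<inter> D = {}" using sub[of C] by blast
    next
      case 3 then show "C \<inter> D = {}" using sub[of D] by blast
    next
      case 4 then show "C \<inter> D = {}" using \<open>C \<noteq> D\<close> by blast
    qed
  qed
  have zQ': "{z} \<in> Q'" using A zV unfolding Q'_def by auto
  \<comment> \<open>Flow-criticality speaks of non-trivial partitions only. If all parts within
    \<open>A\<close> were single vertices, \<open>Q\<close> would be \<open>inner G A\<close>
    itself.\<close>
  have "\<exists>C\<in>Q'. card C \<ge> 2"
  proof (rule ccontr)
    assume "\<not> (\<exists>C\<in>Q'. card C \<ge> 2)"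
    then have c: "card C < 2" if "C \<in> Q" "C \<noteq> V - A" for C using that unfolding Q'_def by force
    have s: "\<exists>v. C = {v}" if C: "C \<in> Q" "C \<noteq> V - A" for C
    proof -
      have "finite C" using part_subset[OF Q(1) C(1)] finite_subset[OF _ fin(1)] by blast
      then have "card C > 0" using part_nonempty[OF Q(1) C(1)] by (simp add: card_gt_0_iff)
      then have "card C = 1" using c[OF C] by simp
      then show ?thesis by (simp add: card_1_singleton_iff)
    qed
    have "Q = inner G A"
    proof
      show "Q \<subseteq> inner G A"
      proof
        fix C assume C: "C \<in> Q"
        show "C \<in> inner G A"
        proof (cases "C = V - A")
          case False
          then obtain v where v: "C = {v}" using s[OF C] by blast
          then show ?thesis using sub[OF C False] unfolding inner_def by auto
        qed (simp add: inner_def)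
      qed
      show "inner G A \<subseteq> Q"
      proof
        fix C assume "C \<in> inner G A"
        then consider "C = V - A" | a where "a \<in> A" "C = {a}" unfolding inner_def by blast
        then show "C \<in> Q"
        proof cases
          case 2
          then have "a \<in> \<Union>Q" using A un by blast
          then obtain D where D: "D \<in> Q" "a \<in> D" by blast
          then have "D \<noteq> V - A" using 2 by blast
          then show ?thesis using s[OF D(1)] D 2 by auto
        qed (use Q(2) in simp)
      qed
    qed
    then show False using Q(4) by simp
  qed
  then obtain C where C: "C \<in> Q'" "card C \<ge> 2" by blast
  obtain h where h: "orients G (edges G) h" "\<And>C. C \<in> Q' \<Longrightarrow> balanced_on G h C" "\<not> ext G singles {z} h"
    using flow_critical_ext[OF p' zQ' C] by blast
  have b: "balanced_on G h (V - A)"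
    by (rule balanced_singles[OF m h(1)]) (use h(2) in \<open>auto simp: Q'_def\<close>)
  have "preflow_on G (V - A) h" by (rule preflow_of_flow[OF h(1) b])
  moreover have "ext G Q (V - A) h"
    unfolding ext_def using h(1,2) b unfolding Q'_def by blast
  moreover have "\<not> ext G (inner G A) (V - A) h"
    by (rule restrict_nonext[OF m A h(3,1)]) (use h(2) in \<open>auto simp: Q'_def\<close>)
  ultimately show "\<exists>\<psi>. preflow_on G (V - A) \<psi> \<and> ext G Q (V - A) \<psi> \<and> \<not> ext G (inner G A) (V - A) \<psi>" by blast
qed

lemma restrict_failing_canvas:
  assumes A: "A \<subseteq> V" "z \<notin> A" and q: "quot f g G K" "fibres f G = inner G A" "w \<in> verts K" "fibre f G {w} = V - A"
    and \<theta>: "preflow_on G (V - A) \<theta>" "\<not> ext G (inner G A) (V - A) \<theta>"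
  shows "failing_canvas K w (f \<circ> \<theta> \<circ> g)"
proof -
  have b: "bordered K" by (rule quot_bordered[OF m q(1) closed[OF fibre_subset]])
  have "ok4 (deg K v) (bd K v)" if v: "v \<in> verts K - {w}" for v
  proof -
    obtain u where u: "u \<in> V" "f u = v" using v quot_verts[OF q(1)] by auto
    have "fibre f G {v} \<in> inner G A" using v q(2) unfolding fibres_def quot_verts[OF q(1)] by auto
    moreover have "u \<in> fibre f G {v}" "u \<notin> fibre f G {w}" using u v by (auto simp: fibre_def)
    ultimately have f: "fibre f G {v} = {u}" "u \<in> A" using q(4) unfolding inner_def by auto
    have "bd K v = bd G u" using quot_bsum[OF m q(1), of "{v}"] v f(1) by simp
    then show ?thesis
      using ok_single[of u] f A u deg_cutdeg[OF bordered_multigraph[OF b]] quot_cutdeg[OF m q(1), of "{v}"] by auto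
  qed
  then have "tame K w" unfolding tame_iff by blast
  moreover have "tip_preflow K w (f \<circ> \<theta> \<circ> g)" "\<not> extends K w (f \<circ> \<theta> \<circ> g)"
    using quot_preflow(1,2)[OF m q(1,3)] q(2,4) \<theta> by auto
  ultimately show ?thesis
    unfolding failing_canvas_def canvas_def using b q(3) restrict_flow_critical[OF A q] by blast
qed

text \<open>Flow-criticality for \<open>outer G A\<close>, the partition that merges exactly
  \<open>A\<close>.\<close>

lemma restrict_exists:
  assumes A: "A \<subseteq> V" "z \<notin> A" "card A \<ge> 2"
  obtains h where "orients G (edges G) h" "\<And>v. v \<in> V - A \<Longrightarrow> balanced_on G h {v}"
    "preflow_on G (V - A) h" "\<not> ext G (inner G A) (V - A) h"
proof -
  have ne: "A \<noteq> {}" using A(3) by auto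
  have "{z} \<in> outer G A" "A \<in> outer G A" using A zV unfolding outer_def by auto
  then obtain h where h: "orients G (edges G) h" "\<And>C. C \<in> outer G A \<Longrightarrow> balanced_on G h C" "\<not> ext G singles {z} h"
    using flow_critical_ext[OF partition_outer[OF A(1) ne] _ _ A(3)] by blast
  have b: "balanced_on G h {v}" if "v \<in> V - A" for v using h(2) that unfolding outer_def by blast
  have "balanced_on G h (V - A)" by (rule balanced_singles[OF m h(1) Diff_subset b])
  then have "preflow_on G (V - A) h" by (rule preflow_of_flow[OF h(1)])
  moreover have "\<not> ext G (inner G A) (V - A) h" by (rule restrict_nonext[OF m A(1,2) h(3,1)]) (use b in auto)
  ultimately show ?thesis using that h(1) b by blast
qed

lemma restrict_tip_bound:
  assumes A: "A \<subseteq> V" "z \<notin> A" "A \<noteq> V - {z}"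
    and \<theta>: "preflow_on G (V - A) \<theta>" "\<not> ext G (inner G A) (V - A) \<theta>" and v: "v \<in> A"
  shows "d {v} + 2 \<le> d A" "d {v} + 2 = d A \<Longrightarrow> one_way \<theta> A {e \<in> cross G A. v \<notin> ends G e}"
    "d {v} + 2 = d A \<Longrightarrow> a \<in> A \<Longrightarrow> a \<noteq> v \<Longrightarrow> d {a} = 4"
proof -
  have "A \<noteq> V" using A(2) zV by blast
  note P = partition_inner[OF A(1) this]
  obtain K :: "(nat, nat) bgraph" and f g where K: "quot f g G K" "fibres f G = inner G A"
    "\<And>v. v \<in> V \<Longrightarrow> fibre f G {f v} = part_of (inner G A) v"
    using nat_quot[OF m P] by metis
  have vV: "v \<in> V" using v A by blast
  have fz: "fibre f G {f z} = V - A" using K(3)[OF zV] part_of_eq[OF P, of "V - A" z] A zV unfolding inner_def by auto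
  have fv: "fibre f G {f v} = {v}" using K(3)[OF vV] part_of_eq[OF P, of "{v}" v] v unfolding inner_def by auto
  have vs: "f z \<in> verts K" "f v \<in> verts K" using zV vV quot_verts[OF K(1)] by auto
  have ne: "f v \<noteq> f z" using fz fv zV A(2) v by auto
  have tc: "failing_canvas K (f z) (f \<circ> \<theta> \<circ> g)" by (rule restrict_failing_canvas[OF A(1,2) K(1,2) vs(1) fz \<theta>])
  \<comment> \<open>\<open>A\<close> omits some vertex besides \<open>z\<close>; it is absorbed by
    the new tip, so the number of vertices drops.\<close>
  have sz: "ord_size K (f z) < N"
  proof -
    have "{e \<in> edges G. (\<exists>u\<in>ends G e. \<exists>v\<in>ends G e. f u \<noteq> f v) \<and> ends G e \<inter> (V - A) = {}} \<subseteq> {e \<in> edges G. z \<notin> ends G e}"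
      using A(2) zV by auto
    then have 1: "card {e \<in> edges G. (\<exists>u\<in>ends G e. \<exists>v\<in>ends G e. f u \<noteq> f v) \<and> ends G e \<inter> (V - A) = {}}
      \<le> card {e \<in> edges G. z \<notin> ends G e}" by (intro card_mono) auto
    have fA: "finite A" using A(1) fin(1) by (rule finite_subset)
    have "A \<subset> V - {z}" using A by blast
    then have "card A < card (V - {z})" by (intro psubset_card_mono) auto
    then have "card A + 1 < card V" using zV by simp
    moreover have "card (inner G A) \<le> card A + 1"
      unfolding inner_def using card_insert_le_m1 card_image_le[OF fA, of "\<lambda>a. {a}"]
      by (metis Suc_eq_plus1 card_insert_if fA finite_imageI le_SucI not_less_eq_eq)
    ultimately show ?thesis
      using 1 size quot_ord_size[OF m K(1), of "f z"] fz K(2) unfolding ord_size_def by simp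
  qed
  have "tip_bound K (f z) (f v) (f \<circ> \<theta> \<circ> g)" using T tc sz ne vs unfolding tip_bound_below_def by blast
  from tip_bound_quot[OF m K(1) vs _ this] have S: "part_bound G (inner G A) (V - A) \<theta> {v}" using fz fv \<theta>(1) K(2) by simp
  have dA: "d (V - A) = d A" by (rule cutdeg_complement[OF m A(1)])
  show "d {v} + 2 \<le> d A" using S unfolding part_bound_def dA by blast
  assume eq: "d {v} + 2 = d A"
  have o: "orients G (cross G A) \<theta>" using \<theta>(1) cross_complement[OF m A(1)] unfolding preflow_on_def by simp
  have "one_way \<theta> (V - A) {e \<in> cross G A. v \<notin> ends G e}"
    using S eq cross_complement[OF m A(1)] unfolding part_bound_def dA by auto
  then show "one_way \<theta> A {e \<in> cross G A. v \<notin> ends G e}"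
    using one_way_complement[OF m o, of "{e \<in> cross G A. v \<notin> ends G e}"] by auto
  show "d {a} = 4" if "a \<in> A" "a \<noteq> v"
  proof -
    have "{a} \<in> inner G A - {{v}, V - A}" using that unfolding inner_def by auto
    then show ?thesis using S eq unfolding part_bound_def dA by blast
  qed
qed

lemma restrict_deg:
  assumes A: "A \<subseteq> V" "z \<notin> A" "A \<noteq> V - {z}" "card A \<ge> 2" and v: "v \<in> A"
  shows "d {v} + 2 \<le> d A" "d {v} + 2 = d A \<Longrightarrow> a \<in> A \<Longrightarrow> a \<noteq> v \<Longrightarrow> d {a} = 4"
proof -
  obtain h where "preflow_on G (V - A) h" "\<not> ext G (inner G A) (V - A) h" using restrict_exists[OF A(1,2,4)] by blast
  note r = restrict_tip_bound[OF A(1-3) this v]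
  show "d {v} + 2 \<le> d A" by (rule r(1))
  show "d {v} + 2 = d A \<Longrightarrow> a \<in> A \<Longrightarrow> a \<noteq> v \<Longrightarrow> d {a} = 4" by (rule r(3))
qed

lemma bd_deg4: "v \<in> V \<Longrightarrow> v \<noteq> z \<Longrightarrow> d {v} = 4 \<Longrightarrow> bd G v = 0"
  using ok_single[of v] unfolding ok4_def by auto

text \<open>By the bound for the restriction each vertex of \<open>A\<close> has degree at most
  \<open>d A - 2\<close>, while tame degrees start at 4. A cut of size 6 leaves only degree 4 and
  boundary 0. A cut of size 7 has a vertex of degree 5 by parity; the other vertices then have
  degree 4, and the boundary of \<open>A\<close> is the non-zero one of that vertex.\<close>

lemma cut_ok6:
  assumes A: "A \<subseteq> V" "z \<notin> A" "A \<noteq> V - {z}" "card A \<ge> 2"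
  shows "ok6 (d A) (bsum G A)"
proof -
  note r = restrict_deg[OF A]
  have fA: "finite A" using A(1) fin(1) by (rule finite_subset)
  obtain v where v: "v \<in> A" using A(4) by fastforce
  have d4: "4 \<le> d {a}" if "a \<in> A" for a using deg4 that A by blast
  have "d A \<ge> 6" using r(1)[OF v] d4[OF v] by simp
  moreover have "bsum G A = 0" if "d A = 6"
  proof -
    have "bd G a = 0" if a: "a \<in> A" for a
      using r(1)[OF a] d4[OF a] \<open>d A = 6\<close> bd_deg4[of a] a A by auto
    then show ?thesis unfolding bsum_def by (simp add: sum.neutral)
  qed
  moreover have "bsum G A \<noteq> 0" if 7: "d A = 7"
  proof (cases "\<exists>a\<in>A. d {a} = 5")
    case True
    then obtain a where a: "a \<in> A" "d {a} = 5" by blast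
    then have "bd G u = 0" if "u \<in> A - {a}" for u using r(2)[OF a(1), of u] that 7 A bd_deg4[of u] by auto
    then have "bsum G A = bd G a" unfolding bsum_def using a(1) fA by (simp add: sum.remove[of A a])
    then show ?thesis using ok_single[of a] a A unfolding ok4_def by auto
  next
    case False
    have "d {a} = 4" if a: "a \<in> A" for a using r(1)[OF a] d4[OF a] False a 7 by fastforce
    then have "even (\<Sum>v\<in>A. d {v})" by (intro dvd_sum) simp
    then show ?thesis using cutdeg_parity[OF m fA] 7 by simp
  qed
  moreover have "d A = 6 \<or> d A = 7 \<or> 8 \<le> d A" using \<open>d A \<ge> 6\<close> by linarith
  ultimately show ?thesis unfolding ok6_def by blast
qed

lemma cut_ok4:
  assumes A: "A \<subseteq> V" "z \<notin> A" "A \<noteq> V - {z}" "A \<noteq> {}"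
  shows "ok4 (d A) (bsum G A)"
proof (cases "card A \<ge> 2")
  case True
  then show ?thesis using cut_ok6[OF A(1-3)] ok6_imp_ok4(1) by blast
next
  case False
  moreover have "card A \<noteq> 0" using A(1,4) finite_subset[OF _ fin(1)] by auto
  ultimately have "card A = 1" by linarith
  then obtain a where "A = {a}" by (auto simp: card_1_singleton_iff)
  then show ?thesis using ok_single[of a] A by auto
qed

lemma restrict_canvas_quot:
  assumes A: "A \<subseteq> V" "z \<notin> A"
  shows "quot (part_of (inner G A)) id G (restrict_canvas G A)" "fibres (part_of (inner G A)) G = inner G A"
    "restrict_tip G A \<in> verts (restrict_canvas G A)" "fibre (part_of (inner G A)) G {restrict_tip G A} = V - A"
    "a \<in> A \<Longrightarrow> fibre (part_of (inner G A)) G {{a}} = {a}" "a \<in> A \<Longrightarrow> {a} \<in> verts (restrict_canvas G A)"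
proof -
  have "A \<noteq> V" using A(2) zV by blast
  note P = partition_inner[OF A(1) this]
  note q = quot_contract[OF m P]
  have e: "restrict_canvas G A = contract G (inner G A)" unfolding restrict_canvas_def inner_def ..
  show "quot (part_of (inner G A)) id G (restrict_canvas G A)" unfolding e by (rule q(1))
  show "fibres (part_of (inner G A)) G = inner G A" by (rule q(3))
  show "restrict_tip G A \<in> verts (restrict_canvas G A)" unfolding e contract_def restrict_tip_def inner_def by simp
  show "fibre (part_of (inner G A)) G {restrict_tip G A} = V - A"
    using q(2)[of "{V - A}"] unfolding restrict_tip_def inner_def by simp
  show "a \<in> A \<Longrightarrow> fibre (part_of (inner G A)) G {{a}} = {a}" using q(2)[of "{{a}}"] unfolding inner_def by simp
  show "a \<in> A \<Longrightarrow> {a} \<in> verts (restrict_canvas G A)" unfolding e contract_def inner_def by simp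
qed

lemma canvas_class_restrict:
  assumes A: "A \<subseteq> V" "z \<notin> A" and \<theta>: "preflow_on G (V - A) \<theta>" "\<not> ext G (inner G A) (V - A) \<theta>"
    and k: "int (d A) \<le> k + 1" "int (d A) = k + 1 \<Longrightarrow> \<not> one_way \<theta> A (cross G A)"
  shows "canvas_class k (restrict_canvas G A) (restrict_tip G A)"
proof -
  note q = restrict_canvas_quot[OF A]
  let ?K = "restrict_canvas G A" and ?w = "restrict_tip G A" and ?f = "part_of (inner G A)"
  have tc: "failing_canvas ?K ?w (?f \<circ> \<theta> \<circ> id)" by (rule restrict_failing_canvas[OF A q(1-4) \<theta>])
  have m': "multigraph ?K" by (rule quot_multigraph[OF m q(1)])
  have dw: "deg ?K ?w = d A"
    using deg_cutdeg[OF m'] quot_cutdeg[OF m q(1), of "{?w}"] q(4) cutdeg_complement[OF m A(1)] by simp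
  have o: "orients G (cross G A) \<theta>" "orients G (cross G (V - A)) \<theta>"
    using \<theta>(1) cross_complement[OF m A(1)] unfolding preflow_on_def by simp_all
  have "same_way ?w (?f \<circ> \<theta> \<circ> id) (inc ?K ?w) \<longleftrightarrow> one_way \<theta> A (cross G A)"
    using quot_same_way(1)[OF m q(1), of ?w \<theta>] q(4) o cross_complement[OF m A(1)] one_way_complement[OF m o(1), of "cross G A"]
    by simp
  then show ?thesis using tc k unfolding canvas_class_def failing_canvas_def tallness_witnessing_def dw by blast
qed

lemma easel_class_restrict:
  assumes A: "A \<subseteq> V" "z \<notin> A" "x \<in> A" and \<theta>: "preflow_on G (V - A) \<theta>" "\<not> ext G (inner G A) (V - A) \<theta>"
    and k: "int (d A) \<le> k + 1" "int (d A) = k + 1 \<Longrightarrow> \<not> one_way \<theta> A (cross G A)"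
    and x: "int (d {x}) \<ge> k - 2 - r"
      "int (d A) = k + 1 \<Longrightarrow> int (d {x}) = k - 2 - r \<Longrightarrow> \<not> one_way \<theta> A {e \<in> cross G A. x \<notin> ends G e}"
  shows "\<exists>\<psi>\<^sub>1. easel_class k r (restrict_canvas G A) (restrict_tip G A) {x} \<psi>\<^sub>1"
proof -
  note q = restrict_canvas_quot[OF A(1,2)]
  let ?K = "restrict_canvas G A" and ?w = "restrict_tip G A" and ?f = "part_of (inner G A)"
  have tc: "failing_canvas ?K ?w (?f \<circ> \<theta> \<circ> id)" by (rule restrict_failing_canvas[OF A(1,2) q(1-4) \<theta>])
  have m': "multigraph ?K" by (rule quot_multigraph[OF m q(1)])
  have dw: "deg ?K ?w = d A"
    using deg_cutdeg[OF m'] quot_cutdeg[OF m q(1), of "{?w}"] q(4) cutdeg_complement[OF m A(1)] by simp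
  have dx: "deg ?K {x} = d {x}"
    using deg_cutdeg[OF m'] quot_cutdeg[OF m q(1), of "{{x}}"] q(5)[OF A(3)] by simp
  have o: "orients G (cross G A) \<theta>" "orients G (cross G (V - A)) \<theta>"
    using \<theta>(1) cross_complement[OF m A(1)] unfolding preflow_on_def by simp_all
  have s: "same_way ?w (?f \<circ> \<theta> \<circ> id) (inc ?K ?w) \<longleftrightarrow> one_way \<theta> A (cross G A)"
    using quot_same_way(1)[OF m q(1), of ?w \<theta>] q(4) o cross_complement[OF m A(1)] one_way_complement[OF m o(1), of "cross G A"]
    by simp
  have sx: "same_way ?w (?f \<circ> \<theta> \<circ> id) {e \<in> inc ?K ?w. {x} \<notin> ends ?K e} \<longleftrightarrow> one_way \<theta> A {e \<in> cross G A. x \<notin> ends G e}"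
    using quot_same_way(2)[OF m q(1), of ?w \<theta> "{x}"] q(4) q(5)[OF A(3)] o cross_complement[OF m A(1)]
      one_way_complement[OF m o(1), of "{e \<in> cross G A. x \<notin> ends G e}"] by auto
  have ne: "{x} \<noteq> ?w" using A(3) unfolding restrict_tip_def by blast
  have "easel_class k r ?K ?w {x} (?f \<circ> \<theta> \<circ> id)"
    using tc k x s sx q(6)[OF A(3)] ne
    unfolding easel_class_def easel_def failing_canvas_def tallness_witness_def tallness_witnessing_def dw dx by blast
  then show ?thesis by blast
qed

end

lemma one_way_tip: "one_way \<psi> {z} F \<longleftrightarrow> same_way z \<psi> F"
  unfolding one_way_def same_way_def by simp

text \<open>Turns a \<open>quot\<close> into the isomorphism from the contraction that
  \<open>expansion\<close> asks for; a part goes to the image of an arbitrary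
  representative.\<close>

lemma quot_iso:
  assumes m: "multigraph G" and q: "quot f g G K"
  shows "bgraph_iso (\<lambda>A. f (SOME v. v \<in> A)) (inv_into (edges K) g) (contract G (fibres f G)) K"
    "A \<in> fibres f G \<Longrightarrow> a \<in> A \<Longrightarrow> f (SOME v. v \<in> A) = f a"
proof -
  let ?F = "\<lambda>A. f (SOME v. v \<in> A)"
  note P = partition_fibres[OF q]
  have F: "?F A = f a" if "A \<in> fibres f G" "a \<in> A" for A a
  proof -
    have "(SOME v. v \<in> A) \<in> A" using that(2) by (rule someI)
    then show ?thesis using that unfolding fibres_def fibre_def by auto
  qed
  then show "A \<in> fibres f G \<Longrightarrow> a \<in> A \<Longrightarrow> f (SOME v. v \<in> A) = f a" .
  have F': "?F (fibre f G {w}) = w \<and> fibre f G {w} \<in> fibres f G" if w: "w \<in> verts K" for w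
  proof -
    obtain u where "u \<in> verts G" "f u = w" using w quot_verts[OF q] by auto
    moreover from this have "fibre f G {w} \<in> fibres f G" unfolding fibres_def by blast
    ultimately show ?thesis using F[of "fibre f G {w}" u] by (simp add: fibre_def)
  qed
  have "bij_betw ?F (fibres f G) (verts K)"
  proof (rule bij_betw_byWitness[where f' = "\<lambda>w. fibre f G {w}"])
    show "\<forall>A\<in>fibres f G. fibre f G {?F A} = A" using F' unfolding fibres_def quot_verts[OF q] by auto
    show "\<forall>w\<in>verts K. ?F (fibre f G {w}) = w" using F' by blast
    show "?F ` fibres f G \<subseteq> verts K" using F' unfolding fibres_def quot_verts[OF q] by auto
    show "(\<lambda>w. fibre f G {w}) ` verts K \<subseteq> fibres f G" using F' by blast
  qed
  moreover have E: "edges (contract G (fibres f G)) = {e \<in> edges G. \<exists>u\<in>ends G e. \<exists>v\<in>ends G e. f u \<noteq> f v}"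
  proof -
    have "(\<exists>A\<in>fibres f G. ends G e \<subseteq> A) \<longleftrightarrow> \<not> (\<exists>u\<in>ends G e. \<exists>v\<in>ends G e. f u \<noteq> f v)" if e: "e \<in> edges G" for e
    proof -
      obtain a b where ab: "ends G e = {a, b}" "a \<in> verts G" "b \<in> verts G" using e m by (rule multigraph_edgeE)
      show ?thesis unfolding ab(1) fibres_def fibre_def using ab(2,3) by auto
    qed
    then have "{e \<in> edges G. \<not> (\<exists>A\<in>fibres f G. ends G e \<subseteq> A)} =
      {e \<in> edges G. \<exists>u\<in>ends G e. \<exists>v\<in>ends G e. f u \<noteq> f v}" by (intro Collect_cong conj_cong refl) simp
    then show ?thesis unfolding contract_def by simp
  qed
  moreover have "bij_betw (inv_into (edges K) g) {e \<in> edges G. \<exists>u\<in>ends G e. \<exists>v\<in>ends G e. f u \<noteq> f v} (edges K)"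
    using q unfolding quot_def by (simp add: bij_betw_inv_into)
  moreover have "ends K (inv_into (edges K) g e) = ?F ` ends (contract G (fibres f G)) e"
    if e: "e \<in> edges (contract G (fibres f G))" for e
  proof -
    have "e \<in> g ` edges K" using e E q unfolding quot_def bij_betw_def by simp
    then have "ends K (inv_into (edges K) g e) = f ` ends G e"
      using q f_inv_into_f[of e g "edges K"] inv_into_into[of e g "edges K"] unfolding quot_def by metis
    moreover have "?F (part_of (fibres f G) u) = f u" if "u \<in> ends G e" for u
    proof -
      have "e \<in> edges G" using e E by simp
      then have "u \<in> verts G" using m that unfolding multigraph_def by blast
      then show ?thesis using F part_of_mem[OF P] by blast
    qed
    ultimately show ?thesis unfolding contract_def by (force simp: image_image)
  qed
  moreover have "bd K (?F A) = bd (contract G (fibres f G)) A" if A: "A \<in> fibres f G" for A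
  proof -
    obtain w where w: "w \<in> verts K" "A = fibre f G {w}" using A unfolding fibres_def quot_verts[OF q] by auto
    then show ?thesis using F'[OF w(1)] q unfolding quot_def contract_def bsum_def by simp
  qed
  ultimately show "bgraph_iso ?F (inv_into (edges K) g) (contract G (fibres f G)) K"
    unfolding bgraph_iso_def E by (simp add: contract_def)
qed

text \<open>Membership in the class of easels with all conditions stated through cuts of
  \<open>G\<close>, so that the outcomes never compute in \<open>K\<close>.\<close>

lemma class_quot:
  assumes m: "multigraph G" and q: "quot f g G K" and tc: "failing_canvas K (f z) (f \<circ> \<psi> \<circ> g)"
    and fz: "fibre f G {f z} = {z}" and fx: "fibre f G {f x} = X" and zx: "z \<in> verts G" "x \<in> verts G" "z \<notin> X"
    and o: "orients G (cross G {z}) \<psi>"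
    and k: "int (cutdeg G {z}) \<le> k + 1" "int (cutdeg G {z}) = k + 1 \<Longrightarrow> \<not> one_way \<psi> {z} (cross G {z})"
    and x: "int (cutdeg G X) \<ge> k - 2 - r" "int (cutdeg G X) = k - 2 - r \<Longrightarrow> int (cutdeg G {z}) = k + 1 \<Longrightarrow>
      \<not> one_way \<psi> {z} {e \<in> cross G {z}. ends G e \<inter> X = {}}"
  shows "easel_class k r K (f z) (f x) (f \<circ> \<psi> \<circ> g)"
proof -
  have d: "deg K u = cutdeg G (fibre f G {u})" for u
    using deg_cutdeg[OF quot_multigraph[OF m q]] quot_cutdeg[OF m q] by metis
  have "f x \<noteq> f z" using zx fx fz by (auto simp: fibre_def)
  moreover have "f x \<in> verts K" using zx quot_verts[OF q] by auto
  moreover note quot_same_way[OF m q, of "f z" \<psi>, unfolded fz, OF o]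
  ultimately show ?thesis
    using tc k x unfolding easel_class_def easel_def failing_canvas_def tallness_witness_def tallness_witnessing_def d fz fx
    by (simp add: fx)
qed

section \<open>A preflow that does not extend, and what its criticality forces locally\<close>

locale crit_flow = crit_canvas G z N for G :: "('v, 'e) bgraph" and z N +
  fixes x :: 'v and \<psi> :: "'e \<Rightarrow> 'v"
  assumes xV: "x \<in> V" and xz: "x \<noteq> z" and pre: "tip_preflow G z \<psi>" and nx: "\<not> extends G z \<psi>"
    and size_eq: "N = ord_size G z"
begin

lemma \<psi>o: "orients G (cross G {z}) \<psi>" and pre_on: "preflow_on G {z} \<psi>"
  using pre balanced_at_iff[OF m] inc_cross[OF m, of z] unfolding tip_preflow_def preflow_on_def by simp_all

lemma nxs: "\<not> ext G singles {z} \<psi>"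
  using nx extends_ext[OF m] \<psi>o inc_cross[OF m] by metis

definition agrees :: "('e \<Rightarrow> 'v) \<Rightarrow> bool" where
  "agrees h \<longleftrightarrow> orients G (edges G) h \<and> (\<forall>e\<in>cross G {z}. h e = z \<longleftrightarrow> \<psi> e = z)"

lemma agrees_balanced: "agrees h \<Longrightarrow> balanced_on G h {z}"
  using pre_on unfolding agrees_def preflow_on_def balanced_on_def net_cross[OF m] by simp

text \<open>Balance at \<open>z\<close> is part of the preflow, and balance at \<open>v\<close>
  follows from balance everywhere else. Many contradictions below end here, with \<open>v\<close>
  the one vertex out of control.\<close>

lemma no_flow:
  assumes h: "agrees h" and v: "v \<in> V" and b: "\<And>w. w \<in> V - {v, z} \<Longrightarrow> balanced_on G h {w}"
  shows False
proof -
  have o: "orients G (edges G) h" using h unfolding agrees_def by blast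
  have b': "balanced_on G h {w}" if "w \<in> V - {v}" for w
    using b[of w] agrees_balanced[OF h] that by (cases "w = z") auto
  have "balanced_on G h (V - {v})" by (rule balanced_singles[OF m o Diff_subset b'])
  then have "balanced_on G h {v}" using balanced_complement[OF m o total, of "{v}"] v by simp
  then have "ext G singles {z} \<psi>" unfolding ext_def using o h b' unfolding agrees_def by auto
  then show False using nxs by blast
qed

text \<open>Criticality of \<psi> expressed by partitions of \<open>V\<close>;
  \<open>crit_preflow_critical\<close> leads back to the original notion.\<close>

definition crit :: bool where
  "crit \<longleftrightarrow> critical_partition G singles {z} \<psi>"

lemma not_critE:
  assumes "\<not> crit"
  obtains Q where "partition_on V Q" "{z} \<in> Q" "Q \<noteq> singles" "\<not> ext G Q {z} \<psi>"
  using assms partition_singles[of V] zV nxs unfolding crit_def critical_partition_def by blast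

lemma coarser_singles: "partition_on V Q \<Longrightarrow> coarser singles Q"
  unfolding coarser_def partition_on_def by blast

lemma crit_ext: "crit \<Longrightarrow> partition_on V Q \<Longrightarrow> {z} \<in> Q \<Longrightarrow> Q \<noteq> singles \<Longrightarrow> ext G Q {z} \<psi>"
  unfolding crit_def critical_partition_def using coarser_singles by blast

text \<open>Unlike in \<open>restrict_exists\<close>, where flow-criticality picks the preflow, the
  orientation obtained here agrees with the given \<psi>.\<close>

lemma crit_flowE:
  assumes c: crit and A: "A \<subseteq> V" "z \<notin> A" "card A \<ge> 2"
  obtains h where "agrees h" "\<And>v. v \<in> V - A \<Longrightarrow> balanced_on G h {v}"
    "preflow_on G (V - A) h" "\<not> ext G (inner G A) (V - A) h"
proof -
  have ne: "A \<noteq> {}" using A(3) by auto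
  have zo: "{z} \<in> outer G A" using A zV unfolding outer_def by auto
  have "A \<in> outer G A" "A \<notin> singles" using A(3) unfolding outer_def by auto
  then have "ext G (outer G A) {z} \<psi>" using crit_ext[OF c partition_outer[OF A(1) ne] zo] by blast
  then obtain h where h: "orients G (edges G) h" "\<And>e. e \<in> cross G {z} \<Longrightarrow> h e \<in> {z} \<longleftrightarrow> \<psi> e \<in> {z}"
    "\<And>C. C \<in> outer G A \<Longrightarrow> balanced_on G h C" unfolding ext_def by blast
  have b: "balanced_on G h {v}" if "v \<in> V - A" for v using h(3) that unfolding outer_def by blast
  have a: "agrees h" unfolding agrees_def using h(1,2) by simp
  have "balanced_on G h (V - A)" by (rule balanced_singles[OF m h(1) Diff_subset b])
  then have "preflow_on G (V - A) h" by (rule preflow_of_flow[OF h(1)])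
  moreover have "\<not> ext G (inner G A) (V - A) h"
    by (rule restrict_nonext[OF m A(1,2) nxs h(1)]) (use h(2) b in auto)
  ultimately show ?thesis using that a b by blast
qed

lemma agrees_glue:
  assumes "agrees h1" "agrees h2"
  shows "agrees (\<lambda>e. if p e then h2 e else h1 e)"
  using assms unfolding agrees_def orients_def by auto

lemma net_cong: "(\<And>e. e \<in> cross G S \<Longrightarrow> h e = h' e) \<Longrightarrow> net G h S = net G h' S"
  unfolding net_cross[OF m] by (rule sum.cong) auto

text \<open>If \<open>a\<close> and \<open>z\<close> separated \<open>K\<close> from the rest, a
  flow that is correct on \<open>K\<close> and one that is correct on the rest could be combined,
  each edge off the tip meeting only one side. Only \<open>a\<close> would remain unchecked.\<close>

lemma no_separation:
  assumes c: crit and a: "a \<in> V" "a \<noteq> z" and K: "K \<subseteq> V - {a, z}" "K \<noteq> {}" "V - {a, z} - K \<noteq> {}"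
    and e: "\<And>e. e \<in> edges G \<Longrightarrow> ends G e \<inter> K \<noteq> {} \<Longrightarrow> ends G e \<inter> (V - {a, z} - K) = {}"
  shows False
proof -
  let ?L = "V - {a, z} - K"
  have fK: "finite K" using K(1) finite_subset[OF _ fin(1)] by blast
  have two: "card (insert a S) \<ge> 2" if "S \<subseteq> V - {a, z}" "S \<noteq> {}" for S
  proof -
    have "finite S" using that(1) finite_subset[OF _ fin(1)] by blast
    then have "card S \<ge> 1" "a \<notin> S" using that by (auto simp: Suc_leI card_gt_0_iff)
    then show ?thesis using \<open>finite S\<close> by simp
  qed
  obtain h1 where h1: "agrees h1" "\<And>v. v \<in> V - insert a K \<Longrightarrow> balanced_on G h1 {v}"
    using crit_flowE[OF c, of "insert a K"] two[OF K(1,2)] K(1) a by blast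
  obtain h2 where h2: "agrees h2" "\<And>v. v \<in> V - insert a ?L \<Longrightarrow> balanced_on G h2 {v}"
    using crit_flowE[OF c, of "insert a ?L"] two[of ?L] K(3) a by blast
  define h where "h = (\<lambda>e. if ends G e \<inter> K \<noteq> {} then h2 e else h1 e)"
  have "balanced_on G h {w}" if w: "w \<in> V - {a, z}" for w
  proof (cases "w \<in> K")
    case True
    have "net G h {w} = net G h2 {w}" by (rule net_cong) (use True in \<open>auto simp: h_def cross_def\<close>)
    then show ?thesis using h2(2)[of w] True K(1) unfolding balanced_on_def by auto
  next
    case False
    have "net G h {w} = net G h1 {w}"
    proof (rule net_cong)
      fix e' assume "e' \<in> cross G {w}"
      then have "e' \<in> edges G" "w \<in> ends G e'" unfolding cross_def by auto
      then have "ends G e' \<inter> K = {}" using e[of e'] w False by blast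
      then show "h e' = h1 e'" by (simp add: h_def)
    qed
    then show ?thesis using h1(2)[of w] False w unfolding balanced_on_def by auto
  qed
  moreover have "agrees h" unfolding h_def by (rule agrees_glue[OF h1(1) h2(1)])
  ultimately show False using no_flow[of h a] a by blast
qed

text \<open>\<open>c\<close> is the sign wanted for \<open>e\<close> at \<open>u\<close>; the
  present orientation may already have it.\<close>

lemma flux_flip:
  assumes "orients G (edges G) h" "e \<in> edges G" "ends G e = {u, v}" "u \<noteq> v" "c = 1 \<or> c = -1"
  shows "\<exists>h'. orients G (edges G) h' \<and> (\<forall>e'. e' \<noteq> e \<longrightarrow> h' e' = h e') \<and>
    net G h' {u} = net G h {u} - flux G h {u} e + c \<and> (\<forall>S. e \<notin> cross G S \<longrightarrow> net G h' S = net G h S)"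
proof -
  define h' where "h' = h(e := if c = 1 then v else u)"
  have "flux G h' {u} e' = flux G h {u} e'" if "e' \<in> edges G - {e}" for e'
    using that unfolding flux_def h'_def by auto
  moreover have "flux G h' {u} e = c" using assms unfolding flux_def h'_def by auto
  ultimately have 1: "net G h' {u} = (\<Sum>e'\<in>edges G - {e}. flux G h {u} e') + c"
    unfolding net_def using assms by (simp add: sum.remove[of "edges G" e])
  have 2: "net G h {u} = (\<Sum>e'\<in>edges G - {e}. flux G h {u} e') + flux G h {u} e"
    unfolding net_def using assms by (simp add: sum.remove[of "edges G" e])
  have 3: "net G h' S = net G h S" if "e \<notin> cross G S" for S by (rule net_cong) (use that in \<open>auto simp: h'_def\<close>)
  have "orients G (edges G) h'" using assms unfolding orients_def h'_def by auto
  then show ?thesis using 1 2 3 by (intro exI[of _ h']) (auto simp: h'_def)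
qed

text \<open>Merging \<open>u\<close> and \<open>v\<close> yields a flow correct elsewhere. Neither
  orientation of \<open>e\<close> can balance \<open>u\<close>, since \<open>v\<close> would follow.
  So two of the three residues are excluded, and \<open>u\<close> is balanced with \<open>e\<close>
  left out.\<close>

lemma crit_edge:
  assumes c: crit and uv: "u \<in> V" "v \<in> V" "u \<noteq> z" "v \<noteq> z" "u \<noteq> v" and e: "e \<in> edges G" "ends G e = {u, v}"
  obtains h where "agrees h" "\<And>w. w \<in> V - {u, v} \<Longrightarrow> balanced_on G h {w}" "of_int (net G h {u} - flux G h {u} e) = bd G u"
proof -
  have 2: "card {u, v} \<ge> 2" using uv by simp
  obtain h where h: "agrees h" "\<And>w. w \<in> V - {u, v} \<Longrightarrow> balanced_on G h {w}"
    using crit_flowE[OF c _ _ 2] uv by blast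
  have o: "orients G (edges G) h" using h unfolding agrees_def by blast
  let ?s = "net G h {u} - flux G h {u} e"
  have "of_int (?s + t) \<noteq> bd G u" if t: "t = 1 \<or> t = -1" for t
  proof
    assume eq: "of_int (?s + t) = bd G u"
    obtain h' where h': "orients G (edges G) h'" "\<forall>e'. e' \<noteq> e \<longrightarrow> h' e' = h e'" "net G h' {u} = ?s + t"
      "\<forall>S. e \<notin> cross G S \<longrightarrow> net G h' S = net G h S"
      using flux_flip[OF o e uv(5) t] by blast
    have ez: "e \<notin> cross G {z}" using uv e unfolding cross_def by auto
    have "agrees h'" using h(1) h'(1,2) ez unfolding agrees_def by metis
    moreover have "balanced_on G h' {w}" if w: "w \<in> V - {v, z}" for w
    proof (cases "w = u")
      case True
      then show ?thesis using eq h'(3) unfolding balanced_on_def by simp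
    next
      case False
      then have "e \<notin> cross G {w}" using w e unfolding cross_def by auto
      then have "net G h' {w} = net G h {w}" using h'(4) by blast
      then show ?thesis using h(2)[of w] w False unfolding balanced_on_def by auto
    qed
    ultimately show False using no_flow uv(2) by blast
  qed
  from this[of 1] this[of "-1"] have "of_int ?s + 1 \<noteq> bd G u" "of_int ?s - 1 \<noteq> bd G u" by simp_all
  then have "of_int ?s = bd G u"
    by (cases "of_int ?s :: 3" rule: Z3_cases; cases "bd G u" rule: Z3_cases) auto
  then show ?thesis using that h by blast
qed

lemma no_parallel:
  assumes c: crit and uv: "u \<in> V" "v \<in> V" "u \<noteq> z" "v \<noteq> z" "u \<noteq> v"
    and e: "e \<in> edges G" "e' \<in> edges G" "ends G e = {u, v}" "ends G e' = {u, v}"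
  shows "e = e'"
proof (rule ccontr)
  assume ne: "e \<noteq> e'"
  obtain h where h: "agrees h" "\<And>w. w \<in> V - {u, v} \<Longrightarrow> balanced_on G h {w}" "of_int (net G h {u} - flux G h {u} e) = bd G u"
    using crit_edge[OF c uv e(1,3)] by blast
  have o: "orients G (edges G) h" using h unfolding agrees_def by blast
  define t where "t = flux G h {u} e'"
  have t: "t = 1 \<or> t = -1" using uv e unfolding t_def flux_def by auto
  then have t': "-t = 1 \<or> -t = -1" by auto
  text \<open>The flow is already correct at \<open>u\<close> without \<open>e\<close>; pointing \<open>e\<close> and \<open>e'\<close> against \<open>t\<close> changes this by \<open>3\<close>.\<close>
  obtain h1 where h1: "orients G (edges G) h1" "\<forall>a. a \<noteq> e' \<longrightarrow> h1 a = h a" "net G h1 {u} = net G h {u} - t + (- t)"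
      "\<forall>S. e' \<notin> cross G S \<longrightarrow> net G h1 S = net G h S"
    using flux_flip[OF o e(2,4) uv(5) t'] unfolding t_def by blast
  obtain h2 where h2: "orients G (edges G) h2" "\<forall>a. a \<noteq> e \<longrightarrow> h2 a = h1 a" "net G h2 {u} = net G h1 {u} - flux G h1 {u} e + (- t)"
      "\<forall>S. e \<notin> cross G S \<longrightarrow> net G h2 S = net G h1 S"
    using flux_flip[OF h1(1) e(1,3) uv(5) t'] by blast
  have "flux G h1 {u} e = flux G h {u} e" using h1(2) ne unfolding flux_def by auto
  then have n: "net G h2 {u} = (net G h {u} - flux G h {u} e) - 3 * t" using h1(3) h2(3) by simp
  have 3: "(3::3) = 0" by simp
  have b2: "of_int (net G h2 {u}) = bd G u" using h(3) unfolding n by (simp add: 3)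
  have ez: "e \<notin> cross G {z}" "e' \<notin> cross G {z}" using uv e unfolding cross_def by auto
  have "agrees h2" using h(1) h1(2) h2(1,2) ez unfolding agrees_def by metis
  moreover have "balanced_on G h2 {w}" if w: "w \<in> V - {v, z}" for w
  proof (cases "w = u")
    case True
    then show ?thesis using b2 unfolding balanced_on_def by simp
  next
    case False
    then have "e \<notin> cross G {w}" "e' \<notin> cross G {w}" using w e unfolding cross_def by auto
    then have "net G h2 {w} = net G h {w}" using h1(4) h2(4) by metis
    then show ?thesis using h(2)[of w] w False unfolding balanced_on_def by auto
  qed
  ultimately show False using no_flow uv(2) by blast
qed

end

text \<open>Three signs sum to -3, -1, 1 or 3, and the multiples of 3 among these need equal
  signs.\<close>

lemma sum_three_signs:
  assumes "card F = 3" "\<And>e. e \<in> F \<Longrightarrow> f e = 1 \<or> f e = (-1::int)" "3 dvd (\<Sum>e\<in>F. f e)" "a \<in> F" "b \<in> F"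
  shows "f a = f b"
proof -
  obtain p q s where F: "F = {p, q, s}" "p \<noteq> q" "p \<noteq> s" "q \<noteq> s" using assms(1) by (metis card_3_iff)
  have v: "f p = 1 \<or> f p = -1" "f q = 1 \<or> f q = -1" "f s = 1 \<or> f s = -1" using assms(2) F(1) by auto
  have "3 dvd f p + f q + f s" using assms(3) F by (simp add: add.assoc)
  then have "f p = f q \<and> f q = f s" using v by (elim disjE) simp_all
  then show ?thesis using assms(4,5) F(1) by auto
qed

section \<open>Vertices of degree four in a critical canvas\<close>

context crit_flow
begin

definition other :: "'v \<Rightarrow> 'e \<Rightarrow> 'v" where
  "other y e = (SOME w. ends G e = {y, w} \<and> w \<noteq> y)"

lemma other: assumes "e \<in> cross G {y}"
  shows "ends G e = {y, other y e}" "other y e \<noteq> y" "other y e \<in> V" "e \<in> edges G"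
proof -
  show e: "e \<in> edges G" by (rule crossD[OF assms])
  obtain a b where ab: "ends G e = {a, b}" "a \<noteq> b" using e m by (rule multigraph_edgeE)
  have "\<exists>w. ends G e = {y, w} \<and> w \<noteq> y" using assms ab unfolding cross_def by auto
  then have *: "ends G e = {y, other y e} \<and> other y e \<noteq> y" unfolding other_def by (rule someI_ex)
  then show "ends G e = {y, other y e}" "other y e \<noteq> y" by blast+
  then show "other y e \<in> V" using m e unfolding multigraph_def by blast
qed

lemma net_single: "net G h {y} = (\<Sum>e\<in>cross G {y}. flux G h {y} e)"
  unfolding net_cross[OF m] by (rule sum.cong) (auto simp: flux_def cross_def)

lemma flux_sign: "e \<in> cross G S \<Longrightarrow> flux G h S e = 1 \<or> flux G h S e = -1"
  unfolding flux_def cross_def by auto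

text \<open>With \<open>e0\<close> discounted by \<open>crit_edge\<close>, the other three edges at
  \<open>y\<close> sum to a multiple of 3 and hence all have the same sign.\<close>

lemma deg4_tip_edges_same_way:
  assumes c: crit and y: "y \<in> V" "y \<noteq> z" "d {y} = 4"
    and e0: "e0 \<in> cross G {y}" "z \<notin> ends G e0" and e: "e \<in> cross G {y}" "z \<in> ends G e" "e' \<in> cross G {y}" "z \<in> ends G e'"
  shows "\<psi> e = z \<longleftrightarrow> \<psi> e' = z"
proof -
  note o0 = other[OF e0(1)]
  have "other y e0 \<noteq> z" using o0(1) e0(2) by auto
  then obtain h where h: "agrees h" "of_int (net G h {y} - flux G h {y} e0) = bd G y"
    using crit_edge[OF c y(1) o0(3) y(2) _ o0(2)[symmetric] o0(4,1)] by blast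
  let ?F = "cross G {y} - {e0}"
  have "net G h {y} - flux G h {y} e0 = (\<Sum>e\<in>?F. flux G h {y} e)"
    unfolding net_single using e0(1) m by (simp add: sum.remove[of "cross G {y}" e0])
  moreover have "bd G y = 0" by (rule bd_deg4[OF y])
  ultimately have dv: "3 dvd (\<Sum>e\<in>?F. flux G h {y} e)" using h(2) of_int_3_eq_0_iff by metis
  have c3: "card ?F = 3" using y(3) e0(1) m unfolding cutdeg_def by simp
  have "e \<in> ?F" "e' \<in> ?F" using e e0(2) by auto
  then have "flux G h {y} e = flux G h {y} e'" using sum_three_signs[OF c3 _ dv] flux_sign by blast
  moreover have "flux G h {y} a = -1 \<longleftrightarrow> \<psi> a \<noteq> z" if a: "a \<in> cross G {y}" "z \<in> ends G a" for a
  proof -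
    have ends: "ends G a = {y, z}" "a \<in> cross G {z}" using other[OF a(1)] a y(2) unfolding cross_def by auto
    then have "h a = z \<longleftrightarrow> \<psi> a = z" using h(1) unfolding agrees_def by blast
    moreover have "h a \<in> {y, z}" using h(1) ends other(4)[OF a(1)] unfolding agrees_def orients_def by auto
    ultimately show ?thesis using ends(1) y(2) unfolding flux_def by auto
  qed
  ultimately show ?thesis using e by metis
qed

text \<open>With three edges to the tip, \<open>y\<close> would have at most one further neighbour
  \<open>a\<close>, and \<open>a\<close> and \<open>z\<close> would separate \<open>y\<close> from a
  fourth vertex.\<close>

lemma deg4_few_tip_edges:
  assumes c: crit and n: "card V \<ge> 4" and y: "y \<in> V" "y \<noteq> z" "d {y} = 4"
  shows "card {e \<in> cross G {y}. z \<in> ends G e} \<le> 2"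
proof (rule ccontr)
  let ?Z = "{e \<in> cross G {y}. z \<in> ends G e}"
  assume "\<not> card ?Z \<le> 2"
  then have "card (cross G {y} - ?Z) \<le> 1" using y(3) m unfolding cutdeg_def by (subst card_Diff_subset) auto
  then have "\<forall>a\<in>cross G {y} - ?Z. \<forall>b\<in>cross G {y} - ?Z. a = b"
    using card_le_Suc0_iff_eq[of "cross G {y} - ?Z"] m by simp
  then obtain e0 where e0: "cross G {y} - ?Z \<subseteq> {e0}" by blast
  \<comment> \<open>The further neighbour of \<open>y\<close> if there is one, otherwise an
    arbitrary third vertex.\<close>
  obtain a where a: "a \<in> V" "a \<noteq> z" "a \<noteq> y" "\<And>e. e \<in> cross G {y} \<Longrightarrow> ends G e \<subseteq> {y, z, a}"
  proof (cases "\<exists>e\<in>cross G {y}. z \<notin> ends G e")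
    case True
    then obtain e where e: "e \<in> cross G {y}" "z \<notin> ends G e" by blast
    have "ends G e' \<subseteq> {y, z, other y e}" if e': "e' \<in> cross G {y}" for e'
    proof (cases "z \<in> ends G e'")
      case True
      then show ?thesis using other(1)[OF e'] y(2) by auto
    next
      case False
      then have "e' = e" using e0 e e' by blast
      then show ?thesis using other(1)[OF e'] by auto
    qed
    then show ?thesis using that[of "other y e"] other[OF e(1)] e(2) by auto
  next
    case False
    have "card (V - {z, y}) \<ge> 2" using n zV y by (simp add: card_Diff_subset)
    then have "V - {z, y} \<noteq> {}" by (metis card.empty not_numeral_le_zero)
    then obtain a where a: "a \<in> V - {z, y}" by blast
    moreover have "ends G e \<subseteq> {y, z, a}" if e: "e \<in> cross G {y}" for e
    proof -
      have "z \<in> ends G e" using False e by blast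
      then show ?thesis using other(1)[OF e] y(2) by auto
    qed
    ultimately show ?thesis using that[of a] by blast
  qed
  have "card (V - {a, z} - {y}) \<ge> 1" using n zV y a(1-3) by (simp add: card_Diff_subset)
  then have ne: "V - {a, z} - {y} \<noteq> {}" by (metis card.empty not_one_le_zero)
  show False
  proof (rule no_separation[OF c a(1,2) _ _ ne])
    show "{y} \<subseteq> V - {a, z}" using y a by auto
    fix e assume e: "e \<in> edges G" "ends G e \<inter> {y} \<noteq> {}"
    then have "e \<in> cross G {y}" using inc_cross[OF m, of y] unfolding inc_def by auto
    then show "ends G e \<inter> (V - {a, z} - {y}) = {}" using a(4) by blast
  qed simp
qed

text \<open>The pairing for the lifting. The ends within a pair differ, so that no loop arises, and
  a tip edge stands first in its pair. If there are tip edges, one of them is paired with an edge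
  that does not go to \<open>x\<close>, so that it stays visible off \<open>x\<close> after the
  lifting (see \<open>lift_keeps_both_ways\<close>).\<close>

lemma deg4_pairs:
  assumes c: crit and n: "card V \<ge> 4" and y: "y \<in> V" "y \<noteq> z" "d {y} = 4"
  obtains e1 e2 e3 e4 w1 w2 w3 w4 where "cross G {y} = {e1, e2, e3, e4}" "distinct [e1, e2, e3, e4]"
    "ends G e1 = {y, w1}" "ends G e2 = {y, w2}" "ends G e3 = {y, w3}" "ends G e4 = {y, w4}"
    "y \<notin> {w1, w2, w3, w4}" "{w1, w2, w3, w4} \<subseteq> V" "w1 \<noteq> w2" "w3 \<noteq> w4" "w2 \<noteq> z" "w4 \<noteq> z"
    "w1 = z \<or> w3 = z \<Longrightarrow> w1 = z \<and> w2 \<noteq> x \<or> w3 = z \<and> w4 \<noteq> x"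
    "w1 = z \<Longrightarrow> w3 = z \<Longrightarrow> \<psi> e1 = z \<longleftrightarrow> \<psi> e3 = z"
proof -
  let ?E = "cross G {y}"
  let ?Z = "{e \<in> ?E. z \<in> ends G e}"
  let ?N = "?E - ?Z"
  have fE: "finite ?E" using m by simp
  have cE: "card ?E = 4" using y(3) unfolding cutdeg_def .
  have cZ: "card ?Z \<le> 2" by (rule deg4_few_tip_edges[OF c n y])
  have cN: "card ?N = 4 - card ?Z" using cE fE by (subst card_Diff_subset) auto
  have oz: "other y e = z \<longleftrightarrow> z \<in> ends G e" if "e \<in> ?E" for e using other[OF that] y(2) by auto
  have inj: "other y e \<noteq> other y e'" if "e \<in> ?N" "e' \<in> ?N" "e \<noteq> e'" for e e'
  proof
    assume eq: "other y e = other y e'"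
    have E: "e \<in> ?E" "e' \<in> ?E" using that by auto
    have oe: "other y e \<noteq> z" using oz[OF E(1)] that by blast
    have "ends G e' = {y, other y e}" using other(1)[OF E(2)] unfolding eq .
    then have "e = e'"
      by (rule no_parallel[OF c y(1) other(3)[OF E(1)] y(2) oe other(2)[OF E(1), symmetric] other(4)[OF E(1)] other(4)[OF E(2)] other(1)[OF E(1)]])
    then show False using that by blast
  qed
  note concl = that
  have main: thesis if s: "?E = {e1, e2, e3, e4}" "distinct [e1, e2, e3, e4]" "e2 \<in> ?N" "e4 \<in> ?N"
    "e1 \<in> ?Z \<or> e3 \<in> ?Z \<Longrightarrow> e1 \<in> ?Z \<and> other y e2 \<noteq> x \<or> e3 \<in> ?Z \<and> other y e4 \<noteq> x" for e1 e2 e3 e4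
  proof (rule concl[OF s(1,2)])
    have E: "e1 \<in> ?E" "e2 \<in> ?E" "e3 \<in> ?E" "e4 \<in> ?E" using s(1) by auto
    show "ends G e1 = {y, other y e1}" "ends G e2 = {y, other y e2}" "ends G e3 = {y, other y e3}" "ends G e4 = {y, other y e4}"
      using other(1) E by blast+
    show "y \<notin> {other y e1, other y e2, other y e3, other y e4}" using E[THEN other(2)] by auto
    show "{other y e1, other y e2, other y e3, other y e4} \<subseteq> V" using other(3) E by blast
    have nz: "other y e2 \<noteq> z" "other y e4 \<noteq> z" using oz E s(3,4) by blast+
    then show "other y e2 \<noteq> z" "other y e4 \<noteq> z" .
    show "other y e1 \<noteq> other y e2"
    proof (cases "e1 \<in> ?Z")
      case True
      then show ?thesis using nz oz[OF E(1)] by auto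
    next
      case False
      then show ?thesis using inj[of e1 e2] E s(2,3) by auto
    qed
    show "other y e3 \<noteq> other y e4"
    proof (cases "e3 \<in> ?Z")
      case True
      then show ?thesis using nz oz[OF E(3)] by auto
    next
      case False
      then show ?thesis using inj[of e3 e4] E s(2,4) by auto
    qed
    show "other y e1 = z \<or> other y e3 = z \<Longrightarrow> other y e1 = z \<and> other y e2 \<noteq> x \<or> other y e3 = z \<and> other y e4 \<noteq> x"
      using s(5) oz E by auto
    assume "other y e1 = z" "other y e3 = z"
    then show "\<psi> e1 = z \<longleftrightarrow> \<psi> e3 = z"
      using deg4_tip_edges_same_way[OF c y, of e2 e1 e3] oz E s(3) by auto
  qed
  consider "card ?Z = 0" | "card ?Z = 1" | "card ?Z = 2" using cZ by linarith
  then show thesis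
  proof cases
    case 1
    then have Z: "?Z = {}" using fE by simp
    obtain S where S: "S \<subseteq> ?E" "card S = 2" using obtain_subset_with_card_n[of 2 ?E] cE by auto
    then have "card (?E - S) = 2" using cE fE finite_subset by (subst card_Diff_subset) auto
    then obtain p q s t where st: "S = {p, q}" "p \<noteq> q" "?E - S = {s, t}" "s \<noteq> t" using S(2) by (auto simp: card_2_iff)
    then have "?E = {p, q, s, t}" "distinct [p, q, s, t]" using S(1) by auto
    then show thesis using main[of p q s t] Z by auto
  next
    case 2
    then obtain p where Z: "?Z = {p}" by (auto simp: card_1_singleton_iff)
    have "card ?N = 3" using cN 2 by simp
    then obtain q s t where N: "?N = {q, s, t}" "q \<noteq> s" "q \<noteq> t" "s \<noteq> t" by (metis card_3_iff)
    have p: "p \<in> ?E" "p \<notin> ?N" "p \<in> ?Z" using Z by auto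
    have mem: "q \<in> ?N" "s \<in> ?N" "t \<in> ?N" unfolding N(1) by simp_all
    have E: "?E = insert p ?N" using Z by auto
    show thesis
    proof (cases "other y q = x")
      case False
      have "?E = {p, q, s, t}" "distinct [p, q, s, t]" using E N p by auto
      then show thesis by (rule main[OF _ _ mem(1,3)]) (use p(3) False in blast)
    next
      case True
      then have os: "other y s \<noteq> x" using inj[OF mem(1,2)] N by auto
      have "?E = {p, s, q, t}" "distinct [p, s, q, t]" using E N p by auto
      then show thesis by (rule main[OF _ _ mem(2,3)]) (use p(3) os in blast)
    qed
  next
    case 3
    then obtain p p' where Z: "?Z = {p, p'}" "p \<noteq> p'" by (auto simp: card_2_iff)
    have "card ?N = 2" using cN 3 by simp
    then obtain q s where N: "?N = {q, s}" "q \<noteq> s" by (auto simp: card_2_iff)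
    have mem: "q \<in> ?N" "s \<in> ?N" unfolding N(1) by simp_all
    have pm: "p \<in> ?Z" "p' \<in> ?Z" unfolding Z(1) by simp_all
    have "?E = ?Z \<union> ?N" by blast
    also have "\<dots> = {p, p'} \<union> {q, s}" by (rule arg_cong2[of _ _ _ _ "(\<union>)", OF Z(1) N(1)])
    finally have E: "?E = {p, q, p', s}" by (simp add: insert_commute)
    have "p \<noteq> q" "p \<noteq> s" "p' \<noteq> q" "p' \<noteq> s" using pm mem by blast+
    then have di: "distinct [p, q, p', s]" using Z(2) N(2) by auto
    have "other y q \<noteq> x \<or> other y s \<noteq> x" using inj[OF mem N(2)] by auto
    then show thesis using main[OF E di mem] pm by blast
  qed
qed

subsection \<open>Expansions\<close>

lemma expansionI:
  assumes P: "partition_on V P" "{z} \<in> P" and iso: "bgraph_iso F \<gamma> (contract G P) H"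
    and tip: "F {z} = z'" and x': "F (part_of P x) = x'" "x' \<noteq> z'"
    and cls: "\<And>A. A \<in> P \<Longrightarrow> card A \<ge> 2 \<Longrightarrow> canvas_class k (restrict_canvas G A) (restrict_tip G A)"
    and xcls: "card (part_of P x) \<ge> 2 \<Longrightarrow>
      \<exists>\<psi>\<^sub>1. easel_class k r (restrict_canvas G (part_of P x)) (restrict_tip G (part_of P x)) {x} \<psi>\<^sub>1"
    and Y: "\<And>y. Inl y \<in> Y \<Longrightarrow> \<exists>A\<in>P. F A = y \<and> card A \<ge> 2"
  shows "expansion (canvas_class k) x x' (easel_class k r) Y G z H z'"
proof -
  have "part_of P x \<in> P" using part_of_mem[OF P(1) xV] by blast
  then have "x' \<in> verts H" using iso x'(1) unfolding bgraph_iso_def bij_betw_def contract_def by auto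
  moreover have "class_partition (canvas_class k) G z P"
    unfolding class_partition_def tip_respecting_def using P cls by blast
  ultimately show ?thesis unfolding expansion_def using xV x' iso tip xcls Y
    by (intro conjI exI[of _ P] exI[of _ F] exI[of _ \<gamma>]) auto
qed

lemma easel_facts:
  assumes "easel_class k r G z x \<psi>"
  shows "int (d {z}) \<le> k + 1" "int (d {z}) = k + 1 \<Longrightarrow> \<not> one_way \<psi> {z} (cross G {z})" "int (d {x}) \<ge> k - 2 - r"
    "int (d {x}) = k - 2 - r \<Longrightarrow> int (d {z}) = k + 1 \<Longrightarrow> \<not> one_way \<psi> {z} {e \<in> cross G {z}. x \<notin> ends G e}"
  using assms deg_cutdeg[OF m] inc_cross[OF m]
  unfolding easel_class_def tallness_witness_def tallness_witnessing_def one_way_tip by auto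

text \<open>At a tip degree of at most \<open>k\<close> the classes put no condition on directions,
  so any failing preflow of the restriction will do.\<close>

lemma class_small:
  assumes A: "A \<subseteq> V" "z \<notin> A" "card A \<ge> 2" and k: "int (d A) \<le> k"
  shows "canvas_class k (restrict_canvas G A) (restrict_tip G A)"
    "x \<in> A \<Longrightarrow> int (d {x}) \<ge> k - 2 - r \<Longrightarrow> \<exists>\<psi>\<^sub>1. easel_class k r (restrict_canvas G A) (restrict_tip G A) {x} \<psi>\<^sub>1"
proof -
  obtain h where h: "preflow_on G (V - A) h" "\<not> ext G (inner G A) (V - A) h" using restrict_exists[OF A] by blast
  show "canvas_class k (restrict_canvas G A) (restrict_tip G A)"
    by (rule canvas_class_restrict[OF A(1,2) h]) (use k in auto)
  show "\<exists>\<psi>\<^sub>1. easel_class k r (restrict_canvas G A) (restrict_tip G A) {x} \<psi>\<^sub>1"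
    if "x \<in> A" "int (d {x}) \<ge> k - 2 - r"
    by (rule easel_class_restrict[OF A(1,2) that(1) h]) (use k that in auto)
qed

lemma card_tip_edges: "{e \<in> edges G. \<not> (\<exists>C\<in>P. ends G e \<subseteq> C) \<and> ends G e \<inter> {z} = {}} \<subseteq> {e \<in> edges G. z \<notin> ends G e}"
  by auto

lemma card_parts: "A \<subseteq> V \<Longrightarrow> A \<noteq> {} \<Longrightarrow> x \<in> A \<Longrightarrow> A = {x} \<or> card A \<ge> 2"
proof -
  assume a: "A \<subseteq> V" "x \<in> A"
  have "finite A" using a(1) fin(1) by (rule finite_subset)
  then have "card A > 0" using a by (auto simp: card_gt_0_iff)
  then have "card A = 1 \<or> card A \<ge> 2" by linarith
  then show ?thesis using a(2) by (auto simp: card_1_singleton_iff)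
qed

lemma card_singles: "card singles = card V"
  by (rule card_image) simp

lemma coarse_card: "partition_on V Q \<Longrightarrow> Q \<noteq> singles \<Longrightarrow> card Q < card V"
  using coarser_card(2)[OF fin(1) partition_singles _ coarser_singles] card_singles by metis

lemma not_crit_partition:
  assumes "\<not> crit"
  obtains Q and K :: "(nat, nat) bgraph" and f g where
    "critical_partition G Q {z} \<psi>" "Q \<noteq> singles" "quot f g G K" "fibres f G = Q"
    "\<And>v. v \<in> V \<Longrightarrow> fibre f G {f v} = part_of Q v"
    "failing_canvas K (f z) (f \<circ> \<psi> \<circ> g)" "ord_size K (f z) < ord_size G z"
    "\<And>A. A \<in> Q \<Longrightarrow> A \<noteq> {z} \<Longrightarrow> part_bound G Q {z} \<psi> A"
proof -
  obtain Q0 where Q0: "partition_on V Q0" "{z} \<in> Q0" "Q0 \<noteq> singles" "\<not> ext G Q0 {z} \<psi>" using not_critE[OF assms] by blast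
  have sz: "card Q0 + card {e \<in> edges G. \<not> (\<exists>C\<in>Q0. ends G e \<subseteq> C) \<and> ends G e \<inter> {z} = {}} < N"
  proof -
    have "card {e \<in> edges G. \<not> (\<exists>C\<in>Q0. ends G e \<subseteq> C) \<and> ends G e \<inter> {z} = {}} \<le> card {e \<in> edges G. z \<notin> ends G e}"
      by (rule card_mono[OF _ card_tip_edges]) simp
    then show ?thesis using coarse_card[OF Q0(1,3)] size_eq unfolding ord_size_def by simp
  qed
  obtain Q and K :: "(nat, nat) bgraph" and f g where K:
    "critical_partition G Q {z} \<psi>" "coarser Q0 Q" "quot f g G K" "fibres f G = Q"
    "\<And>v. v \<in> V \<Longrightarrow> fibre f G {f v} = part_of Q v"
    "\<And>b. b \<in> {z} \<Longrightarrow> failing_canvas K (f b) (f \<circ> \<psi> \<circ> g) \<and> ord_size K (f b) < N"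
    "\<And>A. A \<in> Q \<Longrightarrow> A \<noteq> {z} \<Longrightarrow> part_bound G Q {z} \<psi> A"
  proof (rule critical_quotient[OF T m total Q0(1,2,4) pre_on _ _ sz])
    show "bsum G A = 0" if "A \<subseteq> V - {z}" "cross G A = {}" for A using closed[of A] that by blast
    show "ok4 (d A) (bsum G A)" if "A \<subseteq> V - {z}" "A \<noteq> {}" "A \<noteq> V - {z}" for A using cut_ok4[of A] that by blast
  qed (rule that)
  have "card Q \<le> card Q0"
    by (rule coarser_card(1)[OF fin(1) Q0(1) _ K(2)]) (use K(1) in \<open>simp add: critical_partition_def\<close>)
  then have "Q \<noteq> singles" using coarse_card[OF Q0(1,3)] card_singles by auto
  then show ?thesis by (rule that[OF K(1) _ K(3-5) _ _ K(7)]) (use K(6) size_eq in auto)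
qed

text \<open>By the bound for the quotient every part has a cut of at most
  \<open>d {z} - 2 \<le> k - 1\<close>, so \<open>class_small\<close> applies. If the part of
  \<open>x\<close> contains more than \<open>x\<close>, its cut is at least
  \<open>d {x} + 2\<close>, and the extreme case cannot occur in the quotient.\<close>

lemma outcome_EXP:
  assumes e: "easel_class k r G z x \<psi>" and nc: "\<not> crit"
  shows "\<exists>(G' :: (nat, nat) bgraph) z' x' \<psi>'. easel_class k r G' z' x' \<psi>' \<and> prec G' z' x' G z x \<and> EXP k r G z x G' z' x'"
proof -
  obtain Q and K :: "(nat, nat) bgraph" and f g where K:
    "critical_partition G Q {z} \<psi>" "Q \<noteq> singles" "quot f g G K" "fibres f G = Q"
    "\<And>v. v \<in> V \<Longrightarrow> fibre f G {f v} = part_of Q v"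
    "failing_canvas K (f z) (f \<circ> \<psi> \<circ> g)" "ord_size K (f z) < ord_size G z"
    "\<And>A. A \<in> Q \<Longrightarrow> A \<noteq> {z} \<Longrightarrow> part_bound G Q {z} \<psi> A"
    using not_crit_partition[OF nc] by metis
  note ef = easel_facts[OF e]
  have P: "partition_on V Q" "{z} \<in> Q" using K(1) unfolding critical_partition_def by auto
  let ?X = "part_of Q x"
  have X: "?X \<in> Q" "x \<in> ?X" using part_of_mem[OF P(1) xV] by auto
  have sub: "A \<subseteq> V \<and> z \<notin> A \<and> A \<noteq> V - {z}" if A: "A \<in> Q" "A \<noteq> {z}" for A
    using part_subset[OF P(1) A(1)] critical_partition_parts(1,3)[OF m total pre_on K(1) A(1)] A(2) by auto
  have zX: "?X \<noteq> {z}" using X xz by auto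
  note sX = sub[OF X(1) zX]
  have fz: "fibre f G {f z} = {z}" using K(5)[OF zV] part_of_eq[OF P, of z] by simp
  have fx: "fibre f G {f x} = ?X" by (rule K(5)[OF xV])
  have small: "d A + 2 \<le> d {z}" if "A \<in> Q" "A \<noteq> {z}" for A using K(8)[OF that] unfolding part_bound_def by blast
  have sizeX: "?X = {x} \<or> card ?X \<ge> 2" using card_parts[of ?X] sX X(2) by auto
  have dX: "d {x} + 2 \<le> d ?X" if "card ?X \<ge> 2" using restrict_deg(1)[of ?X x] sX that X(2) by blast
  have eq: "{e \<in> cross G {z}. ends G e \<inter> {x} = {}} = {e \<in> cross G {z}. x \<notin> ends G e}" by auto
  have cl: "easel_class k r K (f z) (f x) (f \<circ> \<psi> \<circ> g)"
  proof (rule class_quot[OF m K(3,6) fz fx zV xV _ \<psi>o ef(1,2)])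
    show "z \<notin> ?X" using sX by blast
    show "int (d ?X) \<ge> k - 2 - r" using sizeX dX ef(3) by fastforce
    assume a: "int (d ?X) = k - 2 - r" "int (d {z}) = k + 1"
    then have "?X = {x}" using sizeX dX ef(3) by fastforce
    then show "\<not> one_way \<psi> {z} {e \<in> cross G {z}. ends G e \<inter> ?X = {}}" using ef(4) a eq by simp
  qed
  note iso = quot_iso[OF m K(3), unfolded K(4)]
  have "EXP k r G z x K (f z) (f x)"
    unfolding EXP_def
  proof (rule expansionI[OF P iso(1)])
    show "f (SOME v. v \<in> {z}) = f z" by simp
    show "f (SOME v. v \<in> ?X) = f x" by (rule iso(2)[OF X])
    show "f x \<noteq> f z" using fz xz xV by (auto simp: fibre_def)
    show "canvas_class k (restrict_canvas G A) (restrict_tip G A)" if A: "A \<in> Q" "card A \<ge> 2" for A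
    proof -
      have "A \<noteq> {z}" using A(2) by auto
      then show ?thesis using class_small(1)[of A k] sub[OF A(1)] small[OF A(1)] A(2) ef(1) by auto
    qed
    show "\<exists>\<psi>\<^sub>1. easel_class k r (restrict_canvas G ?X) (restrict_tip G ?X) {x} \<psi>\<^sub>1" if "card ?X \<ge> 2"
      using class_small(2)[of ?X k r] sX small[OF X(1) zX] X(2) that ef(1,3) by auto
  qed simp
  then show ?thesis using cl K(7) unfolding prec_def by blast
qed

end

subsection \<open>Lifting at a vertex of degree four\<close>

locale lifting = crit_flow G z N x \<psi>
  for G :: "('v, 'e) bgraph" and z N x \<psi> +
  fixes y w1 w2 w3 w4 :: 'v and e1 e2 e3 e4 :: 'e
  assumes c: crit and y: "y \<in> V" "y \<noteq> z" "y \<noteq> x" "d {y} = 4"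
    and E: "cross G {y} = {e1, e2, e3, e4}" and dist: "distinct [e1, e2, e3, e4]"
    and ends1: "ends G e1 = {y, w1}" and ends2: "ends G e2 = {y, w2}"
    and ends3: "ends G e3 = {y, w3}" and ends4: "ends G e4 = {y, w4}"
    and yw: "y \<notin> {w1, w2, w3, w4}" and wV: "{w1, w2, w3, w4} \<subseteq> V" and w12: "w1 \<noteq> w2" and w34: "w3 \<noteq> w4"
    and w2z: "w2 \<noteq> z" and w4z: "w4 \<noteq> z"
begin

text \<open>The names \<open>e1\<close> and \<open>e3\<close> are reused for the lifted edges. As
  \<open>w2\<close> and \<open>w4\<close> differ from the tip, the tip keeps all its edges under
  their old names.\<close>

definition G1 :: "('v, 'e) bgraph" where
  "G1 = \<lparr>verts = V - {y}, edges = edges G - {e2, e4}, ends = (ends G)(e1 := {w1, w2}, e3 := {w3, w4}), bd = bd G\<rparr>"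

text \<open>An edge from the tip into \<open>y\<close> now points to the far end of its pair; the
  direction at the tip is unchanged.\<close>

definition \<psi>1 :: "'e \<Rightarrow> 'v" where
  "\<psi>1 e = (if e = e1 \<and> \<psi> e = y then w2 else if e = e3 \<and> \<psi> e = y then w4 else \<psi> e)"

definition E0 :: "'e set" where
  "E0 = edges G - {e1, e2, e3, e4}"

lemma eE: "e1 \<in> edges G" "e2 \<in> edges G" "e3 \<in> edges G" "e4 \<in> edges G"
  using E crossD[of _ G "{y}"] by auto

lemma ne: "e1 \<noteq> e2" "e1 \<noteq> e3" "e1 \<noteq> e4" "e2 \<noteq> e3" "e2 \<noteq> e4" "e3 \<noteq> e4"
  using dist by auto

lemma yw': "w1 \<noteq> y" "w2 \<noteq> y" "w3 \<noteq> y" "w4 \<noteq> y"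
  using yw by auto

lemma E0: "finite E0" "e1 \<notin> E0" "e2 \<notin> E0" "e3 \<notin> E0" "e4 \<notin> E0"
  "edges G = insert e1 (insert e2 (insert e3 (insert e4 E0)))" "edges G1 = insert e1 (insert e3 E0)"
  using eE ne unfolding E0_def G1_def by auto

lemma E0_y: "e \<in> E0 \<Longrightarrow> y \<notin> ends G e"
proof
  assume e: "e \<in> E0" "y \<in> ends G e"
  then have "e \<in> inc G y" unfolding inc_def E0_def by simp
  then have "e \<in> {e1, e2, e3, e4}" using inc_cross[OF m] E by simp
  then show False using e(1) unfolding E0_def by simp
qed

lemma ends_G1: "ends G1 e1 = {w1, w2}" "ends G1 e3 = {w3, w4}" "e \<in> E0 \<Longrightarrow> ends G1 e = ends G e"
  using ne E0 unfolding G1_def by auto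

lemma verts_G1: "verts G1 = V - {y}"
  by (simp add: G1_def)

lemma bsum_G1: "bsum G1 S = bsum G S"
  by (simp add: bsum_def G1_def)

lemma sum_G: "(\<Sum>e\<in>edges G. \<phi> e) = (\<Sum>e\<in>E0. \<phi> e) + \<phi> e1 + \<phi> e2 + \<phi> e3 + (\<phi> e4 :: int)"
  unfolding E0(6) using E0(1-5) ne by simp

lemma sum_G1: "(\<Sum>e\<in>edges G1. \<phi> e) = (\<Sum>e\<in>E0. \<phi> e) + \<phi> e1 + (\<phi> e3 :: int)"
  unfolding E0(7) using E0(1-5) ne by simp

lemma m1: "multigraph G1"
  unfolding multigraph_def
proof (intro conjI ballI)
  show "finite (verts G1)" "finite (edges G1)" unfolding verts_G1 E0(7) using E0(1) by auto
  fix e assume e: "e \<in> edges G1"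
  have "ends G1 e \<subseteq> verts G1 \<and> card (ends G1 e) = 2"
  proof (cases "e \<in> E0")
    case True
    then have "e \<in> edges G" unfolding E0_def by simp
    then have "ends G e \<subseteq> V \<and> card (ends G e) = 2" using m unfolding multigraph_def by blast
    then show ?thesis using E0_y[OF True] ends_G1(3)[OF True] unfolding verts_G1 by auto
  next
    case False
    then have "e = e1 \<or> e = e3" using e unfolding E0(7) by blast
    then show ?thesis using ends_G1(1,2) w12 w34 wV yw' unfolding verts_G1 by auto
  qed
  then show "ends G1 e \<subseteq> verts G1" "card (ends G1 e) = 2" by blast+
qed

lemma flux_E0: "e \<in> E0 \<Longrightarrow> h e = h1 e \<Longrightarrow> flux G1 h1 S e = flux G h S e"
  unfolding flux_def using ends_G1(3) by simp

lemma cutdeg_G1: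
  assumes S: "y \<notin> S"
  shows "cutdeg G1 S + (if w1 \<in> S \<and> w2 \<in> S then 2 else 0) + (if w3 \<in> S \<and> w4 \<in> S then 2 else 0) = d S"
proof -
  let ?i = "\<lambda>H e. if ends H e \<inter> S \<noteq> {} \<and> \<not> ends H e \<subseteq> S then 1 else (0::int)"
  have "(\<Sum>e\<in>E0. ?i G1 e) = (\<Sum>e\<in>E0. ?i G e)" by (rule sum.cong) (use ends_G1(3) in auto)
  moreover have "?i G1 e1 + (if w1 \<in> S \<and> w2 \<in> S then 2 else 0) = ?i G e1 + ?i G e2"
    unfolding ends_G1 ends1 ends2 using S by auto
  moreover have "?i G1 e3 + (if w3 \<in> S \<and> w4 \<in> S then 2 else 0) = ?i G e3 + ?i G e4"
    unfolding ends_G1 ends3 ends4 using S by auto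
  ultimately have "int (cutdeg G1 S) + (if w1 \<in> S \<and> w2 \<in> S then 2 else 0) + (if w3 \<in> S \<and> w4 \<in> S then 2 else 0) = int (d S)"
    unfolding cutdeg_sum[OF m1] cutdeg_sum[OF m] sum_G sum_G1 by linarith
  then show ?thesis by (auto split: if_splits)
qed

text \<open>A lifted edge becomes a directed path through \<open>y\<close>. Each pair enters and
  leaves \<open>y\<close> once, in accordance with boundary 0 at a vertex of degree four.\<close>

definition unlift :: "('e \<Rightarrow> 'v) \<Rightarrow> 'e \<Rightarrow> 'v" where
  "unlift h1 e = (if e = e1 then if h1 e1 = w2 then y else w1 else if e = e2 then if h1 e1 = w2 then w2 else y
     else if e = e3 then if h1 e3 = w4 then y else w3 else if e = e4 then if h1 e3 = w4 then w4 else y else h1 e)"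

lemma unlift:
  assumes h1: "orients G1 (edges G1) h1"
  shows "orients G (edges G) (unlift h1)" "y \<notin> S \<Longrightarrow> net G (unlift h1) S = net G1 h1 S" "net G (unlift h1) {y} = 0"
proof -
  have h0: "unlift h1 e = h1 e" if "e \<in> E0" for e using that E0 unfolding unlift_def by auto
  have o1: "h1 e1 \<in> {w1, w2}" "h1 e3 \<in> {w3, w4}" using h1 ends_G1 unfolding orients_def E0(7) by auto
  have u: "unlift h1 e1 = (if h1 e1 = w2 then y else w1)" "unlift h1 e2 = (if h1 e1 = w2 then w2 else y)"
    "unlift h1 e3 = (if h1 e3 = w4 then y else w3)" "unlift h1 e4 = (if h1 e3 = w4 then w4 else y)"
    using ne unfolding unlift_def by auto
  show "orients G (edges G) (unlift h1)"
    unfolding orients_def E0(6) using h1 h0 ends_G1(3) u ends1 ends2 ends3 ends4 unfolding orients_def E0(7) by auto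
  show "net G (unlift h1) S = net G1 h1 S" if S: "y \<notin> S"
  proof -
    have 0: "(\<Sum>e\<in>E0. flux G (unlift h1) S e) = (\<Sum>e\<in>E0. flux G1 h1 S e)"
      by (intro sum.cong refl flux_E0[symmetric] h0)
    have 1: "flux G (unlift h1) S e1 + flux G (unlift h1) S e2 = flux G1 h1 S e1"
      unfolding flux_def u ends1 ends2 ends_G1 using S o1(1) w12
      by (cases "w1 \<in> S"; cases "w2 \<in> S"; cases "h1 e1 = w2") auto
    have 2: "flux G (unlift h1) S e3 + flux G (unlift h1) S e4 = flux G1 h1 S e3"
      unfolding flux_def u ends3 ends4 ends_G1 using S o1(2) w34
      by (cases "w3 \<in> S"; cases "w4 \<in> S"; cases "h1 e3 = w4") auto
    show ?thesis unfolding net_def sum_G sum_G1 using 0 1 2 by linarith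
  qed
  have "(\<Sum>e\<in>E0. flux G (unlift h1) {y} e) = 0" by (rule sum.neutral) (use E0_y in \<open>auto simp: flux_def\<close>)
  moreover have "flux G (unlift h1) {y} e1 + flux G (unlift h1) {y} e2 = 0" "flux G (unlift h1) {y} e3 + flux G (unlift h1) {y} e4 = 0"
    unfolding flux_def u ends1 ends2 ends3 ends4 using yw' by auto
  ultimately show "net G (unlift h1) {y} = 0" unfolding net_def sum_G by linarith
qed

lemma cross_z: "cross G1 {z} = cross G {z}"
proof -
  have "e \<in> cross G1 {z} \<longleftrightarrow> e \<in> cross G {z}" for e
  proof -
    consider "e \<in> E0" | "e = e1" | "e = e2" | "e = e3" | "e = e4" | "e \<notin> edges G" unfolding E0(6) by blast
    then show ?thesis
    proof cases
      case 1
      then show ?thesis unfolding cross_def using ends_G1(3) E0(6,7) by auto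
    qed (use ends_G1 ends1 ends2 ends3 ends4 y w2z w4z w12 w34 E0 ne in \<open>auto simp: cross_def\<close>)
  qed
  then show ?thesis by blast
qed

lemma \<psi>1_z: "\<psi>1 e = z \<longleftrightarrow> \<psi> e = z"
  unfolding \<psi>1_def using y(2) w2z w4z by auto

lemma one_way_\<psi>1: "one_way \<psi>1 {z} F \<longleftrightarrow> one_way \<psi> {z} F"
  unfolding one_way_def using \<psi>1_z by simp

lemma z1: "z \<in> verts G1" "x \<in> verts G1"
  using zV xV y unfolding verts_G1 by auto

lemma total1: "bsum G1 (verts G1) = 0"
proof -
  have "bsum G V = bsum G (V - {y}) + bd G y" using bsum_Un[of "V - {y}" "{y}" G] y(1) by (simp add: insert_absorb)
  then show ?thesis using total bd_deg4[OF y(1,2,4)] unfolding bsum_G1 verts_G1 by simp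
qed

lemma pre1: "preflow_on G1 {z} \<psi>1"
  unfolding preflow_on_def
proof
  show "orients G1 (cross G1 {z}) \<psi>1"
    unfolding orients_def
  proof
    fix e assume e: "e \<in> cross G1 {z}"
    then have p: "\<psi> e \<in> ends G e" using \<psi>o cross_z unfolding orients_def by blast
    have "e \<in> E0 \<or> e = e1 \<or> e = e3" using crossD[OF e] unfolding E0(7) by blast
    then show "\<psi>1 e \<in> ends G1 e"
    proof (elim disjE)
      assume "e \<in> E0"
      then show ?thesis using p E0 ends_G1(3) unfolding \<psi>1_def by auto
    qed (use p ends_G1 ends1 ends3 ne in \<open>auto simp: \<psi>1_def\<close>)
  qed
  have "net G1 \<psi>1 {z} = net G \<psi> {z}"
    unfolding net_cross[OF m] net_cross[OF m1] cross_z by (rule sum.cong) (use \<psi>1_z in auto)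
  then show "balanced_on G1 \<psi>1 {z}" using pre_on unfolding preflow_on_def balanced_on_def bsum_G1 by simp
qed

abbreviation "singles1 \<equiv> (\<lambda>v. {v}) ` verts G1"

lemma nx1: "\<not> ext G1 singles1 {z} \<psi>1"
proof
  assume "ext G1 singles1 {z} \<psi>1"
  then obtain h1 where h1: "orients G1 (edges G1) h1" "\<And>e. e \<in> cross G1 {z} \<Longrightarrow> h1 e \<in> {z} \<longleftrightarrow> \<psi>1 e \<in> {z}"
    "\<And>A. A \<in> singles1 \<Longrightarrow> balanced_on G1 h1 A" unfolding ext_def by blast
  note u = unlift[OF h1(1)]
  have "agrees (unlift h1)" unfolding agrees_def
  proof (intro conjI ballI)
    show "orients G (edges G) (unlift h1)" by (rule u(1))
    fix e assume e: "e \<in> cross G {z}"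
    then have e': "e \<in> cross G1 {z}" unfolding cross_z .
    then have "e \<in> E0 \<or> e = e1 \<and> w1 = z \<or> e = e3 \<and> w3 = z"
      using crossD[OF e'] ends_G1 w2z w4z unfolding E0(7) cross_def by auto
    moreover have "h1 e \<in> ends G1 e" using h1(1) crossD[OF e'] unfolding orients_def by blast
    ultimately have "unlift h1 e = z \<longleftrightarrow> h1 e = z"
      using E0 ne y(2) w2z w4z ends_G1 w12 w34 unfolding unlift_def by auto
    then show "unlift h1 e = z \<longleftrightarrow> \<psi> e = z" using h1(2)[OF e'] \<psi>1_z by simp
  qed
  moreover have "balanced_on G (unlift h1) {w}" if w: "w \<in> V - {y, z}" for w
  proof -
    have "balanced_on G1 h1 {w}" using w h1(3) unfolding verts_G1 by blast
    then show ?thesis using u(2)[of "{w}"] w unfolding balanced_on_def bsum_G1 by auto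
  qed
  ultimately show False by (rule no_flow[OF _ y(1)])
qed

text \<open>Otherwise adding \<open>y\<close> to \<open>A\<close> gives a proper merging of
  \<open>G\<close>, to which \<psi> extends by criticality. All edges at \<open>y\<close> disappear
  inside that part, so the same orientation extends \<open>\<psi>1\<close> in the lifted
  graph.\<close>

lemma not_all_inside:
  assumes Q: "partition_on (verts G1) Q" "{z} \<in> Q" "\<not> ext G1 Q {z} \<psi>1" and A: "A \<in> Q"
  shows "\<not> {w1, w2, w3, w4} \<subseteq> A"
proof
  assume w: "{w1, w2, w3, w4} \<subseteq> A"
  have Az: "A \<noteq> {z}" using w w2z by auto
  have zA: "z \<notin> A" using part_disjoint[OF Q(1) A Q(2) Az] by blast
  have yA: "y \<notin> A" "A \<subseteq> V" using part_subset[OF Q(1) A] unfolding verts_G1 by auto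
  let ?Q = "insert (insert y A) (Q - {A})"
  have P: "partition_on V ?Q"
  proof (rule partition_onI)
    have "\<Union>Q = V - {y}" using Q(1) unfolding partition_on_def verts_G1 by simp
    then show "\<Union>?Q = V" using A y(1) by blast
    show "{} \<notin> ?Q" using part_nonempty[OF Q(1)] by blast
    have *: "disjnt (insert y A) C" if C: "C \<in> Q - {A}" for C
      using part_disjoint[OF Q(1) A, of C] part_subset[OF Q(1), of C] C unfolding verts_G1 disjnt_def by blast
    fix C D assume "C \<in> ?Q" "D \<in> ?Q" "C \<noteq> D"
    then consider "C = insert y A" "D \<in> Q - {A}" | "D = insert y A" "C \<in> Q - {A}" | "C \<in> Q" "D \<in> Q" by blast
    then show "disjnt C D"
    proof cases
      case 3
      then show ?thesis using part_disjoint[OF Q(1) _ _ \<open>C \<noteq> D\<close>] unfolding disjnt_def by blast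
    qed (use * disjnt_sym in blast)+
  qed
  have "insert y A \<notin> singles" using w yw' by auto
  then have "?Q \<noteq> singles" by blast
  then have "ext G ?Q {z} \<psi>" using crit_ext[OF c P] Q(2) Az by blast
  then obtain h where h: "orients G (edges G) h" "\<And>e. e \<in> cross G {z} \<Longrightarrow> h e \<in> {z} \<longleftrightarrow> \<psi> e \<in> {z}"
    "\<And>C. C \<in> ?Q \<Longrightarrow> balanced_on G h C" unfolding ext_def by blast
  \<comment> \<open>The lifted edges lie inside \<open>A\<close>, so any orientation of them
    serves.\<close>
  define h1 where "h1 e = (if e = e1 then w1 else if e = e3 then w3 else h e)" for e
  have h0: "h e = h1 e" if "e \<in> E0" for e using that E0 unfolding h1_def by auto
  have "orients G1 (edges G1) h1"
    unfolding orients_def E0(7) using h(1) h0 ends_G1 ne unfolding orients_def E0(6) h1_def by auto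
  moreover have "h1 e \<in> {z} \<longleftrightarrow> \<psi>1 e \<in> {z}" if e: "e \<in> cross G1 {z}" for e
  proof -
    have "e \<noteq> e1" "e \<noteq> e3" using e w zA ends_G1 unfolding cross_def by auto
    then have "h1 e = h e" by (simp add: h1_def)
    then show ?thesis using h(2)[of e] e \<psi>1_z cross_z by simp
  qed
  moreover have "balanced_on G1 h1 C" if C: "C \<in> Q" for C
  proof (cases "C = A")
    case True
    have "flux G1 h1 A e = flux G h (insert y A) e" if e: "e \<in> E0" for e
    proof -
      have "h e \<noteq> y" using h(1) e E0_y[OF e] unfolding orients_def E0(6) by auto
      then show ?thesis unfolding flux_def ends_G1(3)[OF e] h0[OF e, symmetric] using E0_y[OF e] by auto
    qed
    then have "(\<Sum>e\<in>E0. flux G1 h1 A e) = (\<Sum>e\<in>E0. flux G h (insert y A) e)" by (rule sum.cong[OF refl])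
    moreover have "flux G1 h1 A e1 = 0" "flux G1 h1 A e3 = 0" "flux G h (insert y A) e1 = 0" "flux G h (insert y A) e2 = 0"
      "flux G h (insert y A) e3 = 0" "flux G h (insert y A) e4 = 0"
      unfolding flux_def ends_G1 ends1 ends2 ends3 ends4 using w by auto
    ultimately have "net G1 h1 A = net G h (insert y A)" unfolding net_def sum_G sum_G1 by linarith
    moreover have "bsum G (insert y A) = bsum G A"
      using bsum_Un[of "{y}" A G] yA bd_deg4[OF y(1,2,4)] finite_subset[OF yA(2) fin(1)] by simp
    ultimately show ?thesis using True h(3)[of "insert y A"] unfolding balanced_on_def bsum_G1 by simp
  next
    case False
    then have dis: "C \<inter> A = {}" "y \<notin> C" using part_disjoint[OF Q(1) C A] part_subset[OF Q(1) C] unfolding verts_G1 by auto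
    have "(\<Sum>e\<in>E0. flux G1 h1 C e) = (\<Sum>e\<in>E0. flux G h C e)" by (intro sum.cong refl flux_E0 h0)
    moreover have "flux G1 h1 C e1 = 0" "flux G1 h1 C e3 = 0" "flux G h C e1 = 0" "flux G h C e2 = 0" "flux G h C e3 = 0" "flux G h C e4 = 0"
      unfolding flux_def ends_G1 ends1 ends2 ends3 ends4 using w dis by auto
    ultimately have "net G1 h1 C = net G h C" unfolding net_def sum_G sum_G1 by linarith
    then show ?thesis using h(3)[of C] C False unfolding balanced_on_def bsum_G1 by simp
  qed
  ultimately have "ext G1 Q {z} \<psi>1" unfolding ext_def by blast
  then show False using Q(3) by blast
qed

text \<open>A lifted pair inside \<open>A\<close> costs two cut edges and keeps the boundary, which
  \<open>ok6\<close> affords; two pairs inside would cost four.\<close>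

lemma inside_few:
  assumes A: "A \<subseteq> V - {y, z}" "A \<noteq> {}" "\<not> {w1, w2, w3, w4} \<subseteq> A"
  shows "ok4 (cutdeg G1 A) (bsum G1 A)"
proof (cases "w1 \<in> A \<and> w2 \<in> A \<or> w3 \<in> A \<and> w4 \<in> A")
  case False
  have "y \<notin> A" using A(1) by blast
  then have "cutdeg G1 A = d A" using cutdeg_G1[of A] False by auto
  moreover have "ok4 (d A) (bsum G A)" by (rule cut_ok4) (use A y in auto)
  ultimately show ?thesis unfolding bsum_G1 by simp
next
  case True
  have fA: "finite A" using A(1) finite_subset[OF _ fin(1)] by blast
  have "card A \<ge> 2"
  proof -
    have "{w1, w2} \<subseteq> A \<or> {w3, w4} \<subseteq> A" using True by blast
    then show ?thesis using w12 w34 card_mono[OF fA, of "{w1, w2}"] card_mono[OF fA, of "{w3, w4}"] by auto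
  qed
  then have "ok6 (d A) (bsum G A)" using cut_ok6[of A] A y by blast
  moreover have "y \<notin> A" using A(1) by blast
  then have "cutdeg G1 A + 2 = d A" using cutdeg_G1[of A] True A(3) by auto
  then have "cutdeg G1 A = d A - 2" by simp
  ultimately show ?thesis unfolding bsum_G1 using ok6_imp_ok4(2) by simp
qed

lemma closed1:
  assumes A: "A \<subseteq> V - {y, z}" "A \<noteq> {}" and cr: "cross G1 A = {}"
  shows "bsum G1 A = 0"
proof (cases "{w1, w2, w3, w4} \<subseteq> A")
  case False
  then have "ok4 (cutdeg G1 A) (bsum G1 A)" by (rule inside_few[OF A])
  then show ?thesis using cr unfolding ok4_def cutdeg_def by simp
next
  case True
  have yA: "y \<notin> A" using A by blast
  \<comment> \<open>The cut of \<open>A\<close> in \<open>G\<close> then consists of the four edges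
    at \<open>y\<close>, so \<open>A \<union> {y}\<close> is closed in \<open>G\<close>.\<close>
  have "ebt G A {y} = card {e1, e2, e3, e4}"
    unfolding ebt_def
  proof (rule arg_cong[of _ _ card])
    show "{e \<in> edges G. ends G e \<inter> A \<noteq> {} \<and> ends G e \<inter> {y} \<noteq> {}} = {e1, e2, e3, e4}"
      using True eE ends1 ends2 ends3 ends4 E0_y unfolding E0(6) by auto
  qed
  then have "ebt G A {y} = 4" using ne by simp
  moreover have "cutdeg G1 A = 0" using cr unfolding cutdeg_def by simp
  then have "d A = 4" using cutdeg_G1[OF yA] True by simp
  ultimately have "d (A \<union> {y}) = 0" using cutdeg_Un[OF m, of A "{y}"] yA y(4) by simp
  then have "cross G (A \<union> {y}) = {}" unfolding cutdeg_def using m by simp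
  then have "bsum G (A \<union> {y}) = 0" using closed[of "A \<union> {y}"] A y(1) by blast
  moreover have "bsum G (A \<union> {y}) = bsum G A"
    using bsum_Un[of A "{y}" G] yA bd_deg4[OF y(1,2,4)] A finite_subset[OF _ fin(1), of A] by auto
  ultimately show ?thesis unfolding bsum_G1 by simp
qed

lemma lift_critical:
  obtains Q and K :: "(nat, nat) bgraph" and f g where
    "critical_partition G1 Q {z} \<psi>1" "quot f g G1 K" "fibres f G1 = Q"
    "\<And>v. v \<in> verts G1 \<Longrightarrow> fibre f G1 {f v} = part_of Q v"
    "failing_canvas K (f z) (f \<circ> \<psi>1 \<circ> g)" "ord_size K (f z) < ord_size G z"
    "\<And>A. A \<in> Q \<Longrightarrow> A \<noteq> {z} \<Longrightarrow> part_bound G1 Q {z} \<psi>1 A"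
proof -
  have sz: "card singles1 + card {e \<in> edges G1. \<not> (\<exists>C\<in>singles1. ends G1 e \<subseteq> C) \<and> ends G1 e \<inter> {z} = {}} < N"
  proof -
    have "{e \<in> edges G1. \<not> (\<exists>C\<in>singles1. ends G1 e \<subseteq> C) \<and> ends G1 e \<inter> {z} = {}} \<subseteq> {e \<in> edges G. z \<notin> ends G e}"
    proof
      fix e assume "e \<in> {e \<in> edges G1. \<not> (\<exists>C\<in>singles1. ends G1 e \<subseteq> C) \<and> ends G1 e \<inter> {z} = {}}"
      then have e: "e \<in> edges G1" "z \<notin> ends G1 e" by auto
      then have "e \<in> E0 \<or> e = e1 \<or> e = e3" unfolding E0(7) by blast
      then show "e \<in> {e \<in> edges G. z \<notin> ends G e}" using e(2) ends_G1 ends1 ends3 y(2) unfolding E0(6) by auto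
    qed
    then have "card {e \<in> edges G1. \<not> (\<exists>C\<in>singles1. ends G1 e \<subseteq> C) \<and> ends G1 e \<inter> {z} = {}} \<le> card {e \<in> edges G. z \<notin> ends G e}"
      by (rule card_mono[rotated]) simp
    moreover have "card singles1 = card V - 1" using y(1) by (simp add: card_image verts_G1)
    moreover have "card V > 0" using zV by (auto simp: card_gt_0_iff)
    ultimately show ?thesis using size_eq unfolding ord_size_def by simp
  qed
  have zs: "{z} \<in> singles1" using z1 by blast
  obtain Q and K :: "(nat, nat) bgraph" and f g where K:
    "critical_partition G1 Q {z} \<psi>1" "coarser singles1 Q" "quot f g G1 K" "fibres f G1 = Q"
    "\<And>v. v \<in> verts G1 \<Longrightarrow> fibre f G1 {f v} = part_of Q v"
    "\<And>b. b \<in> {z} \<Longrightarrow> failing_canvas K (f b) (f \<circ> \<psi>1 \<circ> g) \<and> ord_size K (f b) < N"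
    "\<And>A. A \<in> Q \<Longrightarrow> A \<noteq> {z} \<Longrightarrow> part_bound G1 Q {z} \<psi>1 A"
  proof (rule critical_quotient[OF T m1 total1 partition_singles zs nx1 pre1 _ _ sz])
    show "bsum G1 A = 0" if "A \<subseteq> verts G1 - {z}" "A \<noteq> {}" "cross G1 A = {}" for A
      by (rule closed1) (use that in \<open>auto simp: verts_G1\<close>)
    show "ok4 (cutdeg G1 A) (bsum G1 A)" if a: "critical_partition G1 Q {z} \<psi>1" "A \<in> Q" "A \<subseteq> verts G1 - {z}" "A \<noteq> {}" for Q A
    proof (rule inside_few[OF _ a(4)])
      show "A \<subseteq> V - {y, z}" using a(3) unfolding verts_G1 by blast
      show "\<not> {w1, w2, w3, w4} \<subseteq> A" using not_all_inside[of Q A] a(1,2) unfolding critical_partition_def by blast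
    qed
  qed (rule that)
  show ?thesis by (rule that[OF K(1,3-5) _ _ K(7)]) (use K(6) size_eq in auto)
qed

end

section \<open>Counting flow across vertices of degree four\<close>

lemma sign_sum_ge:
  assumes "finite F" "\<And>e. e \<in> F \<Longrightarrow> f e = 1 \<or> f e = (-1::int)" "S \<subseteq> F" "\<And>e. e \<in> S \<Longrightarrow> f e = 1"
  shows "(\<Sum>e\<in>F. f e) \<ge> 2 * int (card S) - int (card F)"
proof -
  have fS: "finite S" using assms(1,3) finite_subset by blast
  have "(\<Sum>e\<in>F. f e) = (\<Sum>e\<in>S. f e) + (\<Sum>e\<in>F - S. f e)"
    using assms(1,3) by (metis add.commute sum.subset_diff)
  moreover have "(\<Sum>e\<in>S. f e) = int (card S)" using assms(4) by simp
  moreover have "(\<Sum>e\<in>F - S. f e) \<ge> (\<Sum>e\<in>F - S. -1)" by (rule sum_mono) (use assms(2) in force)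
  moreover have "int (card (F - S)) = int (card F) - int (card S)"
    using assms(1,3) fS by (simp add: card_Diff_subset card_mono of_nat_diff)
  ultimately show ?thesis by simp
qed

text \<open>Two of four cancelling signs are 1, so besides \<open>p\<close> either one or two of
  them are.\<close>

lemma signs_cancel:
  fixes a b q p :: int
  assumes "a = 1 \<or> a = -1" "b = 1 \<or> b = -1" "q = 1 \<or> q = -1" "p = 1 \<or> p = -1" "a + b + p + q = 0"
  shows "p = 1 \<and> a = 1 \<or> p = 1 \<and> b = 1 \<or> p = 1 \<and> q = 1
    \<or> p = -1 \<and> a = 1 \<and> b = 1 \<or> p = -1 \<and> a = 1 \<and> q = 1 \<or> p = -1 \<and> b = 1 \<and> q = 1"
  using assms by (elim disjE) simp_all

context crit_flow
begin

lemma tip_edge: assumes "e \<in> cross G {z}"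
  obtains u where "ends G e = {z, u}" "u \<noteq> z" "u \<in> V" "e \<in> edges G"
  using other[OF assms] by blast

text \<open>At a vertex of degree four the net flow is an even multiple of 3 and at most 4 in
  absolute value, hence exactly 0. So the set \<open>W\<close> of these vertices only passes flow on
  between the tip and \<open>A\<close>, and \<open>d A = d {z}\<close> means that it has equally
  many edges to both.\<close>

lemma euler_sums:
  assumes A: "A \<subseteq> V" "z \<notin> A" and h: "agrees h" "\<forall>v\<in>V - A. balanced_on G h {v}"
    and d4: "\<forall>w\<in>V - A - {z}. d {w} = 4" and dA: "d A = d {z}"
  defines "W \<equiv> V - A - {z}"
  defines "Wz \<equiv> {e \<in> cross G {z}. ends G e \<inter> A = {}}"
  defines "WA \<equiv> {e \<in> cross G A. z \<notin> ends G e}"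
  shows "(\<Sum>e\<in>Wz. flux G h W e) + (\<Sum>e\<in>WA. flux G h W e) = 0" "card Wz = card WA"
    "e \<in> Wz \<Longrightarrow> flux G h W e = (if h e = z then 1 else -1)" "e \<in> WA \<Longrightarrow> flux G h W e = (if h e \<in> A then 1 else -1)"
    "w \<in> W \<Longrightarrow> net G h {w} = 0"
proof -
  have o: "orients G (edges G) h" using h(1) unfolding agrees_def by blast
  have net0: "net G h {w} = 0" if w: "w \<in> W" for w
  proof -
    have w': "w \<in> V" "w \<noteq> z" "w \<in> V - A" using w unfolding W_def by auto
    have d4w: "d {w} = 4" using d4 w unfolding W_def by blast
    have "of_int (net G h {w}) = (0::3)"
      using h(2) w'(3) bd_deg4[OF w'(1,2) d4w] unfolding balanced_on_def by auto
    then have "3 dvd net G h {w}" by (simp add: of_int_3_eq_0_iff)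
    moreover have "even (net G h {w})" "\<bar>net G h {w}\<bar> \<le> 4"
      using net_parity[OF m, of h "{w}"] net_bound[OF m, of h "{w}"] d4w by auto
    ultimately show ?thesis by presburger
  qed
  then show "w \<in> W \<Longrightarrow> net G h {w} = 0" .
  have WV: "W \<subseteq> V" unfolding W_def by blast
  have fW: "finite W" using WV fin(1) by (rule finite_subset)
  have "net G h W = net G h (\<Union>((\<lambda>w. {w}) ` W))" by simp
  also have "\<dots> = (\<Sum>A\<in>(\<lambda>w. {w}) ` W. net G h A)"
    by (rule net_Union[OF m o]) (use fW in \<open>auto simp: disjoint_def\<close>)
  also have "\<dots> = 0" by (rule sum.neutral) (use net0 in auto)
  finally have nW: "net G h W = 0" .
  have V3: "V = W \<union> {z} \<union> A" using A zV unfolding W_def by auto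
  have edge: "e \<in> Wz \<or> e \<in> WA \<longleftrightarrow> e \<in> cross G W" "\<not> (e \<in> Wz \<and> e \<in> WA)" for e
  proof -
    have "e \<in> Wz \<or> e \<in> WA \<longleftrightarrow> e \<in> cross G W" if e: "e \<in> edges G"
    proof -
      obtain a b where ab: "ends G e = {a, b}" "a \<noteq> b" "a \<in> V" "b \<in> V" using e m by (rule multigraph_edgeE)
      show ?thesis unfolding Wz_def WA_def W_def cross_def mem_Collect_eq ab(1) using ab(2-4) A e zV by auto
    qed
    then show "e \<in> Wz \<or> e \<in> WA \<longleftrightarrow> e \<in> cross G W" unfolding Wz_def WA_def cross_def by blast
    show "\<not> (e \<in> Wz \<and> e \<in> WA)" unfolding Wz_def WA_def cross_def by blast
  qed
  have un: "cross G W = Wz \<union> WA" "Wz \<inter> WA = {}" using edge by blast+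
  have f: "finite Wz" "finite WA" unfolding Wz_def WA_def using m by auto
  have "net G h W = (\<Sum>e\<in>cross G W. flux G h W e)"
    unfolding net_cross[OF m] by (rule sum.cong) (auto simp: flux_def cross_def)
  then show "(\<Sum>e\<in>Wz. flux G h W e) + (\<Sum>e\<in>WA. flux G h W e) = 0"
    using nW un f by (simp add: sum.union_disjoint)
  have fl: "flux G h W e = (if h e \<in> W then -1 else 1)" if "e \<in> Wz \<or> e \<in> WA" for e
    using that un unfolding flux_def cross_def by auto
  have hend: "h e \<in> ends G e" if "e \<in> Wz \<or> e \<in> WA" for e
    using that o un cross_edges[of G W] unfolding orients_def by blast
  show "flux G h W e = (if h e = z then 1 else -1)" if e: "e \<in> Wz" for e
  proof -
    have ez: "e \<in> cross G {z}" "ends G e \<inter> A = {}" using e unfolding Wz_def by auto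
    obtain u where "ends G e = {z, u}" "u \<noteq> z" "u \<in> V" using tip_edge[OF ez(1)] by metis
    then show ?thesis using fl[of e] hend[of e] e ez unfolding W_def by auto
  qed
  show "flux G h W e = (if h e \<in> A then 1 else -1)" if e: "e \<in> WA" for e
  proof -
    have ez: "e \<in> cross G A" "z \<notin> ends G e" using e unfolding WA_def by auto
    have "h e \<in> V" using hend[of e] e m crossD[OF ez(1)] unfolding multigraph_def by blast
    then show ?thesis using fl[of e] hend[of e] e ez unfolding W_def by auto
  qed
  have dis: "A \<inter> W = {}" "A \<inter> {z} = {}" "W \<inter> {z} = {}" "{z} \<inter> W = {}" "{z} \<inter> A = {}" "W \<inter> A = {}"
    using A(2) unfolding W_def by blast+
  have "d A = ebt G A W + ebt G A {z}" by (rule cutdeg_ebt[OF m dis(1-3)]) (use V3 in blast)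
  moreover have "d {z} = ebt G {z} W + ebt G {z} A" by (rule cutdeg_ebt[OF m dis(4-6)]) (use V3 in blast)
  moreover have "Wz = {e \<in> edges G. ends G e \<inter> {z} \<noteq> {} \<and> ends G e \<inter> W \<noteq> {}}"
  proof -
    have "e \<in> Wz \<longleftrightarrow> ends G e \<inter> {z} \<noteq> {} \<and> ends G e \<inter> W \<noteq> {}" if e: "e \<in> edges G" for e
    proof -
      obtain a b where ab: "ends G e = {a, b}" "a \<noteq> b" "a \<in> V" "b \<in> V" using e m by (rule multigraph_edgeE)
      show ?thesis unfolding Wz_def W_def cross_def mem_Collect_eq ab(1) using ab(2-4) A e zV by auto
    qed
    moreover have "Wz \<subseteq> edges G" unfolding Wz_def cross_def by blast
    ultimately show ?thesis by blast
  qed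
  moreover have "WA = {e \<in> edges G. ends G e \<inter> A \<noteq> {} \<and> ends G e \<inter> W \<noteq> {}}"
  proof -
    have "e \<in> WA \<longleftrightarrow> ends G e \<inter> A \<noteq> {} \<and> ends G e \<inter> W \<noteq> {}" if e: "e \<in> edges G" for e
    proof -
      obtain a b where ab: "ends G e = {a, b}" "a \<noteq> b" "a \<in> V" "b \<in> V" using e m by (rule multigraph_edgeE)
      show ?thesis unfolding WA_def W_def cross_def mem_Collect_eq ab(1) using ab(2-4) A e zV by auto
    qed
    moreover have "WA \<subseteq> edges G" unfolding WA_def cross_def by blast
    ultimately show ?thesis by blast
  qed
  ultimately show "card Wz = card WA" using dA ebt_commute[of G A "{z}"] unfolding ebt_def by simp
qed

text \<open>Edges between the tip and \<open>W\<close> that all point one way carry as much flow as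
  their number allows. Equally many edges join \<open>W\<close> to \<open>A\<close>, so each of them
  has to carry its unit on in the same sense.\<close>

lemma euler_cut:
  assumes A: "A \<subseteq> V" "z \<notin> A" and h: "agrees h" "\<forall>v\<in>V - A. balanced_on G h {v}"
    and d4: "\<forall>w\<in>V - A - {z}. d {w} = 4" and dA: "d A = d {z}"
    and c: "\<forall>e\<in>cross G {z}. ends G e \<inter> A = {} \<longrightarrow> (h e = z \<longleftrightarrow> p)"
    and f: "f \<in> cross G A" "z \<notin> ends G f"
  shows "h f \<in> A \<longleftrightarrow> \<not> p"
proof -
  note es = euler_sums[OF A h d4 dA]
  let ?W = "V - A - {z}" and ?Wz = "{e \<in> cross G {z}. ends G e \<inter> A = {}}" and ?WA = "{e \<in> cross G A. z \<notin> ends G e}"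
  let ?c = "if p then 1 else -1 :: int"
  let ?f = "\<lambda>e. ?c * flux G h ?W e"
  have fin: "finite ?WA" using m by simp
  have "(\<Sum>e\<in>?Wz. flux G h ?W e) = (\<Sum>e\<in>?Wz. ?c)"
  proof (rule sum.cong[OF refl])
    fix e assume e: "e \<in> ?Wz"
    then show "flux G h ?W e = ?c" using es(3)[OF e] c by auto
  qed
  then have "(\<Sum>e\<in>?WA. flux G h ?W e) = - int (card ?WA) * ?c" using es(1,2) by simp
  then have s: "(\<Sum>e\<in>?WA. ?f e) = - int (card ?WA)" unfolding sum_distrib_left[symmetric] by auto
  have sg: "?f e = 1 \<or> ?f e = -1" if "e \<in> ?WA" for e using es(4)[OF that] by auto
  have fW: "f \<in> ?WA" using f by blast
  have "?f f \<noteq> 1"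
  proof
    assume f1: "?f f = 1"
    have "(\<Sum>e\<in>?WA. ?f e) \<ge> 2 * int (card {f}) - int (card ?WA)"
      by (rule sign_sum_ge[OF fin sg]) (use fW f1 in auto)
    then show False using s by simp
  qed
  then show ?thesis using es(4)[OF fW] by (auto split: if_splits)
qed

text \<open>
  If a lifted pair lies in a part whose cut is as large as the degree of the tip, then all vertices
  outside have degree four, and counting the edges across the Eulerian remainder shows that the
  part is not entered from everywhere.
\<close>

lemma wide_part_not_one_way:
  assumes c: crit and A: "A \<subseteq> V" "z \<notin> A" "card A \<ge> 2"
    and y: "y \<in> V" "y \<noteq> z" "y \<notin> A"
    and E: "cross G {y} = {ea, eb, ep, eq}" and dist: "distinct [ea, eb, ep, eq]"
    and ends: "ends G ea = {y, a}" "ends G eb = {y, b}" "ends G ep = {y, p}" "ends G eq = {y, q}"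
    and ab: "a \<in> A" "b \<in> A" "a \<noteq> b" and q: "q \<noteq> z" and pq: "\<not> (p \<in> A \<and> q \<in> A)"
    and d4: "\<forall>w\<in>V - A - {z}. d {w} = 4" and dA: "d A = d {z}"
    and ow: "one_way \<psi> {z} {e \<in> cross G {z}. ends G e \<inter> A = {} \<and> (e = ep \<longrightarrow> q \<notin> A)}"
    and X: "X \<subseteq> {x0}" "y \<notin> X" "\<not> one_way \<psi> {z} {e \<in> cross G {z}. ends G e \<inter> X = {}}"
  shows "\<exists>h. preflow_on G (V - A) h \<and> \<not> ext G (inner G A) (V - A) h \<and> \<not> one_way h A {e \<in> cross G A. ends G e \<inter> X = {}}"
proof -
  obtain h where h': "agrees h" "\<And>v. v \<in> V - A \<Longrightarrow> balanced_on G h {v}"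
    "preflow_on G (V - A) h" "\<not> ext G (inner G A) (V - A) h" using crit_flowE[OF c A] by blast
  then have h: "agrees h" "\<forall>v\<in>V - A. balanced_on G h {v}" by auto
  have hz: "h e = z \<longleftrightarrow> \<psi> e = z" if "e \<in> cross G {z}" for e using h(1) that unfolding agrees_def by blast
  let ?W = "V - A - {z}" and ?Wz = "{e \<in> cross G {z}. ends G e \<inter> A = {}}" and ?WA = "{e \<in> cross G A. z \<notin> ends G e}"
  note es = euler_sums[OF A(1,2) h(1,2) d4 dA]
  have yW: "y \<in> ?W" using y by blast
  have eE: "ea \<in> edges G" "eb \<in> edges G" "ep \<in> edges G" "eq \<in> edges G" using E crossD[of _ G "{y}"] by auto
  have ne: "ea \<noteq> eb" "ea \<noteq> ep" "ea \<noteq> eq" "eb \<noteq> ep" "eb \<noteq> eq" "ep \<noteq> eq" using dist by auto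
  have az: "a \<noteq> z" "b \<noteq> z" using ab A(2) by auto
  have yab: "ea \<in> ?WA" "eb \<in> ?WA" using ends ab y eE az unfolding cross_def by auto
  have he: "h e \<in> ends G e" if "e \<in> edges G" for e using h(1) that unfolding agrees_def orients_def by blast
  have ny: "flux G h {y} ea + flux G h {y} eb + flux G h {y} ep + flux G h {y} eq = 0"
    using es(5)[OF yW] ne unfolding net_single E by simp
  have fl: "flux G h {y} e = flux G h ?W e" if e: "e \<in> cross G {y}" "ends G e = {y, u}" "u \<in> A \<or> u = z" for e u
  proof -
    have u: "u \<noteq> y" "u \<notin> ?W" using e(2,3) y(2,3) by auto
    have "h e \<in> {y, u}" using he[OF crossD[OF e(1)]] e(2) by simp
    then show ?thesis unfolding flux_def e(2) using u yW by auto
  qed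
  have Ey: "ea \<in> cross G {y}" "eb \<in> cross G {y}" "ep \<in> cross G {y}" "eq \<in> cross G {y}" using E by auto
  have sy: "flux G h {y} e = 1 \<or> flux G h {y} e = -1" if "e \<in> cross G {y}" for e by (rule flux_sign[OF that])
  obtain P where P: "\<And>e. e \<in> cross G {z} \<Longrightarrow> ends G e \<inter> A = {} \<Longrightarrow> (e = ep \<longrightarrow> q \<notin> A) \<Longrightarrow> h e = z \<longleftrightarrow> P"
  proof -
    have "\<exists>P. \<forall>e. e \<in> cross G {z} \<longrightarrow> ends G e \<inter> A = {} \<longrightarrow> (e = ep \<longrightarrow> q \<notin> A) \<longrightarrow> (h e = z \<longleftrightarrow> P)"
      using ow hz unfolding one_way_def by blast
    then show ?thesis using that by blast
  qed
  have "\<not> one_way h A {e \<in> cross G A. ends G e \<inter> X = {}}"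
  proof (cases "p = z \<and> q \<in> A")
    case True
    let ?c = "if P then 1 else -1 :: int"
    have epz: "ep \<in> ?Wz" using True ends(3) eE(3) y A(2) unfolding cross_def by auto
    have eqA: "eq \<in> ?WA" using True ends(4) eE(4) y q unfolding cross_def by auto
    have fWz: "finite ?Wz" "finite ?WA" using m by auto
    have "flux G h ?W e = ?c" if e: "e \<in> ?Wz - {ep}" for e
      using es(3)[of e] P[of e] e by auto
    then have s1: "(\<Sum>e\<in>?Wz - {ep}. flux G h ?W e) = int (card (?Wz - {ep})) * ?c" by simp
    have "(\<Sum>e\<in>?Wz. flux G h ?W e) = flux G h ?W ep + (\<Sum>e\<in>?Wz - {ep}. flux G h ?W e)"
      by (rule sum.remove[OF fWz(1) epz])
    moreover have cW: "int (card (?Wz - {ep})) = int (card ?Wz) - 1"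
      using epz fWz(1) card_gt_0_iff[of ?Wz] by (subst card_Diff_singleton) (auto simp: of_nat_diff Suc_leI)
    ultimately have sum: "(\<Sum>e\<in>?WA. flux G h ?W e) = - flux G h ?W ep - (int (card ?WA) - 1) * ?c"
      using es(1,2) s1 by simp
    let ?f = "\<lambda>e. ?c * flux G h ?W e"
    have sumf: "(\<Sum>e\<in>?WA. ?f e) = - ?f ep - (int (card ?WA) - 1)"
      unfolding sum_distrib_left[symmetric] sum by (auto simp: algebra_simps)
    have sg: "?f e = 1 \<or> ?f e = -1" if "e \<in> ?WA" for e using es(4)[OF that] by auto
    have ff: "flux G h {y} ea = flux G h ?W ea" "flux G h {y} eb = flux G h ?W eb" "flux G h {y} ep = flux G h ?W ep"
      "flux G h {y} eq = flux G h ?W eq"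
      using fl[OF Ey(1) ends(1)] fl[OF Ey(2) ends(2)] fl[OF Ey(3) ends(3)] fl[OF Ey(4) ends(4)] ab True by auto
    have "?c * (flux G h ?W ea + flux G h ?W eb + flux G h ?W ep + flux G h ?W eq) = 0" using ny unfolding ff by simp
    then have nyf: "?f ea + ?f eb + ?f ep + ?f eq = 0" by (simp add: algebra_simps split: if_splits)
    have sep: "?f ep = 1 \<or> ?f ep = -1" using sy[OF Ey(3)] ff(3) by auto
    have bound: "(\<Sum>e\<in>?WA. ?f e) \<ge> 2 * int (card S) - int (card ?WA)" if "S \<subseteq> ?WA" "\<And>e. e \<in> S \<Longrightarrow> ?f e = 1" for S
      by (rule sign_sum_ge[OF fWz(2) sg that])
    \<comment> \<open>By \<open>sumf\<close> the signs on \<open>?WA\<close> contain no 1 if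
      \<open>?f ep = 1\<close>, and exactly one if \<open>?f ep = -1\<close>. Cancellation at
      \<open>y\<close> produces at least one more in either case, so
      \<open>p = z \<and> q \<in> A\<close> is impossible.\<close>
    have "\<exists>S\<subseteq>{ea, eb, eq}. (\<forall>e\<in>S. ?f e = 1) \<and> (?f ep = 1 \<and> card S \<ge> 1 \<or> ?f ep = -1 \<and> card S \<ge> 2)"
    proof -
      have s3: "?f ea = 1 \<or> ?f ea = -1" "?f eb = 1 \<or> ?f eb = -1" "?f eq = 1 \<or> ?f eq = -1" using sg yab eqA by blast+
      have "?f ep = 1 \<and> ?f ea = 1 \<or> ?f ep = 1 \<and> ?f eb = 1 \<or> ?f ep = 1 \<and> ?f eq = 1
        \<or> ?f ep = -1 \<and> ?f ea = 1 \<and> ?f eb = 1 \<or> ?f ep = -1 \<and> ?f ea = 1 \<and> ?f eq = 1 \<or> ?f ep = -1 \<and> ?f eb = 1 \<and> ?f eq = 1"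
        by (rule signs_cancel[OF s3 sep nyf])
      then show ?thesis
      proof (elim disjE conjE)
        assume "?f ep = 1" "?f ea = 1" then show ?thesis by (intro exI[of _ "{ea}"]) auto
      next
        assume "?f ep = 1" "?f eb = 1" then show ?thesis by (intro exI[of _ "{eb}"]) auto
      next
        assume "?f ep = 1" "?f eq = 1" then show ?thesis by (intro exI[of _ "{eq}"]) auto
      next
        assume "?f ep = -1" "?f ea = 1" "?f eb = 1" then show ?thesis using ne by (intro exI[of _ "{ea, eb}"]) auto
      next
        assume "?f ep = -1" "?f ea = 1" "?f eq = 1" then show ?thesis using ne by (intro exI[of _ "{ea, eq}"]) auto
      next
        assume "?f ep = -1" "?f eb = 1" "?f eq = 1" then show ?thesis using ne by (intro exI[of _ "{eb, eq}"]) auto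
      qed
    qed
    then obtain S where S: "S \<subseteq> {ea, eb, eq}" "\<forall>e\<in>S. ?f e = 1" "?f ep = 1 \<and> card S \<ge> 1 \<or> ?f ep = -1 \<and> card S \<ge> 2" by blast
    have "S \<subseteq> ?WA" using S(1) yab eqA by blast
    then have "(\<Sum>e\<in>?WA. ?f e) \<ge> 2 * int (card S) - int (card ?WA)" by (rule bound) (use S(2) in blast)
    then show ?thesis unfolding sumf using S(3) by linarith
  next
    case False
    have PW: "h e = z \<longleftrightarrow> P" if "e \<in> cross G {z}" "ends G e \<inter> A = {}" for e
    proof (rule P[OF that])
      show "e = ep \<longrightarrow> q \<notin> A"
      proof
        assume "e = ep"
        then have "p = z" using that(1) ends(3) y(2) unfolding cross_def by auto
        then show "q \<notin> A" using False by blast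
      qed
    qed
    have PW': "\<forall>e\<in>cross G {z}. ends G e \<inter> A = {} \<longrightarrow> (h e = z \<longleftrightarrow> P)" using PW by blast
    have out: "h f \<in> A \<longleftrightarrow> \<not> P" if "f \<in> ?WA" for f
      by (rule euler_cut[OF A(1,2) h(1,2) d4 dA PW']) (use that in auto)
    let ?c = "if P then -1 else 1 :: int"
    have out': "flux G h {y} e = ?c" if e: "e \<in> cross G {y}" "ends G e = {y, u}" "u \<in> A" for e u
    proof -
      have "u \<noteq> z" using e(3) A(2) by blast
      then have "e \<in> ?WA" using e y crossD[OF e(1)] unfolding cross_def by auto
      then show ?thesis using es(4)[of e] out[of e] fl[OF e(1,2)] e(3) by auto
    qed
    have "p \<notin> A"
    proof
      assume "p \<in> A"
      then show False using ny out'[OF Ey(1) ends(1) ab(1)] out'[OF Ey(2) ends(2) ab(2)] out'[OF Ey(3) ends(3)] sy[OF Ey(4)]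
        by (auto split: if_splits)
    qed
    have "q \<notin> A"
    proof
      assume "q \<in> A"
      then show False using ny out'[OF Ey(1) ends(1) ab(1)] out'[OF Ey(2) ends(2) ab(2)] out'[OF Ey(4) ends(4)] sy[OF Ey(3)]
        by (auto split: if_splits)
    qed
    \<comment> \<open>A tip edge off \<open>X\<close> against the common direction towards
      \<open>W\<close>. It must end in \<open>A\<close>, and it crosses the cut of \<open>A\<close>
      against the edges coming from \<open>W\<close>; of these, \<open>ea\<close> or
      \<open>eb\<close> avoids \<open>X\<close>.\<close>
    obtain e where e: "e \<in> cross G {z}" "ends G e \<inter> X = {}" "\<psi> e = z \<longleftrightarrow> \<not> P"
    proof -
      have "\<exists>e\<in>cross G {z}. ends G e \<inter> X = {} \<and> (\<psi> e = z \<longleftrightarrow> \<not> P)" using X(3) unfolding one_way_def by blast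
      then show ?thesis using that by blast
    qed
    have "ends G e \<inter> A \<noteq> {}" using PW[OF e(1)] hz[OF e(1)] e(3) by blast
    then obtain u where u: "ends G e = {z, u}" "u \<in> A" "e \<in> edges G" using tip_edge[OF e(1)] A(2) by (metis Int_emptyI insertE singletonD)
    then have eA: "e \<in> cross G A" using A(2) unfolding cross_def by auto
    have "h e \<in> {z, u}" using he[OF u(3)] u(1) by simp
    then have heA: "h e \<in> A \<longleftrightarrow> P" using hz[OF e(1)] e(3) u(2) A(2) by auto
    obtain f where f: "f \<in> ?WA" "ends G f \<inter> X = {}"
    proof -
      have "a \<notin> X \<or> b \<notin> X" using X(1) ab(3) by blast
      then show ?thesis using that[of ea] that[of eb] yab ends X(2) by auto
    qed
    show ?thesis
    proof
      assume ow: "one_way h A {e \<in> cross G A. ends G e \<inter> X = {}}"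
      have "e \<in> {e \<in> cross G A. ends G e \<inter> X = {}}" "f \<in> {e \<in> cross G A. ends G e \<inter> X = {}}" using eA e(2) f by auto
      then have "h e \<in> A \<longleftrightarrow> h f \<in> A" using ow unfolding one_way_def by blast
      then show False using heA out[OF f(1)] by blast
    qed
  qed
  then show ?thesis using h'(3,4) by blast
qed

end

lemma one_way_subset: "one_way h B F \<Longrightarrow> F' \<subseteq> F \<Longrightarrow> one_way h B F'"
  unfolding one_way_def by blast

section \<open>Sets around \<open>x\<close> that attain the bound\<close>

context crit_flow
begin

text \<open>Sets whose restriction attains the bound at \<open>x\<close>, so that the same-way and
  degree-four clauses become available for them.\<close>

definition tight :: "'v set \<Rightarrow> bool" where
  "tight S \<longleftrightarrow> x \<in> S \<and> S \<subseteq> V \<and> z \<notin> S \<and> S \<noteq> V - {z} \<and> card S \<ge> 2 \<and> d S = d {x} + 2"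

lemma tight_deg4: "tight S \<Longrightarrow> v \<in> S \<Longrightarrow> v \<noteq> x \<Longrightarrow> d {v} = 4"
  unfolding tight_def using restrict_deg(2)[of S x v] by force

lemma x_cut: "x \<in> S \<Longrightarrow> S \<subseteq> V \<Longrightarrow> z \<notin> S \<Longrightarrow> S \<noteq> V - {z} \<Longrightarrow> S = {x} \<or> d {x} + 2 \<le> d S"
  using card_parts[of S] restrict_deg(1)[of S x] by blast

lemma tight_one_way:
  assumes c: crit and S: "tight S"
  obtains h where "agrees h" "\<forall>v\<in>V - S. balanced_on G h {v}" "one_way h S {e \<in> cross G S. x \<notin> ends G e}"
proof -
  have s: "S \<subseteq> V" "z \<notin> S" "card S \<ge> 2" "S \<noteq> V - {z}" "x \<in> S" "d {x} + 2 = d S" using S unfolding tight_def by auto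
  obtain h where h: "agrees h" "\<And>v. v \<in> V - S \<Longrightarrow> balanced_on G h {v}"
    "preflow_on G (V - S) h" "\<not> ext G (inner G S) (V - S) h" using crit_flowE[OF c s(1-3)] by blast
  have "one_way h S {e \<in> cross G S. x \<notin> ends G e}" by (rule restrict_tip_bound(2)[OF s(1,2,4) h(3,4) s(5,6)])
  then show ?thesis using that h(1,2) by blast
qed

text \<open>The orientation from \<open>tight_one_way\<close> agrees with \<psi> at the tip, so tip
  edges ending in \<open>S\<close> off \<open>x\<close> share its single direction.\<close>

lemma tight_tip_edges:
  assumes c: crit and S: "tight S" and e: "e \<in> cross G {z}" "ends G e = {z, u}" "u \<in> S" "u \<noteq> x"
    "e' \<in> cross G {z}" "ends G e' = {z, u'}" "u' \<in> S" "u' \<noteq> x"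
  shows "\<psi> e = z \<longleftrightarrow> \<psi> e' = z"
proof -
  obtain h where h: "agrees h" "one_way h S {e \<in> cross G S. x \<notin> ends G e}" using tight_one_way[OF c S] by blast
  have zS: "z \<notin> S" using S unfolding tight_def by blast
  have key: "f \<in> {e \<in> cross G S. x \<notin> ends G e} \<and> (h f \<in> S \<longleftrightarrow> \<psi> f \<noteq> z)"
    if f: "f \<in> cross G {z}" "ends G f = {z, v}" "v \<in> S" "v \<noteq> x" for f v
  proof -
    have fe: "f \<in> edges G" by (rule crossD[OF f(1)])
    have "h f \<in> {z, v}" using h(1) fe f(2) unfolding agrees_def orients_def by auto
    moreover have "h f = z \<longleftrightarrow> \<psi> f = z" using h(1) f(1) unfolding agrees_def by blast
    ultimately have "h f \<in> S \<longleftrightarrow> \<psi> f \<noteq> z" using zS f(3) by auto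
    moreover have "f \<in> cross G S" using fe f(2,3) zS unfolding cross_def by auto
    moreover have "x \<notin> ends G f" using f(2,4) xz by auto
    ultimately show ?thesis by blast
  qed
  show ?thesis using key[OF e(1-4)] key[OF e(5-8)] h(2) unfolding one_way_def by blast
qed

end

section \<open>The critical quotient after the lifting\<close>

locale lifted = lifting G z N x \<psi> y w1 w2 w3 w4 e1 e2 e3 e4
  for G :: "('v, 'e) bgraph" and z N x \<psi> y w1 w2 w3 w4 and e1 e2 e3 e4 :: 'e +
  fixes Q :: "'v set set"
  assumes crQ: "critical_partition G1 Q {z} \<psi>1" and bound_Q: "\<And>A. A \<in> Q \<Longrightarrow> A \<noteq> {z} \<Longrightarrow> part_bound G1 Q {z} \<psi>1 A"
begin

lemma PQ: "partition_on (verts G1) Q" "{z} \<in> Q" "\<not> ext G1 Q {z} \<psi>1"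
  using crQ unfolding critical_partition_def by auto

lemma part:
  assumes "A \<in> Q" "A \<noteq> {z}"
  shows "A \<subseteq> V" "y \<notin> A" "z \<notin> A" "A \<noteq> {}" "A \<noteq> V - {z}" "A \<noteq> V - {y, z}" "insert y A \<noteq> V - {z}" "\<not> {w1, w2, w3, w4} \<subseteq> A"
proof -
  have s: "A \<subseteq> V - {y}" using part_subset[OF PQ(1) assms(1)] unfolding verts_G1 .
  then show "A \<subseteq> V" "y \<notin> A" by auto
  show zA: "z \<notin> A" using critical_partition_parts(3)[OF m1 total1 pre1 crQ assms] by blast
  show "A \<noteq> {}" by (rule part_nonempty[OF PQ(1) assms(1)])
  show n: "A \<noteq> V - {y, z}"
    using critical_partition_parts(1)[OF m1 total1 pre1 crQ assms(1)] unfolding verts_G1 by auto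
  show "A \<noteq> V - {z}" using s y by blast
  show "insert y A \<noteq> V - {z}" using n s zA by blast
  show "\<not> {w1, w2, w3, w4} \<subseteq> A" by (rule not_all_inside[OF PQ assms(1)])
qed

abbreviation "has_pair A \<equiv> w1 \<in> A \<and> w2 \<in> A \<or> w3 \<in> A \<and> w4 \<in> A"

lemma part_cutdeg:
  assumes "A \<in> Q" "A \<noteq> {z}"
  shows "d A = cutdeg G1 A + (if has_pair A then 2 else 0)"
  using cutdeg_G1[OF part(2)[OF assms]] part(8)[OF assms] by auto

lemma dz: "cutdeg G1 {z} = d {z}"
  unfolding cutdeg_def cross_z ..

text \<open>Reading the bound of the lifted graph in \<open>G\<close> loses at most 2. A cut in
  \<open>G\<close> can therefore reach the tip degree, but only around a lifted pair and with
  equality in the bound.\<close>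

lemma part_small:
  assumes "A \<in> Q" "A \<noteq> {z}"
  shows "cutdeg G1 A + 2 \<le> d {z}" "d A \<le> d {z}" "d A = d {z} \<Longrightarrow> has_pair A \<and> cutdeg G1 A + 2 = d {z}"
proof -
  show a: "cutdeg G1 A + 2 \<le> d {z}" using bound_Q[OF assms] dz unfolding part_bound_def by simp
  then show "d A \<le> d {z}" using part_cutdeg[OF assms] by simp
  show "has_pair A \<and> cutdeg G1 A + 2 = d {z}" if "d A = d {z}"
    using a part_cutdeg[OF assms] that by (auto split: if_splits)
qed

lemma pair_card: "A \<subseteq> V \<Longrightarrow> has_pair A \<Longrightarrow> card A \<ge> 2"
proof -
  assume A: "A \<subseteq> V" "has_pair A"
  have "finite A" using A(1) fin(1) by (rule finite_subset)
  moreover have "{w1, w2} \<subseteq> A \<or> {w3, w4} \<subseteq> A" using A(2) by blast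
  ultimately show ?thesis using w12 w34 card_mono[of A "{w1, w2}"] card_mono[of A "{w3, w4}"] by auto
qed

lemma single_cut: "v \<noteq> y \<Longrightarrow> cutdeg G1 {v} = d {v}"
  using cutdeg_G1[of "{v}"] w12 w34 by (auto split: if_splits)

text \<open>A part with several vertices has a cut of at least 6 in \<open>G\<close>, hence of
  exactly 6 here, and the bound inside it leaves only degree 4.\<close>

lemma small_part_deg4:
  assumes C: "C \<in> Q" "C \<noteq> {z}" "cutdeg G1 C = 4" and w: "w \<in> C"
  shows "d {w} = 4"
proof -
  note p = part[OF C(1,2)]
  have "finite C" using p(1) fin(1) by (rule finite_subset)
  then have "card C > 0" using p(4) by (simp add: card_gt_0_iff)
  then consider "card C = 1" | "card C \<ge> 2" by linarith
  then show ?thesis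
  proof cases
    case 1
    then have "C = {w}" using w by (auto simp: card_1_singleton_iff)
    moreover have "w \<noteq> y" using w p(2) by blast
    ultimately show ?thesis using single_cut[of w] C(3) by simp
  next
    case 2
    have "d C \<ge> 6" using cut_ok6[OF p(1,3,5) 2] unfolding ok6_def by auto
    then have "d C = 6" using part_cutdeg[OF C(1,2)] C(3) by (auto split: if_splits)
    then show ?thesis using restrict_deg(1)[OF p(1,3,5) 2 w] deg4[of w] w p by auto
  qed
qed

lemma outside_deg4:
  assumes A: "A \<in> Q" "A \<noteq> {z}" "cutdeg G1 A + 2 = d {z}"
  shows "\<forall>w\<in>V - A - {z}. d {w} = 4"
proof
  fix w assume w: "w \<in> V - A - {z}"
  show "d {w} = 4"
  proof (cases "w = y")
    case False
    then have "w \<in> verts G1" using w unfolding verts_G1 by simp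
    then have C: "part_of Q w \<in> Q" "w \<in> part_of Q w" using part_of_mem[OF PQ(1)] by blast+
    then have "part_of Q w \<in> Q - {A, {z}}" using w by auto
    then have "cutdeg G1 (part_of Q w) = 4" using bound_Q[OF A(1,2)] A(3) dz unfolding part_bound_def by auto
    then show ?thesis using small_part_deg4[OF C(1) _ _ C(2)] w C by auto
  qed (use y(4) in simp)
qed

text \<open>\<open>wide_part_not_one_way\<close> for whichever pair lies in \<open>A\<close>; the
  other pair takes the places of \<open>ep\<close> and \<open>eq\<close>.\<close>

lemma wide_part:
  assumes A: "A \<in> Q" "A \<noteq> {z}" "d A = d {z}"
    and X: "X \<subseteq> {x0}" "y \<notin> X" "\<not> one_way \<psi> {z} {e \<in> cross G {z}. ends G e \<inter> X = {}}"
  shows "\<exists>h. preflow_on G (V - A) h \<and> \<not> ext G (inner G A) (V - A) h \<and> \<not> one_way h A {e \<in> cross G A. ends G e \<inter> X = {}}"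
proof -
  note p = part[OF A(1,2)]
  have pr: "has_pair A" "cutdeg G1 A + 2 = d {z}" using part_small(3)[OF A(1,2)] A(3) by auto
  have cA: "card A \<ge> 2" by (rule pair_card[OF p(1) pr(1)])
  note d4 = outside_deg4[OF A(1,2) pr(2)]
  have ow: "one_way \<psi> {z} {e \<in> cross G1 {z}. ends G1 e \<inter> A = {}}"
    using bound_Q[OF A(1,2)] pr(2) dz one_way_\<psi>1 unfolding part_bound_def by auto
  have sub: "e \<in> cross G1 {z} \<and> ends G1 e \<inter> A = {}"
    if e: "e \<in> cross G {z}" "ends G e \<inter> A = {}" "e = e1 \<Longrightarrow> w2 \<notin> A" "e = e3 \<Longrightarrow> w4 \<notin> A" for e
  proof -
    have e': "e \<in> cross G1 {z}" using e(1) cross_z by simp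
    then have "e \<in> E0 \<or> e = e1 \<and> w1 = z \<or> e = e3 \<and> w3 = z"
      using crossD[OF e'] ends_G1 w2z w4z unfolding E0(7) cross_def by auto
    then show ?thesis using e e' ends_G1 p(3) by auto
  qed
  show ?thesis
  proof (cases "w1 \<in> A \<and> w2 \<in> A")
    case True
    have o: "one_way \<psi> {z} {e \<in> cross G {z}. ends G e \<inter> A = {} \<and> (e = e3 \<longrightarrow> w4 \<notin> A)}"
    proof (rule one_way_subset[OF ow], rule subsetI)
      fix e assume e: "e \<in> {e \<in> cross G {z}. ends G e \<inter> A = {} \<and> (e = e3 \<longrightarrow> w4 \<notin> A)}"
      have "e \<noteq> e1" using e True ends1 by auto
      then show "e \<in> {e \<in> cross G1 {z}. ends G1 e \<inter> A = {}}" using sub[of e] e by blast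
    qed
    have pq: "\<not> (w3 \<in> A \<and> w4 \<in> A)" using p(8) True by blast
    show ?thesis
      by (rule wide_part_not_one_way[OF c p(1,3) cA y(1,2) p(2) E dist ends1 ends2 ends3 ends4 _ _ w12 w4z pq d4 A(3) o X])
        (use True in auto)
  next
    case False
    then have T: "w3 \<in> A" "w4 \<in> A" using pr(1) by auto
    have o: "one_way \<psi> {z} {e \<in> cross G {z}. ends G e \<inter> A = {} \<and> (e = e1 \<longrightarrow> w2 \<notin> A)}"
    proof (rule one_way_subset[OF ow], rule subsetI)
      fix e assume e: "e \<in> {e \<in> cross G {z}. ends G e \<inter> A = {} \<and> (e = e1 \<longrightarrow> w2 \<notin> A)}"
      have "e \<noteq> e3" using e T ends3 by auto
      then show "e \<in> {e \<in> cross G1 {z}. ends G1 e \<inter> A = {}}" using sub[of e] e by blast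
    qed
    have E': "cross G {y} = {e3, e4, e1, e2}" using E by auto
    have dist': "distinct [e3, e4, e1, e2]" using dist by auto
    show ?thesis
      by (rule wide_part_not_one_way[OF c p(1,3) cA y(1,2) p(2) E' dist' ends3 ends4 ends1 ends2 T w34 w2z False d4 A(3) o X])
  qed
qed

abbreviation "X \<equiv> part_of Q x"

lemma X: "X \<in> Q" "x \<in> X" "X \<noteq> {z}"
  using part_of_mem[OF PQ(1), of x] z1(2) xz by auto

lemma X_cut: "X = {x} \<and> cutdeg G1 X = d {x} \<or> card X \<ge> 2 \<and> d {x} + 2 \<le> d X \<and> d {x} \<le> cutdeg G1 X"
proof (cases "X = {x}")
  case True
  then show ?thesis using single_cut[of x] y(3) by auto
next
  case False
  note p = part[OF X(1,3)]
  have "d {x} + 2 \<le> d X" using x_cut[OF X(2) p(1,3,5)] False by blast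
  moreover have "card X \<ge> 2" using card_parts[of X] p X(2) False by blast
  ultimately show ?thesis using part_cutdeg[OF X(1,3)] by (auto split: if_splits)
qed

lemma X_tight:
  assumes "card X \<ge> 2" "cutdeg G1 X = d {x}"
  shows "tight X" "has_pair X"
  using X_cut part[OF X(1,3)] X(2) part_cutdeg[OF X(1,3)] assms unfolding tight_def by (auto split: if_splits)

text \<open>Moving \<open>y\<close> into \<open>X\<close> would change the cut by at most
  \<open>4 - 2 * 3 = -2\<close>, which brings it down to \<open>d {x}\<close>, below the bound for
  proper sets around \<open>x\<close>.\<close>

lemma third_neighbour:
  assumes S: "card X \<ge> 2" "cutdeg G1 X = d {x}" and a: "{ea, eb, ec} \<subseteq> {e1, e2, e3, e4}" "distinct [ea, eb, ec]"
    and ends: "ends G ea \<inter> X \<noteq> {}" "ends G eb \<inter> X \<noteq> {}" "ends G ec \<inter> X \<noteq> {}"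
  shows False
proof -
  note p = part[OF X(1,3)]
  have t: "d X = d {x} + 2" using X_tight(1)[OF S] unfolding tight_def by blast
  have "{ea, eb, ec} \<subseteq> {e \<in> edges G. ends G e \<inter> X \<noteq> {} \<and> ends G e \<inter> {y} \<noteq> {}}"
    using a(1) ends eE ends1 ends2 ends3 ends4 by auto
  then have "card {ea, eb, ec} \<le> ebt G X {y}" unfolding ebt_def by (rule card_mono[rotated]) simp
  then have "3 \<le> ebt G X {y}" using a(2) by simp
  moreover have "d (X \<union> {y}) + 2 * ebt G X {y} = d X + d {y}" by (rule cutdeg_Un[OF m]) (use p(2) in blast)
  ultimately have 1: "d (X \<union> {y}) \<le> d {x}" using t y(4) by linarith
  have "x \<in> insert y X" "insert y X \<subseteq> V" "z \<notin> insert y X" using X(2) p y by auto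
  from x_cut[OF this p(7)] 1 show False using y(3) by auto
qed

text \<open>Serves the extreme easel. If \<open>X = {x}\<close>, the pairing (\<open>pp\<close>,
  \<open>pd\<close>) keeps a substitute for each tip edge lost to \<open>x\<close>. If
  \<open>X\<close> is larger it is tight, and a direction can vanish only if \<open>X\<close>
  swallows a tip edge ending off \<open>x\<close>; the choice of \<open>y\<close> in
  \<open>cy\<close> rules this out.\<close>

lemma lift_keeps_both_ways:
  assumes XX: "d {x} + 2 \<le> d {z}" and eq: "cutdeg G1 X = d {x}"
    and bw: "\<not> one_way \<psi> {z} {e \<in> cross G {z}. x \<notin> ends G e}"
    and pp: "w1 = z \<or> w3 = z \<Longrightarrow> w1 = z \<and> w2 \<noteq> x \<or> w3 = z \<and> w4 \<noteq> x"
    and pd: "w1 = z \<Longrightarrow> w3 = z \<Longrightarrow> \<psi> e1 = z \<longleftrightarrow> \<psi> e3 = z"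
    and cy: "(\<forall>S e u. tight S \<longrightarrow> e \<in> cross G {z} \<longrightarrow> ends G e = {z, u} \<longrightarrow> u \<in> S \<longrightarrow> u = x) \<or>
      (\<exists>S0 e0. tight S0 \<and> y \<in> S0 \<and> e0 \<in> cross G {z} \<and> ends G e0 = {z, y})"
  shows "\<not> one_way \<psi>1 {z} {e \<in> cross G1 {z}. ends G1 e \<inter> X = {}}"
proof
  assume "one_way \<psi>1 {z} {e \<in> cross G1 {z}. ends G1 e \<inter> X = {}}"
  then have ow: "one_way \<psi> {z} {e \<in> cross G {z}. ends G1 e \<inter> X = {}}" unfolding one_way_\<psi>1 cross_z .
  have kind: "e \<in> E0 \<and> ends G1 e = ends G e \<or> e = e1 \<and> w1 = z \<or> e = e3 \<and> w3 = z" if e: "e \<in> cross G {z}" for e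
  proof -
    have e': "e \<in> cross G1 {z}" using e cross_z by simp
    then show ?thesis using crossD[OF e'] ends_G1 w2z w4z unfolding E0(7) cross_def by auto
  qed
  note p = part[OF X(1,3)]
  show False
  proof (cases "X = {x}")
    case True
    have rep: "\<exists>f\<in>cross G {z}. ends G1 f \<inter> X = {} \<and> (\<psi> f = z \<longleftrightarrow> \<psi> e = z)" if e: "e \<in> cross G {z}" "x \<notin> ends G e" for e
    proof (cases "ends G1 e \<inter> X = {}")
      case True
      then show ?thesis using e(1) by blast
    next
      case False
      then have "e = e1 \<and> w1 = z \<and> w2 = x \<or> e = e3 \<and> w3 = z \<and> w4 = x"
        using kind[OF e(1)] e(2) True ends_G1 xz by auto
      then show ?thesis
      proof
        assume a: "e = e1 \<and> w1 = z \<and> w2 = x"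
        then have "w3 = z" "w4 \<noteq> x" using pp by auto
        moreover from this have "e3 \<in> cross G {z}" unfolding cross_z[symmetric] using E0(7) ends_G1(2) w4z by (auto simp: cross_def)
        ultimately show ?thesis using a pd True ends_G1 xz by auto
      next
        assume a: "e = e3 \<and> w3 = z \<and> w4 = x"
        then have "w1 = z" "w2 \<noteq> x" using pp by auto
        moreover from this have "e1 \<in> cross G {z}" unfolding cross_z[symmetric] using E0(7) ends_G1(1) w2z by (auto simp: cross_def)
        ultimately show ?thesis using a pd True ends_G1 xz by auto
      qed
    qed
    have "one_way \<psi> {z} {e \<in> cross G {z}. x \<notin> ends G e}" using ow rep unfolding one_way_def by blast
    then show False using bw by blast
  next
    case False
    then have cX: "card X \<ge> 2" using X_cut by blast
    note t = X_tight[OF cX eq]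
    have td: "d X = d {x} + 2" using t(1) unfolding tight_def by blast
    \<comment> \<open>If a pair ran from the tip into \<open>X\<close>, the other pair would have to
      lie inside \<open>X\<close>, and three edges would join \<open>y\<close> to
      \<open>X\<close>.\<close>
    have keep: "ends G1 e \<inter> X = {}" if e: "e \<in> cross G {z}" "ends G e \<inter> X = {}" for e
    proof (rule ccontr)
      assume "ends G1 e \<inter> X \<noteq> {}"
      then have "e = e1 \<and> w1 = z \<and> w2 \<in> X \<or> e = e3 \<and> w3 = z \<and> w4 \<in> X" using kind[OF e(1)] e(2) ends_G1 p(3) by auto
      then show False
      proof
        assume a: "e = e1 \<and> w1 = z \<and> w2 \<in> X"
        then have "w3 \<in> X \<and> w4 \<in> X" using t(2) p(3) by blast
        then show False using third_neighbour[OF cX eq, of e2 e3 e4] a ends2 ends3 ends4 ne by auto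
      next
        assume a: "e = e3 \<and> w3 = z \<and> w4 \<in> X"
        then have "w1 \<in> X \<and> w2 \<in> X" using t(2) p(3) by blast
        then show False using third_neighbour[OF cX eq, of e4 e1 e2] a ends1 ends2 ends4 ne by auto
      qed
    qed
    have owS: "\<psi> e = z \<longleftrightarrow> \<psi> e' = z" if "e \<in> cross G {z}" "ends G e \<inter> X = {}" "e' \<in> cross G {z}" "ends G e' \<inter> X = {}" for e e'
      using ow keep[OF that(1,2)] keep[OF that(3,4)] that(1,3) unfolding one_way_def by blast
    have hit: "\<exists>e u. e \<in> cross G {z} \<and> ends G e = {z, u} \<and> u \<in> X \<and> u \<noteq> x \<and> (\<psi> e = z \<longleftrightarrow> b)"
      if b: "\<And>e. e \<in> cross G {z} \<Longrightarrow> ends G e \<inter> X = {} \<Longrightarrow> \<psi> e = z \<longleftrightarrow> \<not> b" for b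
    proof -
      obtain e where e: "e \<in> cross G {z}" "x \<notin> ends G e" "\<psi> e = z \<longleftrightarrow> b"
      proof -
        have "\<exists>e\<in>cross G {z}. x \<notin> ends G e \<and> (\<psi> e = z \<longleftrightarrow> b)" using bw unfolding one_way_def by blast
        then show ?thesis using that by blast
      qed
      obtain u where u: "ends G e = {z, u}" using tip_edge[OF e(1)] by blast
      have "ends G e \<inter> X \<noteq> {}" using b[OF e(1)] e(3) by blast
      then have "u \<in> X" using u p(3) by auto
      moreover have "u \<noteq> x" using e(2) u by blast
      ultimately show ?thesis using e u by blast
    qed
    from cy show False
    proof
      assume no: "\<forall>S e u. tight S \<longrightarrow> e \<in> cross G {z} \<longrightarrow> ends G e = {z, u} \<longrightarrow> u \<in> S \<longrightarrow> u = x"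
      have "\<exists>b. \<forall>e. e \<in> cross G {z} \<longrightarrow> ends G e \<inter> X = {} \<longrightarrow> (\<psi> e = z \<longleftrightarrow> \<not> b)" using owS by blast
      then obtain b where "\<And>e. e \<in> cross G {z} \<Longrightarrow> ends G e \<inter> X = {} \<Longrightarrow> \<psi> e = z \<longleftrightarrow> \<not> b" by blast
      then show False using hit[of b] no t(1) by blast
    next
      assume "\<exists>S0 e0. tight S0 \<and> y \<in> S0 \<and> e0 \<in> cross G {z} \<and> ends G e0 = {z, y}"
      then obtain S0 e0 where S0: "tight S0" "y \<in> S0" and e0: "e0 \<in> cross G {z}" "ends G e0 = {z, y}" by blast
      have s0: "x \<in> S0" "S0 \<subseteq> V" "z \<notin> S0" "S0 \<noteq> V - {z}" "d S0 = d {x} + 2" using S0(1) unfolding tight_def by auto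
      have e0X: "ends G e0 \<inter> X = {}" using e0(2) p(2,3) by auto
      obtain e u where e: "e \<in> cross G {z}" "ends G e = {z, u}" "u \<in> X" "u \<noteq> x" "\<psi> e = z \<longleftrightarrow> \<psi> e0 \<noteq> z"
        using hit[of "\<psi> e0 \<noteq> z"] owS[OF _ _ e0(1) e0X] by auto
      obtain f a where fa: "f \<in> {e1, e2, e3, e4}" "ends G f = {y, a}" "a \<in> X" "a \<noteq> x" "a \<noteq> y"
      proof -
        have "w1 \<in> X \<and> w1 \<noteq> x \<or> w2 \<in> X \<and> w2 \<noteq> x \<or> w3 \<in> X \<and> w3 \<noteq> x \<or> w4 \<in> X \<and> w4 \<noteq> x" using t(2) w12 w34 by blast
        then show ?thesis using that ends1 ends2 ends3 ends4 yw' by blast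
      qed
      have fe: "f \<in> edges G" using fa(1) eE by blast
      have sub: "d (X \<inter> S0) + d (X \<union> S0) + 2 * ebt G (X - S0) (S0 - X) = d X + d S0" by (rule cutdeg_submodular[OF m])
      have inter: "X \<inter> S0 = {x} \<or> d {x} + 2 \<le> d (X \<inter> S0)"
        by (rule x_cut) (use X(2) s0 p y S0(2) in auto)
      \<comment> \<open>Uncrossing \<open>X\<close> and \<open>S0\<close>: either \<open>a\<close>
        makes the intersection larger than \<open>{x}\<close>, or the edge \<open>f\<close> joins
        the two differences. Both save 2.\<close>
      have U: "d (X \<union> S0) \<le> d {x} + 2"
      proof (cases "a \<in> S0")
        case True
        then have "X \<inter> S0 \<noteq> {x}" using fa(3,4) by blast
        then show ?thesis using inter sub td s0(5) by linarith
      next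
        case False
        have "f \<in> {e \<in> edges G. ends G e \<inter> (X - S0) \<noteq> {} \<and> ends G e \<inter> (S0 - X) \<noteq> {}}"
          using fe fa False S0(2) p(2) by auto
        then have "card {f} \<le> ebt G (X - S0) (S0 - X)" unfolding ebt_def by (intro card_mono) auto
        moreover have "d {x} \<le> d (X \<inter> S0)" using inter by auto
        ultimately show ?thesis using sub td s0(5) by simp
      qed
      have Ux: "x \<in> X \<union> S0" "X \<union> S0 \<subseteq> V" "z \<notin> X \<union> S0" using X(2) p s0 by auto
      show False
      proof (cases "X \<union> S0 = V - {z}")
        case False
        have "X \<union> S0 \<noteq> {x}" using S0(2) y(3) by blast
        then have dU: "d (X \<union> S0) = d {x} + 2" using x_cut[OF Ux False] U by linarith
        have "card X \<le> card (X \<union> S0)" by (rule card_mono) (use Ux(2) finite_subset[OF _ fin(1)] in auto)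
        then have "tight (X \<union> S0)" unfolding tight_def using Ux False dU cX by simp
        from tight_tip_edges[OF c this e(1,2) _ e(4) e0(1,2)] show False using e(3,5) S0(2) y(3) by auto
      next
        case True
        \<comment> \<open>The union is not a proper set, so it cannot be tight. But now
          \<open>d X = d {z}\<close>, and the vertices outside \<open>X\<close> other than
          \<open>z\<close> lie in \<open>S0\<close> and have degree four, so that
          \<open>euler_cut\<close> decides the directions.\<close>
        have "d (V - {z}) = d {z}" by (rule cutdeg_complement[OF m]) (use zV in blast)
        then have dX: "d X = d {z}" using True U XX td by simp
        obtain h where h: "agrees h" "\<forall>v\<in>V - X. balanced_on G h {v}" "one_way h X {e \<in> cross G X. x \<notin> ends G e}"
          by (rule tight_one_way[OF c t(1)])
        have d4: "\<forall>w\<in>V - X - {z}. d {w} = 4" using True tight_deg4[OF S0(1)] X(2) by blast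
        have hz: "h e' = z \<longleftrightarrow> \<psi> e' = z" if "e' \<in> cross G {z}" for e' using h(1) that unfolding agrees_def by blast
        have cc: "\<forall>e\<in>cross G {z}. ends G e \<inter> X = {} \<longrightarrow> (h e = z \<longleftrightarrow> \<psi> e0 = z)" using owS[OF _ _ e0(1) e0X] hz by blast
        have fX: "f \<in> cross G X" "z \<notin> ends G f" "x \<notin> ends G f" using fe fa p y unfolding cross_def by auto
        have hf: "h f \<in> X \<longleftrightarrow> \<not> (\<psi> e0 = z)" by (rule euler_cut[OF p(1,3) h(1,2) d4 dX cc fX(1,2)])
        have ee: "e \<in> edges G" by (rule crossD[OF e(1)])
        have "h e \<in> {z, u}" using h(1) ee e(2) unfolding agrees_def orients_def by auto
        then have he: "h e \<in> X \<longleftrightarrow> \<psi> e0 = z" using hz[OF e(1)] e(3,5) p(3) by auto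
        have "e \<in> cross G X" "x \<notin> ends G e" using ee e p(3) xz unfolding cross_def by auto
        then show False using h(3) hf he fX unfolding one_way_def by blast
      qed
    qed
  qed
qed

end

context lifted
begin

text \<open>A cut exceeding \<open>k\<close> equals the tip degree \<open>k + 1\<close>, and then
  \<open>wide_part\<close> supplies a failing preflow with both directions.\<close>

lemma class_part:
  assumes e: "easel_class k r G z x \<psi>" and A: "A \<in> Q" "A \<noteq> {z}" "card A \<ge> 2"
  shows "canvas_class k (restrict_canvas G A) (restrict_tip G A)"
proof (cases "int (d A) \<le> k")
  case True
  then show ?thesis using class_small(1) part(1,3)[OF A(1,2)] A(3) by blast
next
  case False
  note ef = easel_facts[OF e]
  have k: "d A = d {z}" "int (d A) = k + 1" using False part_small(2)[OF A(1,2)] ef(1) by linarith+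
  have "\<not> one_way \<psi> {z} {e \<in> cross G {z}. ends G e \<inter> {} = {}}" using ef(2) k by simp
  then obtain h where h: "preflow_on G (V - A) h" "\<not> ext G (inner G A) (V - A) h"
    "\<not> one_way h A {e \<in> cross G A. ends G e \<inter> {} = {}}"
    using wide_part[OF A(1,2) k(1), of "{}" x] by blast
  show ?thesis by (rule canvas_class_restrict[OF part(1,3)[OF A(1,2)] h(1,2)]) (use k h(3) in auto)
qed

lemma class_X:
  assumes e: "easel_class k r G z x \<psi>" and cX: "card X \<ge> 2"
  shows "\<exists>\<psi>\<^sub>1. easel_class k r (restrict_canvas G X) (restrict_tip G X) {x} \<psi>\<^sub>1"
proof (cases "int (d X) \<le> k")
  case True
  then show ?thesis using class_small(2)[OF part(1,3)[OF X(1,3)] cX _ X(2)] easel_facts(3)[OF e] by blast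
next
  case False
  note ef = easel_facts[OF e]
  have k: "d X = d {z}" "int (d X) = k + 1" using False part_small(2)[OF X(1,3)] ef(1) by linarith+
  \<comment> \<open>Both directions have to be found off \<open>x\<close> only in the extreme
    case.\<close>
  define Y where "Y = (if int (d {x}) = k - 2 - r then {x} else {})"
  have "\<not> one_way \<psi> {z} {e \<in> cross G {z}. ends G e \<inter> Y = {}}" using ef(2,4) k unfolding Y_def by auto
  moreover have "Y \<subseteq> {x}" "y \<notin> Y" using y(3) unfolding Y_def by auto
  ultimately obtain h where h: "preflow_on G (V - X) h" "\<not> ext G (inner G X) (V - X) h"
    "\<not> one_way h X {e \<in> cross G X. ends G e \<inter> Y = {}}"
    using wide_part[OF X(1,3) k(1), of Y x] by blast
  show ?thesis
  proof (rule easel_class_restrict[OF part(1,3)[OF X(1,3)] X(2) h(1,2) _ _ ef(3)])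
    show "int (d X) \<le> k + 1" using k by simp
    show "\<not> one_way h X (cross G X)" using h(3) one_way_subset[of h X "cross G X" "{e \<in> cross G X. ends G e \<inter> Y = {}}"] by blast
    assume "int (d {x}) = k - 2 - r"
    then have "Y = {x}" by (simp add: Y_def)
    then have "{e \<in> cross G X. ends G e \<inter> Y = {}} = {e \<in> cross G X. x \<notin> ends G e}" by auto
    then show "\<not> one_way h X {e \<in> cross G X. x \<notin> ends G e}" using h(3) by simp
  qed
qed

lemma class_reduced:
  assumes e: "easel_class k r G z x \<psi>" and r: "r \<ge> -1"
    and q: "quot f g G1 K" "fibres f G1 = Q" "\<And>v. v \<in> verts G1 \<Longrightarrow> fibre f G1 {f v} = part_of Q v"
    and tc: "failing_canvas K (f z) (f \<circ> \<psi>1 \<circ> g)"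
    and pp: "w1 = z \<or> w3 = z \<Longrightarrow> w1 = z \<and> w2 \<noteq> x \<or> w3 = z \<and> w4 \<noteq> x"
    and pd: "w1 = z \<Longrightarrow> w3 = z \<Longrightarrow> \<psi> e1 = z \<longleftrightarrow> \<psi> e3 = z"
    and cy: "(\<forall>S e u. tight S \<longrightarrow> e \<in> cross G {z} \<longrightarrow> ends G e = {z, u} \<longrightarrow> u \<in> S \<longrightarrow> u = x) \<or>
      (\<exists>S0 e0. tight S0 \<and> y \<in> S0 \<and> e0 \<in> cross G {z} \<and> ends G e0 = {z, y})"
  shows "easel_class k r K (f z) (f x) (f \<circ> \<psi>1 \<circ> g)"
proof (rule class_quot[OF m1 q(1) tc _ q(3)[OF z1(2)] z1])
  note ef = easel_facts[OF e]
  show "fibre f G1 {f z} = {z}" using q(3)[OF z1(1)] part_of_eq[OF PQ(1,2), of z] by simp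
  show "z \<notin> X" by (rule part(3)[OF X(1,3)])
  show "orients G1 (cross G1 {z}) \<psi>1" using pre1 unfolding preflow_on_def by blast
  show "int (cutdeg G1 {z}) \<le> k + 1" unfolding dz by (rule ef(1))
  show "\<not> one_way \<psi>1 {z} (cross G1 {z})" if "int (cutdeg G1 {z}) = k + 1"
    using ef(2) that unfolding dz one_way_\<psi>1 cross_z by blast
  show "int (cutdeg G1 X) \<ge> k - 2 - r" using X_cut ef(3) by auto
  assume a: "int (cutdeg G1 X) = k - 2 - r" "int (cutdeg G1 {z}) = k + 1"
  have dx: "d {x} \<le> cutdeg G1 X" using X_cut by auto
  then have eq: "cutdeg G1 X = d {x}" using a(1) ef(3) by linarith
  show "\<not> one_way \<psi>1 {z} {e \<in> cross G1 {z}. ends G1 e \<inter> X = {}}"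
  proof (rule lift_keeps_both_ways[OF _ eq _ pp pd cy])
    \<comment> \<open>In this case
      \<open>d {z} - d {x} = (k + 1) - (k - 2 - r) = r + 3\<close>.\<close>
    show "d {x} + 2 \<le> d {z}" using a eq r dz by linarith
    show "\<not> one_way \<psi> {z} {e \<in> cross G {z}. x \<notin> ends G e}" using ef(4) a eq dz by simp
  qed
qed

text \<open>Undoes the lifting inside the quotient, with \<open>y\<close> returning as the new
  vertex \<open>y0\<close>. A lifted edge that survives in \<open>K\<close> is subdivided; if its
  ends were merged, the alteration takes place at the merged vertex.\<close>

lemma EXPA_reduced:
  fixes K :: "(nat, nat) bgraph"
  assumes e: "easel_class k r G z x \<psi>"
    and q: "quot f g G1 K" "fibres f G1 = Q" "\<And>v. v \<in> verts G1 \<Longrightarrow> fibre f G1 {f v} = part_of Q v"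
  shows "EXPA k r G z x K (f z) (f x)"
proof -
  have mK: "multigraph K" by (rule quot_multigraph[OF m1 q(1)])
  note iso = quot_iso[OF m1 q(1), unfolded q(2)]
  obtain y0 where y0: "y0 \<notin> verts K" using mK ex_new_if_finite[OF infinite_UNIV_nat] by (metis multigraph_finite(1))
  \<comment> \<open>\<open>n\<close> to \<open>n + 3\<close> will be fresh names for the four edges
    at \<open>y0\<close>.\<close>
  obtain n where n: "\<forall>a\<in>edges K. a < n" using mK finite_nat_set_iff_bounded by (metis multigraph_finite(2))
  define gi where "gi = inv_into (edges K) g"
  define F where "F A = (if A = {y} then y0 else f (SOME v. v \<in> A))" for A
  define \<gamma> where "\<gamma> e = (if e = e1 then n else if e = e2 then n + 1 else if e = e3 then n + 2 else if e = e4 then n + 3 else gi e)" for e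
  define t1 where "t1 = (if f w1 \<noteq> f w2 then Inr (gi e1) else Inl (f w1))"
  define t2 where "t2 = (if f w3 \<noteq> f w4 then Inr (gi e3) else Inl (f w3))"
  define H :: "(nat, nat) bgraph" where "H = \<lparr>verts = insert y0 (verts K),
    edges = {a \<in> edges K. Inr a \<notin> {t1, t2}} \<union> {n, n + 1, n + 2, n + 3},
    ends = (\<lambda>a. if a = n then {f w1, y0} else if a = n + 1 then {f w2, y0} else if a = n + 2 then {f w3, y0}
      else if a = n + 3 then {f w4, y0} else ends K a), bd = (bd K)(y0 := 0)\<rparr>"
  have wv: "w1 \<in> verts G1" "w2 \<in> verts G1" "w3 \<in> verts G1" "w4 \<in> verts G1" using wV yw' unfolding verts_G1 by auto
  have feq: "f u = f v \<longleftrightarrow> part_of Q u = part_of Q v" if "u \<in> verts G1" "v \<in> verts G1" for u v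
  proof
    assume "f u = f v"
    then show "part_of Q u = part_of Q v" using q(3)[OF that(1)] q(3)[OF that(2)] by simp
  next
    assume "part_of Q u = part_of Q v"
    then have "u \<in> fibre f G1 {f v}" using q(3)[OF that(2)] part_of_mem[OF PQ(1) that(1)] by simp
    then show "f u = f v" by (simp add: fibre_def)
  qed
  have nall: "\<not> (f w1 = f w2 \<and> f w2 = f w3 \<and> f w3 = f w4)"
  proof
    assume a: "f w1 = f w2 \<and> f w2 = f w3 \<and> f w3 = f w4"
    have P: "part_of Q w1 \<in> Q" using part_of_mem[OF PQ(1) wv(1)] by blast
    have "part_of Q w1 = part_of Q w2" "part_of Q w1 = part_of Q w3" "part_of Q w1 = part_of Q w4"
      using a feq[OF wv(1,2)] feq[OF wv(1,3)] feq[OF wv(1,4)] by auto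
    then have "{w1, w2, w3, w4} \<subseteq> part_of Q w1" using wv[THEN part_of_mem[OF PQ(1)]] by auto
    then show False using not_all_inside[OF PQ P] by blast
  qed
  define S where "S = {e \<in> edges G1. \<exists>u\<in>ends G1 e. \<exists>v\<in>ends G1 e. f u \<noteq> f v}"
  have bg: "bij_betw gi S (edges K)" unfolding gi_def S_def using q(1) unfolding quot_def by (simp add: bij_betw_inv_into)
  have eK: "ends K (gi e) = f ` ends G1 e" if "e \<in> S" for e
  proof -
    have "e \<in> g ` edges K" using that q(1) unfolding S_def quot_def bij_betw_def by simp
    then show ?thesis using q(1) f_inv_into_f[of e g "edges K"] inv_into_into[of e g "edges K"] unfolding quot_def gi_def by metis
  qed
  have S1: "e1 \<in> S \<longleftrightarrow> f w1 \<noteq> f w2" "e3 \<in> S \<longleftrightarrow> f w3 \<noteq> f w4" unfolding S_def using E0(7) ends_G1 by auto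
  have S0: "S = {e \<in> E0. e \<in> S} \<union> {e \<in> {e1, e3}. e \<in> S}" unfolding S_def E0(7) by blast
  have gK: "gi e \<in> edges K" if "e \<in> S" for e using bg that bij_betwE by blast
  \<comment> \<open>If \<open>t1\<close> and \<open>t2\<close> coincided, the set
    \<open>{t1, t2}\<close> would yield only two of the four edges at \<open>y0\<close>. Equal
    vertices would mean that all four ends were merged, against \<open>nall\<close>.\<close>
  have t12: "t1 \<noteq> t2"
  proof -
    have "gi e1 \<noteq> gi e3" if "e1 \<in> S" "e3 \<in> S" using bg ne(2) that unfolding bij_betw_def inj_on_def by blast
    then show ?thesis using nall S1 unfolding t1_def t2_def by (auto split: if_splits)
  qed
  have rest: "{a \<in> edges K. Inr a \<notin> {t1, t2}} = gi ` {e \<in> E0. e \<in> S}"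
  proof
    show "gi ` {e \<in> E0. e \<in> S} \<subseteq> {a \<in> edges K. Inr a \<notin> {t1, t2}}"
    proof
      fix a assume "a \<in> gi ` {e \<in> E0. e \<in> S}"
      then obtain e where e: "e \<in> E0" "e \<in> S" "a = gi e" by blast
      have "gi e \<noteq> gi e'" if "e' \<in> S" "e' \<in> {e1, e3}" for e'
        using bg e(1,2) that E0 unfolding bij_betw_def inj_on_def by blast
      then have "Inr a \<notin> {t1, t2}" using S1 e(3) unfolding t1_def t2_def by auto
      then show "a \<in> {a \<in> edges K. Inr a \<notin> {t1, t2}}" using gK[OF e(2)] e(3) by blast
    qed
    show "{a \<in> edges K. Inr a \<notin> {t1, t2}} \<subseteq> gi ` {e \<in> E0. e \<in> S}"
    proof
      fix a assume a: "a \<in> {a \<in> edges K. Inr a \<notin> {t1, t2}}"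
      then have "a \<in> gi ` S" using bg unfolding bij_betw_def by blast
      then obtain e where e: "e \<in> S" "a = gi e" by blast
      have "e \<noteq> e1" "e \<noteq> e3" using a e S1 unfolding t1_def t2_def by auto
      then have "e \<in> E0" using e(1) S0 by blast
      then show "a \<in> gi ` {e \<in> E0. e \<in> S}" using e by blast
    qed
  qed
  have nK: "n \<notin> edges K" "n + 1 \<notin> edges K" "n + 2 \<notin> edges K" "n + 3 \<notin> edges K" using n by auto
  have tw: "two_alteration K {t1, t2} H"
    unfolding two_alteration_def
  proof (intro conjI exI[of _ y0])
    show "{t1, t2} \<noteq> {}" "card {t1, t2} \<le> 2" by (auto simp: card_insert_if)
    have "f w1 \<in> verts K" "f w3 \<in> verts K" using wv quot_verts[OF q(1)] by auto
    then show "{t1, t2} \<subseteq> verts K <+> edges K" using gK S1 unfolding t1_def t2_def by auto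
    show "y0 \<notin> verts K" by (rule y0)
    show "verts H = insert y0 (verts K)" "bd H y0 = 0" "\<forall>v\<in>verts K. bd H v = bd K v" unfolding H_def using y0 by auto
    show "rewire K y0 {t1, t2} H"
      unfolding rewire_def
    proof (intro exI[of _ "{n, n + 1, n + 2, n + 3}"] conjI)
      show "finite {n, n + 1, n + 2, n + 3}" by simp
      show "{n, n + 1, n + 2, n + 3} \<inter> edges K = {}" using nK by blast
      show "edges H = {e \<in> edges K. Inr e \<notin> {t1, t2}} \<union> {n, n + 1, n + 2, n + 3}" unfolding H_def by simp
      show "\<forall>e\<in>edges K. Inr e \<notin> {t1, t2} \<longrightarrow> ends H e = ends K e" unfolding H_def using n by auto
      have s1: "spokes K y0 t1 = {#{f w1, y0}, {f w2, y0}#}"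
      proof (cases "f w1 = f w2")
        case True
        then show ?thesis unfolding t1_def spokes_def by simp
      next
        case False
        then have "ends K (gi e1) = {f w1, f w2}" using eK S1 ends_G1 by simp
        then show ?thesis using False unfolding t1_def spokes_def by simp
      qed
      have s2: "spokes K y0 t2 = {#{f w3, y0}, {f w4, y0}#}"
      proof (cases "f w3 = f w4")
        case True
        then show ?thesis unfolding t2_def spokes_def by simp
      next
        case False
        then have "ends K (gi e3) = {f w3, f w4}" using eK S1 ends_G1 by simp
        then show ?thesis using False unfolding t2_def spokes_def by simp
      qed
      have "(\<Sum>t\<in>{t1, t2}. spokes K y0 t) = spokes K y0 t1 + spokes K y0 t2" using t12 by simp
      then show "image_mset (ends H) (mset_set {n, n + 1, n + 2, n + 3}) = (\<Sum>t\<in>{t1, t2}. spokes K y0 t)"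
        unfolding s1 s2 H_def by simp
    qed
  qed
  let ?P = "insert {y} Q"
  have yQ: "{y} \<notin> Q" using part_subset[OF PQ(1)] unfolding verts_G1 by blast
  have P: "partition_on V ?P"
  proof (rule partition_onI)
    show "\<Union>?P = V" using PQ(1) y(1) unfolding partition_on_def verts_G1 by auto
    show "{} \<notin> ?P" using part_nonempty[OF PQ(1)] by blast
    fix C D assume "C \<in> ?P" "D \<in> ?P" "C \<noteq> D"
    then consider "C \<in> Q" "D \<in> Q" | "C = {y}" "D \<in> Q" | "D = {y}" "C \<in> Q" by blast
    then show "disjnt C D"
    proof cases
      case 1
      then show ?thesis using part_disjoint[OF PQ(1) _ _ \<open>C \<noteq> D\<close>] unfolding disjnt_def by blast
    qed (use part_subset[OF PQ(1)] in \<open>auto simp: verts_G1 disjnt_def\<close>)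
  qed
  have pP: "part_of ?P v = part_of Q v" if v: "v \<in> verts G1" for v
    using part_of_eq[OF P, of "part_of Q v" v] part_of_mem[OF PQ(1) v] by blast
  have pY: "part_of ?P y = {y}" using part_of_eq[OF P, of "{y}" y] by simp
  have FQ: "F A = f (SOME v. v \<in> A)" if "A \<in> Q" for A using that yQ unfolding F_def by auto
  have Ff: "F (part_of ?P v) = f v" if v: "v \<in> verts G1" for v
    using pP[OF v] FQ iso(2) part_of_mem[OF PQ(1) v] by simp
  have Fy: "F {y} = y0" unfolding F_def by simp
  have edges_P: "edges (contract G ?P) = insert e1 (insert e2 (insert e3 (insert e4 {e \<in> E0. e \<in> S})))"
  proof -
    have no4: "\<not> (\<exists>A\<in>?P. ends G e \<subseteq> A)" if e4: "e \<in> {e1, e2, e3, e4}" for e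
    proof
      assume "\<exists>A\<in>?P. ends G e \<subseteq> A"
      then obtain A where A: "A \<in> ?P" "ends G e \<subseteq> A" by blast
      have "\<exists>w. ends G e = {y, w} \<and> w \<noteq> y" using e4 ends1 ends2 ends3 ends4 yw' by blast
      then show False using A part_subset[OF PQ(1)] unfolding verts_G1 by auto
    qed
    have inS: "(\<exists>A\<in>?P. ends G e \<subseteq> A) \<longleftrightarrow> e \<notin> S" if e: "e \<in> E0" for e
    proof -
      have eG: "e \<in> edges G" using e E0(6) by blast
      obtain a b where ab: "ends G e = {a, b}" "a \<in> V" "b \<in> V" using eG m by (rule multigraph_edgeE)
      have v: "a \<in> verts G1" "b \<in> verts G1" using ab E0_y[OF e] unfolding verts_G1 by auto
      have "e \<notin> S \<longleftrightarrow> part_of Q a = part_of Q b"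
        unfolding S_def using E0(7) e ends_G1(3)[OF e] ab(1) feq[OF v] by auto
      also have "\<dots> \<longleftrightarrow> (\<exists>A\<in>?P. {a, b} \<subseteq> A)"
      proof
        assume "part_of Q a = part_of Q b"
        then have "{a, b} \<subseteq> part_of Q a" "part_of Q a \<in> ?P" using part_of_mem[OF PQ(1) v(1)] part_of_mem[OF PQ(1) v(2)] by auto
        then show "\<exists>A\<in>?P. {a, b} \<subseteq> A" by blast
      next
        assume "\<exists>A\<in>?P. {a, b} \<subseteq> A"
        then obtain A where A: "A \<in> ?P" "a \<in> A" "b \<in> A" by blast
        then have "part_of ?P a = A" "part_of ?P b = A" using part_of_eq[OF P A(1)] by auto
        then show "part_of Q a = part_of Q b" using pP v by simp
      qed
      finally show ?thesis using ab(1) by auto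
    qed
    have "e \<in> edges (contract G ?P) \<longleftrightarrow> e \<in> insert e1 (insert e2 (insert e3 (insert e4 {e \<in> E0. e \<in> S})))" for e
    proof -
      consider "e \<in> {e1, e2, e3, e4}" | "e \<in> E0" "e \<notin> {e1, e2, e3, e4}" | "e \<notin> edges G" unfolding E0(6) by blast
      then show ?thesis
      proof cases
        case 1
        then show ?thesis using no4[OF 1] eE unfolding contract_def by auto
      next
        case 2
        then show ?thesis using inS[OF 2(1)] E0(6) unfolding contract_def by auto
      next
        case 3
        then show ?thesis using E0(6) unfolding contract_def by auto
      qed
    qed
    then show ?thesis by blast
  qed
  have \<gamma>0: "\<gamma> e = gi e" if "e \<in> E0" for e using that E0 unfolding \<gamma>_def by auto
  have \<gamma>e: "\<gamma> e1 = n" "\<gamma> e2 = n + 1" "\<gamma> e3 = n + 2" "\<gamma> e4 = n + 3" unfolding \<gamma>_def using ne by auto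
  have lt: "gi e < n" if "e \<in> S" for e using n gK[OF that] by blast
  have isoH: "bgraph_iso F \<gamma> (contract G ?P) H"
    unfolding bgraph_iso_def
  proof (intro conjI ballI)
    have bF: "bij_betw (\<lambda>A. f (SOME v. v \<in> A)) Q (verts K)" using iso(1) unfolding bgraph_iso_def contract_def by simp
    then have "bij_betw F Q (verts K)" using FQ bij_betw_cong[of Q F "\<lambda>A. f (SOME v. v \<in> A)"] by simp
    then have "bij_betw F (Q \<union> {{y}}) (verts K \<union> {y0})"
      using Fy y0 yQ notIn_Un_bij_betw[of "{y}" Q F "verts K"] by simp
    then show "bij_betw F (verts (contract G ?P)) (verts H)" unfolding contract_def H_def by simp
    have "inj_on gi S" using bg unfolding bij_betw_def by blast
    then have "inj_on gi {e \<in> E0. e \<in> S}" by (rule inj_on_subset) blast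
    then have i0: "inj_on \<gamma> {e \<in> E0. e \<in> S}" using \<gamma>0 by (simp add: inj_on_def)
    have im0: "\<gamma> ` {e \<in> E0. e \<in> S} = {a \<in> edges K. Inr a \<notin> {t1, t2}}" unfolding rest using \<gamma>0 by (intro image_cong) auto
    have g0: "\<gamma> e < n" if "e \<in> {e \<in> E0. e \<in> S}" for e using that \<gamma>0 lt by auto
    show "bij_betw \<gamma> (edges (contract G ?P)) (edges H)"
      unfolding bij_betw_def
    proof
      show "inj_on \<gamma> (edges (contract G ?P))"
        unfolding edges_P using i0 g0 \<gamma>e E0(1-5) ne by (auto simp: inj_on_insert) (force dest: g0)+
      show "\<gamma> ` edges (contract G ?P) = edges H"
        unfolding edges_P image_insert \<gamma>e im0 H_def by auto
    qed
    fix e assume e: "e \<in> edges (contract G ?P)"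
    have ec: "ends (contract G ?P) e = part_of ?P ` ends G e" by (simp add: contract_def)
    show "ends H (\<gamma> e) = F ` ends (contract G ?P) e"
    proof (cases "e \<in> {e1, e2, e3, e4}")
      case True
      then show ?thesis
        unfolding ec using \<gamma>e ends1 ends2 ends3 ends4 pY Fy Ff wv unfolding H_def by auto
    next
      case False
      then have e0: "e \<in> E0" "e \<in> S" using e unfolding edges_P by auto
      have "ends H (\<gamma> e) = f ` ends G e" using \<gamma>0[OF e0(1)] lt[OF e0(2)] eK[OF e0(2)] ends_G1(3)[OF e0(1)] unfolding H_def by simp
      moreover have "ends G e \<subseteq> verts G1"
      proof -
        have "e \<in> edges G" using e0(1) E0(6) by blast
        then have "ends G e \<subseteq> V" using m unfolding multigraph_def by blast
        then show ?thesis using E0_y[OF e0(1)] unfolding verts_G1 by auto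
      qed
      then have "F ` part_of ?P ` ends G e = f ` ends G e" unfolding image_image using Ff by (intro image_cong) auto
      ultimately show ?thesis unfolding ec by simp
    qed
  next
    fix A assume "A \<in> verts (contract G ?P)"
    then consider "A = {y}" | "A \<in> Q" unfolding contract_def by auto
    then show "bd H (F A) = bd (contract G ?P) A"
    proof cases
      case 1
      then show ?thesis using Fy bd_deg4[OF y(1,2,4)] unfolding H_def contract_def by simp
    next
      case 2
      have "F A \<in> verts K" using FQ[OF 2] iso(1) 2 unfolding bgraph_iso_def bij_betw_def contract_def by auto
      then have "F A \<noteq> y0" using y0 by blast
      then have "bd H (F A) = bd K (f (SOME v. v \<in> A))" unfolding H_def using FQ[OF 2] by simp
      also have "\<dots> = sum (bd G1) A" using iso(1) 2 unfolding bgraph_iso_def contract_def by simp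
      finally show ?thesis unfolding contract_def by (simp add: G1_def)
    qed
  qed
  have fzx: "f x \<noteq> f z"
  proof -
    have "part_of Q z = {z}" using part_of_eq[OF PQ(1,2)] by simp
    then show ?thesis using feq[OF z1(2,1)] X(3) by simp
  qed
  have "expansion (canvas_class k) x (f x) (easel_class k r) {t1, t2} G z H (f z)"
  proof (rule expansionI[OF P _ isoH])
    show "{z} \<in> ?P" using PQ(2) by blast
    show "F {z} = f z" using Ff[OF z1(1)] pP[OF z1(1)] part_of_eq[OF PQ(1,2), of z] by simp
    show "F (part_of ?P x) = f x" by (rule Ff[OF z1(2)])
    show "f x \<noteq> f z" by (rule fzx)
    show "canvas_class k (restrict_canvas G A) (restrict_tip G A)" if "A \<in> ?P" "card A \<ge> 2" for A
    proof -
      have "A \<in> Q" "A \<noteq> {z}" using that by auto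
      then show ?thesis using class_part[OF e] that(2) by blast
    qed
    show "\<exists>\<psi>\<^sub>1. easel_class k r (restrict_canvas G (part_of ?P x)) (restrict_tip G (part_of ?P x)) {x} \<psi>\<^sub>1"
      if "card (part_of ?P x) \<ge> 2"
      using class_X[OF e] that unfolding pP[OF z1(2)] by blast
    \<comment> \<open>A vertex is among \<open>t1\<close>, \<open>t2\<close> only because two
      distinct ends were merged into it, so its part has the required size.\<close>
    show "\<exists>A\<in>?P. F A = v \<and> card A \<ge> 2" if "Inl v \<in> {t1, t2}" for v
    proof -
      have "v = f w1 \<and> f w1 = f w2 \<or> v = f w3 \<and> f w3 = f w4" using that unfolding t1_def t2_def by (auto split: if_splits)
      moreover have "\<exists>A\<in>?P. F A = f u \<and> card A \<ge> 2" if u: "u \<in> verts G1" "u' \<in> verts G1" "f u = f u'" "u \<noteq> u'" for u u'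
      proof -
        let ?A = "part_of Q u"
        have A: "?A \<in> Q" "u \<in> ?A" "u' \<in> ?A" using part_of_mem[OF PQ(1)] u feq[OF u(1,2)] by auto
        have "finite ?A" using part_subset[OF PQ(1) A(1)] finite_subset m1 by (metis multigraph_finite(1))
        then have "card ?A \<ge> 2" using card_mono[of ?A "{u, u'}"] A u(4) by simp
        moreover have "F ?A = f u" using Ff[OF u(1)] pP[OF u(1)] by simp
        ultimately show ?thesis using A(1) by blast
      qed
      ultimately show ?thesis using wv w12 w34 by metis
    qed
  qed
  then show ?thesis unfolding EXPA_def using tw by blast
qed

end

context crit_flow
begin

lemma outcome_EXPA:
  assumes c: crit and n: "card V \<ge> 4" and e: "easel_class k r G z x \<psi>" and r: "r \<ge> -1"
    and v: "v \<in> V" "v \<noteq> z" "v \<noteq> x" "d {v} = 4"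
  shows "\<exists>(G' :: (nat, nat) bgraph) z' x' \<psi>'. easel_class k r G' z' x' \<psi>' \<and> prec G' z' x' G z x \<and> EXPA k r G z x G' z' x'"
proof -
  \<comment> \<open>If some tip edge ends in a tight set off \<open>x\<close>, its end has degree
    four and is chosen; otherwise any vertex of degree four other than \<open>x\<close> and
    \<open>z\<close> is suitable.\<close>
  have "\<exists>y. y \<in> V \<and> y \<noteq> z \<and> y \<noteq> x \<and> d {y} = 4 \<and>
    ((\<forall>S e u. tight S \<longrightarrow> e \<in> cross G {z} \<longrightarrow> ends G e = {z, u} \<longrightarrow> u \<in> S \<longrightarrow> u = x) \<or>
      (\<exists>S0 e0. tight S0 \<and> y \<in> S0 \<and> e0 \<in> cross G {z} \<and> ends G e0 = {z, y}))"
  proof (cases "\<forall>S e u. tight S \<longrightarrow> e \<in> cross G {z} \<longrightarrow> ends G e = {z, u} \<longrightarrow> u \<in> S \<longrightarrow> u = x")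
    case True
    then show ?thesis using v by blast
  next
    case False
    then obtain S e u where S: "tight S" "e \<in> cross G {z}" "ends G e = {z, u}" "u \<in> S" "u \<noteq> x" by blast
    moreover have "u \<in> V" "u \<noteq> z" using S(1,4) unfolding tight_def by auto
    ultimately show ?thesis using tight_deg4[OF S(1,4,5)] by blast
  qed
  then obtain y where y: "y \<in> V" "y \<noteq> z" "y \<noteq> x" "d {y} = 4" and
    cy: "(\<forall>S e u. tight S \<longrightarrow> e \<in> cross G {z} \<longrightarrow> ends G e = {z, u} \<longrightarrow> u \<in> S \<longrightarrow> u = x) \<or>
      (\<exists>S0 e0. tight S0 \<and> y \<in> S0 \<and> e0 \<in> cross G {z} \<and> ends G e0 = {z, y})" by blast
  obtain e1 e2 e3 e4 w1 w2 w3 w4 where L: "cross G {y} = {e1, e2, e3, e4}" "distinct [e1, e2, e3, e4]"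
    "ends G e1 = {y, w1}" "ends G e2 = {y, w2}" "ends G e3 = {y, w3}" "ends G e4 = {y, w4}"
    "y \<notin> {w1, w2, w3, w4}" "{w1, w2, w3, w4} \<subseteq> V" "w1 \<noteq> w2" "w3 \<noteq> w4" "w2 \<noteq> z" "w4 \<noteq> z"
    and pp: "w1 = z \<or> w3 = z \<Longrightarrow> w1 = z \<and> w2 \<noteq> x \<or> w3 = z \<and> w4 \<noteq> x"
    and pd: "w1 = z \<Longrightarrow> w3 = z \<Longrightarrow> \<psi> e1 = z \<longleftrightarrow> \<psi> e3 = z"
    by (rule deg4_pairs[OF c n y(1,2,4)]) (rule that)
  interpret lifting G z N x \<psi> y w1 w2 w3 w4 e1 e2 e3 e4
    by unfold_locales (fact c y L)+
  obtain Q and K :: "(nat, nat) bgraph" and f g where K: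
    "critical_partition G1 Q {z} \<psi>1" "quot f g G1 K" "fibres f G1 = Q"
    "\<And>v. v \<in> verts G1 \<Longrightarrow> fibre f G1 {f v} = part_of Q v"
    "failing_canvas K (f z) (f \<circ> \<psi>1 \<circ> g)" "ord_size K (f z) < ord_size G z"
    "\<And>A. A \<in> Q \<Longrightarrow> A \<noteq> {z} \<Longrightarrow> part_bound G1 Q {z} \<psi>1 A"
    by (rule lift_critical) blast
  interpret lifted G z N x \<psi> y w1 w2 w3 w4 e1 e2 e3 e4 Q
    by unfold_locales (fact K)+
  have "easel_class k r K (f z) (f x) (f \<circ> \<psi>1 \<circ> g)" by (rule class_reduced[OF e r K(2-5) pp pd cy])
  moreover have "EXPA k r G z x K (f z) (f x)" by (rule EXPA_reduced[OF e K(2-4)])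
  ultimately show ?thesis using K(6) unfolding prec_def by blast
qed

end

subsection \<open>Deleting oriented edges\<close>

text \<open>The boundary absorbs what \<open>h0\<close> sends along \<open>F\<close>, so balance in
  the smaller graph is balance in \<open>G\<close> with \<open>F\<close> oriented by
  \<open>h0\<close>.\<close>

definition delete_oriented :: "('v, 'e) bgraph \<Rightarrow> 'e set \<Rightarrow> ('e \<Rightarrow> 'v) \<Rightarrow> ('v, 'e) bgraph" where
  "delete_oriented G F h0 = \<lparr>verts = verts G, edges = edges G - F, ends = ends G,
     bd = (\<lambda>v. bd G v - of_int (\<Sum>e\<in>F. flux G h0 {v} e))\<rparr>"

lemma delete_simps [simp]:
  "verts (delete_oriented G F h0) = verts G" "edges (delete_oriented G F h0) = edges G - F"
  "ends (delete_oriented G F h0) = ends G" "flux (delete_oriented G F h0) h S = flux G h S"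
  by (auto simp: delete_oriented_def flux_def fun_eq_iff)

lemma cross_delete: "cross (delete_oriented G F h0) S = cross G S - F"
  by (auto simp: cross_def)

lemma delete_multigraph: "multigraph G \<Longrightarrow> multigraph (delete_oriented G F h0)"
  unfolding multigraph_def by simp

lemma cutdeg_delete:
  assumes "multigraph G"
  shows "cutdeg (delete_oriented G F h0) S + card (F \<inter> cross G S) = cutdeg G S"
  using assms card_Diff_subset_Int[of "cross G S" F] card_mono[of "cross G S" "F \<inter> cross G S"]
  unfolding cutdeg_def cross_delete by (simp add: Int_commute)

lemma flux_sum_singles:
  assumes m: "multigraph G" and h: "orients G (edges G) h" and S: "finite S" and e: "e \<in> edges G"
  shows "(\<Sum>v\<in>S. flux G h {v} e) = flux G h S e"
  using S
proof (induction S rule: finite_induct)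
  case empty
  show ?case by (simp add: flux_def)
next
  case (insert v S)
  then have "flux G h ({v} \<union> S) e = flux G h {v} e + flux G h S e" by (intro flux_Un[OF m h _ e]) auto
  then show ?case using insert by simp
qed

lemma bsum_delete:
  assumes m: "multigraph G" and h: "orients G (edges G) h0" and F: "F \<subseteq> edges G" and S: "S \<subseteq> verts G"
  shows "bsum (delete_oriented G F h0) S = bsum G S - of_int (\<Sum>e\<in>F. flux G h0 S e)"
proof -
  have fS: "finite S" using S m by (meson finite_subset multigraph_finite)
  have "bsum (delete_oriented G F h0) S = bsum G S - of_int (\<Sum>v\<in>S. \<Sum>e\<in>F. flux G h0 {v} e)"
    unfolding bsum_def delete_oriented_def by (simp add: sum_subtractf)
  also have "(\<Sum>v\<in>S. \<Sum>e\<in>F. flux G h0 {v} e) = (\<Sum>e\<in>F. \<Sum>v\<in>S. flux G h0 {v} e)" by (rule sum.swap)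
  also have "\<dots> = (\<Sum>e\<in>F. flux G h0 S e)" using flux_sum_singles[OF m h fS] F by (intro sum.cong) auto
  finally show ?thesis .
qed

lemma net_delete:
  assumes m: "multigraph G" and F: "F \<subseteq> edges G"
  shows "net G h S = net (delete_oriented G F h0) h S + (\<Sum>e\<in>F. flux G h S e)"
  unfolding net_def using sum.subset_diff[OF F, of "flux G h S"] m by simp

lemma balanced_delete:
  assumes m: "multigraph G" and h0: "orients G (edges G) h0" and F: "F \<subseteq> edges G" and S: "S \<subseteq> verts G"
    and h: "\<And>e. e \<in> F \<Longrightarrow> h e = h0 e"
  shows "balanced_on (delete_oriented G F h0) h S \<longleftrightarrow> balanced_on G h S"
proof -
  have "(\<Sum>e\<in>F. flux G h S e) = (\<Sum>e\<in>F. flux G h0 S e)" by (rule sum.cong) (use h in \<open>auto simp: flux_def\<close>)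
  then show ?thesis
    unfolding balanced_on_def net_delete[OF m F, of h S h0] bsum_delete[OF m h0 F S] by (simp add: eq_diff_eq)
qed

lemma ext_delete:
  assumes m: "multigraph G" and h0: "orients G (edges G) h0" and F: "F \<subseteq> edges G"
    and Q: "\<And>A. A \<in> Q \<Longrightarrow> A \<subseteq> verts G" and agree: "\<And>e. e \<in> F \<Longrightarrow> e \<in> cross G B \<Longrightarrow> h0 e \<in> B \<longleftrightarrow> \<psi> e \<in> B"
    and e: "ext (delete_oriented G F h0) Q B \<psi>"
  shows "ext G Q B \<psi>"
proof -
  let ?G = "delete_oriented G F h0"
  obtain h where h: "orients ?G (edges ?G) h" "\<And>e. e \<in> cross ?G B \<Longrightarrow> h e \<in> B \<longleftrightarrow> \<psi> e \<in> B"
    "\<And>A. A \<in> Q \<Longrightarrow> balanced_on ?G h A" using e unfolding ext_def by blast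
  define h' where "h' e = (if e \<in> F then h0 e else h e)" for e
  have "orients G (edges G) h'" using h(1) h0 unfolding orients_def h'_def by auto
  moreover have "h' e \<in> B \<longleftrightarrow> \<psi> e \<in> B" if "e \<in> cross G B" for e
    using agree[of e] h(2)[of e] that unfolding h'_def cross_delete by auto
  moreover have "balanced_on G h' A" if A: "A \<in> Q" for A
  proof -
    have "net ?G h' A = net ?G h A" unfolding net_def by (rule sum.cong) (auto simp: flux_def h'_def)
    then have "balanced_on ?G h' A" using h(3)[OF A] unfolding balanced_on_def by simp
    then show ?thesis using balanced_delete[OF m h0 F Q[OF A], of h'] by (simp add: h'_def)
  qed
  ultimately show ?thesis unfolding ext_def by blast
qed

text \<open>Converse of \<open>ext_delete\<close>. The given flow may differ from \<open>h0\<close>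
  on \<open>F\<close>, but only on edges inside parts; the other edges of \<open>F\<close> are at
  the tip, where the preflow prescribes the head.\<close>

lemma ext_delete_outer:
  assumes m: "multigraph G" and h0: "orients G (edges G) h0" and F: "F \<subseteq> edges G"
    and Q: "\<And>A. A \<in> Q \<Longrightarrow> A \<subseteq> verts G"
    and tip: "\<And>e A. e \<in> F \<Longrightarrow> A \<in> Q \<Longrightarrow> e \<in> cross G A \<Longrightarrow> e \<in> cross G {z} \<and> (h0 e = z \<longleftrightarrow> \<psi> e = z)"
    and e: "ext G Q {z} \<psi>"
  shows "ext (delete_oriented G F h0) Q {z} \<psi>"
proof -
  let ?G = "delete_oriented G F h0"
  obtain h where h: "orients G (edges G) h" "\<And>e. e \<in> cross G {z} \<Longrightarrow> h e \<in> {z} \<longleftrightarrow> \<psi> e \<in> {z}"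
    "\<And>A. A \<in> Q \<Longrightarrow> balanced_on G h A" using e unfolding ext_def by blast
  have "balanced_on ?G h A" if A: "A \<in> Q" for A
  proof -
    have "flux G h A e = flux G h0 A e" if e: "e \<in> F" for e
    proof (cases "e \<in> cross G A")
      case True
      then have t: "e \<in> cross G {z}" "h0 e = z \<longleftrightarrow> \<psi> e = z" using tip[OF e A] by auto
      have eG: "e \<in> edges G" using e F by blast
      obtain a b where ab: "ends G e = {a, b}" "a \<noteq> b" using eG m by (rule multigraph_edgeE)
      have "h e \<in> {a, b}" "h0 e \<in> {a, b}" "z \<in> {a, b}" using h(1) h0 eG ab t(1) unfolding orients_def cross_def by auto
      moreover have "h e = z \<longleftrightarrow> h0 e = z" using h(2)[OF t(1)] t(2) by simp
      ultimately have "h e = h0 e" by auto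
      then show ?thesis by (simp add: flux_def)
    next
      case False
      then show ?thesis using e F unfolding flux_def cross_def by auto
    qed
    then have "(\<Sum>e\<in>F. flux G h A e) = (\<Sum>e\<in>F. flux G h0 A e)" by (rule sum.cong[OF refl])
    then show ?thesis using h(3)[OF A]
      unfolding balanced_on_def net_delete[OF m F, of h A h0] bsum_delete[OF m h0 F Q[OF A]] by (simp add: eq_diff_eq)
  qed
  moreover have "orients ?G (edges ?G) h" using h(1) unfolding orients_def by simp
  ultimately show ?thesis unfolding ext_def using h(2) unfolding cross_delete by blast
qed

lemma orientation_exists:
  assumes "multigraph G" "\<And>e. e \<in> F \<Longrightarrow> p e \<in> ends G e"
  obtains h0 where "orients G (edges G) h0" "\<And>e. e \<in> F \<Longrightarrow> h0 e = p e"
proof -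
  define h0 where "h0 e = (if e \<in> F then p e else SOME v. v \<in> ends G e)" for e
  have "h0 e \<in> ends G e" if e: "e \<in> edges G" for e
  proof -
    obtain a where "a \<in> ends G e" using e assms(1) by (rule multigraph_edgeE) auto
    then show ?thesis using assms(2) unfolding h0_def by (auto intro: someI)
  qed
  then show ?thesis using that[of h0] unfolding orients_def h0_def by auto
qed

subsection \<open>Friendly vertices\<close>

text \<open>
  \<open>can_lose G t v\<close>: an edge whose flow out of \<open>v\<close> is \<open>t\<close> may be removed at \<open>v\<close> while moving \<open>tau\<close> towards \<open>0\<close>.
\<close>

definition can_lose :: "('v, 'e) bgraph \<Rightarrow> 3 \<Rightarrow> 'v \<Rightarrow> bool" where
  "can_lose G t v \<longleftrightarrow> (if even (deg G v) then bd G v \<noteq> t else bd G v \<noteq> - t)"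

lemma friendly_iff: "out_friendly G v \<longleftrightarrow> can_lose G 1 v" "in_friendly G v \<longleftrightarrow> can_lose G (-1) v"
  unfolding out_friendly_def in_friendly_def can_lose_def tau_def
  by (cases "bd G v" rule: Z3_cases; simp)+

text \<open>From degree 7 on the new degree is at least 6 and any boundary is allowed. For degrees 5
  and 6, \<open>can_lose\<close> is exactly what the smaller degree demands.\<close>

lemma can_lose_ok4:
  assumes "ok4 (deg G v) (bd G v)" "deg G v \<noteq> 4" "can_lose G t v" "t = 1 \<or> t = -1"
  shows "ok4 (deg G v - 1) (bd G v - t)"
proof -
  have "deg G v = 5 \<or> deg G v = 6 \<or> deg G v \<ge> 7" using assms(1,2) unfolding ok4_def by linarith
  then show ?thesis
  proof (elim disjE)
    assume "deg G v = 5"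
    then show ?thesis using assms unfolding ok4_def can_lose_def
      by (cases "bd G v" rule: Z3_cases) auto
  next
    assume "deg G v = 6"
    then show ?thesis using assms unfolding ok4_def can_lose_def by auto
  qed (auto simp: ok4_def)
qed

lemma can_lose_one: "t = 1 \<or> t = -1 \<Longrightarrow> can_lose G t v \<or> can_lose G (-t) v"
  unfolding can_lose_def by auto

subsection \<open>Deleting an edge off the tip\<close>

text \<open>\<open>h0\<close> directs \<open>e0\<close> from \<open>u\<close> to \<open>v\<close>,
  so \<open>u\<close> loses outflow 1 and \<open>v\<close> loses outflow -1; \<open>oku\<close> and
  \<open>okv\<close> say that both ends stay tame.\<close>

locale deleting = crit_flow G z N x \<psi>
  for G :: "('v, 'e) bgraph" and z N x \<psi> +
  fixes u v :: 'v and e0 :: 'e and h0 :: "'e \<Rightarrow> 'v"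
  assumes c: crit and e0: "e0 \<in> edges G" "ends G e0 = {u, v}" and uv: "u \<noteq> v" "u \<noteq> z" "v \<noteq> z"
    and h0: "orients G (edges G) h0" "h0 e0 = v"
    and oku: "ok4 (d {u} - 1) (bd G u - 1)" and okv: "ok4 (d {v} - 1) (bd G v + 1)"
begin

definition "G1 = delete_oriented G {e0} h0"

lemma m1: "multigraph G1"
  unfolding G1_def by (rule delete_multigraph[OF m])

lemma G1 [simp]: "verts G1 = V" "edges G1 = edges G - {e0}" "ends G1 = ends G"
  by (simp_all add: G1_def)

lemma uvV: "u \<in> V" "v \<in> V"
  using e0 m unfolding multigraph_def by auto

lemma bsum1: "S \<subseteq> V \<Longrightarrow> bsum G1 S = bsum G S - of_int (flux G h0 S e0)"
  unfolding G1_def using bsum_delete[OF m h0(1), of "{e0}" S] e0 by simp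

lemma flux0: "flux G h0 S e0 = (if u \<in> S \<and> v \<notin> S then 1 else if v \<in> S \<and> u \<notin> S then -1 else 0)"
  unfolding flux_def e0(2) h0(2) by auto

lemma cutdeg1: "cutdeg G1 S + (if (u \<in> S) \<noteq> (v \<in> S) then 1 else 0) = d S"
proof -
  have "{e0} \<inter> cross G S = (if (u \<in> S) \<noteq> (v \<in> S) then {e0} else {})" using e0 unfolding cross_def by auto
  then show ?thesis using cutdeg_delete[OF m, of "{e0}" h0 S] unfolding G1_def by (auto split: if_splits)
qed

lemma cross1: "cross G1 {z} = cross G {z}"
  unfolding G1_def cross_delete using e0 uv by (auto simp: cross_def)

lemma total1: "bsum G1 (verts G1) = 0"
  using bsum1[of V] total flux0 uvV by simp

lemma pre1: "preflow_on G1 {z} \<psi>"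
proof -
  have "net G1 \<psi> {z} = net G \<psi> {z}" unfolding net_cross[OF m] net_cross[OF m1] cross1 ..
  moreover have "bsum G1 {z} = bsum G {z}" using bsum1[of "{z}"] zV flux0 uv by simp
  ultimately show ?thesis using pre_on unfolding preflow_on_def balanced_on_def cross1 orients_def by simp
qed

lemma ext1:
  assumes P: "partition_on V Q" and x: "ext G1 Q {z} \<psi>"
  shows "ext G Q {z} \<psi>"
proof (rule ext_delete[OF m h0(1) _ _ _ x[unfolded G1_def]])
  show "{e0} \<subseteq> edges G" using e0 by blast
  show "A \<subseteq> V" if "A \<in> Q" for A by (rule part_subset[OF P that])
  show "h0 e \<in> {z} \<longleftrightarrow> \<psi> e \<in> {z}" if "e \<in> {e0}" "e \<in> cross G {z}" for e
    using that e0 uv unfolding cross_def by auto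
qed

lemma ok1:
  assumes A: "A \<subseteq> V - {z}" "A \<noteq> {}" "A \<noteq> V - {z}"
  shows "ok4 (cutdeg G1 A) (bsum G1 A)"
proof (cases "card A \<ge> 2")
  case True
  have 6: "ok6 (d A) (bsum G A)" using cut_ok6[of A] A True by blast
  have b: "bsum G1 A = bsum G A - of_int (flux G h0 A e0)" using bsum1 A by blast
  show ?thesis
  proof (cases "(u \<in> A) \<noteq> (v \<in> A)")
    case True
    then have "cutdeg G1 A = d A - 1" "bsum G1 A \<noteq> bsum G A" using cutdeg1[of A] b unfolding flux0 by auto
    then show ?thesis using ok6_imp_ok4(3)[OF 6] by simp
  next
    case False
    then have "cutdeg G1 A = d A" "bsum G1 A = bsum G A" using cutdeg1[of A] b unfolding flux0 by auto
    then show ?thesis using ok6_imp_ok4(1)[OF 6] by simp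
  qed
next
  case False
  have "finite A" using A(1) finite_subset[OF _ fin(1)] by blast
  then have "card A = 1" using False A(2) by (metis One_nat_def Suc_1 card_0_eq less_2_cases_iff not_le)
  then obtain a where a: "A = {a}" by (auto simp: card_1_singleton_iff)
  then have aV: "a \<in> V" "a \<noteq> z" using A by auto
  have b: "bsum G1 A = bd G a - of_int (flux G h0 A e0)" using bsum1[of A] A a by auto
  consider "a = u" | "a = v" | "a \<noteq> u" "a \<noteq> v" by blast
  then show ?thesis
  proof cases
    case 1
    then have "cutdeg G1 A = d {u} - 1" "bsum G1 A = bd G u - 1" using cutdeg1[of A] b a uv unfolding flux0 by auto
    then show ?thesis using oku by simp
  next
    case 2
    then have "cutdeg G1 A = d {v} - 1" "bsum G1 A = bd G v + 1" using cutdeg1[of A] b a uv unfolding flux0 by auto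
    then show ?thesis using okv by simp
  next
    case 3
    then have "cutdeg G1 A = d {a}" "bsum G1 A = bd G a" using cutdeg1[of A] b a unfolding flux0 by auto
    then show ?thesis using ok_single[OF aV] by simp
  qed
qed

text \<open>The ends of \<open>e0\<close> are separated: if they shared a part, \<psi> would extend
  to the partition by criticality of \<open>G\<close>, and deleting an edge inside a part does not
  affect this.\<close>

lemma delete_critical:
  obtains Q and K :: "(nat, nat) bgraph" and f g where
    "critical_partition G1 Q {z} \<psi>" "quot f g G1 K" "fibres f G1 = Q"
    "\<And>v. v \<in> verts G1 \<Longrightarrow> fibre f G1 {f v} = part_of Q v"
    "failing_canvas K (f z) (f \<circ> \<psi> \<circ> g)" "ord_size K (f z) < ord_size G z"
    "\<And>A. A \<in> Q \<Longrightarrow> A \<noteq> {z} \<Longrightarrow> part_bound G1 Q {z} \<psi> A" "part_of Q u \<noteq> part_of Q v"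
proof -
  have zs: "{z} \<in> singles" using zV by blast
  have sz: "card singles + card {e \<in> edges G1. \<not> (\<exists>C\<in>singles. ends G1 e \<subseteq> C) \<and> ends G1 e \<inter> {z} = {}} < N"
  proof -
    have "{e \<in> edges G1. \<not> (\<exists>C\<in>singles. ends G1 e \<subseteq> C) \<and> ends G1 e \<inter> {z} = {}} \<subset> {e \<in> edges G. z \<notin> ends G e}"
      using e0 uv by auto
    then have "card {e \<in> edges G1. \<not> (\<exists>C\<in>singles. ends G1 e \<subseteq> C) \<and> ends G1 e \<inter> {z} = {}} < card {e \<in> edges G. z \<notin> ends G e}"
      by (rule psubset_card_mono[rotated]) simp
    then show ?thesis using card_singles size_eq unfolding ord_size_def by simp
  qed
  have P1: "partition_on (verts G1) singles" using partition_singles by simp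
  have nx1: "\<not> ext G1 singles {z} \<psi>" using ext1[OF partition_singles] nxs by blast
  obtain Q and K :: "(nat, nat) bgraph" and f g where K:
    "critical_partition G1 Q {z} \<psi>" "coarser singles Q" "quot f g G1 K" "fibres f G1 = Q"
    "\<And>v. v \<in> verts G1 \<Longrightarrow> fibre f G1 {f v} = part_of Q v"
    "\<And>b. b \<in> {z} \<Longrightarrow> failing_canvas K (f b) (f \<circ> \<psi> \<circ> g) \<and> ord_size K (f b) < N"
    "\<And>A. A \<in> Q \<Longrightarrow> A \<noteq> {z} \<Longrightarrow> part_bound G1 Q {z} \<psi> A"
  proof (rule critical_quotient[OF T m1 total1 P1 zs nx1 pre1 _ _ sz])
    show "ok4 (cutdeg G1 A) (bsum G1 A)" if "A \<subseteq> verts G1 - {z}" "A \<noteq> {}" "A \<noteq> verts G1 - {z}" for A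
      using ok1[of A] that by simp
    show "bsum G1 A = 0" if "A \<subseteq> verts G1 - {z}" "A \<noteq> {}" "A \<noteq> verts G1 - {z}" "cross G1 A = {}" for A
      using ok1[of A] that unfolding ok4_def cutdeg_def by simp
  qed (rule that)
  have Q: "partition_on V Q" "{z} \<in> Q" "\<not> ext G1 Q {z} \<psi>" using K(1) unfolding critical_partition_def by auto
  have "part_of Q u \<noteq> part_of Q v"
  proof
    assume eq: "part_of Q u = part_of Q v"
    have u: "part_of Q u \<in> Q" "u \<in> part_of Q u" "v \<in> part_of Q u"
      using part_of_mem[OF Q(1)] uvV eq by auto
    then have "Q \<noteq> singles" using uv(1) by auto
    then have x: "ext G Q {z} \<psi>" by (rule crit_ext[OF c Q(1,2)])
    have "ext G1 Q {z} \<psi>"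
      unfolding G1_def
    proof (rule ext_delete_outer[OF m h0(1) _ _ _ x])
      show "{e0} \<subseteq> edges G" using e0 by blast
      show "A \<subseteq> V" if "A \<in> Q" for A by (rule part_subset[OF Q(1) that])
      fix e A assume a: "e \<in> {e0}" "A \<in> Q" "e \<in> cross G A"
      then have "(u \<in> A) \<noteq> (v \<in> A)" using e0 unfolding cross_def by auto
      then have "part_of Q u = A" using part_of_eq[OF Q(1) a(2)] eq by metis
      then show "e \<in> cross G {z} \<and> (h0 e = z \<longleftrightarrow> \<psi> e = z)" using u \<open>(u \<in> A) \<noteq> (v \<in> A)\<close> by blast
    qed
    then show False using Q(3) by blast
  qed
  then show ?thesis by (intro that[OF K(1,3-5) _ _ K(7)]) (use K(6) size_eq in auto)
qed

text \<open>The deleted edge is restored between \<open>f u\<close> and \<open>f v\<close>; it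
  survives in the contraction because its ends lie in different parts.\<close>

lemma one_alteration_expansion:
  fixes K :: "(nat, nat) bgraph"
  assumes crQ: "critical_partition G1 Q {z} \<psi>" and q: "quot f g G1 K" "fibres f G1 = Q"
    "\<And>v. v \<in> V \<Longrightarrow> fibre f G1 {f v} = part_of Q v" and ne: "part_of Q u \<noteq> part_of Q v"
    and cls: "\<And>A. A \<in> Q \<Longrightarrow> card A \<ge> 2 \<Longrightarrow> canvas_class k (restrict_canvas G A) (restrict_tip G A)"
    and xcls: "card (part_of Q x) \<ge> 2 \<Longrightarrow>
      \<exists>\<psi>\<^sub>1. easel_class k r (restrict_canvas G (part_of Q x)) (restrict_tip G (part_of Q x)) {x} \<psi>\<^sub>1"
  shows "EXPB k r G z x K (f z) (f x)"
proof -
  have mK: "multigraph K" by (rule quot_multigraph[OF m1 q(1)])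
  note iso = quot_iso[OF m1 q(1), unfolded q(2)]
  have Q: "partition_on V Q" "{z} \<in> Q" using crQ unfolding critical_partition_def by auto
  let ?F = "\<lambda>A. f (SOME v. v \<in> A)"
  obtain n where n: "n \<notin> edges K" using mK ex_new_if_finite[OF infinite_UNIV_nat] by (metis multigraph_finite(2))
  define gi where "gi = inv_into (edges K) g"
  define H where "H = \<lparr>verts = verts K, edges = insert n (edges K), ends = (ends K)(n := {f u, f v}),
            bd = (bd K)(f u := bd K (f u) + 1, f v := bd K (f v) - 1)\<rparr>"
  have feq: "f a = f b \<longleftrightarrow> part_of Q a = part_of Q b" if "a \<in> V" "b \<in> V" for a b
  proof
    assume "f a = f b"
    then show "part_of Q a = part_of Q b" using q(3)[OF that(1)] q(3)[OF that(2)] by simp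
  next
    assume "part_of Q a = part_of Q b"
    then have "a \<in> fibre f G1 {f b}" using q(3)[OF that(2)] part_of_mem[OF Q(1) that(1)] by simp
    then show "f a = f b" by (simp add: fibre_def)
  qed
  have pz: "part_of Q z = {z}" using part_of_eq[OF Q, of z] by simp
  have notz: "f a \<noteq> f z" if "a \<in> V" "a \<noteq> z" for a using feq[OF that(1) zV] pz part_of_mem[OF Q(1) that(1)] that(2) by auto
  have fuv: "f u \<noteq> f v" using feq[OF uvV] ne by blast
  have "alteration K (f u) (f v) H" unfolding alteration_def
    using uvV quot_verts[OF q(1)] fuv n by (intro conjI exI[of _ n]) (auto simp: H_def)
  then have alt: "one_alteration K (f z) H" unfolding one_alteration_def using notz uvV uv by blast
  have Ff: "?F (part_of Q a) = f a" if "a \<in> V" for a using iso(2) part_of_mem[OF Q(1) that] by blast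
  have "e0 \<in> edges (contract G Q)"
  proof -
    have "\<not> (\<exists>A\<in>Q. {u, v} \<subseteq> A)" using ne part_of_eq[OF Q(1)] by (metis insert_subset)
    then show ?thesis unfolding contract_def using e0 by simp
  qed
  then have EP: "edges (contract G Q) = insert e0 (edges (contract G1 Q))" "e0 \<notin> edges (contract G1 Q)"
    unfolding contract_def by auto
  have isoH: "bgraph_iso ?F (gi(e0 := n)) (contract G Q) H"
    unfolding bgraph_iso_def
  proof (intro conjI ballI)
    show "bij_betw ?F (verts (contract G Q)) (verts H)" using iso(1) unfolding bgraph_iso_def contract_def H_def by simp
    have b: "bij_betw gi (edges (contract G1 Q)) (edges K)" using iso(1) unfolding bgraph_iso_def gi_def by blast
    then have "bij_betw (gi(e0 := n)) (edges (contract G1 Q)) (edges K)"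
      using EP(2) by (subst bij_betw_cong[of _ _ gi]) auto
    then have "bij_betw (gi(e0 := n)) (edges (contract G1 Q) \<union> {e0}) (edges K \<union> {(gi(e0 := n)) e0})"
      by (intro notIn_Un_bij_betw) (use EP(2) n in auto)
    then show "bij_betw (gi(e0 := n)) (edges (contract G Q)) (edges H)" unfolding EP(1) H_def by simp
    fix e assume e: "e \<in> edges (contract G Q)"
    show "ends H ((gi(e0 := n)) e) = ?F ` ends (contract G Q) e"
    proof (cases "e = e0")
      case True
      then show ?thesis unfolding H_def contract_def using e0 Ff uvV by simp
    next
      case False
      then have e1: "e \<in> edges (contract G1 Q)" using e EP by blast
      then have "gi e \<noteq> n" using b n bij_betwE by blast
      moreover have "ends K (gi e) = ?F ` ends (contract G1 Q) e" using iso(1) e1 unfolding bgraph_iso_def gi_def by blast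
      ultimately show ?thesis using False unfolding H_def contract_def by simp
    qed
  next
    fix A assume "A \<in> verts (contract G Q)"
    then have A: "A \<in> Q" unfolding contract_def by simp
    have AV: "A \<subseteq> V" by (rule part_subset[OF Q(1) A])
    have 1: "bd K (?F A) = bsum G1 A" using iso(1) A unfolding bgraph_iso_def contract_def bsum_def by simp
    define w where "w = ?F A"
    have uA: "f u = w \<longleftrightarrow> u \<in> A" and vA: "f v = w \<longleftrightarrow> v \<in> A"
    proof -
      obtain a where a: "a \<in> A" using part_nonempty[OF Q(1) A] by blast
      then have pa: "part_of Q a = A" "?F A = f a" "a \<in> V" using part_of_eq[OF Q(1) A] iso(2)[OF A] AV by auto
      show "f u = w \<longleftrightarrow> u \<in> A" "f v = w \<longleftrightarrow> v \<in> A"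
        unfolding w_def pa(2) feq[OF uvV(1) pa(3)] feq[OF uvV(2) pa(3)] pa(1)
        using part_of_eq_iff[OF Q(1) A] uvV by auto
    qed
    have n2: "\<not> (u \<in> A \<and> v \<in> A)" using ne part_of_eq[OF Q(1) A] by auto
    have "bd H w = bd K w + (if f u = w then 1 else 0) - (if f v = w then 1 else 0)"
      unfolding H_def using fuv by simp
    then have "bd H w = bd K w + (if u \<in> A then 1 else 0) - (if v \<in> A then 1 else 0)" unfolding uA vA .
    then show "bd H (?F A) = bd (contract G Q) A"
      using n2 unfolding w_def 1 bsum1[OF AV] flux0 by (auto simp: contract_def bsum_def)
  qed
  have "expansion (canvas_class k) x (f x) (easel_class k r) {} G z H (f z)"
    by (rule expansionI[OF Q isoH _ Ff[OF xV] notz[OF xV xz] cls xcls]) auto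
  then show ?thesis unfolding EXPB_def using alt by blast
qed

end

context crit_flow
begin

text \<open>Cuts are at most \<open>d {z} - 2\<close> in the smaller graph, and restoring one edge
  adds at most 1, so they stay within \<open>k\<close> and \<open>class_small\<close> applies to
  every part. Since the edge avoids \<open>x\<close>, the degree of \<open>x\<close> is
  kept.\<close>

lemma outcome_EXPB:
  assumes c: crit and e: "easel_class k r G z x \<psi>" and e0: "e0 \<in> edges G" "ends G e0 = {u, v}"
    and ne: "u \<noteq> v" "u \<noteq> z" "v \<noteq> z" "u \<noteq> x" "v \<noteq> x"
    and oku: "ok4 (d {u} - 1) (bd G u - 1)" and okv: "ok4 (d {v} - 1) (bd G v + 1)"
  shows "\<exists>(G' :: (nat, nat) bgraph) z' x' \<psi>'. easel_class k r G' z' x' \<psi>' \<and> prec G' z' x' G z x \<and> EXPB k r G z x G' z' x'"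
proof -
  obtain h0 where h0: "orients G (edges G) h0" "\<And>e. e \<in> {e0} \<Longrightarrow> h0 e = v"
    using orientation_exists[OF m, of "{e0}" "\<lambda>_. v"] e0 by auto
  interpret deleting G z N x \<psi> u v e0 h0
    by unfold_locales (use c e0 ne h0 oku okv in auto)
  obtain Q and K :: "(nat, nat) bgraph" and f g where K:
    "critical_partition G1 Q {z} \<psi>" "quot f g G1 K" "fibres f G1 = Q"
    "\<And>v. v \<in> verts G1 \<Longrightarrow> fibre f G1 {f v} = part_of Q v"
    "failing_canvas K (f z) (f \<circ> \<psi> \<circ> g)" "ord_size K (f z) < ord_size G z"
    "\<And>A. A \<in> Q \<Longrightarrow> A \<noteq> {z} \<Longrightarrow> part_bound G1 Q {z} \<psi> A" "part_of Q u \<noteq> part_of Q v"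
    by (rule delete_critical) (rule that)
  note ef = easel_facts[OF e]
  have Q: "partition_on V Q" "{z} \<in> Q" using K(1) unfolding critical_partition_def by auto
  have dz: "cutdeg G1 {z} = d {z}" unfolding cutdeg_def cross1 ..
  have part: "A \<subseteq> V \<and> z \<notin> A \<and> A \<noteq> V - {z} \<and> int (d A) \<le> k" if A: "A \<in> Q" "A \<noteq> {z}" for A
  proof -
    have "cutdeg G1 A + 2 \<le> d {z}" using K(7)[OF A] dz unfolding part_bound_def by simp
    then have "int (d A) \<le> k" using cutdeg1[of A] ef(1) by (auto split: if_splits)
    then show ?thesis using part_subset[OF Q(1) A(1)] critical_partition_parts(1,3)[OF m1 total1 pre1 K(1) A(1)] A(2) by auto
  qed
  let ?X = "part_of Q x"
  have X: "?X \<in> Q" "x \<in> ?X" using part_of_mem[OF Q(1) xV] by auto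
  have Xz: "?X \<noteq> {z}" using X xz by auto
  note pX = part[OF X(1) Xz]
  have dX: "?X = {x} \<and> cutdeg G1 ?X = d {x} \<or> d {x} < cutdeg G1 ?X"
  proof (cases "?X = {x}")
    case True
    have "cutdeg G1 {x} = d {x}" using cutdeg1[of "{x}"] ne by auto
    then show ?thesis using True by simp
  next
    case False
    then have "d {x} + 2 \<le> d ?X" using x_cut[OF X(2)] pX by blast
    then show ?thesis using cutdeg1[of ?X] by (simp split: if_splits)
  qed
  have cl: "easel_class k r K (f z) (f x) (f \<circ> \<psi> \<circ> g)"
  proof (rule class_quot[OF m1 K(2,5) _ K(4)])
    show "fibre f G1 {f z} = {z}" using K(4)[of z] zV part_of_eq[OF Q, of z] by simp
    show "x \<in> verts G1" "z \<in> verts G1" "x \<in> verts G1" "z \<notin> ?X" using xV zV pX by auto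
    show "orients G1 (cross G1 {z}) \<psi>" using pre1 unfolding preflow_on_def by blast
    show "int (cutdeg G1 {z}) \<le> k + 1" "int (cutdeg G1 {z}) = k + 1 \<Longrightarrow> \<not> one_way \<psi> {z} (cross G1 {z})"
      using ef(1,2) unfolding dz cross1 by auto
    show "int (cutdeg G1 ?X) \<ge> k - 2 - r" using dX ef(3) by auto
    assume a: "int (cutdeg G1 ?X) = k - 2 - r" "int (cutdeg G1 {z}) = k + 1"
    then have "?X = {x}" "int (d {x}) = k - 2 - r" using dX ef(3) by auto
    then show "\<not> one_way \<psi> {z} {e \<in> cross G1 {z}. ends G1 e \<inter> ?X = {}}" using ef(4) a(2) dz cross1 by auto
  qed
  have "EXPB k r G z x K (f z) (f x)"
  proof (rule one_alteration_expansion[OF K(1-3) _ K(8)])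
    show "fibre f G1 {f a} = part_of Q a" if "a \<in> V" for a using K(4) that by simp
    show "canvas_class k (restrict_canvas G A) (restrict_tip G A)" if A: "A \<in> Q" "card A \<ge> 2" for A
    proof -
      have "A \<noteq> {z}" using A by auto
      then show ?thesis using class_small(1)[of A k] part[OF A(1)] A(2) by blast
    qed
    show "\<exists>\<psi>\<^sub>1. easel_class k r (restrict_canvas G ?X) (restrict_tip G ?X) {x} \<psi>\<^sub>1" if "card ?X \<ge> 2"
      using class_small(2)[of ?X k r] pX that X(2) ef(3) by blast
  qed
  then show ?thesis using cl K(6) unfolding prec_def by blast
qed

end

section \<open>Copies over \<open>nat\<close> without merging\<close>

lemma card_ge_2: "finite S \<Longrightarrow> w \<in> S \<Longrightarrow> S \<noteq> {w} \<Longrightarrow> card S \<ge> 2"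
  using card_le_Suc0_iff_eq[of S] by (metis One_nat_def Suc_1 is_singletonI' is_singleton_the_elem not_less_eq_eq singletonD empty_iff)

lemma two_elements: assumes "card S \<ge> 2" obtains a b where "a \<in> S" "b \<in> S" "a \<noteq> b"
proof -
  obtain T where "T \<subseteq> S" "card T = 2" using obtain_subset_with_card_n[OF assms] by blast
  then show ?thesis using that unfolding card_2_iff by blast
qed

lemma fibre_singles:
  assumes "multigraph G"
  obtains K :: "(nat, nat) bgraph" and f g where "quot f g G K" "fibres f G = (\<lambda>v. {v}) ` verts G"
    "\<And>v. v \<in> verts G \<Longrightarrow> fibre f G {f v} = {v}" "inj_on f (verts G)"
proof -
  have P: "partition_on (verts G) ((\<lambda>v. {v}) ` verts G)" by (rule partition_singles)
  obtain K :: "(nat, nat) bgraph" and f g where K: "quot f g G K" "fibres f G = (\<lambda>v. {v}) ` verts G"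
    "\<And>v. v \<in> verts G \<Longrightarrow> fibre f G {f v} = part_of ((\<lambda>v. {v}) ` verts G) v" using nat_quot[OF assms P] by metis
  have fb: "fibre f G {f v} = {v}" if "v \<in> verts G" for v
    using K(3)[OF that] part_of_eq[OF P, of "{v}" v] that by simp
  have "inj_on f (verts G)"
  proof (rule inj_onI)
    fix a b assume ab: "a \<in> verts G" "b \<in> verts G" "f a = f b"
    then have "a \<in> fibre f G {f b}" by (simp add: fibre_def)
    then show "a = b" using fb[OF ab(2)] by simp
  qed
  then show ?thesis using that[OF K(1,2) fb] by blast
qed

lemma singles_iso:
  assumes m: "multigraph G" and q: "quot f g G K" and i: "inj_on f (verts G)"
  shows "bgraph_iso f (inv_into (edges K) g) G K" "v \<in> verts G \<Longrightarrow> fibre f G {f v} = {v}"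
    "bij_betw g (edges K) (edges G)" "e \<in> edges G \<Longrightarrow> ends K (inv_into (edges K) g e) = f ` ends G e"
proof -
  have fb: "fibre f G {f v} = {v}" if "v \<in> verts G" for v
    using i that unfolding fibre_def inj_on_def by auto
  then show "v \<in> verts G \<Longrightarrow> fibre f G {f v} = {v}" .
  have "{e \<in> edges G. \<exists>u\<in>ends G e. \<exists>v\<in>ends G e. f u \<noteq> f v} = edges G"
  proof -
    have "\<exists>u\<in>ends G e. \<exists>v\<in>ends G e. f u \<noteq> f v" if e: "e \<in> edges G" for e
    proof -
      obtain a b where "ends G e = {a, b}" "a \<noteq> b" "a \<in> verts G" "b \<in> verts G" using e m by (rule multigraph_edgeE)
      then show ?thesis using i unfolding inj_on_def by auto
    qed
    then show ?thesis by blast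
  qed
  then show b: "bij_betw g (edges K) (edges G)" using q unfolding quot_def by simp
  then have gi: "bij_betw (inv_into (edges K) g) (edges G) (edges K)" by (simp add: bij_betw_inv_into)
  show en: "ends K (inv_into (edges K) g e) = f ` ends G e" if e: "e \<in> edges G" for e
  proof -
    have eg: "e \<in> g ` edges K" using b e unfolding bij_betw_def by simp
    then show ?thesis using q f_inv_into_f[OF eg] inv_into_into[OF eg] unfolding quot_def by metis
  qed
  have "bd K (f v) = bd G v" if "v \<in> verts G" for v
  proof -
    have "bd K (f v) = bsum G (fibre f G {f v})" using q that unfolding quot_def by auto
    then show ?thesis using fb[OF that] by simp
  qed
  moreover have "bij_betw f (verts G) (verts K)" using i quot_verts[OF q] unfolding bij_betw_def by simp
  ultimately show "bgraph_iso f (inv_into (edges K) g) G K" unfolding bgraph_iso_def using gi en by blast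
qed

lemma singles_failing_canvas:
  assumes m: "multigraph G" and t: "bsum G (verts G) = 0" and z: "z \<in> verts G" and p: "preflow_on G {z} \<psi>"
    and c: "critical_partition G ((\<lambda>v. {v}) ` verts G) {z} \<psi>"
    and closed: "\<And>A. A \<subseteq> verts G - {z} \<Longrightarrow> A \<noteq> {} \<Longrightarrow> A \<noteq> verts G - {z} \<Longrightarrow> cross G A = {} \<Longrightarrow> bsum G A = 0"
    and ok: "\<And>v. v \<in> verts G \<Longrightarrow> v \<noteq> z \<Longrightarrow> ok4 (cutdeg G {v}) (bd G v)"
  obtains K :: "(nat, nat) bgraph" and f g where "quot f g G K" "inj_on f (verts G)"
    "\<And>v. v \<in> verts G \<Longrightarrow> fibre f G {f v} = {v}" "failing_canvas K (f z) (f \<circ> \<psi> \<circ> g)"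
    "ord_size K (f z) = ord_size G z" "\<And>v. v \<in> verts G \<Longrightarrow> deg K (f v) = cutdeg G {v} \<and> bd K (f v) = bd G v"
proof -
  obtain K :: "(nat, nat) bgraph" and f g where K: "quot f g G K" "fibres f G = (\<lambda>v. {v}) ` verts G"
    "\<And>v. v \<in> verts G \<Longrightarrow> fibre f G {f v} = {v}" "inj_on f (verts G)" using fibre_singles[OF m] by metis
  have fz: "fibre f G {f z} = {z}" by (rule K(3)[OF z])
  have tc: "failing_canvas K (f z) (f \<circ> \<psi> \<circ> g)"
  proof (rule quot_failing_canvas[OF m t K(1) _ fz p])
    show "f z \<in> verts K" using z quot_verts[OF K(1)] by simp
    show "critical_partition G (fibres f G) {z} \<psi>" unfolding K(2) by (rule c)
    show "ok4 (cutdeg G A) (bsum G A)" if A: "A \<in> fibres f G" "A \<noteq> {z}" for A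
    proof -
      obtain v where v: "v \<in> verts G" "A = {v}" using A(1) unfolding K(2) by blast
      then show ?thesis using ok[of v] A(2) by (auto simp: bsum_def)
    qed
    fix S assume S: "S \<subseteq> verts K" "f z \<notin> S" "cross G (fibre f G S) = {}"
    show "bsum G (fibre f G S) = 0"
    proof (cases "fibre f G S = {} \<or> fibre f G S = verts G - {z}")
      case True
      have "bsum G (verts G - {z}) = 0" if e: "cross G (verts G - {z}) = {}"
      proof -
        have "cross G {z} = {}" using e cross_complement[OF m, of "{z}"] z by simp
        then have "bsum G {z} = 0" using p net_cross[OF m, of \<psi> "{z}"] unfolding preflow_on_def balanced_on_def by simp
        then show ?thesis using bsum_complement[OF m t, of "{z}"] z by simp
      qed
      then show ?thesis using True S(3) by (auto simp: bsum_def)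
    next
      case False
      have "z \<notin> fibre f G S" using S(2) by (auto simp: fibre_def)
      then show ?thesis using closed[of "fibre f G S"] False S(3) fibre_subset[of f G S] by blast
    qed
  qed
  have mK: "multigraph K" by (rule quot_multigraph[OF m K(1)])
  have all: "{e \<in> edges G. \<exists>u\<in>ends G e. \<exists>v\<in>ends G e. f u \<noteq> f v} = edges G"
    using singles_iso(3)[OF m K(1,4)] K(1) unfolding quot_def bij_betw_def by metis
  have "\<exists>u\<in>ends G e. \<exists>v\<in>ends G e. f u \<noteq> f v" if "e \<in> edges G" for e
  proof -
    have "e \<in> {e \<in> edges G. \<exists>u\<in>ends G e. \<exists>v\<in>ends G e. f u \<noteq> f v}" unfolding all by (rule that)
    then show ?thesis by blast
  qed
  then have "{e \<in> edges G. (\<exists>u\<in>ends G e. \<exists>v\<in>ends G e. f u \<noteq> f v) \<and> ends G e \<inter> fibre f G {f z} = {}} = {e \<in> edges G. z \<notin> ends G e}"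
    unfolding fz by auto
  moreover have "card (fibres f G) = card (verts G)" unfolding K(2) by (rule card_image) simp
  ultimately have os: "ord_size K (f z) = ord_size G z" using quot_ord_size[OF m K(1), of "f z"] unfolding ord_size_def by simp
  have "deg K (f v) = cutdeg G {v} \<and> bd K (f v) = bd G v" if "v \<in> verts G" for v
    using deg_cutdeg[OF mK] quot_cutdeg[OF m K(1), of "{f v}"] K(3)[OF that] quot_bsum[OF m K(1), of "{f v}"] that quot_verts[OF K(1)]
    by simp
  then show ?thesis using that[OF K(1,4,3) tc os] by blast
qed

lemma can_lose_cong: "deg G v = deg K w \<Longrightarrow> bd G v = bd K w \<Longrightarrow> can_lose G t v = can_lose K t w"
  unfolding can_lose_def by simp

context crit_flow
begin

text \<open>The flow of a tip edge out of its other end \<open>u\<close>, so that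
  \<open>can_lose G (out_value e) u\<close> allows deleting \<open>e\<close> when \<open>u\<close>
  has degree at least five.\<close>

definition out_value :: "'e \<Rightarrow> 3" where
  "out_value e = (if \<psi> e = z then 1 else - 1)"

text \<open>Deleting an edge at the tip preserves criticality exactly, since its orientation is prescribed.\<close>

lemma delete_tip_edge:
  assumes c: crit and e0: "e0 \<in> cross G {z}" "ends G e0 = {z, u}" "u \<noteq> z"
    and ok: "ok4 (d {u} - 1) (bd G u - out_value e0)"
    and h0: "orients G (edges G) h0" "\<And>e. e \<in> cross G {z} \<Longrightarrow> h0 e = \<psi> e"
  defines "G1 \<equiv> delete_oriented G {e0} h0"
  obtains K :: "(nat, nat) bgraph" and f g where "quot f g G1 K" "inj_on f V"
    "\<And>v. v \<in> V \<Longrightarrow> fibre f G1 {f v} = {v}" "failing_canvas K (f z) (f \<circ> \<psi> \<circ> g)"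
    "ord_size K (f z) = ord_size G z" "\<And>v. v \<in> V \<Longrightarrow> deg K (f v) = cutdeg G1 {v} \<and> bd K (f v) = bd G1 v"
    "\<And>S. cutdeg G1 S + (if (u \<in> S) \<noteq> (z \<in> S) then 1 else 0) = d S"
    "bd G1 = (bd G)(u := bd G u - out_value e0, z := bd G z + out_value e0)" "multigraph G1" "preflow_on G1 {z} \<psi>"
    "cross G1 {z} = cross G {z} - {e0}" "critical_partition G1 singles {z} \<psi>"
proof -
  have eG: "e0 \<in> edges G" by (rule crossD[OF e0(1)])
  have F: "{e0} \<subseteq> edges G" using eG by blast
  have m1: "multigraph G1" unfolding G1_def by (rule delete_multigraph[OF m])
  have V1: "verts G1 = V" by (simp add: G1_def)
  have b1: "bsum G1 S = bsum G S - of_int (flux G h0 S e0)" if "S \<subseteq> V" for S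
    unfolding G1_def using bsum_delete[OF m h0(1) F that] by simp
  have h00: "h0 e0 = \<psi> e0" "\<psi> e0 \<in> {z, u}" using h0 e0 eG \<psi>o unfolding orients_def by auto
  have fl: "of_int (flux G h0 S e0) = (if u \<in> S \<and> z \<notin> S then out_value e0 else if z \<in> S \<and> u \<notin> S then - out_value e0 else 0)" for S
    unfolding flux_def e0(2) h00(1) out_value_def using h00(2) e0(3) by auto
  have cd: "cutdeg G1 S + (if (u \<in> S) \<noteq> (z \<in> S) then 1 else 0) = d S" for S
  proof -
    have "{e0} \<inter> cross G S = (if (u \<in> S) \<noteq> (z \<in> S) then {e0} else {})" using eG e0 unfolding cross_def by auto
    then show ?thesis using cutdeg_delete[OF m, of "{e0}" h0 S] unfolding G1_def by (auto split: if_splits)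
  qed
  have bd1: "bd G1 = (bd G)(u := bd G u - out_value e0, z := bd G z + out_value e0)"
  proof
    fix v
    have "bd G1 v = bd G v - of_int (flux G h0 {v} e0)" unfolding G1_def delete_oriented_def by simp
    then show "bd G1 v = ((bd G)(u := bd G u - out_value e0, z := bd G z + out_value e0)) v"
      unfolding fl using e0(3) by auto
  qed
  have uV: "u \<in> V" using eG e0(2) m unfolding multigraph_def by blast
  have t1: "bsum G1 (verts G1) = 0" using b1[of V] total fl[of V] uV zV unfolding V1 by simp
  have cr1: "cross G1 {z} = cross G {z} - {e0}" unfolding G1_def cross_delete ..
  have p1: "preflow_on G1 {z} \<psi>"
    unfolding preflow_on_def
  proof
    show "orients G1 (cross G1 {z}) \<psi>" using \<psi>o unfolding cr1 orients_def by (simp add: G1_def)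
    have "net G \<psi> {z} = net G1 \<psi> {z} + flux G \<psi> {z} e0" using net_delete[OF m F, of \<psi> "{z}" h0] unfolding G1_def by simp
    moreover have "flux G \<psi> {z} e0 = flux G h0 {z} e0" unfolding flux_def h00(1) ..
    ultimately show "balanced_on G1 \<psi> {z}"
      using pre_on b1[of "{z}"] zV unfolding preflow_on_def balanced_on_def by (metis add_right_cancel diff_add_cancel of_int_add empty_subsetI insert_subset)
  qed
  have cp: "critical_partition G1 singles {z} \<psi>"
    unfolding critical_partition_def V1
  proof (intro conjI allI impI)
    show "partition_on V singles" by (rule partition_singles)
    show "{z} \<in> singles" using zV by blast
    show "\<not> ext G1 singles {z} \<psi>"
    proof
      assume x: "ext G1 singles {z} \<psi>"
      have "ext G singles {z} \<psi>"
        by (rule ext_delete[OF m h0(1) F _ _ x[unfolded G1_def]]) (use h0(2) in auto)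
      then show False using nxs by blast
    qed
    fix Q assume Q: "partition_on V Q" "{z} \<in> Q" "Q \<noteq> singles"
    show "ext G1 Q {z} \<psi>"
      unfolding G1_def
    proof (rule ext_delete_outer[OF m h0(1) F _ _ crit_ext[OF c Q]])
      show "A \<subseteq> V" if "A \<in> Q" for A by (rule part_subset[OF Q(1) that])
    qed (use e0 h0(2) in auto)
  qed
  have ok1: "ok4 (cutdeg G1 {v}) (bd G1 v)" if v: "v \<in> V" "v \<noteq> z" for v
  proof (cases "v = u")
    case True
    then have "cutdeg G1 {v} = d {u} - 1" using cd[of "{u}"] e0(3) by auto
    then show ?thesis using ok True e0(3) unfolding bd1 by simp
  next
    case False
    then have "cutdeg G1 {v} = d {v}" using cd[of "{v}"] v by auto
    then show ?thesis using ok_single[OF v] False v unfolding bd1 by simp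
  qed
  have cl: "bsum G1 A = 0" if A: "A \<subseteq> V - {z}" "A \<noteq> {}" "A \<noteq> V - {z}" "cross G1 A = {}" for A
  proof -
    have "ok4 (d A) (bsum G A)" by (rule cut_ok4) (use A in auto)
    then have "d A \<ge> 4" unfolding ok4_def by auto
    moreover have "cutdeg G1 A = 0" using A(4) unfolding cutdeg_def by simp
    ultimately show ?thesis using cd[of A] by (auto split: if_splits)
  qed
  obtain K :: "(nat, nat) bgraph" and f g where K: "quot f g G1 K" "inj_on f (verts G1)"
    "\<And>v. v \<in> verts G1 \<Longrightarrow> fibre f G1 {f v} = {v}" "failing_canvas K (f z) (f \<circ> \<psi> \<circ> g)"
    "ord_size K (f z) = ord_size G1 z" "\<And>v. v \<in> verts G1 \<Longrightarrow> deg K (f v) = cutdeg G1 {v} \<and> bd K (f v) = bd G1 v"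
    by (rule singles_failing_canvas[OF m1 t1 _ p1, of thesis]) (use zV cp cl ok1 V1 in auto)
  have "{e \<in> edges G1. z \<notin> ends G1 e} = {e \<in> edges G. z \<notin> ends G e}" using e0 unfolding G1_def by auto
  then have "ord_size G1 z = ord_size G z" unfolding ord_size_def V1 by simp
  then show ?thesis using K that[OF K(1) _ _ K(4) _ _ cd bd1 m1 p1 cr1 cp] unfolding V1 by auto
qed

lemma outcome_ADD:
  assumes c: crit and e: "easel_class k r G z x \<psi>" and hom: "homogeneous G z x"
    and e0: "e0 \<in> cross G {z}" "ends G e0 = {z, u}" "u \<noteq> z" "u \<noteq> x"
    and ok: "ok4 (d {u} - 1) (bd G u - out_value e0)"
  shows "\<exists>(G' :: (nat, nat) bgraph) z' x' \<psi>'. easel_class k r G' z' x' \<psi>' \<and> prec G' z' x' G z x \<and> ADD G z x G' z' x'"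
proof -
  obtain h0 where h0: "orients G (edges G) h0" "\<And>e. e \<in> cross G {z} \<Longrightarrow> h0 e = \<psi> e"
    using orientation_exists[OF m, of "cross G {z}" \<psi>] \<psi>o unfolding orients_def by blast
  define G1 where "G1 = delete_oriented G {e0} h0"
  obtain K :: "(nat, nat) bgraph" and f g where K: "quot f g G1 K" "inj_on f V"
    "\<And>v. v \<in> V \<Longrightarrow> fibre f G1 {f v} = {v}" "failing_canvas K (f z) (f \<circ> \<psi> \<circ> g)"
    "ord_size K (f z) = ord_size G z" "\<And>v. v \<in> V \<Longrightarrow> deg K (f v) = cutdeg G1 {v} \<and> bd K (f v) = bd G1 v"
    "\<And>S. cutdeg G1 S + (if (u \<in> S) \<noteq> (z \<in> S) then 1 else 0) = d S"
    "bd G1 = (bd G)(u := bd G u - out_value e0, z := bd G z + out_value e0)" "multigraph G1" "preflow_on G1 {z} \<psi>"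
    "cross G1 {z} = cross G {z} - {e0}" "critical_partition G1 singles {z} \<psi>"
    by (rule delete_tip_edge[OF c e0(1-3) ok h0(1), folded G1_def]) (erule h0(2), rule that)
  note ef = easel_facts[OF e]
  have V1: "verts G1 = V" by (simp add: G1_def)
  have i: "inj_on f (verts G1)" using K(2) V1 by simp
  note iso = singles_iso[OF K(9,1) i]
  have uV: "u \<in> V" using crossD[OF e0(1)] e0(2) m unfolding multigraph_def by blast
  have dz: "cutdeg G1 {z} + 1 = d {z}" using K(7)[of "{z}"] e0(3) by simp
  have dx: "cutdeg G1 {x} = d {x}" using K(7)[of "{x}"] e0(4) xz by auto
  have cl: "easel_class k r K (f z) (f x) (f \<circ> \<psi> \<circ> g)"
    by (rule class_quot[OF K(9,1,4) K(3)[OF zV] K(3)[OF xV]])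
      (use zV xV xz V1 K(10) dz dx ef in \<open>auto simp: preflow_on_def\<close>)
  have dK: "deg K (f z) < deg G z" using K(6)[OF zV] dz deg_cutdeg[OF m] by simp
  \<comment> \<open>The order is unchanged. If \<open>K\<close> is not homogeneous, it precedes the
    homogeneous \<open>G\<close> for this reason; otherwise its tip degree is smaller.\<close>
  have pr: "prec K (f z) (f x) G z x" unfolding prec_def using K(5) hom dK by auto
  have mK: "multigraph K" by (rule quot_multigraph[OF K(9,1)])
  obtain n where n: "n \<notin> edges K" using mK ex_new_if_finite[OF infinite_UNIV_nat] by (metis multigraph_finite(2))
  define gi where "gi = inv_into (edges K) g"
  define t where "t = out_value e0"
  define H where "H = \<lparr>verts = verts K, edges = insert n (edges K), ends = (ends K)(n := {f u, f z}),
            bd = (bd K)(f u := bd K (f u) + t, f z := bd K (f z) - t)\<rparr>"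
  have fne: "f u \<noteq> f z" "f u \<noteq> f x" using K(2) uV zV xV e0(3,4) unfolding inj_on_def by auto
  have fV: "f u \<in> verts K" "f z \<in> verts K" using uV zV quot_verts[OF K(1)] V1 by auto
  have "tip_alteration K (f z) (f u) H"
  proof (cases "\<psi> e0 = z")
    case True
    then have "alteration K (f u) (f z) H" unfolding alteration_def using fne fV n
      by (intro conjI exI[of _ n]) (auto simp: H_def t_def out_value_def)
    then show ?thesis unfolding tip_alteration_def by blast
  next
    case False
    then have "alteration K (f z) (f u) H" unfolding alteration_def using fne fV n
      by (intro conjI exI[of _ n]) (auto simp: H_def t_def out_value_def fun_upd_twist insert_commute)
    then show ?thesis unfolding tip_alteration_def by blast
  qed
  moreover have "pointed_iso G z x H (f z) (f x)"
    unfolding pointed_iso_def bgraph_iso_def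
  proof (intro exI[of _ f] exI[of _ "gi(e0 := n)"] conjI ballI)
    show "bij_betw f V (verts H)" using iso(1) V1 unfolding bgraph_iso_def H_def by simp
    have b: "bij_betw gi (edges G1) (edges K)" using iso(1) unfolding bgraph_iso_def gi_def by blast
    have e1: "e0 \<notin> edges G1" "edges G = edges G1 \<union> {e0}" using crossD[OF e0(1)] by (auto simp: G1_def)
    have "bij_betw (gi(e0 := n)) (edges G1) (edges K)" using b e1(1) by (subst bij_betw_cong[of _ _ gi]) auto
    then have "bij_betw (gi(e0 := n)) (edges G1 \<union> {e0}) (edges K \<union> {(gi(e0 := n)) e0})"
      by (intro notIn_Un_bij_betw) (use e1(1) n in auto)
    then show "bij_betw (gi(e0 := n)) (edges G) (edges H)" unfolding e1(2) H_def by simp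
    show "ends H ((gi(e0 := n)) e) = f ` ends G e" if e: "e \<in> edges G" for e
    proof (cases "e = e0")
      case True
      then show ?thesis unfolding H_def using e0(2) by (simp add: insert_commute)
    next
      case False
      then have e1': "e \<in> edges G1" using e e1 by blast
      then have "gi e \<noteq> n" using b n bij_betwE by blast
      moreover have "ends K (gi e) = f ` ends G e" using iso(4)[OF e1'] unfolding gi_def by (simp add: G1_def)
      ultimately show ?thesis using False unfolding H_def by simp
    qed
    show "bd H (f v) = bd G v" if v: "v \<in> V" for v
    proof -
      have "f v = f u \<longleftrightarrow> v = u" "f v = f z \<longleftrightarrow> v = z" using K(2) uV zV v unfolding inj_on_def by auto
      then show ?thesis using K(6)[OF v] e0(3) unfolding H_def K(8) t_def by auto
    qed
  qed simp_all
  ultimately have "ADD G z x K (f z) (f x)" unfolding ADD_def using fne by blast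
  then show ?thesis using cl pr by blast
qed

subsection \<open>Uniform canvases\<close>

text \<open>A vertex that cannot lose \<open>t\<close> can lose \<open>-t\<close>, so by
  \<open>nm\<close> its neighbours off \<open>x\<close> and \<open>z\<close> cannot lose
  \<open>t\<close> either. By \<open>no_separation\<close> at \<open>x\<close> this spreads over all
  of \<open>V - {x, z}\<close>.\<close>

lemma uniform_sign:
  assumes c: crit and n: "card V \<ge> 4"
    and nm: "\<And>e u v. e \<in> edges G \<Longrightarrow> ends G e = {u, v} \<Longrightarrow> u \<notin> {x, z} \<Longrightarrow> v \<notin> {x, z} \<Longrightarrow>
      \<not> (can_lose G (-1) u \<and> can_lose G 1 v)"
  obtains t :: 3 where "t = 1 \<or> t = -1" "\<And>v. v \<in> V - {x, z} \<Longrightarrow> \<not> can_lose G t v"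
    "\<And>v. v \<in> V - {x, z} \<Longrightarrow> \<exists>e\<in>edges G. \<exists>w\<in>V - {x, z}. ends G e = {v, w} \<and> v \<noteq> w"
proof -
  let ?R = "V - {x, z}"
  have cR: "card ?R \<ge> 2" using n xV zV xz by (simp add: card_Diff_subset)
  have nb: "\<exists>e\<in>edges G. \<exists>w\<in>?R. ends G e = {v, w} \<and> v \<noteq> w" if v: "v \<in> ?R" for v
  proof (rule ccontr)
    assume no: "\<not> (\<exists>e\<in>edges G. \<exists>w\<in>?R. ends G e = {v, w} \<and> v \<noteq> w)"
    have "?R - {v} \<noteq> {}"
    proof
      assume "?R - {v} = {}"
      then have "?R \<subseteq> {v}" by blast
      then have "card ?R \<le> card {v}" by (rule card_mono[rotated]) simp
      then show False using cR by simp
    qed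
    then show False
    proof (rule no_separation[OF c xV xz, of "{v}", rotated 2])
      show "{v} \<subseteq> ?R" using v by blast
      fix e assume e: "e \<in> edges G" "ends G e \<inter> {v} \<noteq> {}"
      obtain a b where ab: "ends G e = {a, b}" "a \<noteq> b" "a \<in> V" "b \<in> V" using e(1) m by (rule multigraph_edgeE)
      show "ends G e \<inter> (?R - {v}) = {}"
      proof (rule ccontr)
        assume "ends G e \<inter> (?R - {v}) \<noteq> {}"
        then obtain w where "w \<in> ?R" "w \<noteq> v" "w \<in> ends G e" by blast
        moreover from this have "ends G e = {v, w}" using ab e(2) by auto
        ultimately show False using no e(1) by blast
      qed
    qed simp
  qed
  have step: "\<not> can_lose G t w" if "e \<in> edges G" "ends G e = {v, w}" "v \<in> ?R" "w \<in> ?R" "can_lose G (-t) v" "t = 1 \<or> t = -1"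
    for e v w and t :: 3
    using nm[of e v w] nm[of e w v] that by (auto simp: insert_commute)
  have "?R \<noteq> {}"
  proof
    assume "?R = {}"
    then show False using cR by (simp only: card.empty)
  qed
  then obtain r0 where r0: "r0 \<in> ?R" by blast
  obtain e0 r1 where e0: "e0 \<in> edges G" "r1 \<in> ?R" "ends G e0 = {r0, r1}" using nb[OF r0] by blast
  obtain t :: 3 where t: "t = 1 \<or> t = -1" "\<not> can_lose G t r1"
    using step[OF e0(1,3) r0 e0(2), of 1] step[OF e0(1,3) r0 e0(2), of "-1"] can_lose_one[of 1 G r0] by auto
  let ?K = "{v \<in> ?R. \<not> can_lose G t v}"
  have "?R - ?K = {}"
  proof (rule ccontr)
    assume ne: "?R - ?K \<noteq> {}"
    show False
    proof (rule no_separation[OF c xV xz, of ?K])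
      show "?K \<subseteq> ?R" by blast
      show "?K \<noteq> {}" using e0(2) t(2) by blast
      show "?R - ?K \<noteq> {}" by (rule ne)
      fix e assume e: "e \<in> edges G" "ends G e \<inter> ?K \<noteq> {}"
      obtain a b where ab: "ends G e = {a, b}" using e(1) m by (rule multigraph_edgeE)
      show "ends G e \<inter> (?R - ?K) = {}"
      proof (rule ccontr)
        assume "ends G e \<inter> (?R - ?K) \<noteq> {}"
        then obtain w where w: "w \<in> ?R" "w \<notin> ?K" "w \<in> ends G e" by blast
        obtain v where v: "v \<in> ?K" "v \<in> ends G e" using e(2) by blast
        have "ends G e = {v, w}" using ab v w by auto
        moreover have "can_lose G (-t) v" using can_lose_one[OF t(1), of G v] v by blast
        ultimately show False using step[OF e(1) _ _ w(1) _ t(1), of v] v w by blast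
      qed
    qed
  qed
  then show ?thesis using that[OF t(1) _ nb] by blast
qed

lemma residue_choice: "\<exists>a b. (a = 1 \<or> a = -1) \<and> (b = 1 \<or> b = -1) \<and> of_int (s + a + b) = (\<beta> :: 3)"
proof -
  have "of_int (s + 1 + 1) = \<beta> \<or> of_int (s + 1 + (-1)) = \<beta> \<or> of_int (s + (-1) + (-1)) = \<beta>"
    by (cases "of_int s :: 3" rule: Z3_cases; cases \<beta> rule: Z3_cases) simp_all
  then show ?thesis by blast
qed

text \<open>
  The idea is to contract \<open>x\<close> and \<open>z\<close> and to use the end \<open>w\<close> of the only edge between the tip and
  the rest as the new tip: the contracted vertex would then violate the degree bound.
\<close>

lemma two_tip_edges:
  assumes c: crit and n: "card V \<ge> 4" and d5: "\<And>v. v \<in> V - {x, z} \<Longrightarrow> d {v} \<ge> 5"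
  shows "\<exists>e e'. e \<noteq> e' \<and> e \<in> cross G {z} \<and> e' \<in> cross G {z} \<and> x \<notin> ends G e \<and> x \<notin> ends G e'"
proof (rule ccontr)
  assume no: "\<not> (\<exists>e e'. e \<noteq> e' \<and> e \<in> cross G {z} \<and> e' \<in> cross G {z} \<and> x \<notin> ends G e \<and> x \<notin> ends G e')"
  let ?R = "V - {x, z}"
  have cR: "card ?R = card V - 2" using xV zV xz by (simp add: card_Diff_subset)
  then have "?R \<noteq> {}" using n by fastforce
  then obtain r where r: "r \<in> ?R" by blast
  obtain w where w: "w \<in> ?R" "\<And>e. e \<in> cross G {z} \<Longrightarrow> x \<notin> ends G e \<Longrightarrow> w \<in> ends G e"
  proof (cases "\<exists>e\<in>cross G {z}. x \<notin> ends G e")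
    case True
    then obtain e where e: "e \<in> cross G {z}" "x \<notin> ends G e" by blast
    obtain u where u: "ends G e = {z, u}" "u \<noteq> z" "u \<in> V" using tip_edge[OF e(1)] by metis
    have "u \<in> ends G e'" if e': "e' \<in> cross G {z}" "x \<notin> ends G e'" for e'
    proof -
      have "e = e'" using no e e' by metis
      then show ?thesis using u(1) by blast
    qed
    then show ?thesis using that[of u] u e(2) by blast
  next
    case False
    then show ?thesis using that[OF r] by blast
  qed
  have wV: "w \<in> V" "w \<noteq> z" "w \<noteq> x" using w(1) by auto
  let ?F = "{e \<in> cross G {w}. z \<notin> ends G e}"
  have "card {e \<in> cross G {w}. z \<in> ends G e} \<le> 1"
  proof -
    have "{e \<in> cross G {w}. z \<in> ends G e} \<subseteq> {e \<in> cross G {z}. x \<notin> ends G e}"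
    proof
      fix e assume e: "e \<in> {e \<in> cross G {w}. z \<in> ends G e}"
      then have "ends G e = {w, other w e}" "e \<in> edges G" using other by auto
      then show "e \<in> {e \<in> cross G {z}. x \<notin> ends G e}" using e wV xz unfolding cross_def by auto
    qed
    then have "card {e \<in> cross G {w}. z \<in> ends G e} \<le> card {e \<in> cross G {z}. x \<notin> ends G e}"
      by (rule card_mono[rotated]) (use m in simp)
    moreover have "card {e \<in> cross G {z}. x \<notin> ends G e} \<le> Suc 0"
      by (subst card_le_Suc0_iff_eq) (use m no in auto)
    ultimately show ?thesis by simp
  qed
  moreover have "card (cross G {w}) \<ge> 5" using d5[OF w(1)] unfolding cutdeg_def .
  moreover have "card (cross G {w}) = card {e \<in> cross G {w}. z \<in> ends G e} + card ?F"
  proof -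
    have "cross G {w} = {e \<in> cross G {w}. z \<in> ends G e} \<union> ?F" by blast
    then show ?thesis using card_Un_disjoint[of "{e \<in> cross G {w}. z \<in> ends G e}" ?F] m by fastforce
  qed
  ultimately have "card ?F \<ge> 2" by linarith
  then obtain f1 f2 where f12: "f1 \<in> ?F" "f2 \<in> ?F" "f1 \<noteq> f2" by (rule two_elements)
  obtain h0 where h0: "orients G (edges G) h0" "\<And>e. e \<in> cross G {z} \<Longrightarrow> h0 e = \<psi> e"
    using orientation_exists[OF m, of "cross G {z}" \<psi>] \<psi>o unfolding orients_def by blast
  have e1: "f1 \<in> edges G" "ends G f1 = {w, other w f1}" "w \<noteq> other w f1" using other[of f1 w] f12 by auto
  have e2: "f2 \<in> edges G" "ends G f2 = {w, other w f2}" "w \<noteq> other w f2" using other[of f2 w] f12 by auto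
  have nz: "f1 \<notin> cross G {z}" "f2 \<notin> cross G {z}" using f12 unfolding cross_def by auto
  \<comment> \<open>The signs of two edges sum to any residue, so \<open>f1\<close> and
    \<open>f2\<close> can balance \<open>w\<close> without touching the tip edges.\<close>
  obtain a b where ab: "a = 1 \<or> a = -1" "b = 1 \<or> b = -1"
    "of_int ((net G h0 {w} - flux G h0 {w} f1 - flux G h0 {w} f2) + a + b) = bd G w" using residue_choice by blast
  obtain h1 where h1: "orients G (edges G) h1" "\<forall>e. e \<noteq> f1 \<longrightarrow> h1 e = h0 e" "net G h1 {w} = net G h0 {w} - flux G h0 {w} f1 + a"
    using flux_flip[OF h0(1) e1 ab(1)] by blast
  obtain h2 where h2: "orients G (edges G) h2" "\<forall>e. e \<noteq> f2 \<longrightarrow> h2 e = h1 e" "net G h2 {w} = net G h1 {w} - flux G h1 {w} f2 + b"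
    using flux_flip[OF h1(1) e2 ab(2)] by blast
  have "flux G h1 {w} f2 = flux G h0 {w} f2" using h1(2) f12(3) unfolding flux_def by auto
  then have "net G h2 {w} = (net G h0 {w} - flux G h0 {w} f1 - flux G h0 {w} f2) + a + b" using h1(3) h2(3) by simp
  then have b2: "balanced_on G h2 {w}" using ab(3) unfolding balanced_on_def by simp
  have h2z: "h2 e = \<psi> e" if "e \<in> cross G {z}" for e using h1(2) h2(2) h0(2) that nz by metis
  let ?P = "outer G {x, z}"
  have P: "partition_on V ?P" by (rule partition_outer) (use xV zV in auto)
  have wP: "{w} \<in> ?P" using w(1) unfolding outer_def by auto
  have nx: "\<not> ext G ?P {w} h2"
  proof
    assume "ext G ?P {w} h2"
    then obtain h where h: "orients G (edges G) h" "\<And>e. e \<in> cross G {w} \<Longrightarrow> h e \<in> {w} \<longleftrightarrow> h2 e \<in> {w}"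
      "\<And>A. A \<in> ?P \<Longrightarrow> balanced_on G h A" unfolding ext_def by blast
    define k where "k e = (if ends G e \<inter> ?R \<noteq> {} then h e else h0 e)" for e
    have "agrees k" unfolding agrees_def
    proof (intro conjI ballI)
      show "orients G (edges G) k" using h(1) h0(1) unfolding orients_def k_def by auto
      fix e assume e: "e \<in> cross G {z}"
      obtain u where u: "ends G e = {z, u}" "u \<noteq> z" "u \<in> V" "e \<in> edges G" using tip_edge[OF e] by metis
      show "k e = z \<longleftrightarrow> \<psi> e = z"
      proof (cases "u = x")
        case True
        then show ?thesis using u h0(2)[OF e] unfolding k_def by auto
      next
        case False
        then have "w \<in> ends G e" using w(2)[OF e] u xz by auto
        then have uw: "u = w" using u wV by auto
        then have "e \<in> cross G {w}" using u unfolding cross_def by auto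
        then have "h e = w \<longleftrightarrow> h2 e = w" using h(2) by simp
        moreover have "h e \<in> {z, w}" "h2 e \<in> {z, w}" using h(1) h2(1) u uw unfolding orients_def by auto
        moreover have "k e = h e" using u uw w(1) unfolding k_def by auto
        ultimately show ?thesis using h2z[OF e] wV by auto
      qed
    qed
    moreover have "balanced_on G k {v}" if v: "v \<in> V - {x, z}" for v
    proof -
      have "net G k {v} = net G h {v}" by (rule net_cong) (use v in \<open>auto simp: k_def cross_def\<close>)
      moreover have "balanced_on G h {v}" using h(3) v unfolding outer_def by blast
      ultimately show ?thesis unfolding balanced_on_def by simp
    qed
    ultimately show False by (rule no_flow[OF _ xV])
  qed
  \<comment> \<open>The order is now taken at the tip \<open>w\<close>. An edge at \<open>z\<close>
    that avoids \<open>w\<close> goes to \<open>x\<close> and vanishes inside \<open>{x, z}\<close>,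
    so no edge at \<open>z\<close> is counted.\<close>
  have sz: "card ?P + card {e \<in> edges G. \<not> (\<exists>C\<in>?P. ends G e \<subseteq> C) \<and> ends G e \<inter> {w} = {}} < N"
  proof -
    have "{e \<in> edges G. \<not> (\<exists>C\<in>?P. ends G e \<subseteq> C) \<and> ends G e \<inter> {w} = {}} \<subseteq> {e \<in> edges G. z \<notin> ends G e}"
    proof clarify
      fix e assume e: "e \<in> edges G" "\<not> (\<exists>C\<in>?P. ends G e \<subseteq> C)" "ends G e \<inter> {w} = {}" "z \<in> ends G e"
      then have ez: "e \<in> cross G {z}" using inc_cross[OF m, of z] unfolding inc_def by auto
      obtain u where u: "ends G e = {z, u}" using tip_edge[OF ez] by metis
      have "u = x" using w(2)[OF ez] e(3) u xz by auto
      then show False using e(2) u unfolding outer_def by auto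
    qed
    then have "card {e \<in> edges G. \<not> (\<exists>C\<in>?P. ends G e \<subseteq> C) \<and> ends G e \<inter> {w} = {}} \<le> card {e \<in> edges G. z \<notin> ends G e}"
      by (rule card_mono[rotated]) simp
    moreover have "card ?P < card V"
    proof (rule coarse_card[OF P])
      have "{x, z} \<in> ?P" unfolding outer_def by blast
      moreover have "{x, z} \<notin> singles" using xz by auto
      ultimately show "?P \<noteq> singles" by blast
    qed
    ultimately show ?thesis using size_eq unfolding ord_size_def by simp
  qed
  have both: "x \<in> A \<longleftrightarrow> z \<in> A" if "\<And>C. C \<in> ?P \<Longrightarrow> C \<subseteq> A \<or> C \<inter> A = {}" for A
    using that[of "{x, z}"] unfolding outer_def by blast
  obtain Q and K :: "(nat, nat) bgraph" and f g where K:
    "critical_partition G Q {w} h2" "coarser ?P Q" "quot f g G K" "fibres f G = Q"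
    "\<And>v. v \<in> V \<Longrightarrow> fibre f G {f v} = part_of Q v"
    "\<And>b. b \<in> {w} \<Longrightarrow> failing_canvas K (f b) (f \<circ> h2 \<circ> g) \<and> ord_size K (f b) < N"
    "\<And>A. A \<in> Q \<Longrightarrow> A \<noteq> {w} \<Longrightarrow> part_bound G Q {w} h2 A"
  proof (rule critical_quotient[OF T m total P wP nx preflow_of_flow[OF h2(1) b2] _ _ sz])
    show "bsum G A = 0" if "A \<subseteq> V - {w}" "cross G A = {}" for A using closed[of A] that by blast
    show "ok4 (d A) (bsum G A)" if a: "A \<subseteq> V - {w}" "A \<noteq> {}" "A \<noteq> V - {w}" "\<And>C. C \<in> ?P \<Longrightarrow> C \<subseteq> A \<or> C \<inter> A = {}" for A
    proof (cases "z \<in> A")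
      case False
      then show ?thesis using cut_ok4[of A] both[OF a(4)] a xV xz by blast
    next
      case True
      \<comment> \<open>Sets containing the old tip are treated through their complement, which
        avoids \<open>z\<close>.\<close>
      then have xA: "x \<in> A" using both[OF a(4)] by blast
      have AV: "A \<subseteq> V" using a(1) by blast
      have wC: "w \<in> V - A" using a(1) wV by blast
      have "V - A \<noteq> {w}" using a(1,3) wV by blast
      then have "card (V - A) \<ge> 2" using card_ge_2[OF _ wC] fin(1) by blast
      then have "ok6 (d (V - A)) (bsum G (V - A))" using cut_ok6[of "V - A"] True xA xV xz by blast
      then show ?thesis
        using ok6_imp_ok4(1) cutdeg_complement[OF m AV] bsum_complement[OF m total AV] by simp
    qed
  qed (rule that)
  have Q: "partition_on V Q" "{w} \<in> Q" using K(1) unfolding critical_partition_def by auto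
  obtain C where C: "C \<in> Q" "{x, z} \<subseteq> C" using K(2) unfolding coarser_def outer_def by blast
  have Cw: "C \<noteq> {w}" using C(2) wV by auto
  have CV: "C \<subseteq> V" by (rule part_subset[OF Q(1) C(1)])
  have p2: "preflow_on G {w} h2" by (rule preflow_of_flow[OF h2(1) b2])
  have wC: "w \<notin> C" "C \<noteq> V - {w}" using critical_partition_parts(1,3)[OF m total p2 K(1) C(1)] Cw by auto
  have "V - C \<noteq> {w}" using wC CV wV by blast
  then have c2: "card (V - C) \<ge> 2" using card_ge_2[of "V - C" w] wC wV fin(1) by blast
  \<comment> \<open>Seen from the old tip \<open>z\<close>, the complement of \<open>C\<close> is a
    proper set containing \<open>w\<close>; seen from the new tip \<open>w\<close>, the set
    \<open>C\<close> is a part. The two bounds exclude each other.\<close>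
  have "d {w} + 2 \<le> d (V - C)"
    by (rule restrict_deg(1)[OF _ _ _ c2]) (use C wC wV xV xz in auto)
  moreover have "d C + 2 \<le> d {w}" using K(7)[OF C(1) Cw] unfolding part_bound_def by blast
  ultimately show False using cutdeg_complement[OF m CV] by simp
qed

end

subsection \<open>Reversing and doubling an edge at the tip\<close>

text \<open>\<open>B\<close> is a switch: \<open>None \<in> B\<close> requests the parallel copy.
  One construction thus serves both the plain reversal and the outcome REM.\<close>

locale flipping = crit_flow G z N x \<psi>
  for G :: "('v, 'e) bgraph" and z N x \<psi> +
  fixes u :: 'v and e0 :: 'e and B :: "'e option set"
  assumes c: crit and e0: "e0 \<in> cross G {z}" "ends G e0 = {z, u}" "u \<noteq> z"
    and ok: "ok4 (d {u} + of_bool (None \<in> B)) (bd G u + (if None \<in> B then 0 else out_value e0))"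
begin

definition new_head :: 'v where
  "new_head = (if \<psi> e0 = z then u else z)"

text \<open>The change of net flow out of \<open>S\<close>: twice the new flux for the reversal,
  once more for the copy.\<close>

definition turn :: "'v set \<Rightarrow> int" where
  "turn S = (2 + of_bool (None \<in> B)) * flux G (\<lambda>_. new_head) S e0"

text \<open>
  The edge \<open>Some e0\<close> gets the other direction and, if \<open>None \<in> B\<close>, a parallel copy \<open>None\<close> with this
  direction is added: since \<open>-1 = 1 + 1\<close> modulo \<open>3\<close>, the boundary does not change in this case.
\<close>

definition D :: "('v, 'e option) bgraph" where
  "D = \<lparr>verts = V, edges = Some ` edges G \<union> (if None \<in> B then {None} else {}), ends = case_option (ends G e0) (ends G),
     bd = (\<lambda>v. bd G v + of_int (turn {v}))\<rparr>"

definition \<psi>D :: "'e option \<Rightarrow> 'v" where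
  "\<psi>D = case_option new_head (\<lambda>e. if e = e0 then new_head else \<psi> e)"

definition flip_of :: "('e option \<Rightarrow> 'v) \<Rightarrow> ('e \<Rightarrow> 'v) \<Rightarrow> bool" where
  "flip_of k h \<longleftrightarrow> h e0 = \<psi> e0 \<and> k (Some e0) = new_head \<and> (None \<in> B \<longrightarrow> k None = new_head) \<and>
     (\<forall>e\<in>edges G - {e0}. k (Some e) = h e)"

lemma D [simp]: "verts D = V" "edges D = Some ` edges G \<union> (if None \<in> B then {None} else {})"
  "ends D None = ends G e0" "ends D (Some e) = ends G e" "bd D v = bd G v + of_int (turn {v})"
  unfolding D_def by simp_all

lemma eG: "e0 \<in> edges G"
  by (rule crossD[OF e0(1)])

lemma uV: "u \<in> V"
  using tip_edge[OF e0(1)] e0(2,3) by (metis doubleton_eq_iff)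

lemma \<psi>e0: "\<psi> e0 = z \<or> \<psi> e0 = u"
  using \<psi>o e0 unfolding orients_def by auto

lemma new_head: "new_head = z \<and> \<psi> e0 = u \<or> new_head = u \<and> \<psi> e0 = z" "new_head \<in> ends G e0"
  using \<psi>e0 e0(2,3) unfolding new_head_def by auto

lemma mD: "multigraph D"
proof -
  have "ends D e \<subseteq> V \<and> card (ends D e) = 2" if "e \<in> edges D" for e
    using that m eG unfolding multigraph_def by (cases e) (auto split: if_splits)
  moreover have "finite (edges D)" by simp
  ultimately show ?thesis unfolding multigraph_def by (simp del: D(2))
qed

lemma cross_D: "Some e \<in> cross D S \<longleftrightarrow> e \<in> cross G S" "None \<in> cross D S \<longleftrightarrow> None \<in> B \<and> e0 \<in> cross G S"
  using eG unfolding cross_def by auto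

lemma cutdeg_D: "cutdeg D S = d S + (if None \<in> B \<and> ((u \<in> S) \<noteq> (z \<in> S)) then 1 else 0)"
proof -
  have e: "e0 \<in> cross G S \<longleftrightarrow> (u \<in> S) \<noteq> (z \<in> S)" using e0 eG unfolding cross_def by auto
  have "cross D S = Some ` cross G S \<union> (if None \<in> B \<and> ((u \<in> S) \<noteq> (z \<in> S)) then {None} else {})"
  proof (rule set_eqI)
    fix o' show "o' \<in> cross D S \<longleftrightarrow> o' \<in> Some ` cross G S \<union> (if None \<in> B \<and> ((u \<in> S) \<noteq> (z \<in> S)) then {None} else {})"
      using cross_D(1)[of _ S] cross_D(2)[of S] e by (cases o') auto
  qed
  then show ?thesis unfolding cutdeg_def using m by (auto simp: card_image)
qed

lemma flux_turn: "flux G (\<lambda>_. new_head) S e0 = - flux G \<psi> S e0"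
  unfolding flux_def e0(2) using new_head(1) e0(3) by auto

lemma turn_singles: assumes "S \<subseteq> V" shows "(\<Sum>v\<in>S. turn {v}) = turn S"
proof -
  obtain h where h: "orients G (edges G) h" "\<And>e. e \<in> {e0} \<Longrightarrow> h e = new_head"
    using orientation_exists[OF m, of "{e0}" "\<lambda>_. new_head"] new_head(2) by auto
  have f: "flux G (\<lambda>_. new_head) T e0 = flux G h T e0" for T unfolding flux_def using h(2) by simp
  have "finite S" using assms fin(1) by (rule finite_subset)
  then show ?thesis unfolding turn_def f sum_distrib_left[symmetric] using flux_sum_singles[OF m h(1) _ eG] by simp
qed

lemma bsum_D: "S \<subseteq> V \<Longrightarrow> bsum D S = bsum G S + of_int (turn S)"
  unfolding bsum_def turn_singles[symmetric] by (simp add: sum.distrib)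

lemma net_D:
  assumes f: "flip_of k h"
  shows "net D k S = net G h S + turn S"
proof -
  have fl: "flux D k S (Some e) = flux G (\<lambda>e. k (Some e)) S e" for e unfolding flux_def by simp
  have "net D k S = (\<Sum>e\<in>Some ` edges G. flux D k S e) + (if None \<in> B then flux D k S None else 0)"
    unfolding net_def by (auto simp: sum.union_disjoint)
  also have "(\<Sum>e\<in>Some ` edges G. flux D k S e) = (\<Sum>e\<in>edges G. flux G (\<lambda>e. k (Some e)) S e)"
    by (subst sum.reindex) (auto simp: fl)
  also have "\<dots> = flux G (\<lambda>_. new_head) S e0 + (\<Sum>e\<in>edges G - {e0}. flux G h S e)"
  proof -
    have "flux G (\<lambda>e. k (Some e)) S e0 = flux G (\<lambda>_. new_head) S e0" using f unfolding flip_of_def flux_def by simp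
    moreover have "(\<Sum>e\<in>edges G - {e0}. flux G (\<lambda>e. k (Some e)) S e) = (\<Sum>e\<in>edges G - {e0}. flux G h S e)"
      by (rule sum.cong) (use f in \<open>auto simp: flip_of_def flux_def\<close>)
    ultimately show ?thesis using sum.remove[OF fin(2) eG, of "flux G (\<lambda>e. k (Some e)) S"] by simp
  qed
  also have "(\<Sum>e\<in>edges G - {e0}. flux G h S e) = net G h S - flux G h S e0"
    unfolding net_def using sum.remove[OF fin(2) eG, of "flux G h S"] by simp
  also have "flux G h S e0 = - flux G (\<lambda>_. new_head) S e0"
    using f unfolding flux_turn by (simp add: flip_of_def flux_def)
  also have "(if None \<in> B then flux D k S None else 0) = of_bool (None \<in> B) * flux G (\<lambda>_. new_head) S e0"
    using f unfolding flip_of_def flux_def by simp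
  finally show ?thesis unfolding turn_def by (simp add: algebra_simps)
qed

lemma balanced_D: "flip_of k h \<Longrightarrow> S \<subseteq> V \<Longrightarrow> balanced_on D k S \<longleftrightarrow> balanced_on G h S"
  unfolding balanced_on_def using net_D bsum_D by simp

text \<open>Only edges at the tip are altered, and there the preflows fix the orientation, so
  extending orientations correspond through \<open>flip_of\<close>.\<close>

lemma ext_D:
  assumes Q: "\<And>A. A \<in> Q \<Longrightarrow> A \<subseteq> V"
  shows "ext D Q {z} \<psi>D \<longleftrightarrow> ext G Q {z} \<psi>"
proof
  assume "ext D Q {z} \<psi>D"
  then obtain k where k: "orients D (edges D) k" "\<And>e. e \<in> cross D {z} \<Longrightarrow> k e = z \<longleftrightarrow> \<psi>D e = z"
    "\<And>A. A \<in> Q \<Longrightarrow> balanced_on D k A" unfolding ext_def by auto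
  define h where "h e = (if e = e0 then \<psi> e0 else k (Some e))" for e
  have kS: "k (Some e) \<in> ends G e" if "e \<in> edges G" for e using k(1) that unfolding orients_def by force
  have c0: "Some e0 \<in> cross D {z}" using cross_D(1) e0(1) by blast
  have "k (Some e0) = new_head" using k(2)[OF c0] kS[OF eG] e0(2,3) new_head(1) unfolding \<psi>D_def by auto
  moreover have "k None = new_head" if "None \<in> B"
  proof -
    have "k None \<in> ends G e0" using k(1) that unfolding orients_def by force
    then show ?thesis using k(2)[of None] cross_D(2)[of "{z}"] that e0 new_head(1) unfolding \<psi>D_def by auto
  qed
  ultimately have f: "flip_of k h" unfolding flip_of_def h_def by auto
  have "orients G (edges G) h" using kS \<psi>o e0(1) unfolding orients_def h_def by auto
  moreover have "h e = z \<longleftrightarrow> \<psi> e = z" if "e \<in> cross G {z}" for e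
    using k(2)[of "Some e"] cross_D(1) that unfolding h_def \<psi>D_def by auto
  ultimately show "ext G Q {z} \<psi>" unfolding ext_def using k(3) balanced_D[OF f Q] by auto
next
  assume "ext G Q {z} \<psi>"
  then obtain h where h: "orients G (edges G) h" "\<And>e. e \<in> cross G {z} \<Longrightarrow> h e = z \<longleftrightarrow> \<psi> e = z"
    "\<And>A. A \<in> Q \<Longrightarrow> balanced_on G h A" unfolding ext_def by auto
  define k where "k = case_option new_head (\<lambda>e. if e = e0 then new_head else h e)"
  have "h e0 \<in> ends G e0" using h(1) eG unfolding orients_def by blast
  then have "h e0 = \<psi> e0" using h(2)[OF e0(1)] \<psi>e0 e0(2,3) by auto
  then have f: "flip_of k h" unfolding flip_of_def k_def by auto
  have "orients D (edges D) k" using h(1) new_head(2) unfolding orients_def k_def by auto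
  moreover have "k e = z \<longleftrightarrow> \<psi>D e = z" if "e \<in> cross D {z}" for e
    using h(2) cross_D(1) that unfolding k_def \<psi>D_def by (cases e) auto
  ultimately show "ext D Q {z} \<psi>D" unfolding ext_def using h(3) balanced_D[OF f Q] by (intro exI[of _ k]) (simp del: D(2))
qed

text \<open>The new flux at \<open>u\<close> is minus the old one, which is
  \<open>out_value e0\<close>. Modulo 3, twice the new flux is therefore the old one, and three
  times is 0.\<close>

lemma bd_D: "bd D u = bd G u + (if None \<in> B then 0 else out_value e0)" "v \<noteq> u \<Longrightarrow> v \<noteq> z \<Longrightarrow> bd D v = bd G v"
proof -
  have "bd D u = bd G u + (if None \<in> B then of_int (3 * flux G (\<lambda>_. new_head) {u} e0) else of_int (2 * flux G (\<lambda>_. new_head) {u} e0))"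
    unfolding D turn_def by simp
  moreover have "of_int (3 * a) = (0 :: 3)" for a :: int by (simp add: of_int_3_eq_0_iff del: of_int_mult)
  moreover have "of_int (2 * flux G (\<lambda>_. new_head) {u} e0) = out_value e0"
    using new_head(1) e0(2,3) unfolding flux_def out_value_def by auto
  ultimately show "bd D u = bd G u + (if None \<in> B then 0 else out_value e0)" by simp
  show "v \<noteq> u \<Longrightarrow> v \<noteq> z \<Longrightarrow> bd D v = bd G v" unfolding D turn_def flux_def e0(2) by simp
qed

lemma total_D: "bsum D (verts D) = 0"
  using bsum_D[of V] total uV zV e0 unfolding turn_def flux_def by simp

lemma pre_D: "preflow_on D {z} \<psi>D"
  unfolding preflow_on_def
proof
  show "orients D (cross D {z}) \<psi>D"
    unfolding orients_def
  proof
    fix e assume e: "e \<in> cross D {z}"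
    show "\<psi>D e \<in> ends D e"
      using e cross_D(1)[of _ "{z}"] \<psi>o new_head(2) unfolding orients_def \<psi>D_def by (cases e) auto
  qed
  have "flip_of \<psi>D \<psi>" unfolding flip_of_def \<psi>D_def by auto
  then show "balanced_on D \<psi>D {z}" using balanced_D pre_on zV unfolding preflow_on_def by simp
qed

lemma crit_D: "critical_partition D singles {z} \<psi>D"
  unfolding critical_partition_def D(1)
proof (intro conjI allI impI)
  show "partition_on V singles" by (rule partition_singles)
  show "{z} \<in> singles" using zV by blast
  show "\<not> ext D singles {z} \<psi>D" by (subst ext_D) (use nxs in auto)
  fix Q assume Q: "partition_on V Q" "{z} \<in> Q" "Q \<noteq> singles"
  show "ext D Q {z} \<psi>D" by (subst ext_D) (use crit_ext[OF c Q] part_subset[OF Q(1)] in auto)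
qed

lemma ok_D: "v \<in> V \<Longrightarrow> v \<noteq> z \<Longrightarrow> ok4 (cutdeg D {v}) (bd D v)"
proof (cases "v = u")
  case True
  then show ?thesis using ok e0(3) bd_D(1) cutdeg_D[of "{u}"] by (auto split: if_splits)
next
  case False
  assume v: "v \<in> V" "v \<noteq> z"
  then show ?thesis using ok_single[OF v] bd_D(2)[OF False v(2)] cutdeg_D[of "{v}"] False by (auto split: if_splits)
qed

lemma flipped_canvas:
  obtains K :: "(nat, nat) bgraph" and f g where "quot f g D K" "inj_on f V"
    "\<And>v. v \<in> V \<Longrightarrow> fibre f D {f v} = {v}" "failing_canvas K (f z) (f \<circ> \<psi>D \<circ> g)"
    "ord_size K (f z) = ord_size G z" "\<And>v. v \<in> V \<Longrightarrow> deg K (f v) = cutdeg D {v} \<and> bd K (f v) = bd D v"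
proof -
  have cl: "bsum D A = 0" if A: "A \<subseteq> V - {z}" "A \<noteq> {}" "A \<noteq> V - {z}" "cross D A = {}" for A
  proof -
    have "ok4 (d A) (bsum G A)" by (rule cut_ok4) (use A in auto)
    then have "d A \<ge> 4" unfolding ok4_def by auto
    moreover have "cutdeg D A = 0" using A(4) unfolding cutdeg_def by simp
    ultimately show ?thesis using cutdeg_D[of A] by simp
  qed
  obtain K :: "(nat, nat) bgraph" and f g where K: "quot f g D K" "inj_on f (verts D)"
    "\<And>v. v \<in> verts D \<Longrightarrow> fibre f D {f v} = {v}" "failing_canvas K (f z) (f \<circ> \<psi>D \<circ> g)"
    "ord_size K (f z) = ord_size D z" "\<And>v. v \<in> verts D \<Longrightarrow> deg K (f v) = cutdeg D {v} \<and> bd K (f v) = bd D v"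
    by (rule singles_failing_canvas[OF mD total_D _ pre_D, of thesis]) (use zV crit_D cl ok_D D(1) in \<open>auto simp del: D(2,5)\<close>)
  have "{e \<in> edges D. z \<notin> ends D e} = Some ` {e \<in> edges G. z \<notin> ends G e}" using e0(2) by (auto split: if_splits)
  then have "ord_size D z = ord_size G z" unfolding ord_size_def by (simp add: card_image)
  then show ?thesis using that[OF K(1) _ _ K(4)] K unfolding D(1) by simp
qed

lemma same_way_D:
  assumes y: "y \<in> cross G {z}" "x \<notin> ends G y" "y \<noteq> e0" "\<psi> y = z \<longleftrightarrow> \<psi> e0 = z" and ux: "u \<noteq> x"
  shows "\<not> one_way \<psi>D {z} {e \<in> cross D {z}. ends D e \<inter> {x} = {}}" "\<not> one_way \<psi>D {z} (cross D {z})"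
proof -
  have "Some e0 \<in> {e \<in> cross D {z}. ends D e \<inter> {x} = {}}" "Some y \<in> {e \<in> cross D {z}. ends D e \<inter> {x} = {}}"
    using y e0 ux xz cross_D(1) by auto
  moreover have "\<psi>D (Some e0) = z \<longleftrightarrow> \<psi>D (Some y) \<noteq> z" using y(3,4) new_head(1) e0(3) unfolding \<psi>D_def by auto
  ultimately show w: "\<not> one_way \<psi>D {z} {e \<in> cross D {z}. ends D e \<inter> {x} = {}}" unfolding one_way_def by blast
  then show "\<not> one_way \<psi>D {z} (cross D {z})" using one_way_subset[of \<psi>D "{z}" "cross D {z}"] by auto
qed

end

context crit_flow
begin

text \<open>
  Reversing an edge at the tip does not change the order, so a tight canvas of the same order with
  tip edges in both directions results.
\<close>

lemma flip_contradiction: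
  assumes c: crit and T12: "\<And>(K :: (nat, nat) bgraph) w \<psi>' v. failing_canvas K w \<psi>' \<Longrightarrow> v \<in> verts K \<Longrightarrow> v \<noteq> w \<Longrightarrow>
      ord_size K w = ord_size G z \<Longrightarrow> deg K v + 2 = deg K w \<Longrightarrow> same_way w \<psi>' {e \<in> inc K w. v \<notin> ends K e}"
    and e0: "e0 \<in> cross G {z}" "ends G e0 = {z, u}" "u \<noteq> z" and ux: "u \<noteq> x"
    and ok: "ok4 (d {u}) (bd G u + out_value e0)" and t: "d {x} + 2 = d {z}"
    and y: "y \<in> cross G {z}" "x \<notin> ends G y" "y \<noteq> e0" "\<psi> y = z \<longleftrightarrow> \<psi> e0 = z"
  shows False
proof -
  interpret flipping G z N x \<psi> u e0 "{}"
    by unfold_locales (use c e0 ok in auto)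
  obtain K :: "(nat, nat) bgraph" and f g where K: "quot f g D K" "inj_on f V"
    "\<And>v. v \<in> V \<Longrightarrow> fibre f D {f v} = {v}" "failing_canvas K (f z) (f \<circ> \<psi>D \<circ> g)"
    "ord_size K (f z) = ord_size G z" "\<And>v. v \<in> V \<Longrightarrow> deg K (f v) = cutdeg D {v} \<and> bd K (f v) = bd D v"
    by (rule flipped_canvas) (rule that)
  have dK: "deg K (f x) = d {x}" "deg K (f z) = d {z}" using K(6) xV zV cutdeg_D by auto
  have "f x \<in> verts K" "f x \<noteq> f z" using xV quot_verts[OF K(1)] K(2) zV xz unfolding inj_on_def by auto
  then have "same_way (f z) (f \<circ> \<psi>D \<circ> g) {e \<in> inc K (f z). f x \<notin> ends K e}"
    using T12[OF K(4)] K(5) dK t by simp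
  moreover have o: "orients D (cross D (fibre f D {f z})) \<psi>D" using pre_D K(3)[OF zV] unfolding preflow_on_def by simp
  ultimately show False
    using quot_same_way(2)[OF mD K(1) o, of "f x"] same_way_D(1)[OF y ux] unfolding K(3)[OF zV] K(3)[OF xV] by blast
qed

text \<open>All tip edges off \<open>x\<close> have one direction; reversing and doubling
  \<open>e0\<close> creates both, as the new easel may require. The degree of \<open>u\<close>
  changes parity while its boundary stays, so \<open>u\<close> can now lose \<open>t\<close> and its
  edge to \<open>w\<close> becomes mixed: the new canvas is not homogeneous and therefore
  precedes.\<close>

lemma outcome_REM:
  assumes c: crit and n: "card V \<ge> 4" and e: "easel_class k r G z x \<psi>" and hom: "homogeneous G z x"
    and e0: "e0 \<in> cross G {z}" "ends G e0 = {z, u}" "u \<noteq> z" and ux: "u \<noteq> x" and d5: "d {u} \<ge> 5"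
    and y: "y \<in> cross G {z}" "x \<notin> ends G y" "y \<noteq> e0"
    and out: "\<And>e. e \<in> cross G {z} \<Longrightarrow> x \<notin> ends G e \<Longrightarrow> out_value e = t"
    and t: "t = 1 \<or> t = -1" "\<not> can_lose G t u" and w: "w \<in> V - {x, z}" "f0 \<in> edges G" "ends G f0 = {u, w}" "u \<noteq> w" "\<not> can_lose G t w"
  shows "\<exists>(G' :: (nat, nat) bgraph) z' x' \<psi>'. (easel_class k r G' z' x' \<psi>' \<or> easel_class (k + 1) r G' z' x' \<psi>') \<and>
    prec G' z' x' G z x \<and> REM G z x G' z' x'"
proof -
  interpret flipping G z N x \<psi> u e0 "{None}"
    by unfold_locales (use c e0 d5 in \<open>auto simp: ok4_def\<close>)
  obtain K :: "(nat, nat) bgraph" and f g where K: "quot f g D K" "inj_on f V"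
    "\<And>v. v \<in> V \<Longrightarrow> fibre f D {f v} = {v}" "failing_canvas K (f z) (f \<circ> \<psi>D \<circ> g)"
    "ord_size K (f z) = ord_size G z" "\<And>v. v \<in> V \<Longrightarrow> deg K (f v) = cutdeg D {v} \<and> bd K (f v) = bd D v"
    by (rule flipped_canvas) (rule that)
  note ef = easel_facts[OF e]
  have dD: "cutdeg D {x} = d {x}" "cutdeg D {z} = d {z} + 1" "cutdeg D {u} = d {u} + 1" using e0 ux xz by (simp_all add: cutdeg_D)
  have ye: "\<psi> y = z \<longleftrightarrow> \<psi> e0 = z"
  proof -
    have "out_value y = out_value e0" using out[OF y(1,2)] out[OF e0(1)] e0 ux xz by simp
    then show ?thesis unfolding out_value_def by (auto split: if_splits)
  qed
  note sw = same_way_D[OF y ye ux]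
  \<comment> \<open>As the tip edges off \<open>x\<close> have one direction, the witness condition
    at tip degree \<open>k + 1\<close> rules out \<open>d {x} = k - 2 - r\<close>. The unit gained
    is what the class for \<open>k + 1\<close> asks for.\<close>
  have tight: "int (d {x}) \<ge> k - 1 - r" if "int (d {z}) = k + 1"
  proof -
    have "one_way \<psi> {z} {e \<in> cross G {z}. x \<notin> ends G e}"
    proof -
      have "\<psi> e = z \<longleftrightarrow> t = 1" if "e \<in> cross G {z}" "x \<notin> ends G e" for e
        using out[OF that] t(1) unfolding out_value_def by (auto split: if_splits)
      then show ?thesis unfolding one_way_def by auto
    qed
    then show ?thesis using ef(3,4) that by linarith
  qed
  have cl: "easel_class k' r K (f z) (f x) (f \<circ> \<psi>D \<circ> g)" if "int (d {z}) \<le> k'" "int (d {x}) \<ge> k' - 2 - r" for k'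
    by (rule class_quot[OF mD K(1,4) K(3)[OF zV] K(3)[OF xV]])
      (use zV xV xz pre_D dD sw that in \<open>auto simp: preflow_on_def\<close>)
  have cls: "easel_class k r K (f z) (f x) (f \<circ> \<psi>D \<circ> g) \<or> easel_class (k + 1) r K (f z) (f x) (f \<circ> \<psi>D \<circ> g)"
  proof (cases "int (d {z}) \<le> k")
    case True
    then show ?thesis using cl[of k] ef(3) by blast
  next
    case False
    then show ?thesis using cl[of "k + 1"] tight ef(1) by auto
  qed
  have mK: "multigraph K" by (rule quot_multigraph[OF mD K(1)])
  have i: "inj_on f (verts D)" using K(2) by simp
  note iso = singles_iso[OF mD K(1) i]
  define gi where "gi = inv_into (edges K) g"
  have b: "bij_betw gi (edges D) (edges K)" using iso(1) unfolding bgraph_iso_def gi_def by blast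
  have en: "ends K (gi e) = f ` ends D e" if "e \<in> edges D" for e unfolding gi_def by (rule iso(4)[OF that])
  have fne: "f u \<noteq> f z" "f u \<noteq> f x" "f w \<noteq> f z" "f w \<noteq> f x" "f u \<noteq> f w"
    using K(2) uV zV xV e0(3) ux w unfolding inj_on_def by auto
  have nh: "\<not> homogeneous K (f z) (f x)"
  proof -
    have bdD: "bd D u = bd G u" "bd D w = bd G w" using bd_D w by auto
    have "can_lose K t (f u)"
      using t K(6)[OF uV] dD(3) bdD(1) deg_cutdeg[OF m, of u] unfolding can_lose_def by auto
    moreover have "can_lose K (-t) (f w)"
    proof -
      have "can_lose G (-t) w" using can_lose_one[OF t(1), of G w] w(5) by blast
      moreover have "deg K (f w) = deg G w" using K(6)[of w] w deg_cutdeg[OF m] cutdeg_D[of "{w}"] by auto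
      ultimately show ?thesis using K(6)[of w] w(1) bdD(2) can_lose_cong[of G w K "f w"] by auto
    qed
    moreover have sf: "Some f0 \<in> edges D" using w(2) by simp
    moreover have "ends K (gi (Some f0)) = {f u, f w}" "ends K (gi (Some f0)) = {f w, f u}" using en[OF sf] w(3) by auto
    moreover have "gi (Some f0) \<in> edges K" using bij_betwE[OF b] sf by blast
    ultimately have "mixed K (f z) (gi (Some f0))"
      unfolding mixed_def friendly_iff using t(1) fne(1,3) by (elim disjE) (simp_all, blast+)
    moreover have "f x \<notin> ends K (gi (Some f0))" using en[OF sf] w(3) fne by auto
    ultimately show ?thesis unfolding homogeneous_def by blast
  qed
  have pr: "prec K (f z) (f x) G z x" unfolding prec_def using K(5) hom nh by blast
  define H where "H = K\<lparr>edges := edges K - {gi None}\<rparr>"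
  have N: "None \<in> edges D" "Some e0 \<in> edges D" using eG by auto
  have "tip_reduction K (f z) (f u) H"
    unfolding tip_reduction_def
  proof (intro conjI bexI)
    show "f u \<in> verts K" using uV quot_verts[OF K(1)] by simp
    show "gi None \<noteq> gi (Some e0)" using b N unfolding bij_betw_def inj_on_def by blast
    show "ends K (gi None) = {f z, f u}" "ends K (gi (Some e0)) = {f z, f u}" using en[OF N(1)] en[OF N(2)] e0(2) by simp_all
    show "gi None \<in> edges K" "gi (Some e0) \<in> edges K" using bij_betwE[OF b] N by blast+
  qed (use fne H_def in simp_all)
  moreover have "pointed_iso G z x H (f z) (f x)"
    unfolding pointed_iso_def bgraph_iso_def
  proof (intro exI[of _ f] exI[of _ "\<lambda>e. gi (Some e)"] conjI ballI)
    show "bij_betw f V (verts H)" using iso(1) unfolding bgraph_iso_def H_def by simp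
    have "bij_betw gi (edges D - {None}) (edges K - {gi None})"
      using b N(1) unfolding bij_betw_def
      by (simp add: inj_on_image_set_diff[of gi "edges D" "edges D" "{None}"] inj_on_diff del: D(2))
    moreover have "edges D - {None} = Some ` edges G" by auto
    moreover have "bij_betw Some (edges G) (Some ` edges G)" by (simp add: bij_betw_def)
    ultimately show "bij_betw (\<lambda>e. gi (Some e)) (edges G) (edges H)"
      unfolding H_def using bij_betw_trans[of Some "edges G" "Some ` edges G" gi] by (simp add: comp_def)
    show "ends H (gi (Some e)) = f ` ends G e" if "e \<in> edges G" for e using en[of "Some e"] that unfolding H_def by simp
    show "bd H (f v) = bd G v" if v: "v \<in> V" for v
    proof -
      have "turn {v} = 3 * flux G (\<lambda>_. new_head) {v} e0" unfolding turn_def by simp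
      then have "of_int (turn {v}) = (0 :: 3)" by (simp add: of_int_3_eq_0_iff del: of_int_mult)
      then show ?thesis using K(6)[OF v] unfolding H_def by simp
    qed
  qed simp_all
  ultimately have "REM G z x K (f z) (f x)" unfolding REM_def using fne by blast
  then show ?thesis using cls pr by blast
qed

end

section \<open>One reduction step\<close>

context crit_flow
begin

lemma out_value_cases: "out_value e = 1 \<or> out_value e = -1"
  unfolding out_value_def by simp

text \<open>With only two vertices, balance at the tip would already force balance at
  \<open>x\<close>.\<close>

lemma card_V_ge_3: "card V \<ge> 3"
proof (rule ccontr)
  assume "\<not> card V \<ge> 3"
  then have c: "card V \<le> card {x, z}" using xz by simp
  have V: "V = {x, z}" using card_seteq[OF fin(1) _ c] xV zV by blast
  obtain h0 where h0: "orients G (edges G) h0" "\<And>e. e \<in> cross G {z} \<Longrightarrow> h0 e = \<psi> e"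
    using orientation_exists[OF m, of "cross G {z}" \<psi>] \<psi>o unfolding orients_def by blast
  then have "agrees h0" unfolding agrees_def by simp
  then show False by (rule no_flow[OF _ xV]) (use V in auto)
qed

lemma crit_preflow_critical: "crit \<Longrightarrow> preflow_critical G z \<psi>"
proof -
  assume c: crit
  have "extends_in_contraction G z Q \<psi>" if Q: "tip_respecting G z Q" "nontrivial Q" for Q
  proof -
    have P: "partition_on V Q" "{z} \<in> Q" using Q(1) unfolding tip_respecting_def by auto
    have "Q \<noteq> singles" using Q(2) unfolding nontrivial_def by auto
    then have "ext G Q {z} \<psi>" by (rule crit_ext[OF c P])
    then show ?thesis using eic_ext[OF m Q(1)] pre unfolding tip_preflow_def by blast
  qed
  then show ?thesis unfolding preflow_critical_def using nx by blast
qed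

text \<open>A mixed edge that avoids \<open>x\<close>, expressed by \<open>can_lose\<close>;
  deleting it keeps its ends tame as soon as their degrees exceed four.\<close>

definition lossy_edge :: bool where
  "lossy_edge \<longleftrightarrow> (\<exists>e\<in>edges G. \<exists>u v. ends G e = {u, v} \<and> u \<notin> {x, z} \<and> v \<notin> {x, z} \<and> can_lose G (-1) u \<and> can_lose G 1 v)"

lemma homogeneous_if_not_lossy: "\<not> lossy_edge \<Longrightarrow> homogeneous G z x"
  unfolding lossy_edge_def homogeneous_def mixed_def friendly_iff
proof clarify
  fix e u v assume "\<not> (\<exists>e\<in>edges G. \<exists>u v. ends G e = {u, v} \<and> u \<notin> {x, z} \<and> v \<notin> {x, z} \<and> can_lose G (-1) u \<and> can_lose G 1 v)"
    and e: "e \<in> edges G" "ends G e = {u, v}" "u \<noteq> z" "v \<noteq> z" "can_lose G (-1) u" "can_lose G 1 v"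
  then have "u = x \<or> v = x" by blast
  then show "x \<in> ends G e" using e(2) by blast
qed

lemma lossy_ok:
  assumes "v \<in> V" "v \<noteq> z" "d {v} \<ge> 5" "can_lose G t v" "t = 1 \<or> t = -1"
  shows "ok4 (d {v} - 1) (bd G v - t)"
  using can_lose_ok4[of G v t] assms ok_single[of v] deg_cutdeg[OF m] by simp

text \<open>The tip edges off \<open>x\<close> must follow the sign of \<open>uniform_sign\<close>:
  their ends can lose \<open>-t\<close>, so by \<open>na\<close> the flow out of these ends is not
  \<open>-t\<close>.\<close>

lemma uniform_canvas:
  assumes c: crit and n: "card V \<ge> 4" and d5: "\<And>v. v \<in> V - {x, z} \<Longrightarrow> d {v} \<ge> 5" and nl: "\<not> lossy_edge"
    and na: "\<And>e u. e \<in> cross G {z} \<Longrightarrow> ends G e = {z, u} \<Longrightarrow> u \<noteq> z \<Longrightarrow> u \<noteq> x \<Longrightarrow> \<not> can_lose G (out_value e) u"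
  obtains t :: 3 where "t = 1 \<or> t = -1" "\<And>v. v \<in> V - {x, z} \<Longrightarrow> \<not> can_lose G t v"
    "\<And>e. e \<in> cross G {z} \<Longrightarrow> x \<notin> ends G e \<Longrightarrow> out_value e = t"
    "\<And>v. v \<in> V - {x, z} \<Longrightarrow> \<exists>e\<in>edges G. \<exists>w\<in>V - {x, z}. ends G e = {v, w} \<and> v \<noteq> w"
proof -
  have nm: "\<not> (can_lose G (-1) u \<and> can_lose G 1 v)"
    if "e \<in> edges G" "ends G e = {u, v}" "u \<notin> {x, z}" "v \<notin> {x, z}" for e u v using nl that unfolding lossy_edge_def by blast
  obtain t :: 3 where t: "t = 1 \<or> t = -1" "\<And>v. v \<in> V - {x, z} \<Longrightarrow> \<not> can_lose G t v"
    "\<And>v. v \<in> V - {x, z} \<Longrightarrow> \<exists>e\<in>edges G. \<exists>w\<in>V - {x, z}. ends G e = {v, w} \<and> v \<noteq> w"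
    by (rule uniform_sign[OF c n nm]) (assumption+, rule that)
  have "out_value e = t" if e: "e \<in> cross G {z}" "x \<notin> ends G e" for e
  proof -
    obtain u where u: "ends G e = {z, u}" "u \<noteq> z" "u \<in> V" using tip_edge[OF e(1)] by metis
    have ux: "u \<noteq> x" using u e(2) by blast
    have "\<not> can_lose G t u" using t(2)[of u] u ux by blast
    moreover have "\<not> can_lose G (out_value e) u" using na[OF e(1) u(1,2) ux] .
    ultimately show ?thesis using can_lose_one[OF t(1), of G u] out_value_cases[of e] t(1) by auto
  qed
  from that[OF t(1,2) this t(3)] show ?thesis by blast
qed

text \<open>When no earlier reduction applies, the hypotheses of REM are met, with
  \<open>two_tip_edges\<close> supplying the second tip edge. The case of three vertices is reported
  together with \<open>crit\<close>, since \<open>three_vertices\<close> relies on it.\<close>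

lemma step:
  assumes e: "easel_class k r G z x \<psi>" and r: "r \<ge> -1"
  shows "(card V = 3 \<and> crit)
      \<or> (\<exists>(G' :: (nat, nat) bgraph) z' x' \<psi>'.
           easel_class k r G' z' x' \<psi>' \<and> prec G' z' x' G z x \<and>
           (EXP k r G z x G' z' x' \<or> EXPA k r G z x G' z' x' \<or> EXPX k r G z x G' z' x' \<or>
            EXPB k r G z x G' z' x' \<or> ADD G z x G' z' x'))
      \<or> (\<exists>(G' :: (nat, nat) bgraph) z' x' \<psi>'.
           (easel_class k r G' z' x' \<psi>' \<or> easel_class (k + 1) r G' z' x' \<psi>') \<and>
           prec G' z' x' G z x \<and> REM G z x G' z' x')" (is ?all)
    and "\<exists>v\<in>V. v \<noteq> z \<and> v \<noteq> x \<and> d {v} = 4 \<Longrightarrow> card V = 3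
      \<or> (\<exists>(G' :: (nat, nat) bgraph) z' x' \<psi>'.
           easel_class k r G' z' x' \<psi>' \<and> prec G' z' x' G z x \<and>
           (EXP k r G z x G' z' x' \<or> EXPA k r G z x G' z' x' \<or> EXPX k r G z x G' z' x'))" (is "?four \<Longrightarrow> ?fours")
proof -
  have n: "card V \<ge> 4" if "card V \<noteq> 3" using that card_V_ge_3 by linarith
  show four: ?fours if ?four
  proof (cases "card V \<noteq> 3 \<and> crit")
    case True
    then show ?thesis using that outcome_EXPA[OF _ _ e r] n by blast
  next
    case False
    then show ?thesis using outcome_EXP[OF e] by blast
  qed
  show ?all
  proof (cases "card V = 3 \<or> \<not> crit \<or> ?four")
    case True
    show ?thesis
    proof (cases crit)
      case c: True
      show ?thesis
      proof (cases "card V = 3")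
        case False
        then have ?fours using True c four by blast
        then show ?thesis using False by blast
      qed (use c in blast)
    next
      case False
      then show ?thesis using outcome_EXP[OF e False] by blast
    qed
  next
    case False
    then have c: crit and n4: "card V \<ge> 4" using n by blast+
    have d5: "d {v} \<ge> 5" if v: "v \<in> V - {x, z}" for v
    proof -
      have "d {v} \<noteq> 4" using False v by blast
      then show ?thesis using deg4[of v] v by auto
    qed
    show ?thesis
    proof (cases lossy_edge)
      case True
      then obtain e1 u v where l: "e1 \<in> edges G" "ends G e1 = {u, v}" "u \<notin> {x, z}" "v \<notin> {x, z}"
        "can_lose G (-1) u" "can_lose G 1 v" unfolding lossy_edge_def by blast
      obtain a b where ab: "ends G e1 = {a, b}" "a \<noteq> b" "a \<in> V" "b \<in> V" using l(1) m by (rule multigraph_edgeE)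
      have uv: "u \<in> V" "v \<in> V" "u \<noteq> v" using ab l(2) by (auto simp: doubleton_eq_iff)
      have "ok4 (d {v} - 1) (bd G v - 1)" by (rule lossy_ok) (use uv l d5[of v] in auto)
      moreover have "ok4 (d {u} - 1) (bd G u - (-1))" by (rule lossy_ok) (use uv l d5[of u] in auto)
      \<comment> \<open>The end \<open>u\<close> loses -1 and \<open>v\<close> loses 1, so the edge
        is directed from \<open>v\<close> to \<open>u\<close>.\<close>
      ultimately show ?thesis using outcome_EXPB[OF c e l(1), of v u] l uv by (simp add: insert_commute) blast
    next
      case nl: False
      note hom = homogeneous_if_not_lossy[OF nl]
      show ?thesis
      proof (cases "\<exists>e u. e \<in> cross G {z} \<and> ends G e = {z, u} \<and> u \<noteq> z \<and> u \<noteq> x \<and> can_lose G (out_value e) u")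
        case True
        then obtain e0 u where e0: "e0 \<in> cross G {z}" "ends G e0 = {z, u}" "u \<noteq> z" "u \<noteq> x" "can_lose G (out_value e0) u" by blast
        have uV: "u \<in> V" using tip_edge[OF e0(1)] e0(2,3) by (metis doubleton_eq_iff)
        have "ok4 (d {u} - 1) (bd G u - out_value e0)" by (rule lossy_ok) (use uV e0 d5[of u] out_value_cases in auto)
        then show ?thesis using outcome_ADD[OF c e hom e0(1-4)] by blast
      next
        case False
        obtain t :: 3 where t: "t = 1 \<or> t = -1" "\<And>v. v \<in> V - {x, z} \<Longrightarrow> \<not> can_lose G t v"
          "\<And>e. e \<in> cross G {z} \<Longrightarrow> x \<notin> ends G e \<Longrightarrow> out_value e = t"
          "\<And>v. v \<in> V - {x, z} \<Longrightarrow> \<exists>e\<in>edges G. \<exists>w\<in>V - {x, z}. ends G e = {v, w} \<and> v \<noteq> w"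
          by (rule uniform_canvas[OF c n4 d5 nl]) (assumption, use False in blast, rule that)
        obtain e0 y where ey: "e0 \<noteq> y" "e0 \<in> cross G {z}" "y \<in> cross G {z}" "x \<notin> ends G e0" "x \<notin> ends G y"
          using two_tip_edges[OF c n4 d5] by blast
        obtain u where u: "ends G e0 = {z, u}" "u \<noteq> z" "u \<in> V" using tip_edge[OF ey(2)] by metis
        have uR: "u \<in> V - {x, z}" using u ey(4) by auto
        obtain f0 w where w: "w \<in> V - {x, z}" "f0 \<in> edges G" "ends G f0 = {u, w}" "u \<noteq> w" using t(4)[OF uR] by blast
        have ux: "u \<noteq> x" using uR by simp
        show ?thesis
          using outcome_REM[OF c n4 e hom ey(2) u(1,2) ux d5[OF uR] ey(3,5) ey(1)[symmetric] t(3,1) t(2)[OF uR] w t(2)[OF w(1)]]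
          by blast
      qed
    qed
  qed
qed

text \<open>The third vertex \<open>u\<close> has at most one edge to \<open>x\<close>, so \<open>d
  {z} = d {x} + d {u} - 2 * ebt G {x} {u} \<ge> d {x} + 4 - 2\<close>. Equality means
  \<open>d {u} = 4\<close> with an edge to \<open>x\<close>, and then
  \<open>deg4_tip_edges_same_way\<close> applies at \<open>u\<close>.\<close>

lemma three_vertices:
  assumes n: "card V = 3" and c: crit
  shows "d {x} + 2 \<le> d {z}" "d {x} + 2 = d {z} \<Longrightarrow> one_way \<psi> {z} {e \<in> cross G {z}. x \<notin> ends G e}"
    "d {x} + 2 = d {z} \<Longrightarrow> v \<in> V \<Longrightarrow> v \<notin> {x, z} \<Longrightarrow> d {v} = 4"
proof -
  have "card (V - {x, z}) = 1" using n xV zV xz by (simp add: card_Diff_subset)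
  then obtain u where "V - {x, z} = {u}" by (rule card_1_singletonE)
  then have V: "V = {x, z, u}" and u: "u \<noteq> x" "u \<noteq> z" "u \<in> V" using xV zV by auto
  have "ebt G {x} {u} \<le> 1"
  proof -
    have "e = e'" if "e \<in> edges G" "e' \<in> edges G" "x \<in> ends G e" "u \<in> ends G e" "x \<in> ends G e'" "u \<in> ends G e'" for e e'
    proof -
      have "ends G e'' = {x, u}" if e'': "e'' \<in> edges G" "x \<in> ends G e''" "u \<in> ends G e''" for e''
      proof -
        obtain a b where "ends G e'' = {a, b}" using e''(1) m by (rule multigraph_edgeE)
        then show ?thesis using e'' u by auto
      qed
      then show ?thesis using no_parallel[OF c xV u(3) xz u(2) u(1)[symmetric]] that by blast
    qed
    then have "card {e \<in> edges G. ends G e \<inter> {x} \<noteq> {} \<and> ends G e \<inter> {u} \<noteq> {}} \<le> Suc 0"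
      by (subst card_le_Suc0_iff_eq) auto
    then show ?thesis unfolding ebt_def by simp
  qed
  moreover have "d ({x} \<union> {u}) + 2 * ebt G {x} {u} = d {x} + d {u}" by (rule cutdeg_Un[OF m]) (use u in auto)
  moreover have "d ({x} \<union> {u}) = d {z}"
  proof -
    have "V - {z} = {x} \<union> {u}" using V u xz by auto
    then show ?thesis using cutdeg_complement[OF m, of "{z}"] zV by simp
  qed
  moreover have "d {u} \<ge> 4" by (rule deg4) (use u in auto)
  ultimately have 1: "d {x} + 2 \<le> d {z}" "d {x} + 2 = d {z} \<Longrightarrow> d {u} = 4 \<and> ebt G {x} {u} = 1" by linarith+
  show "d {x} + 2 \<le> d {z}" by (rule 1)
  show "d {x} + 2 = d {z} \<Longrightarrow> v \<in> V \<Longrightarrow> v \<notin> {x, z} \<Longrightarrow> d {v} = 4" using 1(2) V by auto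
  assume t: "d {x} + 2 = d {z}"
  have "{e \<in> edges G. ends G e \<inter> {x} \<noteq> {} \<and> ends G e \<inter> {u} \<noteq> {}} \<noteq> {}"
    using 1(2)[OF t] unfolding ebt_def by (metis card.empty zero_neq_one)
  then obtain e0 where e0: "e0 \<in> edges G" "x \<in> ends G e0" "u \<in> ends G e0" by blast
  obtain a b where "ends G e0 = {a, b}" using e0(1) m by (rule multigraph_edgeE)
  then have "ends G e0 = {x, u}" using u(1) e0 by auto
  then have e0': "e0 \<in> cross G {u}" "z \<notin> ends G e0" using e0(1) u xz unfolding cross_def by auto
  have "\<psi> e = z \<longleftrightarrow> \<psi> e' = z" if "e \<in> cross G {z}" "x \<notin> ends G e" "e' \<in> cross G {z}" "x \<notin> ends G e'" for e e'
  proof -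
    have "e'' \<in> cross G {u}" "z \<in> ends G e''" if e'': "e'' \<in> cross G {z}" "x \<notin> ends G e''" for e''
    proof -
      obtain w where w: "ends G e'' = {z, w}" "w \<noteq> z" "w \<in> V" "e'' \<in> edges G" using tip_edge[OF e''(1)] by metis
      then have "w = u" using V e''(2) by auto
      then show "e'' \<in> cross G {u}" "z \<in> ends G e''" using w unfolding cross_def by auto
    qed
    then show ?thesis using deg4_tip_edges_same_way[OF c u(3,2) _ e0'] 1(2)[OF t] that by blast
  qed
  then show "one_way \<psi> {z} {e \<in> cross G {z}. x \<notin> ends G e}" unfolding one_way_def by blast
qed

end

section \<open>The descent at \<open>r = -1\<close>\<close>

definition measure_of :: "('v, 'e) bgraph \<Rightarrow> 'v \<Rightarrow> 'v \<Rightarrow> nat" where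
  "measure_of G z x = (if homogeneous G z x then Suc (deg G z) else 0)"

text \<open>At equal order, \<open>measure_of\<close> packs the clauses on homogeneity and on the
  tip degree into one number, which gives the descent its well-founded measure.\<close>

lemma prec_cases: "prec G1 z1 x1 G2 z2 x2 \<Longrightarrow>
  ord_size G1 z1 < ord_size G2 z2 \<or> ord_size G1 z1 = ord_size G2 z2 \<and> measure_of G1 z1 x1 < measure_of G2 z2 x2"
  unfolding prec_def measure_of_def by auto

lemma crit_flow_of_failing_canvas:
  assumes "failing_canvas G z \<psi>" "tip_bound_below (ord_size G z)" "x \<in> verts G" "x \<noteq> z"
  shows "crit_flow G z (ord_size G z) x \<psi>"
  using assms unfolding failing_canvas_def by unfold_locales auto

lemma easel_failing_canvas: "easel_class k r G z x \<psi> \<Longrightarrow> failing_canvas G z \<psi> \<and> x \<in> verts G \<and> x \<noteq> z"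
  unfolding easel_class_def easel_def tallness_witness_def tallness_witnessing_def failing_canvas_def by blast

lemma tip_bound_no_easel: assumes "tip_bound G z x \<psi>" shows "\<not> easel_class k (-1) G z x \<psi>"
proof
  assume "easel_class k (-1) G z x \<psi>"
  then have e: "int (deg G z) \<le> k + 1" "int (deg G x) \<ge> k - 2 - -1"
    "int (deg G x) = k - 2 - -1 \<and> int (deg G z) = k + 1 \<longrightarrow> \<not> same_way z \<psi> {e \<in> inc G z. x \<notin> ends G e}"
    unfolding easel_class_def tallness_witness_def by blast+
  have t: "deg G x + 2 \<le> deg G z" "deg G x + 2 = deg G z \<longrightarrow> same_way z \<psi> {e \<in> inc G z. x \<notin> ends G e}"
    using assms unfolding tip_bound_def by blast+
  show False using e t by linarith
qed

text \<open>\<open>k\<close> is chosen to fit the violation: \<open>deg G z - 1\<close> if only the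
  same-way clause fails, which is the extreme case, and \<open>deg G z\<close> if the inequality
  fails, where directions are unconstrained.\<close>

lemma easel_if_not_tip_bound:
  assumes t: "failing_canvas G z \<psi>" "x \<in> verts G" "x \<noteq> z"
    and n: "\<not> (deg G x + 2 \<le> deg G z \<and> (deg G x + 2 = deg G z \<longrightarrow> same_way z \<psi> {e \<in> inc G z. x \<notin> ends G e}))"
  shows "\<exists>k. easel_class k (-1) G z x \<psi>"
proof (cases "deg G x + 2 \<le> deg G z")
  case True
  then have e: "deg G x + 2 = deg G z" "\<not> same_way z \<psi> {e \<in> inc G z. x \<notin> ends G e}" using n by auto
  then have "\<not> same_way z \<psi> (inc G z)" unfolding same_way_def by blast
  then have "easel_class (int (deg G z) - 1) (-1) G z x \<psi>"
    using t e unfolding failing_canvas_def easel_class_def easel_def tallness_witness_def tallness_witnessing_def by auto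
  then show ?thesis by blast
next
  case False
  then have "easel_class (int (deg G z)) (-1) G z x \<psi>"
    using t unfolding failing_canvas_def easel_class_def easel_def tallness_witness_def tallness_witnessing_def by auto
  then show ?thesis by blast
qed

text \<open>Apart from critical canvases on three vertices, \<open>step\<close> always provides a
  preceding easel, again with \<open>r = -1\<close>. A smaller order contradicts \<open>T\<close>,
  and at equal order the measure drops. \<open>k\<close> is arbitrary in the induction because REM
  may raise it.\<close>

lemma no_easel_at:
  assumes T: "tip_bound_below N"
  shows "ord_size G z = N \<Longrightarrow> \<not> easel_class k (-1) (G :: (nat, nat) bgraph) z x \<psi>"
proof (induction "measure_of G z x" arbitrary: G z x \<psi> k rule: less_induct)
  case less
  show ?case
  proof
    assume e: "easel_class k (-1) G z x \<psi>"
    note t = easel_failing_canvas[OF e]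
    interpret crit_flow G z "ord_size G z" x \<psi>
      by (rule crit_flow_of_failing_canvas) (use t T less.prems in auto)
    have no: "\<not> easel_class k' (-1) G' z' x' \<psi>'" if "prec G' z' x' G z x" for k' and G' :: "(nat, nat) bgraph" and z' x' \<psi>'
    proof
      assume e': "easel_class k' (-1) G' z' x' \<psi>'"
      show False
      proof (cases "ord_size G' z' < ord_size G z")
        case True
        then have "tip_bound G' z' x' \<psi>'" using easel_failing_canvas[OF e'] T less.prems unfolding tip_bound_below_def by blast
        from tip_bound_no_easel[OF this] show False using e' by blast
      next
        case False
        then show False using prec_cases[OF that] less.hyps less.prems e' by metis
      qed
    qed
    have "card V = 3 \<and> crit" using step(1)[OF e] no by blast
    then have "d {x} + 2 \<le> d {z}" "d {x} + 2 = d {z} \<Longrightarrow> one_way \<psi> {z} {e \<in> cross G {z}. x \<notin> ends G e}"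
      using three_vertices by blast+
    moreover note easel_facts[OF e]
    ultimately show False by auto
  qed
qed

section \<open>Equality in the degree bound\<close>

context crit_flow
begin

lemma ebt_le_1:
  assumes c: crit and ab: "a \<in> V" "b \<in> V" "a \<noteq> z" "b \<noteq> z" "a \<noteq> b"
  shows "ebt G {a} {b} \<le> 1"
proof -
  have en: "ends G e = {a, b}" if e: "e \<in> edges G" "a \<in> ends G e" "b \<in> ends G e" for e
  proof -
    obtain a' b' where "ends G e = {a', b'}" using e(1) m by (rule multigraph_edgeE)
    then show ?thesis using e ab by auto
  qed
  have "card {e \<in> edges G. ends G e \<inter> {a} \<noteq> {} \<and> ends G e \<inter> {b} \<noteq> {}} \<le> Suc 0"
    by (subst card_le_Suc0_iff_eq) (auto intro: no_parallel[OF c ab] dest: en)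
  then show ?thesis unfolding ebt_def by simp
qed

lemma ebt_insert:
  assumes "v \<notin> T" "S \<inter> insert v T = {}"
  shows "ebt G S (insert v T) = ebt G S {v} + ebt G S T"
proof -
  let ?E = "\<lambda>T. {e \<in> edges G. ends G e \<inter> S \<noteq> {} \<and> ends G e \<inter> T \<noteq> {}}"
  have "?E {v} \<inter> ?E T = {}"
  proof (rule ccontr)
    assume "?E {v} \<inter> ?E T \<noteq> {}"
    then obtain e where e: "e \<in> edges G" "ends G e \<inter> S \<noteq> {}" "v \<in> ends G e" "ends G e \<inter> T \<noteq> {}" by blast
    obtain a b where "ends G e = {a, b}" using e(1) m by (rule multigraph_edgeE)
    then show False using e assms by auto
  qed
  moreover have "?E (insert v T) = ?E {v} \<union> ?E T" by blast
  ultimately show ?thesis unfolding ebt_def by (simp add: card_Un_disjoint)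
qed

lemma ebt_sum_singles:
  assumes "finite T" "S \<inter> T = {}"
  shows "ebt G S T = (\<Sum>v\<in>T. ebt G S {v})"
  using assms
proof (induction T rule: finite_induct)
  case empty
  show ?case by (simp add: ebt_def)
next
  case (insert v T)
  then show ?case using ebt_insert[of v T S] by auto
qed

text \<open>In the quotient by a coarsest failing partition, the part of \<open>x\<close> must be
  \<open>{x}\<close> and equality persists, so all other parts have cut 4. A part with several
  vertices would have a cut of at least 6, so the partition is trivial.\<close>

lemma tight_not_crit:
  assumes nc: "\<not> crit" and t: "d {x} + 2 = d {z}"
  shows False
proof -
  obtain Q and K :: "(nat, nat) bgraph" and f g where K:
    "critical_partition G Q {z} \<psi>" "Q \<noteq> singles" "quot f g G K" "fibres f G = Q"
    "\<And>v. v \<in> V \<Longrightarrow> fibre f G {f v} = part_of Q v"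
    "failing_canvas K (f z) (f \<circ> \<psi> \<circ> g)" "ord_size K (f z) < ord_size G z"
    "\<And>A. A \<in> Q \<Longrightarrow> A \<noteq> {z} \<Longrightarrow> part_bound G Q {z} \<psi> A"
    using not_crit_partition[OF nc] by metis
  have Q: "partition_on V Q" "{z} \<in> Q" using K(1) unfolding critical_partition_def by auto
  have p: "A \<subseteq> V" "z \<notin> A" "A \<noteq> V - {z}" if "A \<in> Q" "A \<noteq> {z}" for A
    using part_subset[OF Q(1) that(1)] critical_partition_parts(1,3)[OF m total pre_on K(1) that(1)] that(2) by auto
  have X: "part_of Q x \<in> Q" "x \<in> part_of Q x" using part_of_mem[OF Q(1) xV] by auto
  have Xz: "part_of Q x \<noteq> {z}" using X(2) xz by auto
  have s: "part_bound G Q {z} \<psi> (part_of Q x)" by (rule K(8)[OF X(1) Xz])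
  have "d (part_of Q x) + 2 \<le> d {z}" by (rule s[unfolded part_bound_def, THEN conjunct1])
  then have Xx: "part_of Q x = {x}" using x_cut[OF X(2) p[OF X(1) Xz]] t by linarith
  have one: "C = {w}" if C: "C \<in> Q" "w \<in> C" for C w
  proof (cases "C = {z} \<or> C = {x}")
    case False
    then have "d C = 4" using s t C(1) unfolding part_bound_def Xx by auto
    moreover have "d {w} + 2 \<le> d C" if "card C \<ge> 2"
      using restrict_deg(1)[of C w] p[of C] C False that by blast
    moreover have "d {w} \<ge> 4" using deg4[of w] p[of C] C False by blast
    moreover have "card C \<ge> 2" if "C \<noteq> {w}"
      using card_ge_2[OF _ C(2) that] part_subset[OF Q(1) C(1)] finite_subset[OF _ fin(1)] by blast
    ultimately show ?thesis by linarith
  qed (use C in auto)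
  have "Q = singles"
  proof
    show "Q \<subseteq> singles"
    proof
      fix C assume C: "C \<in> Q"
      then obtain w where "w \<in> C" using part_nonempty[OF Q(1)] by blast
      then show "C \<in> singles" using one[OF C] part_subset[OF Q(1) C] by blast
    qed
    show "singles \<subseteq> Q"
    proof clarify
      fix v assume "v \<in> V"
      then show "{v} \<in> Q" using one[of "part_of Q v" v] part_of_mem[OF Q(1), of v] by simp
    qed
  qed
  then show False using K(2) by blast
qed

text \<open>Lifting at \<open>y\<close> keeps equality. Outside the part of \<open>x\<close> the
  bound for the smaller canvas gives degree four, and inside it the tightness of that part
  does.\<close>

lemma tight_all_deg4:
  assumes c: crit and n: "card V \<ge> 4" and t: "d {x} + 2 = d {z}" and y: "y \<in> V" "y \<noteq> z" "y \<noteq> x" "d {y} = 4"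
    and w: "w \<in> V - {x, z}"
  shows "d {w} = 4"
proof -
  obtain e1 e2 e3 e4 w1 w2 w3 w4 where L: "cross G {y} = {e1, e2, e3, e4}" "distinct [e1, e2, e3, e4]"
    "ends G e1 = {y, w1}" "ends G e2 = {y, w2}" "ends G e3 = {y, w3}" "ends G e4 = {y, w4}"
    "y \<notin> {w1, w2, w3, w4}" "{w1, w2, w3, w4} \<subseteq> V" "w1 \<noteq> w2" "w3 \<noteq> w4" "w2 \<noteq> z" "w4 \<noteq> z"
    and "w1 = z \<or> w3 = z \<Longrightarrow> w1 = z \<and> w2 \<noteq> x \<or> w3 = z \<and> w4 \<noteq> x"
    and "w1 = z \<Longrightarrow> w3 = z \<Longrightarrow> \<psi> e1 = z \<longleftrightarrow> \<psi> e3 = z"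
    by (rule deg4_pairs[OF c n y(1,2,4)]) (rule that)
  interpret lifting G z N x \<psi> y w1 w2 w3 w4 e1 e2 e3 e4
    by unfold_locales (fact c y L)+
  obtain Q and K :: "(nat, nat) bgraph" and f g where K:
    "critical_partition G1 Q {z} \<psi>1" "quot f g G1 K" "fibres f G1 = Q"
    "\<And>v. v \<in> verts G1 \<Longrightarrow> fibre f G1 {f v} = part_of Q v"
    "failing_canvas K (f z) (f \<circ> \<psi>1 \<circ> g)" "ord_size K (f z) < ord_size G z"
    "\<And>A. A \<in> Q \<Longrightarrow> A \<noteq> {z} \<Longrightarrow> part_bound G1 Q {z} \<psi>1 A"
    by (rule lift_critical) blast
  interpret lifted G z N x \<psi> y w1 w2 w3 w4 e1 e2 e3 e4 Q
    by unfold_locales (fact K)+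
  have eq: "cutdeg G1 X = d {x}" using part_small(1)[OF X(1,3)] X_cut t single_cut[of x] y(3) by linarith
  then have "cutdeg G1 X + 2 = d {z}" using t by simp
  note o = outside_deg4[OF X(1,3) this]
  show ?thesis
  proof (cases "w \<in> X")
    case True
    then have "card X \<ge> 2" using X_cut w by auto
    then show ?thesis using tight_deg4[OF X_tight(1)[OF _ eq] True] w by blast
  next
    case False
    then show ?thesis using o w by blast
  qed
qed

end

text \<open>The situation to be refuted: equality at \<open>x\<close> although a vertex off
  \<open>x\<close> and \<open>z\<close> has degree other than four, so that by
  \<open>tight_all_deg4\<close> all of them have degree at least five. \<open>T1\<close> and
  \<open>T12\<close> are the parts of the bound already known at this order.\<close>

locale tight_canvas = crit_flow G z N x \<psi> for G :: "('v, 'e) bgraph" and z N x \<psi> +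
  assumes c: crit and n: "card V \<ge> 4" and tx: "d {x} + 2 = d {z}" and d5: "\<And>v. v \<in> V - {x, z} \<Longrightarrow> d {v} \<ge> 5"
    and T1: "\<And>v. v \<in> V \<Longrightarrow> v \<noteq> z \<Longrightarrow> d {v} + 2 \<le> d {z}"
    and T12: "\<And>(K :: (nat, nat) bgraph) w \<psi>' v. failing_canvas K w \<psi>' \<Longrightarrow> v \<in> verts K \<Longrightarrow> v \<noteq> w \<Longrightarrow>
      ord_size K w = ord_size G z \<Longrightarrow> deg K v + 2 \<le> deg K w \<and>
      (deg K v + 2 = deg K w \<longrightarrow> same_way w \<psi>' {e \<in> inc K w. v \<notin> ends K e})"
begin

lemma R_nonempty: "\<exists>w. w \<in> V - {x, z}"
proof -
  have "card (V - {x, z}) = card V - 2" using xV zV xz by (simp add: card_Diff_subset)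
  then have "V - {x, z} \<noteq> {}" using n by fastforce
  then show ?thesis by blast
qed

lemma all_deg5: assumes "w \<in> V" "w \<noteq> z" shows "d {w} \<ge> 5"
proof -
  obtain r where r: "r \<in> V - {x, z}" using R_nonempty by blast
  then show ?thesis using T1[of r] d5[OF r] tx d5[of w] assms by (cases "w = x") auto
qed

text \<open>Equality in the bound for the restriction would give the other vertices of
  \<open>A\<close> degree four. With all degrees at least five, cuts around several vertices thus
  have size at least 8.\<close>

lemma cut8: assumes A: "A \<subseteq> V" "z \<notin> A" "A \<noteq> V - {z}" "card A \<ge> 2" and v: "v \<in> A"
  shows "d {v} + 3 \<le> d A"
proof -
  obtain a where a: "a \<in> A" "a \<noteq> v" using two_elements[OF A(4)] by metis
  have "d {a} \<noteq> 4" using all_deg5[of a] a A by fastforce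
  then show ?thesis using restrict_deg[OF A v] a by fastforce
qed

text \<open>Deleting the edge keeps equality at \<open>x\<close>, so every other part has cut 4 in
  the smaller graph. Cuts of size 8 forbid merging and degrees of at least five leave only
  \<open>u\<close> and \<open>v\<close>. On the vertices \<open>x\<close>, \<open>z\<close>,
  \<open>u\<close>, \<open>v\<close> there are too few edges: \<open>d {u, v}\<close> is at least 8
  by the degrees, but at most \<open>2 + 4\<close> by the edges to \<open>x\<close> and
  \<open>z\<close>.\<close>

lemma no_lossy_edge: "\<not> lossy_edge"
proof
  assume lossy_edge
  then obtain e1 u v where l': "e1 \<in> edges G" "ends G e1 = {v, u}" and l3: "u \<notin> {x, z}" "v \<notin> {x, z}"
    "can_lose G (-1) v" "can_lose G 1 u" unfolding lossy_edge_def by blast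
  then have l: "e1 \<in> edges G" "ends G e1 = {u, v}" "u \<notin> {x, z}" "v \<notin> {x, z}"
    "can_lose G (-1) v" "can_lose G 1 u" by (simp_all add: insert_commute)
  obtain a b where ab: "ends G e1 = {a, b}" "a \<noteq> b" "a \<in> V" "b \<in> V" using l(1) m by (rule multigraph_edgeE)
  have uv: "u \<in> V" "v \<in> V" "u \<noteq> v" using ab l(2) by (auto simp: doubleton_eq_iff)
  have o1: "ok4 (d {u} - 1) (bd G u - 1)" by (rule lossy_ok) (use uv l d5[of u] in auto)
  have "ok4 (d {v} - 1) (bd G v - (-1))" by (rule lossy_ok) (use uv l d5[of v] in auto)
  then have o2: "ok4 (d {v} - 1) (bd G v + 1)" by simp
  obtain h0 where h0: "orients G (edges G) h0" "\<And>e. e \<in> {e1} \<Longrightarrow> h0 e = v"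
    using orientation_exists[OF m, of "{e1}" "\<lambda>_. v"] l(1,2) by auto
  interpret deleting G z N x \<psi> u v e1 h0
    by unfold_locales (use c l uv h0 o1 o2 in auto)
  obtain Q and K :: "(nat, nat) bgraph" and f g where K:
    "critical_partition G1 Q {z} \<psi>" "quot f g G1 K" "fibres f G1 = Q"
    "\<And>v. v \<in> verts G1 \<Longrightarrow> fibre f G1 {f v} = part_of Q v"
    "failing_canvas K (f z) (f \<circ> \<psi> \<circ> g)" "ord_size K (f z) < ord_size G z"
    "\<And>A. A \<in> Q \<Longrightarrow> A \<noteq> {z} \<Longrightarrow> part_bound G1 Q {z} \<psi> A" "part_of Q u \<noteq> part_of Q v"
    by (rule delete_critical) (rule that)
  have Q: "partition_on V Q" "{z} \<in> Q" using K(1) unfolding critical_partition_def by auto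
  have p: "A \<subseteq> V" "z \<notin> A" "A \<noteq> V - {z}" if "A \<in> Q" "A \<noteq> {z}" for A
    using part_subset[OF Q(1) that(1)] critical_partition_parts(1,3)[OF m1 total1 pre1 K(1) that(1)] that(2) by auto
  have X: "part_of Q x \<in> Q" "x \<in> part_of Q x" using part_of_mem[OF Q(1) xV] by auto
  have Xz: "part_of Q x \<noteq> {z}" using X(2) xz by auto
  have s: "part_bound G1 Q {z} \<psi> (part_of Q x)" by (rule K(7)[OF X(1) Xz])
  have dz: "cutdeg G1 {z} = d {z}" unfolding cutdeg_def cross1 ..
  have cd: "d S \<le> cutdeg G1 S + 1" for S using cutdeg1[of S] by (auto split: if_splits)
  have "cutdeg G1 (part_of Q x) + 2 \<le> d {z}" using s dz unfolding part_bound_def by simp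
  then have Xx: "part_of Q x = {x}" using x_cut[OF X(2) p[OF X(1) Xz]] tx cd[of "part_of Q x"] by linarith
  have "cutdeg G1 {x} = d {x}" using cutdeg1[of "{x}"] l by auto
  then have d4: "cutdeg G1 C = 4" if "C \<in> Q - {{x}, {z}}" for C using s dz tx that unfolding Xx part_bound_def by auto
  have R: "w \<in> {u, v} \<and> d {w} = 5" if w: "w \<in> V - {x, z}" for w
  proof -
    have C: "part_of Q w \<in> Q" "w \<in> part_of Q w" using part_of_mem[OF Q(1)] w by auto
    then have C4: "cutdeg G1 (part_of Q w) = 4" "part_of Q w \<noteq> {z}" using d4 w by auto
    have "part_of Q w = {w}"
    proof (rule ccontr)
      assume "part_of Q w \<noteq> {w}"
      then have "card (part_of Q w) \<ge> 2" using card_ge_2[OF _ C(2)] p(1)[OF C(1) C4(2)] finite_subset[OF _ fin(1)] by blast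
      then have "d (part_of Q w) \<ge> 8" using cut8[OF p[OF C(1) C4(2)] _ C(2)] d5[OF w] by linarith
      then show False using cd[of "part_of Q w"] C4 by linarith
    qed
    then show ?thesis using C4 cutdeg1[of "{w}"] d5[OF w] by (auto split: if_splits)
  qed
  have uvR: "u \<in> V - {x, z}" "v \<in> V - {x, z}" using l uvV by auto
  have V: "V = {x} \<union> {z} \<union> {u, v}" using R xV zV uvR by blast
  have "d ({u} \<union> {v}) + 2 * ebt G {u} {v} = d {u} + d {v}" by (rule cutdeg_Un[OF m]) (use uv in auto)
  moreover have "ebt G {u} {v} \<le> 1" by (rule ebt_le_1[OF c]) (use uvR uv in auto)
  ultimately have duv: "d {u, v} \<ge> 8" using R uvR by (simp add: insert_commute)
  have "d {x} = ebt G {x} {z} + ebt G {x} {u, v}" "d {z} = ebt G {z} {x} + ebt G {z} {u, v}"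
    "d {u, v} = ebt G {u, v} {x} + ebt G {u, v} {z}"
    by (rule cutdeg_ebt[OF m]; use V l xz in auto)+
  moreover have "ebt G {x} {u, v} = ebt G {x} {u} + ebt G {x} {v}" using ebt_insert[of u "{v}" "{x}"] uv l by auto
  moreover have "ebt G {x} {u} \<le> 1" "ebt G {x} {v} \<le> 1" by (rule ebt_le_1[OF c]; use uvR xV xz in auto)+
  ultimately show False
    using duv tx ebt_commute[of G "{z}" "{x}"] ebt_commute[of G "{u, v}" "{x}"] ebt_commute[of G "{u, v}" "{z}"] by linarith
qed

text \<open>Deleting the edge would lower the degree of the tip but not that of \<open>x\<close>,
  against \<open>T12\<close> at the same order.\<close>

lemma no_lossy_tip_edge:
  assumes e0: "e0 \<in> cross G {z}" "ends G e0 = {z, u}" "u \<noteq> z" "u \<noteq> x"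
  shows "\<not> can_lose G (out_value e0) u"
proof
  assume l: "can_lose G (out_value e0) u"
  have uV: "u \<in> V" using tip_edge[OF e0(1)] e0(2,3) by (metis doubleton_eq_iff)
  have ok: "ok4 (d {u} - 1) (bd G u - out_value e0)"
    by (rule lossy_ok) (use uV e0 l d5[of u] out_value_cases in auto)
  obtain h0 where h0: "orients G (edges G) h0" "\<And>e. e \<in> cross G {z} \<Longrightarrow> h0 e = \<psi> e"
    using orientation_exists[OF m, of "cross G {z}" \<psi>] \<psi>o unfolding orients_def by blast
  define G1 where "G1 = delete_oriented G {e0} h0"
  obtain K :: "(nat, nat) bgraph" and f g where K: "quot f g G1 K" "inj_on f V"
    "\<And>v. v \<in> V \<Longrightarrow> fibre f G1 {f v} = {v}" "failing_canvas K (f z) (f \<circ> \<psi> \<circ> g)"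
    "ord_size K (f z) = ord_size G z" "\<And>v. v \<in> V \<Longrightarrow> deg K (f v) = cutdeg G1 {v} \<and> bd K (f v) = bd G1 v"
    "\<And>S. cutdeg G1 S + (if (u \<in> S) \<noteq> (z \<in> S) then 1 else 0) = d S"
    "bd G1 = (bd G)(u := bd G u - out_value e0, z := bd G z + out_value e0)" "multigraph G1" "preflow_on G1 {z} \<psi>"
    "cross G1 {z} = cross G {z} - {e0}" "critical_partition G1 singles {z} \<psi>"
    by (rule delete_tip_edge[OF c e0(1-3) ok h0(1), folded G1_def]) (erule h0(2), rule that)
  have "f x \<in> verts K" using xV quot_verts[OF K(1)] by (simp add: G1_def)
  moreover have "f x \<noteq> f z" using K(2) xV zV xz unfolding inj_on_def by auto
  ultimately have "deg K (f x) + 2 \<le> deg K (f z)" using T12[OF K(4) _ _ K(5)] by blast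
  moreover have "cutdeg G1 {z} + 1 = d {z}" using K(7)[of "{z}"] e0(3) by simp
  moreover have "cutdeg G1 {x} = d {x}" using K(7)[of "{x}"] e0(4) xz by auto
  ultimately show False using K(6)[OF xV] K(6)[OF zV] tx by simp
qed

text \<open>By equality at \<open>x\<close>, the tip sends two more edges into
  \<open>V - {x, z}\<close> than \<open>x\<close> does, so some vertex receives more from the
  tip.\<close>

lemma more_tip_edges:
  obtains v e0 where "v \<in> V - {x, z}" "ebt G {x} {v} < ebt G {z} {v}" "e0 \<in> cross G {z}" "ends G e0 = {z, v}"
proof -
  let ?R = "V - {x, z}"
  have fR: "finite ?R" by simp
  have "d {x} = ebt G {x} {z} + ebt G {x} ?R" "d {z} = ebt G {z} {x} + ebt G {z} ?R"
    by (rule cutdeg_ebt[OF m]; use xV zV xz in auto)+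
  then have "ebt G {z} ?R = ebt G {x} ?R + 2" using tx ebt_commute[of G "{z}" "{x}"] by linarith
  then have "(\<Sum>v\<in>?R. ebt G {z} {v}) > (\<Sum>v\<in>?R. ebt G {x} {v})"
    using ebt_sum_singles[OF fR, of "{z}"] ebt_sum_singles[OF fR, of "{x}"] by simp
  then obtain v where v: "v \<in> ?R" "ebt G {x} {v} < ebt G {z} {v}" by (meson not_le sum_mono)
  then have "card {e \<in> edges G. ends G e \<inter> {z} \<noteq> {} \<and> ends G e \<inter> {v} \<noteq> {}} > 0" unfolding ebt_def by linarith
  then have "{e \<in> edges G. ends G e \<inter> {z} \<noteq> {} \<and> ends G e \<inter> {v} \<noteq> {}} \<noteq> {}" unfolding card_gt_0_iff by (rule conjunct1)
  then obtain e0 where e0: "e0 \<in> edges G" "z \<in> ends G e0" "v \<in> ends G e0" by blast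
  obtain a b where "ends G e0 = {a, b}" using e0(1) m by (rule multigraph_edgeE)
  then have "ends G e0 = {z, v}" using e0 v(1) by auto
  moreover from this have "e0 \<in> cross G {z}" using e0(1) v(1) unfolding cross_def by auto
  ultimately show ?thesis using that v by blast
qed

end

text \<open>
  All edges between a vertex \<open>v\<close> of degree five and \<open>V - {x, z}\<close> are deleted with the value \<open>t\<close>, and
  \<open>v\<close> is merged with \<open>x\<close>: the edges at \<open>v\<close> can then all be given the value \<open>t\<close>.
\<close>

locale star_deletion = tight_canvas G z N x \<psi> for G :: "('v, 'e) bgraph" and z N x \<psi> +
  fixes v :: 'v and t :: 3 and h0 :: "'e \<Rightarrow> 'v"
  assumes vR: "v \<in> V - {x, z}" and dv: "d {v} = 5" and t: "t = 1 \<or> t = -1"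
    and nl: "\<And>w. w \<in> V - {x, z} \<Longrightarrow> \<not> can_lose G t w"
    and out: "\<And>e. e \<in> cross G {z} \<Longrightarrow> x \<notin> ends G e \<Longrightarrow> out_value e = t"
    and more: "ebt G {x} {v} < ebt G {z} {v}"
    and h0: "orients G (edges G) h0" "\<And>e. e \<in> cross G {v} \<Longrightarrow> h0 e = v \<longleftrightarrow> t \<noteq> 1"
begin

definition F :: "'e set" where
  "F = {e \<in> cross G {v}. ends G e \<inter> {x, z} = {}}"

definition G1 :: "('v, 'e) bgraph" where
  "G1 = delete_oriented G F h0"

abbreviation "P \<equiv> outer G {x, v}"

lemma G1 [simp]: "verts G1 = V" "edges G1 = edges G - F" "ends G1 = ends G"
  unfolding G1_def by simp_all

lemma v: "v \<in> V" "v \<noteq> x" "v \<noteq> z"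
  using vR by auto

lemma F: "F \<subseteq> edges G" "finite F"
  using finite_subset[OF _ fin(2), of F] unfolding F_def cross_def by auto

lemma m1: "multigraph G1"
  unfolding G1_def by (rule delete_multigraph[OF m])

lemma cutdeg1: "cutdeg G1 S + card (F \<inter> cross G S) = d S"
  unfolding G1_def by (rule cutdeg_delete[OF m])

lemma bsum1: "S \<subseteq> V \<Longrightarrow> bsum G1 S = bsum G S - of_int (\<Sum>e\<in>F. flux G h0 S e)"
  unfolding G1_def by (rule bsum_delete[OF m h0(1) F(1)])

lemma cross1: "cross G1 {z} = cross G {z}"
  unfolding G1_def cross_delete F_def cross_def by auto

lemma flux_out: "e \<in> cross G {v} \<Longrightarrow> h e = v \<longleftrightarrow> t \<noteq> 1 \<Longrightarrow> of_int (flux G h {v} e) = t"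
  using t unfolding flux_def cross_def by auto

lemma total1: "bsum G1 (verts G1) = 0"
proof -
  have "(\<Sum>e\<in>F. flux G h0 V e) = 0"
  proof (rule sum.neutral, clarify)
    fix e assume "e \<in> F"
    then have "ends G e \<subseteq> V" using F(1) m unfolding multigraph_def by blast
    then show "flux G h0 V e = 0" unfolding flux_def by simp
  qed
  then show ?thesis using bsum1[of V] total by simp
qed

lemma pre1: "preflow_on G1 {z} \<psi>"
proof -
  have "(\<Sum>e\<in>F. flux G h {z} e) = 0" for h by (rule sum.neutral) (auto simp: F_def flux_def)
  then have "bsum G1 {z} = bsum G {z}" "net G \<psi> {z} = net G1 \<psi> {z}"
    using bsum1[of "{z}"] zV net_delete[OF m F(1), of \<psi> "{z}" h0] unfolding G1_def by simp_all
  then show ?thesis using pre_on unfolding preflow_on_def balanced_on_def cross1 orients_def by simp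
qed

lemma P: "partition_on V P" "{z} \<in> P"
  using partition_outer[of "{x, v}" G] xV v zV xz unfolding outer_def by auto

text \<open>An extension in the smaller graph is changed to \<open>h0\<close> on all edges at
  \<open>v\<close>. The vertices other than \<open>x\<close> and \<open>z\<close> are then balanced,
  and \<open>no_flow\<close> takes care of \<open>x\<close>.\<close>

lemma nx1: "\<not> ext G1 P {z} \<psi>"
proof
  assume "ext G1 P {z} \<psi>"
  then obtain h where h: "orients G1 (edges G1) h" "\<And>e. e \<in> cross G {z} \<Longrightarrow> h e = z \<longleftrightarrow> \<psi> e = z"
    "\<And>A. A \<in> P \<Longrightarrow> balanced_on G1 h A" unfolding ext_def cross1 by auto
  define k where "k e = (if e \<in> cross G {v} then h0 e else h e)" for e
  define k' where "k' e = (if e \<in> F then h0 e else h e)" for e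
  have "agrees k"
    unfolding agrees_def
  proof (intro conjI ballI)
    show "orients G (edges G) k"
      unfolding orients_def
    proof
      fix e assume e: "e \<in> edges G"
      have "e \<notin> F" if "e \<notin> cross G {v}" using that unfolding F_def by blast
      then show "k e \<in> ends G e" using e h0(1) h(1) unfolding orients_def k_def by auto
    qed
    fix e assume e: "e \<in> cross G {z}"
    show "k e = z \<longleftrightarrow> \<psi> e = z"
    proof (cases "e \<in> cross G {v}")
      case True
      obtain u where u: "ends G e = {z, u}" "e \<in> edges G" using tip_edge[OF e] by metis
      then have uv: "ends G e = {z, v}" using True v unfolding cross_def by auto
      then have "out_value e = t" using out[OF e] v xz by auto
      then have "\<psi> e = z \<longleftrightarrow> t = 1" using t unfolding out_value_def by (auto split: if_splits)
      moreover have "h0 e \<in> {z, v}" using h0(1) uv u(2) unfolding orients_def by auto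
      ultimately show ?thesis using h0(2)[OF True] True v unfolding k_def by auto
    qed (use h(2)[OF e] k_def in simp)
  qed
  moreover have "balanced_on G k {w}" if w: "w \<in> V - {x, z}" for w
  proof (cases "w = v")
    case True
    have "of_int (net G k {v}) = (\<Sum>e\<in>cross G {v}. of_int (flux G k {v} e))" unfolding net_single by simp
    also have "\<dots> = (\<Sum>e\<in>cross G {v}. t)" by (rule sum.cong) (use flux_out h0(2) in \<open>auto simp: k_def\<close>)
    \<comment> \<open>\<open>5 * t = - t\<close> modulo 3, and \<open>- t\<close> is the boundary of
      \<open>v\<close>, since \<open>v\<close> has odd degree and cannot lose
      \<open>t\<close>.\<close>
    also have "\<dots> = of_nat 5 * t" using dv unfolding cutdeg_def by simp
    also have "\<dots> = - t" by (cases t rule: Z3_cases) simp_all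
    also have "\<dots> = bd G v" using nl[OF vR] dv deg_cutdeg[OF m, of v] unfolding can_lose_def by simp
    finally show ?thesis using True unfolding balanced_on_def bsum_def by simp
  next
    case False
    then have "{w} \<in> P" using w unfolding outer_def by auto
    then have "balanced_on G1 h {w}" by (rule h(3))
    moreover have "net G1 k' {w} = net G1 h {w}" unfolding net_cross[OF m1] by (rule sum.cong) (auto simp: cross_def k'_def flux_def)
    ultimately have "balanced_on G1 k' {w}" unfolding balanced_on_def by simp
    then have "balanced_on G k' {w}" using balanced_delete[OF m h0(1) F(1), of "{w}" k'] w unfolding G1_def k'_def by simp
    moreover have "net G k {w} = net G k' {w}"
    proof (rule net_cong)
      fix e assume e: "e \<in> cross G {w}"
      have "e \<in> cross G {v} \<longleftrightarrow> e \<in> F"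
      proof
        assume ev: "e \<in> cross G {v}"
        have "ends G e = {v, w}" using other[OF ev] e False unfolding cross_def by auto
        then show "e \<in> F" using ev w v unfolding F_def by auto
      qed (simp add: F_def)
      then show "k e = k' e" unfolding k_def k'_def by simp
    qed
    ultimately show ?thesis unfolding balanced_on_def by simp
  qed
  ultimately show False by (rule no_flow[OF _ xV])
qed

lemma cross_inside: "S \<subseteq> V - {v} \<Longrightarrow> card (F \<inter> cross G S) \<le> ebt G S {v}"
  unfolding ebt_def by (rule card_mono) (auto simp: F_def cross_def)

lemma star_count: "card F + ebt G {z} {v} + ebt G {x} {v} \<le> 5"
proof -
  let ?E = "\<lambda>w. {e \<in> edges G. ends G e \<inter> {w} \<noteq> {} \<and> ends G e \<inter> {v} \<noteq> {}}"
  have E: "ends G e = {w, v} \<and> e \<in> cross G {v}" if e: "e \<in> ?E w" and w: "w \<noteq> v" for e w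
  proof -
    have eG: "e \<in> edges G" "w \<in> ends G e" "v \<in> ends G e" using e by auto
    obtain a b where "ends G e = {a, b}" using eG(1) m by (rule multigraph_edgeE)
    then have "ends G e = {w, v}" using eG w by auto
    then show ?thesis using eG(1) w unfolding cross_def by auto
  qed
  have "F \<subseteq> cross G {v}" "?E z \<subseteq> cross G {v}" "?E x \<subseteq> cross G {v}" using E v unfolding F_def by blast+
  then have "card (F \<union> ?E z \<union> ?E x) \<le> card (cross G {v})" by (intro card_mono) (use m in auto)
  then have "card (F \<union> ?E z \<union> ?E x) \<le> 5" using dv unfolding cutdeg_def by simp
  moreover have "card (F \<union> ?E z \<union> ?E x) = card F + card (?E z) + card (?E x)"
  proof -
    have "F \<inter> ?E z = {}" unfolding F_def by auto
    moreover have "z \<notin> ends G e" if "e \<in> ?E x" for e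
    proof -
      have "ends G e = {x, v}" by (rule E[OF that v(2)[symmetric], THEN conjunct1])
      then show ?thesis using v(3) xz by simp
    qed
    then have "(F \<union> ?E z) \<inter> ?E x = {}" unfolding F_def by blast
    ultimately show ?thesis using F(2) by (simp add: card_Un_disjoint)
  qed
  ultimately show ?thesis unfolding ebt_def by simp
qed

text \<open>For \<open>A = {x, v}\<close> the remaining cut is at least
  \<open>d {x} + ebt G {z} {v} - ebt G {x} {v}\<close>, and \<open>more\<close> applies. Otherwise
  \<open>A\<close> and \<open>A - {v}\<close> both have cuts of at least \<open>d {x} + 3\<close>,
  and combining them gives \<open>2 * cutdeg G1 A \<ge> 2 * d {x} + 1\<close>.\<close>

lemma big_cut:
  assumes A: "A \<subseteq> V" "z \<notin> A" "A \<noteq> V - {z}" "x \<in> A" "v \<in> A"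
  shows "cutdeg G1 A \<ge> d {x} + 1"
proof (cases "A = {x, v}")
  case True
  have "d ({x} \<union> {v}) + 2 * ebt G {x} {v} = d {x} + d {v}" by (rule cutdeg_Un[OF m]) (use v in auto)
  moreover have "card (F \<inter> cross G A) \<le> card F" by (rule card_mono[OF F(2)]) blast
  moreover have "{x} \<union> {v} = A" using True by blast
  ultimately show ?thesis using star_count more dv cutdeg1[of A] by simp
next
  case False
  let ?B = "A - {v}"
  have fA: "finite A" using A(1) fin(1) by (rule finite_subset)
  have "?B \<noteq> {x}" using False A(4,5) by blast
  then have "card ?B \<ge> 2" using card_ge_2[of ?B x] A(4) v fA by blast
  then have dB: "d {x} + 3 \<le> d ?B" by (intro cut8) (use A v in auto)
  have "card A \<ge> 2" using card_ge_2[OF fA A(4)] A(5) v by blast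
  then have dA: "d {x} + 3 \<le> d A" by (rule cut8[OF A(1-3) _ A(4)])
  have un: "d (?B \<union> {v}) + 2 * ebt G ?B {v} = d ?B + d {v}" by (rule cutdeg_Un[OF m]) blast
  have BA: "?B \<union> {v} = A" using A(5) by blast
  let ?E = "{e \<in> edges G. ends G e \<inter> ?B \<noteq> {} \<and> ends G e \<inter> {v} \<noteq> {}}"
  have "card ((F \<inter> cross G A) \<union> ?E) \<le> card (cross G {v})"
    by (rule card_mono) (use m A(5) in \<open>auto simp: F_def cross_def\<close>)
  moreover have "(F \<inter> cross G A) \<inter> ?E = {}"
  proof (rule ccontr)
    assume "(F \<inter> cross G A) \<inter> ?E \<noteq> {}"
    then obtain e where e: "e \<in> cross G {v}" "e \<in> cross G A" "ends G e \<inter> ?B \<noteq> {}" unfolding F_def by blast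
    have "ends G e = {v, other v e}" using other[OF e(1)] by blast
    then show False using e(2,3) A(5) unfolding cross_def by auto
  qed
  ultimately have "card (F \<inter> cross G A) + ebt G ?B {v} \<le> 5"
    using dv F(2) unfolding cutdeg_def ebt_def by (simp add: card_Un_disjoint)
  then show ?thesis using dA dB un dv cutdeg1[of A] unfolding BA by linarith
qed

text \<open>A single vertex loses at most one edge, of value \<open>- t\<close>, which it can
  afford. For a larger set off \<open>v\<close>, both \<open>d A\<close> and
  \<open>d (A \<union> {v})\<close> are at least 8, so at most \<open>(d A - 3) div 2\<close> of its
  cut edges go to \<open>v\<close>, and at least six remain.\<close>

lemma cut_ok1:
  assumes A: "A \<subseteq> V" "z \<notin> A" "A \<noteq> V - {z}" "A \<noteq> {}" and xv: "x \<in> A \<longleftrightarrow> v \<in> A"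
  shows "ok4 (cutdeg G1 A) (bsum G1 A)"
proof (cases "v \<in> A")
  case True
  then have "cutdeg G1 A \<ge> 6" using big_cut[OF A(1-3)] xv all_deg5[OF xV xz] by force
  then show ?thesis unfolding ok4_def by simp
next
  case False
  have fA: "finite A" using A(1) fin(1) by (rule finite_subset)
  have AV: "A \<subseteq> V - {v}" using A(1) False by blast
  obtain w where w: "w \<in> A" using A(4) by blast
  show ?thesis
  proof (cases "A = {w}")
    case True
    have wR: "w \<in> V - {x, z}" "w \<noteq> v" using A True False xv by auto
    have "ebt G {w} {v} \<le> 1" by (rule ebt_le_1[OF c]) (use wR v in auto)
    then have le: "card (F \<inter> cross G {w}) \<le> 1" using cross_inside[of "{w}"] AV True by simp
    have s: "(\<Sum>e\<in>F. flux G h0 {w} e) = (\<Sum>e\<in>F \<inter> cross G {w}. flux G h0 {w} e)"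
      by (rule sum.mono_neutral_right[OF F(2)]) (use F(1) in \<open>auto simp: flux_def cross_def\<close>)
    show ?thesis
    proof (cases "F \<inter> cross G {w} = {}")
      case e: True
      then have "cutdeg G1 A = d {w}" "bsum G1 A = bd G w"
        using cutdeg1[of "{w}"] bsum1[of "{w}"] s wR True by simp_all
      then show ?thesis using ok_single[of w] wR by simp
    next
      case False
      then have "card (F \<inter> cross G {w}) = 1" using le F(2) by (simp add: card_gt_0_iff le_antisym Suc_leI)
      then obtain f where f: "F \<inter> cross G {w} = {f}" by (rule card_1_singletonE)
      then have fv: "f \<in> cross G {v}" "f \<in> cross G {w}" unfolding F_def by auto
      have en: "ends G f = {v, w}" using other[OF fv(1)] fv(2) wR(2) unfolding cross_def by auto
      have "h0 f \<in> ends G f" using h0(1) crossD[OF fv(1)] unfolding orients_def by blast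
      then have "of_int (flux G h0 {w} f) = - t"
        using h0(2)[OF fv(1)] en wR(2) t unfolding flux_def by auto
      then have "cutdeg G1 A = d {w} - 1" "bsum G1 A = bd G w - (- t)"
        using cutdeg1[of "{w}"] bsum1[of "{w}"] s wR True f by simp_all
      moreover have "ok4 (d {w} - 1) (bd G w - (- t))"
        by (rule lossy_ok) (use wR d5[OF wR(1)] t nl[OF wR(1)] can_lose_one[OF t, of G w] in auto)
      ultimately show ?thesis by simp
    qed
  next
    case Aw: False
    then have c2: "card A \<ge> 2" using card_ge_2[OF fA w] by blast
    have wV: "w \<in> V" "w \<noteq> z" using w A by auto
    have dA: "d A \<ge> 8" using cut8[OF A(1-3) c2 w] all_deg5[OF wV] by linarith
    have un: "d (A \<union> {v}) + 2 * ebt G A {v} = d A + d {v}" by (rule cutdeg_Un[OF m]) (use False in blast)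
    have "d {w} + 3 \<le> d (A \<union> {v})"
    proof (rule cut8)
      show "card (A \<union> {v}) \<ge> 2" using c2 False fA by simp
    qed (use A v xv False w xV xz in auto)
    then have "d (A \<union> {v}) \<ge> 8" using all_deg5[OF wV] by linarith
    then have "cutdeg G1 A \<ge> 6" using un dA dv cutdeg1[of A] cross_inside[OF AV] by linarith
    then show ?thesis unfolding ok4_def by simp
  qed
qed

lemma P_union: assumes "\<And>C. C \<in> P \<Longrightarrow> C \<subseteq> A \<or> C \<inter> A = {}" shows "x \<in> A \<longleftrightarrow> v \<in> A"
  using assms[of "{x, v}"] unfolding outer_def by blast

text \<open>The part containing \<open>x\<close> and \<open>v\<close> has a cut of at least
  \<open>d {x} + 1\<close>, while the bound in the smaller graph allows only
  \<open>d {z} - 2 = d {x}\<close>.\<close>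

lemma star_contradiction: False
proof -
  have sz: "card P + card {e \<in> edges G1. \<not> (\<exists>C\<in>P. ends G1 e \<subseteq> C) \<and> ends G1 e \<inter> {z} = {}} < N"
  proof -
    have "card {e \<in> edges G1. \<not> (\<exists>C\<in>P. ends G1 e \<subseteq> C) \<and> ends G1 e \<inter> {z} = {}} \<le> card {e \<in> edges G. z \<notin> ends G e}"
      by (rule card_mono) auto
    moreover have "card P < card V"
    proof (rule coarse_card[OF P(1)])
      have "{x, v} \<in> P" unfolding outer_def by blast
      moreover have "{x, v} \<notin> singles" using v by auto
      ultimately show "P \<noteq> singles" by blast
    qed
    ultimately show ?thesis using size_eq unfolding ord_size_def by simp
  qed
  obtain Q and K :: "(nat, nat) bgraph" and f g where K:
    "critical_partition G1 Q {z} \<psi>" "coarser P Q" "quot f g G1 K" "fibres f G1 = Q"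
    "\<And>v. v \<in> verts G1 \<Longrightarrow> fibre f G1 {f v} = part_of Q v"
    "\<And>b. b \<in> {z} \<Longrightarrow> failing_canvas K (f b) (f \<circ> \<psi> \<circ> g) \<and> ord_size K (f b) < N"
    "\<And>A. A \<in> Q \<Longrightarrow> A \<noteq> {z} \<Longrightarrow> part_bound G1 Q {z} \<psi> A"
  proof (rule critical_quotient[OF T m1 total1 _ P(2) nx1 pre1 _ _ sz])
    show "partition_on (verts G1) P" using P(1) by simp
    show "ok4 (cutdeg G1 A) (bsum G1 A)"
      if "A \<subseteq> verts G1 - {z}" "A \<noteq> {}" "A \<noteq> verts G1 - {z}" "\<And>C. C \<in> P \<Longrightarrow> C \<subseteq> A \<or> C \<inter> A = {}" for A
      by (rule cut_ok1) (use that P_union[OF that(4)] in auto)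
    then show "bsum G1 A = 0"
      if A: "A \<subseteq> verts G1 - {z}" "A \<noteq> {}" "A \<noteq> verts G1 - {z}" "\<And>C. C \<in> P \<Longrightarrow> C \<subseteq> A \<or> C \<inter> A = {}" "cross G1 A = {}" for A
      using A(5) \<open>\<And>A. A \<subseteq> verts G1 - {z} \<Longrightarrow> A \<noteq> {} \<Longrightarrow> A \<noteq> verts G1 - {z} \<Longrightarrow> (\<And>C. C \<in> P \<Longrightarrow> C \<subseteq> A \<or> C \<inter> A = {}) \<Longrightarrow>
        ok4 (cutdeg G1 A) (bsum G1 A)\<close>[OF A(1-4)] unfolding ok4_def cutdeg_def by simp
  qed (rule that)
  have Q: "partition_on V Q" using K(1) unfolding critical_partition_def by auto
  obtain C where C: "C \<in> Q" "{x, v} \<subseteq> C" using K(2) unfolding coarser_def outer_def by blast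
  have Cz: "C \<noteq> {z}" using C(2) xz by auto
  have "C \<subseteq> V" "z \<notin> C" "C \<noteq> V - {z}"
    using part_subset[OF Q C(1)] critical_partition_parts(1,3)[OF m1 total1 pre1 K(1) C(1)] Cz by auto
  then have "cutdeg G1 C \<ge> d {x} + 1" by (rule big_cut) (use C(2) in auto)
  moreover have "cutdeg G1 C + 2 \<le> cutdeg G1 {z}" by (rule K(7)[OF C(1) Cz, unfolded part_bound_def, THEN conjunct1])
  moreover have "cutdeg G1 {z} = d {z}" unfolding cutdeg_def cross1 ..
  ultimately show False using tx by linarith
qed

end

context tight_canvas
begin

text \<open>A vertex with more edges to the tip than to \<open>x\<close> either has degree five, and
  its star is deleted, or has degree at least six, and a tip edge at it may be reversed whatever its
  boundary becomes.\<close>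

lemma tight_contradiction: False
proof -
  obtain t :: 3 where t: "t = 1 \<or> t = -1" "\<And>v. v \<in> V - {x, z} \<Longrightarrow> \<not> can_lose G t v"
    "\<And>e. e \<in> cross G {z} \<Longrightarrow> x \<notin> ends G e \<Longrightarrow> out_value e = t"
    "\<And>v. v \<in> V - {x, z} \<Longrightarrow> \<exists>e\<in>edges G. \<exists>w\<in>V - {x, z}. ends G e = {v, w} \<and> v \<noteq> w"
    by (rule uniform_canvas[OF c n d5 no_lossy_edge]) (assumption, use no_lossy_tip_edge in blast, rule that)
  obtain v e0 where v: "v \<in> V - {x, z}" "ebt G {x} {v} < ebt G {z} {v}" "e0 \<in> cross G {z}" "ends G e0 = {z, v}"
    by (rule more_tip_edges)
  show False
  proof (cases "d {v} = 5")
    case True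
    have "\<forall>e\<in>cross G {v}. (if t = 1 then other v e else v) \<in> ends G e" using other by auto
    then obtain h0 where h0: "orients G (edges G) h0" "\<And>e. e \<in> cross G {v} \<Longrightarrow> h0 e = (if t = 1 then other v e else v)"
      using orientation_exists[OF m, of "cross G {v}" "\<lambda>e. if t = 1 then other v e else v"] by auto
    have "h0 e = v \<longleftrightarrow> t \<noteq> 1" if "e \<in> cross G {v}" for e using h0(2)[OF that] other[OF that] by auto
    then interpret star_deletion G z N x \<psi> v t h0
      by unfold_locales (use v True t h0(1) in auto)
    show False by (rule star_contradiction)
  next
    case False
    then have d6: "d {v} \<ge> 6" using d5[OF v(1)] by linarith
    obtain e e' where ee: "e \<noteq> e'" "e \<in> cross G {z}" "e' \<in> cross G {z}" "x \<notin> ends G e" "x \<notin> ends G e'"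
      using two_tip_edges[OF c n d5] by blast
    then obtain y where y: "y \<in> cross G {z}" "x \<notin> ends G y" "y \<noteq> e0" by metis
    have "x \<notin> ends G e0" using v(1,4) xz by blast
    then have "out_value y = out_value e0" using t(3)[OF y(1,2)] t(3)[OF v(3)] by simp
    then have ye: "\<psi> y = z \<longleftrightarrow> \<psi> e0 = z" unfolding out_value_def by (auto split: if_splits)
    show False
      by (rule flip_contradiction[OF c _ v(3,4) _ _ _ tx y ye]) (use T12 v d6 in \<open>auto simp: ok4_def\<close>)
  qed
qed

end

section \<open>The degree bound at every order, and the theorem\<close>

lemma tip_bound_below_Suc:
  assumes T: "tip_bound_below N"
  shows "tip_bound_below (Suc N)"
  unfolding tip_bound_below_def
proof (intro allI impI)
  fix G :: "(nat, nat) bgraph" and z x \<psi>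
  assume t: "failing_canvas G z \<psi>" "x \<in> verts G" "x \<noteq> z" and s: "ord_size G z < Suc N"
  show "tip_bound G z x \<psi>"
  proof (cases "ord_size G z < N")
    case True
    then show ?thesis using T t unfolding tip_bound_below_def by blast
  next
    case False
    then have N: "ord_size G z = N" using s by simp
    have T12: "deg K v + 2 \<le> deg K w \<and> (deg K v + 2 = deg K w \<longrightarrow> same_way w \<psi>' {e \<in> inc K w. v \<notin> ends K e})"
      if "failing_canvas K w \<psi>'" "v \<in> verts K" "v \<noteq> w" "ord_size K w = N" for K :: "(nat, nat) bgraph" and w \<psi>' v
      using easel_if_not_tip_bound[OF that(1-3)] no_easel_at[OF T that(4)] by blast
    interpret crit_flow G z N x \<psi>
      using crit_flow_of_failing_canvas[OF t(1) _ t(2,3)] T N by simp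
    have deg: "deg G u = d {u}" for u by (rule deg_cutdeg[OF m])
    have "d {u} = 4" if tx: "d {x} + 2 = d {z}" and u: "u \<in> V - {x, z}" for u
    proof (rule ccontr)
      assume u4: "d {u} \<noteq> 4"
      have c: crit using tight_not_crit tx by blast
      have n: "card V \<ge> 4" using three_vertices(3)[OF _ c tx, of u] u u4 card_V_ge_3 by force
      have d5: "d {w} \<ge> 5" if w: "w \<in> V - {x, z}" for w
        using tight_all_deg4[OF c n tx, of w u] deg4[of w] w u u4 by force
      interpret tight_canvas G z N x \<psi>
        by unfold_locales (use c n tx d5 T12[OF t(1) _ _ N] T12 N deg in auto)
      show False by (rule tight_contradiction)
    qed
    then have "d {x} + 2 = d {z} \<longrightarrow> (\<forall>u\<in>V - {x, z}. d {u} = 4)" by blast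
    then show ?thesis using T12[OF t N] unfolding tip_bound_def deg by blast
  qed
qed

lemma tip_bound_below_all: "tip_bound_below N"
  by (induction N) (auto simp: tip_bound_below_def[of 0] intro: tip_bound_below_Suc)

lemma crit_flow_of_easel: "easel_class k r G z x \<psi> \<Longrightarrow> crit_flow G z (ord_size G z) x \<psi>"
  using easel_failing_canvas crit_flow_of_failing_canvas tip_bound_below_all by metis

text \<open>The induction covers graphs over \<open>nat\<close> only; for other types a single
  application of \<open>step\<close> leads to such a graph or to three vertices.\<close>

lemma no_easel: "\<not> easel_class k (-1) G z x \<psi>"
proof
  assume e: "easel_class k (-1) G z x \<psi>"
  interpret crit_flow G z "ord_size G z" x \<psi> by (rule crit_flow_of_easel[OF e])
  have "\<not> easel_class k' (-1) (G' :: (nat, nat) bgraph) z' x' \<psi>'" for k' G' z' x' \<psi>'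
    using no_easel_at[OF tip_bound_below_all refl] .
  then have "card V = 3 \<and> crit" using step(1)[OF e] by blast
  then have "d {x} + 2 \<le> d {z}" "d {x} + 2 = d {z} \<Longrightarrow> one_way \<psi> {z} {e \<in> cross G {z}. x \<notin> ends G e}"
    using three_vertices by blast+
  moreover note easel_facts[OF e]
  ultimately show False by auto
qed

lemma easel_deg: assumes "easel_class k r G z x \<psi>" shows "deg G x + 2 \<le> deg G z"
  using easel_if_not_tip_bound easel_failing_canvas[OF assms] no_easel by metis

theorem mainTheorem9:
  fixes k r :: int
    and G :: "('v, 'e) bgraph" and z x :: 'v and \<psi> :: "'e \<Rightarrow> 'v"
  assumes "easel_class k r G z x \<psi>"
  shows
    "(card (verts G) = 3
      \<or> (\<exists>(G' :: (nat, nat) bgraph) z' x' \<psi>'.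
           easel_class k r G' z' x' \<psi>' \<and> prec G' z' x' G z x \<and>
           (EXP k r G z x G' z' x' \<or> EXPA k r G z x G' z' x' \<or> EXPX k r G z x G' z' x' \<or>
            EXPB k r G z x G' z' x' \<or> ADD G z x G' z' x'))
      \<or> (\<exists>(G' :: (nat, nat) bgraph) z' x' \<psi>'.
           (easel_class k r G' z' x' \<psi>' \<or> easel_class (k + 1) r G' z' x' \<psi>') \<and>
           prec G' z' x' G z x \<and> REM G z x G' z' x'))
    \<and> ((\<exists>v\<in>verts G. v \<noteq> x \<and> deg G v = 4) \<longrightarrow>
         card (verts G) = 3
         \<or> (\<exists>(G' :: (nat, nat) bgraph) z' x' \<psi>'.
              easel_class k r G' z' x' \<psi>' \<and> prec G' z' x' G z x \<and>
              (EXP k r G z x G' z' x' \<or> EXPA k r G z x G' z' x' \<or> EXPX k r G z x G' z' x')))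
    \<and> (\<not> preflow_critical G z \<psi> \<longrightarrow>
         (\<exists>(G' :: (nat, nat) bgraph) z' x' \<psi>'.
            easel_class k r G' z' x' \<psi>' \<and> prec G' z' x' G z x \<and> EXP k r G z x G' z' x'))"
proof -
  interpret crit_flow G z "ord_size G z" x \<psi> by (rule crit_flow_of_easel[OF assms])
  have deg: "deg G u = d {u}" for u by (rule deg_cutdeg[OF m])
  have dx: "d {x} + 2 \<le> d {z}" using easel_deg[OF assms] unfolding deg .
  \<comment> \<open>The chain is
    \<open>k - 2 - r \<le> d {x} \<le> d {z} - 2 \<le> k - 1\<close>.\<close>
  then have r: "r \<ge> -1" using easel_facts(1,3)[OF assms] by linarith
  have "\<exists>v\<in>V. v \<noteq> z \<and> v \<noteq> x \<and> d {v} = 4" if four: "\<exists>v\<in>V. v \<noteq> x \<and> deg G v = 4"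
  proof -
    \<comment> \<open>The vertex of degree four in the statement might be the tip, but the tip has
      degree at least \<open>4 + 2\<close>.\<close>
    have "d {z} \<noteq> 4" using dx deg4[OF xV xz] by linarith
    then show ?thesis using four unfolding deg by metis
  qed
  then show ?thesis
    using step[OF assms r] outcome_EXP[OF assms] crit_preflow_critical by blast
qed

end
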